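(* Assume that for every $j=1,\dots,m$ the restrictions of $\rho$ and $EI$ to $(l^{j-1},l^j)$ are Lipschitz continuous and uniformly positive. Assume that the open loop triplet $(\mathfrak{A}_0,\mathfrak{B},\mathfrak{C})$ is impedance passive, and that the finite-dimensional control systems $\Sigma_c^j=(A_c^j,B_c^j,C_c^j,D_c^j)$, $j=0,1,\dots,m$, satisfy the following for every $j$: (i) there is $\kappa_j>0$ such that $\operatorname{Re}( A_c^j x_c^j+B_c^j u_c^j \mid x_c^j)_{X_c^j}\le \operatorname{Re}( C_c^j x_c^j+D_c^j u_c^j\mid u_c^j)_{\mathbb{K}^2}-\kappa_j|D_c^j u_c^j|^2$ for all $x_c^j\in X_c^j$, $u_c^j\in\mathbb{K}^2$; (ii) $\ker D_c^j\subseteq\ker B_c^j$; (iii) $\sigma(A_c^j)\subseteq\mathbb{C}_0^-:=\{\lambda\in\mathbb{C}:\operatorname{Re}\lambda<0\}$. Suppose moreover that there is $\kappa>0$ such that $$\operatorname{Re}(\mathcal{A}(x,x_c)\mid(x,x_c))_{\mathcal{X}}\le-\kappa|\mathfrak{R}x|_{\mathbb{K}^4}^2,\qquad (x,x_c)\in D(\mathcal{A}),$$ where, writing $f=\mathcal{H}x$, the map $\mathfrak{R}:D(\mathfrak{A})\to\mathbb{K}^4$ is one of $$\begin{pmatrix}f_1(0)\\ f_1'(0)\\ f_2(0)\\ f_2'(L)\end{pmatrix},\quad \begin{pmatrix}f_1(0)\\ f_1'(0)\\ f_2'(0)\\ f_2(L)\end{pmatrix},\quad \begin{pmatrix}f_1(0)\\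 f_2(0)\\ f_2'(0)\\ f_1'(L)\end{pmatrix},\quad \begin{pmatrix}f_1'(0)\\ f_2(0)\\ f_2'(0)\\ f_1(L)\end{pmatrix}.$$ Then the $C_0$-semigroup $(\mathcal{T}(t))_{t\ge0}$ generated by $\mathcal{A}$ is asymptotically stable on $\mathcal{X}$, i.e. $\mathcal{T}(t)(x_0,x_{c,0})\to0$ as $t\to\infty$ for every $(x_0,x_{c,0})\in\mathcal{X}$. In particular, $\sigma(\mathcal{A})=\sigma_p(\mathcal{A})\subseteq\mathbb{C}_0^-$.
   Context: Setting. $\mathbb{K}=\mathbb{R}$ or $\mathbb{C}$ (spectra are understood after complexification if $\mathbb{K}=\mathbb{R}$). $L>0$, $m\ge1$, $0=l^0<l^1<\dots<l^m=L$. $\rho,EI:(0,L)\to\mathbb{R}$ are bounded, measurable and bounded below by some $\varepsilon>0$ ($EI$ denotes a single function). Put $\mathcal{H}(\zeta)=\operatorname{diag}(\rho(\zeta)^{-1},EI(\zeta))$ and $P=\begin{pmatrix}0&-1\\ 1&0\end{pmatrix}$. The state space is $X=L_2(0,L;\mathbb{K}^2)$ with inner product $(x\mid y)_X=\int_0^L(x(\zeta)\mid\mathcal{H}(\zeta)y(\zeta))_{\mathbb{K}^2}\,d\zeta$. The maximal operator is $D(\mathfrak{A})=\{x\in X:(\mathcal{H}x)|_{(l^{j-1},l^j)}\in H^2(l^{j-1},l^j;\mathbb{K}^2),\ j=1,\dots,m\}$, $\mathfrak{A}x=P(\mathcal{H}x)''$ on each $(l^{j-1},l^j)$. (This encodes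 the Euler-Bernoulli equations $\rho\omega_{tt}+(EI\omega_{\zeta\zeta})_{\zeta\zeta}=0$ on each subinterval with $x=(\rho\omega_t,\omega_{\zeta\zeta})$.) For $x\in D(\mathfrak{A})$ write $f=(f_1,f_2)=\mathcal{H}x$ (so $f_1=\omega_t$, $f_2=EI\omega_{\zeta\zeta}$); at $0$ and $L$ values of $f,f'$ are one-sided traces from inside $(0,L)$; for $1\le j\le m-1$ and $g\in\{f_1,f_2,f_1',f_2'\}$ set $[g]_j=g(l^j-)-g(l^j+)$ and $\{g\}_j=\frac12(g(l^j-)+g(l^j+))$. Boundary control and observation maps. For $j\in\{0,m\}$ fix $W_B^j,W_C^j\in\mathbb{K}^{2\times4}$ with $\begin{pmatrix} W_B^j \\ W_C^j \end{pmatrix}\in\mathbb{K}^{4\times 4}$ invertible and set $\begin{pmatrix} \mathfrak{B}^0x \\ \mathfrak{C}^0x \end{pmatrix}=\begin{pmatrix} W_B^0 \\ W_C^0 \end{pmatrix}\begin{pmatrix} f(0) \\ -P f'(0) \end{pmatrix}$, $\begin{pmatrix} \mathfrak{B}^mx \\ \mathfrak{C}^mx \end{pmatrix}=\begin{pmatrix} W_B^m \\ W_C^m \end{pmatrix}\begin{pmatrix} f(L) \\ P f'(L) \end{pmatrix}$. For each junction $j=1,\dots,m-1$ one of the following four types is chosen, defining $\mathfrak{B}_0^j,\mathfrak{B}^j,\mathfrak{C}^j:D(\mathfrak{A})\to\mathbb{K}^2$: (1) $\mathfrak{B}_0^jx=([f_1]_j,[f_1']_j)$, $\mathfrak{B}^jx=(-[f_2']_j,[f_2]_j)$,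 $\mathfrak{C}^jx=(\{f_1\}_j,\{f_1'\}_j)$; (2) $\mathfrak{B}_0^jx=([f_1]_j,[f_2]_j)$, $\mathfrak{B}^jx=(-[f_2']_j,[f_1']_j)$, $\mathfrak{C}^jx=(\{f_1\}_j,\{f_2\}_j)$; (3) $\mathfrak{B}_0^jx=(-[f_2']_j,[f_1']_j)$, $\mathfrak{B}^jx=([f_1]_j,[f_2]_j)$, $\mathfrak{C}^jx=(-\{f_2'\}_j,\{f_1'\}_j)$; (4) $\mathfrak{B}_0^jx=(-[f_2']_j,[f_2]_j)$, $\mathfrak{B}^jx=([f_1]_j,[f_1']_j)$, $\mathfrak{C}^jx=(-\{f_2'\}_j,\{f_2\}_j)$. Let $\mathfrak{A}_0$ be the restriction of $\mathfrak{A}$ to $D(\mathfrak{A}_0)=\bigcap_{j=1}^{m-1}\ker\mathfrak{B}_0^j$, and $\mathfrak{B}=(\mathfrak{B}^j)_{j=0}^m$, $\mathfrak{C}=(\mathfrak{C}^j)_{j=0}^m:D(\mathfrak{A}_0)\to\mathbb{K}^{2(m+1)}$. The triplet $(\mathfrak{A}_0,\mathfrak{B},\mathfrak{C})$ is impedance passive if $\operatorname{Re}(\mathfrak{A}_0x\mid x)_X\le\operatorname{Re}(\mathfrak{B}x\mid\mathfrak{C}x)_{\mathbb{K}^{2(m+1)}}$ for all $x\in D(\mathfrak{A}_0)$. Controllers and closed loop operator. For $j=0,\dots,m$ let $X_c^j$ be a finite-dimensional Hilbert space over $\mathbb{K}$ (possibly $\{0\}$) and $A_c^j:X_c^j\to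 X_c^j$, $B_c^j:\mathbb{K}^2\to X_c^j$, $C_c^j:X_c^j\to\mathbb{K}^2$, $D_c^j:\mathbb{K}^2\to\mathbb{K}^2$ linear. Put $X_c=\prod_{j=0}^mX_c^j$ and $A_c=\operatorname{diag}(A_c^j)_j$, $B_c=\operatorname{diag}(B_c^j)_j$, $C_c=\operatorname{diag}(C_c^j)_j$, $D_c=\operatorname{diag}(D_c^j)_j$. On the Hilbert space $\mathcal{X}=X\times X_c$ (product inner product) define $\mathcal{A}(x,x_c)=(\mathfrak{A}x,\ B_c\mathfrak{C}x+A_cx_c)$, $D(\mathcal{A})=\{(x,x_c)\in D(\mathfrak{A}_0)\times X_c:\ \mathfrak{B}x=-(C_cx_c+D_c\mathfrak{C}x)\}$. It is known that, under the passivity assumptions, $\mathcal{A}$ has compact resolvent and generates a contractive $C_0$-semigroup on $\mathcal{X}$. *)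

theory Defs
  imports "HOL-Analysis.Analysis" "HOL-Library.Function_Algebras"
begin

section \<open>Scalars\<close>

text \<open>
  The field \<open>\<bbbK> \<in> {\<real>, \<complex>}\<close>: a normed field together with an isometric
  embedding of real algebras into \<^typ>\<open>complex\<close> whose range is \<open>\<real>\<close> or \<open>\<complex>\<close>.
  Topological superclasses are there for Bochner integration only.
\<close>

class real_or_complex = real_normed_field + banach + second_countable_topology +
  fixes to_complex :: "'a \<Rightarrow> complex"
  assumes to_complex_add: "to_complex (x + y) = to_complex x + to_complex y"
    and to_complex_mult: "to_complex (x * y) = to_complex x * to_complex y"
    and to_complex_scaleR: "to_complex (r *\<^sub>R x) = r *\<^sub>R to_complex x"
    and norm_to_complex: "norm (to_complex x) = norm x"
    and range_to_complex: "range to_complex = \<real> \<or> range to_complex = UNIV"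

instantiation real :: real_or_complex
begin
definition "to_complex = complex_of_real"
instance
  by standard (auto simp: to_complex_real_def Reals_def scaleR_conv_of_real)
end

instantiation complex :: real_or_complex
begin
definition "to_complex = (\<lambda>z::complex. z)"
instance
  by standard (auto simp: to_complex_complex_def)
end

definition ip_vec :: "'k::real_or_complex ^ 'n \<Rightarrow> 'k ^ 'n \<Rightarrow> complex" where
  "ip_vec u v = (\<Sum>i\<in>UNIV. to_complex (u $ i) * cnj (to_complex (v $ i)))"


section \<open>Operators on seminormed spaces\<close>

text \<open>
  Square integrable functions are not identified when they agree almost everywhere. A Hilbert
  space is therefore given by a carrier \<open>V\<close>, a scalar multiplication \<open>sc\<close> and a seminorm \<open>q\<close>;
  its vectors are the elements of \<open>V\<close> modulo the null space of \<open>q\<close>, and equality of \<open>u\<close> and \<open>v\<close>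
  is expressed by \<open>q (u - v) = 0\<close>. An unbounded operator is given by its domain \<open>D\<close>, which must be
  saturated under this identification, and a map \<open>A\<close> that matters only on \<open>D\<close> and modulo null
  vectors.
\<close>

definition C0_semigroup_on ::
  "'v::ab_group_add set \<Rightarrow> ('k::real_normed_field \<Rightarrow> 'v \<Rightarrow> 'v) \<Rightarrow> ('v \<Rightarrow> real) \<Rightarrow>
   (real \<Rightarrow> 'v \<Rightarrow> 'v) \<Rightarrow> bool" where
  "C0_semigroup_on V sc q T \<longleftrightarrow>
     (\<forall>t\<ge>0. \<forall>u\<in>V. T t u \<in> V) \<and>
     (\<forall>t\<ge>0. \<forall>u\<in>V. \<forall>v\<in>V. q (T t (u + v) - (T t u + T t v)) = 0) \<and>
     (\<forall>t\<ge>0. \<forall>u\<in>V. \<forall>a. q (T t (sc a u) - sc a (T t u)) = 0) \<and>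
     (\<forall>t\<ge>0. \<exists>M. \<forall>u\<in>V. q (T t u) \<le> M * q u) \<and>
     (\<forall>u\<in>V. q (T 0 u - u) = 0) \<and>
     (\<forall>s\<ge>0. \<forall>t\<ge>0. \<forall>u\<in>V. q (T (s + t) u - T s (T t u)) = 0) \<and>
     (\<forall>u\<in>V. ((\<lambda>t. q (T t u - u)) \<longlongrightarrow> 0) (at_right 0))"

definition has_generator_on ::
  "'v::ab_group_add set \<Rightarrow> ('k::real_normed_field \<Rightarrow> 'v \<Rightarrow> 'v) \<Rightarrow> ('v \<Rightarrow> real) \<Rightarrow>
   (real \<Rightarrow> 'v \<Rightarrow> 'v) \<Rightarrow> 'v set \<Rightarrow> ('v \<Rightarrow> 'v) \<Rightarrow> bool" where
  "has_generator_on V sc q T D A \<longleftrightarrow>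
     (\<forall>u\<in>V. \<forall>w\<in>V.
        ((\<lambda>h. q (sc (of_real (1 / h)) (T h u - u) - w)) \<longlongrightarrow> 0) (at_right 0) \<longleftrightarrow>
        u \<in> D \<and> q (A u - w) = 0)"

definition asymptotically_stable_on ::
  "'v set \<Rightarrow> ('v \<Rightarrow> real) \<Rightarrow> (real \<Rightarrow> 'v \<Rightarrow> 'v) \<Rightarrow> bool" where
  "asymptotically_stable_on V q T \<longleftrightarrow> (\<forall>u\<in>V. ((\<lambda>t. q (T t u)) \<longlongrightarrow> 0) at_top)"

text \<open>The bound in \<open>complex_resolvent_set\<close> contains both injectivity of \<open>\<mu> - A\<close> and
  boundedness of its inverse.\<close>

definition complex_resolvent_set ::
  "'v::ab_group_add set \<Rightarrow> (complex \<Rightarrow> 'v \<Rightarrow> 'v) \<Rightarrow> ('v \<Rightarrow> real) \<Rightarrow> 'v set \<Rightarrow> ('v \<Rightarrow> 'v) \<Rightarrow>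
   complex set" where
  "complex_resolvent_set V sc q D A = {\<mu>.
     (\<forall>w\<in>V. \<exists>u\<in>D. q (sc \<mu> u - A u - w) = 0) \<and>
     (\<exists>M. \<forall>u\<in>D. q u \<le> M * q (sc \<mu> u - A u))}"

definition complex_point_spectrum ::
  "(complex \<Rightarrow> 'v::ab_group_add \<Rightarrow> 'v) \<Rightarrow> ('v \<Rightarrow> real) \<Rightarrow> 'v set \<Rightarrow> ('v \<Rightarrow> 'v) \<Rightarrow> complex set" where
  "complex_point_spectrum sc q D A = {\<mu>. \<exists>u\<in>D. q u \<noteq> 0 \<and> q (sc \<mu> u - A u) = 0}"

text \<open>Complexification: the pair \<open>(u, v)\<close> stands for \<open>u + \<i> v\<close>.\<close>

definition complexified_scale ::
  "('k::real_normed_field \<Rightarrow> 'v::ab_group_add \<Rightarrow> 'v) \<Rightarrow> complex \<Rightarrow> 'v \<times> 'v \<Rightarrow> 'v \<times> 'v" where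
  "complexified_scale sc \<mu> = (\<lambda>(u, v).
     (sc (of_real (Re \<mu>)) u - sc (of_real (Im \<mu>)) v,
      sc (of_real (Re \<mu>)) v + sc (of_real (Im \<mu>)) u))"

definition complexified_norm :: "('v \<Rightarrow> real) \<Rightarrow> 'v \<times> 'v \<Rightarrow> real" where
  "complexified_norm q = (\<lambda>(u, v). sqrt ((q u)\<^sup>2 + (q v)\<^sup>2))"

text \<open>For \<open>\<bbbK> = \<complex>\<close> the spectrum is that of the operator itself, for \<open>\<bbbK> = \<real>\<close> that of its
  complexification.\<close>

definition spectrum ::
  "'v::ab_group_add set \<Rightarrow> ('k::real_or_complex \<Rightarrow> 'v \<Rightarrow> 'v) \<Rightarrow> ('v \<Rightarrow> real) \<Rightarrow>
   'v set \<Rightarrow> ('v \<Rightarrow> 'v) \<Rightarrow> complex set" where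
  "spectrum V sc q D A =
     (if range (to_complex :: 'k \<Rightarrow> complex) = UNIV
      then - complex_resolvent_set V (\<lambda>\<mu>. sc (inv to_complex \<mu>)) q D A
      else - complex_resolvent_set (V \<times> V) (complexified_scale sc) (complexified_norm q)
               (D \<times> D) (map_prod A A))"

definition point_spectrum ::
  "('k::real_or_complex \<Rightarrow> 'v::ab_group_add \<Rightarrow> 'v) \<Rightarrow> ('v \<Rightarrow> real) \<Rightarrow>
   'v set \<Rightarrow> ('v \<Rightarrow> 'v) \<Rightarrow> complex set" where
  "point_spectrum sc q D A =
     (if range (to_complex :: 'k \<Rightarrow> complex) = UNIV
      then complex_point_spectrum (\<lambda>\<mu>. sc (inv to_complex \<mu>)) q D A
      else complex_point_spectrum (complexified_scale sc) (complexified_norm q)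
             (D \<times> D) (map_prod A A))"


section \<open>Sobolev functions on an interval\<close>

definition L2_on :: "real \<Rightarrow> real \<Rightarrow> (real \<Rightarrow> 'k::real_or_complex) \<Rightarrow> bool" where
  "L2_on a b g \<longleftrightarrow> g \<in> borel_measurable (lebesgue_on {a<..<b}) \<and>
     integrable (lebesgue_on {a<..<b}) (\<lambda>\<zeta>. (norm (g \<zeta>))\<^sup>2)"

text \<open>Test functions are \<open>C\<^sup>1\<close> with compact support in the open interval; on an interval this yields
  the same weak derivatives as smooth test functions.\<close>

definition test_function :: "real \<Rightarrow> real \<Rightarrow> (real \<Rightarrow> real) \<Rightarrow> (real \<Rightarrow> real) \<Rightarrow> bool" where
  "test_function a b \<phi> \<phi>' \<longleftrightarrow>
     (\<forall>\<zeta>. (\<phi> has_real_derivative \<phi>' \<zeta>) (at \<zeta>)) \<and> continuous_on UNIV \<phi>' \<and>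
     (\<exists>c d. a < c \<and> d < b \<and> (\<forall>\<zeta>. \<zeta> \<notin> {c..d} \<longrightarrow> \<phi> \<zeta> = 0))"

definition is_weak_derivative ::
  "real \<Rightarrow> real \<Rightarrow> (real \<Rightarrow> 'k::real_or_complex) \<Rightarrow> (real \<Rightarrow> 'k) \<Rightarrow> bool" where
  "is_weak_derivative a b g g' \<longleftrightarrow> (\<forall>\<phi> \<phi>'. test_function a b \<phi> \<phi>' \<longrightarrow>
     (LINT \<zeta>|lebesgue_on {a<..<b}. \<phi>' \<zeta> *\<^sub>R g \<zeta>) =
     - (LINT \<zeta>|lebesgue_on {a<..<b}. \<phi> \<zeta> *\<^sub>R g' \<zeta>))"

definition H1_on :: "real \<Rightarrow> real \<Rightarrow> (real \<Rightarrow> 'k::real_or_complex) \<Rightarrow> bool" where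
  "H1_on a b g \<longleftrightarrow> L2_on a b g \<and> (\<exists>g'. L2_on a b g' \<and> is_weak_derivative a b g g')"

definition weak_deriv :: "real \<Rightarrow> real \<Rightarrow> (real \<Rightarrow> 'k::real_or_complex) \<Rightarrow> real \<Rightarrow> 'k" where
  "weak_deriv a b g = (SOME g'. L2_on a b g' \<and> is_weak_derivative a b g g')"

definition H2_on :: "real \<Rightarrow> real \<Rightarrow> (real \<Rightarrow> 'k::real_or_complex) \<Rightarrow> bool" where
  "H2_on a b g \<longleftrightarrow> H1_on a b g \<and> H1_on a b (weak_deriv a b g)"

text \<open>The trace of an \<open>H\<^sup>1\<close> function at \<open>c \<in> {a, b}\<close>: the value there of its representative that is
  continuous on the closed interval.\<close>

definition bdry_trace :: "real \<Rightarrow> real \<Rightarrow> (real \<Rightarrow> 'k::real_or_complex) \<Rightarrow> real \<Rightarrow> 'k" where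
  "bdry_trace a b g c = (THE v. \<exists>h. continuous_on {a..b} h \<and>
     (AE \<zeta> in lebesgue_on {a<..<b}. h \<zeta> = g \<zeta>) \<and> h c = v)"


section \<open>The chain of beams\<close>

datatype junction_type = Type1 | Type2 | Type3 | Type4

text \<open>\<open>n_seg\<close> is \<open>m\<close> and \<open>node j\<close> is \<open>l\<^sup>j\<close>. The fields \<open>WB\<close>, \<open>WC\<close> are used at \<open>0\<close> and \<open>m\<close>,
  and \<open>junction\<close> at \<open>1, \<dots>, m - 1\<close> only.\<close>

record 'k beam =
  n_seg :: nat
  node :: "nat \<Rightarrow> real"
  rho :: "real \<Rightarrow> real"
  EI :: "real \<Rightarrow> real"
  WB :: "nat \<Rightarrow> 'k ^ 4 ^ 2"
  WC :: "nat \<Rightarrow> 'k ^ 4 ^ 2"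
  junction :: "nat \<Rightarrow> junction_type"

definition len :: "'k beam \<Rightarrow> real" where
  "len b = node b (n_seg b)"

definition stack :: "'a::zero ^ 2 \<Rightarrow> 'a ^ 2 \<Rightarrow> 'a ^ 4" where
  "stack u v = vector [u $ 1, u $ 2, v $ 1, v $ 2]"

definition beam_setting :: "'k::real_or_complex beam \<Rightarrow> bool" where
  "beam_setting b \<longleftrightarrow>
     1 \<le> n_seg b \<and> node b 0 = 0 \<and> (\<forall>j<n_seg b. node b j < node b (Suc j)) \<and>
     (\<forall>g\<in>{rho b, EI b}. g \<in> borel_measurable (lebesgue_on {0<..<len b}) \<and>
        (\<exists>\<epsilon>>0. \<exists>M. \<forall>\<zeta>\<in>{0<..<len b}. \<epsilon> \<le> g \<zeta> \<and> g \<zeta> \<le> M)) \<and>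
     (\<forall>j\<in>{0, n_seg b}. invertible (stack (WB b j) (WC b j)))"

definition P_mat :: "'k::real_or_complex ^ 2 ^ 2" where
  "P_mat = vector [vector [0, -1], vector [1, 0]]"

text \<open>The field \<open>f = \<H>x\<close>.\<close>

definition co_energy ::
  "'k::real_or_complex beam \<Rightarrow> (real \<Rightarrow> 'k ^ 2) \<Rightarrow> real \<Rightarrow> 'k ^ 2" where
  "co_energy b x \<zeta> = vector [inverse (rho b \<zeta>) *\<^sub>R (x \<zeta> $ 1), EI b \<zeta> *\<^sub>R (x \<zeta> $ 2)]"

definition X_space :: "'k::real_or_complex beam \<Rightarrow> (real \<Rightarrow> 'k ^ 2) set" where
  "X_space b = {x. \<forall>i. L2_on 0 (len b) (\<lambda>\<zeta>. x \<zeta> $ i)}"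

definition X_ip ::
  "'k::real_or_complex beam \<Rightarrow> (real \<Rightarrow> 'k ^ 2) \<Rightarrow> (real \<Rightarrow> 'k ^ 2) \<Rightarrow> complex" where
  "X_ip b x y = (LINT \<zeta>|lebesgue_on {0<..<len b}. ip_vec (x \<zeta>) (co_energy b y \<zeta>))"

text \<open>\<open>seg_deriv b k x j i\<close> is the \<open>k\<close>-th weak derivative of \<open>f\<^sub>i\<close> on \<open>(l\<^sup>j\<^sup>-\<^sup>1, l\<^sup>j)\<close>.\<close>

definition seg_deriv ::
  "'k::real_or_complex beam \<Rightarrow> nat \<Rightarrow> (real \<Rightarrow> 'k ^ 2) \<Rightarrow> nat \<Rightarrow> 2 \<Rightarrow> real \<Rightarrow> 'k" where
  "seg_deriv b k x j i =
     (weak_deriv (node b (j - 1)) (node b j) ^^ k) (\<lambda>\<zeta>. co_energy b x \<zeta> $ i)"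

definition dom_max :: "'k::real_or_complex beam \<Rightarrow> (real \<Rightarrow> 'k ^ 2) set" where
  "dom_max b = {x \<in> X_space b. \<forall>j\<in>{1..n_seg b}. \<forall>i.
     H2_on (node b (j - 1)) (node b j) (\<lambda>\<zeta>. co_energy b x \<zeta> $ i)}"

definition op_max ::
  "'k::real_or_complex beam \<Rightarrow> (real \<Rightarrow> 'k ^ 2) \<Rightarrow> real \<Rightarrow> 'k ^ 2" where
  "op_max b x \<zeta> = (\<Sum>j=1..n_seg b. indicator {node b (j - 1)<..<node b j} \<zeta> *\<^sub>R
     (P_mat *v (\<chi> i. seg_deriv b 2 x j i \<zeta>)))"

text \<open>\<open>val_left b k x j $ i\<close> is \<open>f\<^sub>i\<^sup>(\<^sup>k\<^sup>)(l\<^sup>j-)\<close> for \<open>1 \<le> j \<le> m\<close>,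
  and \<open>val_right b k x j $ i\<close> is \<open>f\<^sub>i\<^sup>(\<^sup>k\<^sup>)(l\<^sup>j+)\<close> for \<open>0 \<le> j \<le> m - 1\<close>.\<close>

definition val_left ::
  "'k::real_or_complex beam \<Rightarrow> nat \<Rightarrow> (real \<Rightarrow> 'k ^ 2) \<Rightarrow> nat \<Rightarrow> 'k ^ 2" where
  "val_left b k x j = (\<chi> i. bdry_trace (node b (j - 1)) (node b j) (seg_deriv b k x j i) (node b j))"

definition val_right ::
  "'k::real_or_complex beam \<Rightarrow> nat \<Rightarrow> (real \<Rightarrow> 'k ^ 2) \<Rightarrow> nat \<Rightarrow> 'k ^ 2" where
  "val_right b k x j =
     (\<chi> i. bdry_trace (node b j) (node b (j + 1)) (seg_deriv b k x (j + 1) i) (node b j))"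

definition jump ::
  "'k::real_or_complex beam \<Rightarrow> nat \<Rightarrow> (real \<Rightarrow> 'k ^ 2) \<Rightarrow> nat \<Rightarrow> 'k ^ 2" where
  "jump b k x j = val_left b k x j - val_right b k x j"

definition mean ::
  "'k::real_or_complex beam \<Rightarrow> nat \<Rightarrow> (real \<Rightarrow> 'k ^ 2) \<Rightarrow> nat \<Rightarrow> 'k ^ 2" where
  "mean b k x j = (1 / 2) *\<^sub>R (val_left b k x j + val_right b k x j)"

definition junction_B0 ::
  "'k::real_or_complex beam \<Rightarrow> (real \<Rightarrow> 'k ^ 2) \<Rightarrow> nat \<Rightarrow> 'k ^ 2" where
  "junction_B0 b x j = (case junction b j of
      Type1 \<Rightarrow> vector [jump b 0 x j $ 1, jump b 1 x j $ 1]
    | Type2 \<Rightarrow> vector [jump b 0 x j $ 1, jump b 0 x j $ 2]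
    | Type3 \<Rightarrow> vector [- (jump b 1 x j $ 2), jump b 1 x j $ 1]
    | Type4 \<Rightarrow> vector [- (jump b 1 x j $ 2), jump b 0 x j $ 2])"

definition junction_B ::
  "'k::real_or_complex beam \<Rightarrow> (real \<Rightarrow> 'k ^ 2) \<Rightarrow> nat \<Rightarrow> 'k ^ 2" where
  "junction_B b x j = (case junction b j of
      Type1 \<Rightarrow> vector [- (jump b 1 x j $ 2), jump b 0 x j $ 2]
    | Type2 \<Rightarrow> vector [- (jump b 1 x j $ 2), jump b 1 x j $ 1]
    | Type3 \<Rightarrow> vector [jump b 0 x j $ 1, jump b 0 x j $ 2]
    | Type4 \<Rightarrow> vector [jump b 0 x j $ 1, jump b 1 x j $ 1])"

definition junction_C ::
  "'k::real_or_complex beam \<Rightarrow> (real \<Rightarrow> 'k ^ 2) \<Rightarrow> nat \<Rightarrow> 'k ^ 2" where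
  "junction_C b x j = (case junction b j of
      Type1 \<Rightarrow> vector [mean b 0 x j $ 1, mean b 1 x j $ 1]
    | Type2 \<Rightarrow> vector [mean b 0 x j $ 1, mean b 0 x j $ 2]
    | Type3 \<Rightarrow> vector [- (mean b 1 x j $ 2), mean b 1 x j $ 1]
    | Type4 \<Rightarrow> vector [- (mean b 1 x j $ 2), mean b 0 x j $ 2])"

definition end_trace ::
  "'k::real_or_complex beam \<Rightarrow> (real \<Rightarrow> 'k ^ 2) \<Rightarrow> nat \<Rightarrow> 'k ^ 4" where
  "end_trace b x j =
     (if j = 0 then stack (val_right b 0 x 0) (- (P_mat *v val_right b 1 x 0))
      else stack (val_left b 0 x j) (P_mat *v val_left b 1 x j))"

definition map_B ::
  "'k::real_or_complex beam \<Rightarrow> (real \<Rightarrow> 'k ^ 2) \<Rightarrow> nat \<Rightarrow> 'k ^ 2" where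
  "map_B b x j =
     (if j = 0 \<or> j = n_seg b then WB b j *v end_trace b x j else junction_B b x j)"

definition map_C ::
  "'k::real_or_complex beam \<Rightarrow> (real \<Rightarrow> 'k ^ 2) \<Rightarrow> nat \<Rightarrow> 'k ^ 2" where
  "map_C b x j =
     (if j = 0 \<or> j = n_seg b then WC b j *v end_trace b x j else junction_C b x j)"

definition dom_open :: "'k::real_or_complex beam \<Rightarrow> (real \<Rightarrow> 'k ^ 2) set" where
  "dom_open b = {x \<in> dom_max b. \<forall>j\<in>{1..<n_seg b}. junction_B0 b x j = 0}"

definition impedance_passive :: "'k::real_or_complex beam \<Rightarrow> bool" where
  "impedance_passive b \<longleftrightarrow> (\<forall>x\<in>dom_open b.
     Re (X_ip b (op_max b x) x) \<le> Re (\<Sum>j\<le>n_seg b. ip_vec (map_B b x j) (map_C b x j)))"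

definition R_maps :: "'k::real_or_complex beam \<Rightarrow> ((real \<Rightarrow> 'k ^ 2) \<Rightarrow> 'k ^ 4) set" where
  "R_maps b =
     {\<lambda>x. vector [val_right b 0 x 0 $ 1, val_right b 1 x 0 $ 1,
                  val_right b 0 x 0 $ 2, val_left b 1 x (n_seg b) $ 2],
      \<lambda>x. vector [val_right b 0 x 0 $ 1, val_right b 1 x 0 $ 1,
                  val_right b 1 x 0 $ 2, val_left b 0 x (n_seg b) $ 2],
      \<lambda>x. vector [val_right b 0 x 0 $ 1, val_right b 0 x 0 $ 2,
                  val_right b 1 x 0 $ 2, val_left b 1 x (n_seg b) $ 1],
      \<lambda>x. vector [val_right b 1 x 0 $ 1, val_right b 0 x 0 $ 2,
                  val_right b 1 x 0 $ 2, val_left b 0 x (n_seg b) $ 1]}"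


section \<open>Controllers\<close>

text \<open>The state space \<open>X\<^sub>c\<close> is a finite-dimensional subspace \<open>cspace\<close> of some vector space with
  carrier \<^typ>\<open>'c\<close>, so that controllers with different state spaces share one type.\<close>

record ('k, 'c) controller =
  cspace :: "'c set"
  cscale :: "'k \<Rightarrow> 'c \<Rightarrow> 'c"
  cip :: "'c \<Rightarrow> 'c \<Rightarrow> 'k"
  cA :: "'c \<Rightarrow> 'c"
  cB :: "'k ^ 2 \<Rightarrow> 'c"
  cC :: "'c \<Rightarrow> 'k ^ 2"
  cD :: "'k ^ 2 \<Rightarrow> 'k ^ 2"

definition inner_product_on ::
  "'c::ab_group_add set \<Rightarrow> ('k::real_or_complex \<Rightarrow> 'c \<Rightarrow> 'c) \<Rightarrow> ('c \<Rightarrow> 'c \<Rightarrow> 'k) \<Rightarrow> bool" where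
  "inner_product_on V sc ip \<longleftrightarrow>
     (\<forall>x\<in>V. \<forall>y\<in>V. \<forall>z\<in>V. ip (x + y) z = ip x z + ip y z) \<and>
     (\<forall>a. \<forall>x\<in>V. \<forall>y\<in>V. ip (sc a x) y = a * ip x y) \<and>
     (\<forall>x\<in>V. \<forall>y\<in>V. to_complex (ip y x) = cnj (to_complex (ip x y))) \<and>
     (\<forall>x\<in>V. x \<noteq> 0 \<longrightarrow> Re (to_complex (ip x x)) > 0)"

definition linear_map_on ::
  "'a::ab_group_add set \<Rightarrow> 'b::ab_group_add set \<Rightarrow> ('k \<Rightarrow> 'a \<Rightarrow> 'a) \<Rightarrow> ('k \<Rightarrow> 'b \<Rightarrow> 'b) \<Rightarrow>
   ('a \<Rightarrow> 'b) \<Rightarrow> bool" where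
  "linear_map_on V W sv sw g \<longleftrightarrow> g \<in> V \<rightarrow> W \<and>
     (\<forall>x\<in>V. \<forall>y\<in>V. g (x + y) = g x + g y) \<and> (\<forall>a. \<forall>x\<in>V. g (sv a x) = sw a (g x))"

definition is_controller :: "('k::real_or_complex, 'c::ab_group_add) controller \<Rightarrow> bool" where
  "is_controller \<Sigma> \<longleftrightarrow>
     vector_space (cscale \<Sigma>) \<and>
     (\<exists>S. finite S \<and> module.span (cscale \<Sigma>) S = cspace \<Sigma>) \<and>
     inner_product_on (cspace \<Sigma>) (cscale \<Sigma>) (cip \<Sigma>) \<and>
     linear_map_on (cspace \<Sigma>) (cspace \<Sigma>) (cscale \<Sigma>) (cscale \<Sigma>) (cA \<Sigma>) \<and>
     linear_map_on UNIV (cspace \<Sigma>) (*s) (cscale \<Sigma>) (cB \<Sigma>) \<and>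
     linear_map_on (cspace \<Sigma>) UNIV (cscale \<Sigma>) (*s) (cC \<Sigma>) \<and>
     linear_map_on UNIV UNIV (*s) (*s) (cD \<Sigma>)"

definition cnorm :: "('k::real_or_complex, 'c) controller \<Rightarrow> 'c \<Rightarrow> real" where
  "cnorm \<Sigma> x = sqrt (Re (to_complex (cip \<Sigma> x x)))"


section \<open>The closed loop\<close>

text \<open>Components \<open>x\<^sub>c j\<close> with \<open>j > m\<close> are ignored by the seminorm.\<close>

type_synonym ('k, 'c) state = "(real \<Rightarrow> 'k ^ 2) \<times> (nat \<Rightarrow> 'c)"

definition cl_space ::
  "'k::real_or_complex beam \<Rightarrow> (nat \<Rightarrow> ('k, 'c) controller) \<Rightarrow> ('k, 'c) state set" where
  "cl_space b \<Sigma> = X_space b \<times> Pi {..n_seg b} (\<lambda>j. cspace (\<Sigma> j))"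

definition cl_scale ::
  "(nat \<Rightarrow> ('k::real_or_complex, 'c) controller) \<Rightarrow> 'k \<Rightarrow> ('k, 'c) state \<Rightarrow> ('k, 'c) state" where
  "cl_scale \<Sigma> a = (\<lambda>(x, xc). (\<lambda>\<zeta>. a *s x \<zeta>, \<lambda>j. cscale (\<Sigma> j) a (xc j)))"

definition cl_ip ::
  "'k::real_or_complex beam \<Rightarrow> (nat \<Rightarrow> ('k, 'c) controller) \<Rightarrow>
   ('k, 'c) state \<Rightarrow> ('k, 'c) state \<Rightarrow> complex" where
  "cl_ip b \<Sigma> = (\<lambda>(x, xc) (y, yc).
     X_ip b x y + (\<Sum>j\<le>n_seg b. to_complex (cip (\<Sigma> j) (xc j) (yc j))))"

definition cl_norm ::
  "'k::real_or_complex beam \<Rightarrow> (nat \<Rightarrow> ('k, 'c) controller) \<Rightarrow> ('k, 'c) state \<Rightarrow> real" where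
  "cl_norm b \<Sigma> z = sqrt (Re (cl_ip b \<Sigma> z z))"

definition cl_dom ::
  "'k::real_or_complex beam \<Rightarrow> (nat \<Rightarrow> ('k, 'c) controller) \<Rightarrow> ('k, 'c) state set" where
  "cl_dom b \<Sigma> = {(x, xc). x \<in> dom_open b \<and> xc \<in> Pi {..n_seg b} (\<lambda>j. cspace (\<Sigma> j)) \<and>
     (\<forall>j\<le>n_seg b. map_B b x j = - (cC (\<Sigma> j) (xc j) + cD (\<Sigma> j) (map_C b x j)))}"

definition cl_op ::
  "'k::real_or_complex beam \<Rightarrow> (nat \<Rightarrow> ('k, 'c::ab_group_add) controller) \<Rightarrow>
   ('k, 'c) state \<Rightarrow> ('k, 'c) state" where
  "cl_op b \<Sigma> = (\<lambda>(x, xc).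
     (op_max b x, \<lambda>j. cB (\<Sigma> j) (map_C b x j) + cA (\<Sigma> j) (xc j)))"

end

theory Submission
  imports Defs "HOL-Complex_Analysis.Great_Picard"
begin

text \<open>
  On each segment the resolvent equation is a linear Volterra system, so that its solutions are
  determined by finitely many initial values. Together with the controller states these have to satisfy as many linear
  equations; hence the resolvent problem is solvable as soon as it has no nontrivial homogeneous solution, and the
  a priori bounds make the resolvent compact.

  A homogeneous solution for \<open>Re \<mu> \<ge> 0\<close> has \<open>Rx = 0\<close> by the dissipation estimate. Passivity of the
  controllers gives \<open>D\<^sub>c Cx = 0\<close>, thus \<open>B\<^sub>c Cx = 0\<close>, thus \<open>x\<^sub>c = 0\<close> by stability of \<open>A\<^sub>c\<close>, and then
  \<open>Bx = 0\<close>: all jumps vanish. On the imaginary axis the real and imaginary parts of \<open>f\<^sub>1\<close> and \<open>f\<^sub>2\<close> then solve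
  cooperative systems on all of \<open>(0, L)\<close>. Three of the four data at \<open>0\<close> vanish, so by monotonicity the fourth one
  propagates with its sign to \<open>L\<close>, where \<open>Rx = 0\<close> forces it to be \<open>0\<close>.

  Stability follows without spectral theory of semigroups: orbits in the domain are precompact, their limit
  points lie in the subspace on which the semigroup is isometric, and there the compact skew inverse of the generator
  would have an imaginary eigenvalue.
\<close>

section \<open>Stability of contraction semigroups with compact resolvent\<close>

text \<open>Two obstacles shape the proof. The scalar field may be real although the spectrum is
  complex. Therefore pairs of states indexed by \<open>bool\<close> are used, \<open>True\<close>
  for the real and \<open>False\<close> for the imaginary part, and \<open>a + i \<beta>\<close>
  acts on them as the matrix \<open>rot a \<beta>\<close>. This format also exposes the signs: at
  \<open>i \<beta>\<close> it couples \<open>f1\<close> of one component to \<open>f2\<close> of the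
  other with real coefficients, both of the sign of \<open>\<beta>\<close>. Moreover vectors are
  bare functions with a seminorm, and limit vectors come only from Arzela-Ascoli on the segments
  together with finitely many controller coordinates. Therefore the solvability theorem delivers
  uniform bounds on the continuous representatives of \<open>f\<close> and \<open>f'\<close> rather
  than mere norm bounds. The four choices of \<open>R\<close> are exactly those that fit the cone
  argument: each omits one of \<open>f1\<close>, \<open>f1'\<close>, \<open>f2\<close>,
  \<open>f2'\<close> at \<open>0\<close> and observes the same quantity at \<open>L\<close>. The
  omitted datum is the only one that can start the growth, and the observation at \<open>L\<close>
  tests that very quantity.\<close>

text \<open>A semigroup is only assumed to be continuous from the right at \<open>0\<close>. Nested intervals yield one point of
  two-sided continuity of an orbit, and the semigroup law spreads it to all later times.\<close>

lemma right_continuous_continuity_point: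
  fixes d :: "real \<Rightarrow> real \<Rightarrow> real"
  assumes sym: "\<And>s t. d s t = d t s"
    and tri: "\<And>r s t. 0 \<le> r \<Longrightarrow> 0 \<le> s \<Longrightarrow> 0 \<le> t \<Longrightarrow> d r t \<le> d r s + d s t"
    and nonneg: "\<And>s t. 0 \<le> d s t"
    and right: "\<And>t. 0 \<le> t \<Longrightarrow> ((\<lambda>s. d t s) \<longlongrightarrow> 0) (at_right t)"
    and "0 < e"
  obtains t where "0 < t" "t < e" "((\<lambda>s. d t s) \<longlongrightarrow> 0) (at t)"
proof -
  have step: "\<exists>a' b'. a < a' \<and> a' < b' \<and> b' < b \<and> (\<forall>s\<in>{a'..b'}. \<forall>s'\<in>{a'..b'}. d s s' < \<delta>)"
    if "0 \<le> a" "a < b" "0 < \<delta>" for a b \<delta> :: real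
  proof -
    define p where "p = (a + b) / 2"
    have p: "a < p" "p < b" "0 \<le> p" using that by (auto simp: p_def)
    have "eventually (\<lambda>s. d p s < \<delta> / 2) (at_right p)"
      using order_tendstoD(2)[OF right[OF p(3)], of "\<delta> / 2"] that by simp
    then obtain c where c: "c > p" "\<And>s. p < s \<Longrightarrow> s < c \<Longrightarrow> d p s < \<delta> / 2"
      unfolding eventually_at_right_field by blast
    define m where "m = min b c - p"
    have m: "0 < m" "p + m \<le> b" "p + m \<le> c" using c p by (auto simp: m_def)
    show ?thesis
    proof (rule exI[of _ "p + m / 3"], rule exI[of _ "p + m / 2"], intro conjI ballI)
      fix s s' assume s: "s \<in> {p + m / 3..p + m / 2}" "s' \<in> {p + m / 3..p + m / 2}"
      have "d s s' \<le> d s p + d p s'" using s p m by (intro tri) auto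
      also have "\<dots> < \<delta>" using c(2)[of s] c(2)[of s'] s m sym[of s p] by force
      finally show "d s s' < \<delta>" .
    qed (use p m in auto)
  qed
  have "\<exists>f. (0 \<le> fst (f 0) \<and> fst (f 0) < snd (f 0) \<and> f 0 = (0, e)) \<and>
     (\<forall>n. fst (f n) < fst (f (Suc n)) \<and> snd (f (Suc n)) < snd (f n) \<and> fst (f (Suc n)) < snd (f (Suc n)) \<and>
      (\<forall>s\<in>{fst (f (Suc n))..snd (f (Suc n))}. \<forall>s'\<in>{fst (f (Suc n))..snd (f (Suc n))}. d s s' < 1 / Suc n))"
  proof -
    have "\<exists>f. \<forall>n. (0 \<le> fst (f n) \<and> fst (f n) < snd (f n) \<and> (n = 0 \<longrightarrow> f n = (0, e))) \<and>
     (fst (f n) < fst (f (Suc n)) \<and> snd (f (Suc n)) < snd (f n) \<and>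
      (\<forall>s\<in>{fst (f (Suc n))..snd (f (Suc n))}. \<forall>s'\<in>{fst (f (Suc n))..snd (f (Suc n))}. d s s' < 1 / Suc n))"
    proof (rule dependent_nat_choice)
      show "\<exists>x. 0 \<le> fst x \<and> fst x < snd x \<and> ((0::nat) = 0 \<longrightarrow> x = (0, e))"
        using \<open>0 < e\<close> by auto
    next
      fix x :: "real \<times> real" and n :: nat
      assume "0 \<le> fst x \<and> fst x < snd x \<and> (n = 0 \<longrightarrow> x = (0, e))"
      then obtain a' b' where "fst x < a'" "a' < b'" "b' < snd x"
        "\<forall>s\<in>{a'..b'}. \<forall>s'\<in>{a'..b'}. d s s' < 1 / Suc n"
        using step[of "fst x" "snd x" "1 / Suc n"] by auto
      then show "\<exists>y. (0 \<le> fst y \<and> fst y < snd y \<and> (Suc n = 0 \<longrightarrow> y = (0, e))) \<and>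
        fst x < fst y \<and> snd y < snd x \<and>
        (\<forall>s\<in>{fst y..snd y}. \<forall>s'\<in>{fst y..snd y}. d s s' < 1 / Suc n)"
        using \<open>0 \<le> fst x \<and> fst x < snd x \<and> (n = 0 \<longrightarrow> x = (0, e))\<close>
        by (intro exI[of _ "(a', b')"]) auto
    qed
    then show ?thesis by metis
  qed
  then obtain f where f: "f 0 = (0, e)" "\<And>n. fst (f n) < fst (f (Suc n))" "\<And>n. snd (f (Suc n)) < snd (f n)"
    "\<And>n. fst (f (Suc n)) < snd (f (Suc n))"
    "\<And>n s s'. s \<in> {fst (f (Suc n))..snd (f (Suc n))} \<Longrightarrow> s' \<in> {fst (f (Suc n))..snd (f (Suc n))} \<Longrightarrow> d s s' < 1 / Suc n"
    by blast
  have inc: "incseq (\<lambda>n. fst (f n))" using f(2) by (intro incseq_SucI) (simp add: less_imp_le)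
  have dec: "decseq (\<lambda>n. snd (f n))" using f(3) by (intro decseq_SucI) (simp add: less_imp_le)
  have lt: "fst (f n) < snd (f n)" for n using f(4) \<open>0 < e\<close> f(1) by (cases n) auto
  have lt2: "fst (f m) < snd (f n)" for m n
  proof -
    have "fst (f m) \<le> fst (f (max m n))" using inc by (auto simp: incseq_def)
    also have "\<dots> < snd (f (max m n))" by (rule lt)
    also have "\<dots> \<le> snd (f n)" using dec by (auto simp: decseq_def)
    finally show ?thesis .
  qed
  \<comment> \<open>Both ends of the intervals move strictly, so the common point \<open>t\<close>
    is interior to each of them. Smallness of \<open>d\<close> on an interval then holds on a
    two-sided neighbourhood of \<open>t\<close>.\<close>
  define t where "t = (SUP n. fst (f n))"
  have bdd: "bdd_above (range (\<lambda>n. fst (f n)))" using lt2[of _ 0] by (intro bdd_aboveI2[of _ _ "snd (f 0)"]) (simp add: less_imp_le)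
  have t1: "fst (f n) < t" for n
    using f(2)[of n] cSUP_upper[OF UNIV_I bdd, of "Suc n"] unfolding t_def by simp
  have t2: "t < snd (f n)" for n
  proof -
    have "t \<le> snd (f (Suc n))" unfolding t_def using lt2 by (intro cSUP_least) (auto simp: less_imp_le)
    with f(3)[of n] show ?thesis by simp
  qed
  have "((\<lambda>s. d t s) \<longlongrightarrow> 0) (at t)"
  proof (rule tendstoI)
    fix \<delta> :: real assume "0 < \<delta>"
    then obtain n where n: "1 / Suc n < \<delta>" using nat_approx_posE by blast
    have "eventually (\<lambda>s. s \<in> {fst (f (Suc n))<..<snd (f (Suc n))}) (at t)"
      using t1 t2 by (intro eventually_at_in_open') auto
    then show "eventually (\<lambda>s. dist (d t s) 0 < \<delta>) (at t)"
    proof eventually_elim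
      case (elim s)
      have "d t s < 1 / Suc n" using elim t1[of "Suc n"] t2[of "Suc n"] by (intro f(5)) auto
      with n nonneg[of t s] show ?case by simp
    qed
  qed
  moreover have "0 < t" "t < e" using t1[of 0] t2[of 0] f(1) by auto
  ultimately show ?thesis using that by blast
qed

text \<open>Only right difference quotients are available along an orbit, so the mean value theorem
  does not apply. Tilt \<open>g\<close> by a small slope \<open>e\<close>: the last point at which
  the tilted function is at most its initial value cannot lie before \<open>b\<close>, since a right
  derivative below \<open>e\<close> pushes this set further to the right.\<close>

lemma right_derivative_nonpos_decreasing:
  fixes g :: "real \<Rightarrow> real"
  assumes "a \<le> b" and cont: "continuous_on {a..b} g"
    and deriv: "\<And>t. a \<le> t \<Longrightarrow> t < b \<Longrightarrow> ((\<lambda>h. (g (t + h) - g t) / h) \<longlongrightarrow> g' t) (at_right 0)"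
    and nonpos: "\<And>t. a \<le> t \<Longrightarrow> t < b \<Longrightarrow> g' t \<le> 0"
  shows "g b \<le> g a"
proof (rule field_le_epsilon)
  fix e0 :: real assume "0 < e0"
  \<comment> \<open>The total tilt \<open>e * (b - a)\<close> stays below \<open>e0\<close>; the
    summand 1 keeps the denominator positive when \<open>a = b\<close>.\<close>
  define e where "e = e0 / (b - a + 1)"
  have e: "0 < e" "e * (b - a) \<le> e0"
    using \<open>0 < e0\<close> \<open>a \<le> b\<close> by (auto simp: e_def field_simps)
  have "g b \<le> g a + e * (b - a)"
  proof (rule ccontr)
    assume neg: "\<not> g b \<le> g a + e * (b - a)"
    define S where "S = {t \<in> {a..b}. g t - e * t \<le> g a - e * a}"
    have "closed S" unfolding S_def
      by (intro continuous_on_closed_Collect_le continuous_intros cont)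
    then have "compact S" using compact_Int_closed[of "{a..b}" S]
      by (metis (no_types, lifting) S_def compact_Icc inf.absorb_iff2 mem_Collect_eq subsetI)
    moreover have "a \<in> S" using \<open>a \<le> b\<close> by (auto simp: S_def)
    ultimately obtain c where c: "c \<in> S" "\<And>t. t \<in> S \<Longrightarrow> t \<le> c"
      using compact_attains_sup[of S] by blast
    have cb: "a \<le> c" "c < b"
      using c(1) neg by (auto simp: S_def algebra_simps less_le)
    have "eventually (\<lambda>h. (g (c + h) - g c) / h < e) (at_right 0)"
      using order_tendstoD(2)[OF deriv[OF cb]] nonpos[OF cb] e by auto
    moreover have "eventually (\<lambda>h. h \<in> {0<..<b - c}) (at_right 0)"
      using cb by (intro eventually_at_right_real) auto
    ultimately have "eventually (\<lambda>h. (g (c + h) - g c) / h < e \<and> h \<in> {0<..<b - c}) (at_right 0)"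
      by (rule eventually_conj)
    then obtain h where h: "(g (c + h) - g c) / h < e" "0 < h" "h < b - c"
      using eventually_happens[of _ "at_right (0::real)"] by auto
    then have "g (c + h) - g c < e * h" by (simp add: pos_divide_less_eq)
    then have "c + h \<in> S" using c(1) h cb by (auto simp: S_def algebra_simps)
    from c(2)[OF this] h show False by simp
  qed
  with e show "g b \<le> g a + e0" by simp
qed

lemma tendsto_zero_squeeze:
  fixes f g :: "nat \<Rightarrow> real"
  assumes "f \<longlonglongrightarrow> 0" "\<And>n. 0 \<le> g n" "\<And>n. g n \<le> f n"
  shows "g \<longlonglongrightarrow> 0"
  using assms(2,3) by (intro tendsto_sandwich[OF _ _ tendsto_const assms(1)]) simp_all

section \<open>Real semi-inner products modulo null vectors\<close>

locale semi_inner =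
  fixes V :: "'v::ab_group_add set" and sc :: "real \<Rightarrow> 'v \<Rightarrow> 'v" and ip :: "'v \<Rightarrow> 'v \<Rightarrow> real"
  assumes add_in [simp, intro]: "u \<in> V \<Longrightarrow> v \<in> V \<Longrightarrow> u + v \<in> V"
    and diff_in [simp, intro]: "u \<in> V \<Longrightarrow> v \<in> V \<Longrightarrow> u - v \<in> V"
    and sc_in [simp, intro]: "u \<in> V \<Longrightarrow> sc a u \<in> V"
    and ip_add [simp]: "u \<in> V \<Longrightarrow> v \<in> V \<Longrightarrow> w \<in> V \<Longrightarrow> ip (u + v) w = ip u w + ip v w"
    and ip_sc [simp]: "u \<in> V \<Longrightarrow> w \<in> V \<Longrightarrow> ip (sc a u) w = a * ip u w"
    and ip_sym: "u \<in> V \<Longrightarrow> w \<in> V \<Longrightarrow> ip u w = ip w u"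
    and ip_pos [simp]: "u \<in> V \<Longrightarrow> 0 \<le> ip u u"
begin

definition q :: "'v \<Rightarrow> real" where "q u = sqrt (ip u u)"

lemma ip_diff [simp]: "u \<in> V \<Longrightarrow> v \<in> V \<Longrightarrow> w \<in> V \<Longrightarrow> ip (u - v) w = ip u w - ip v w"
  using ip_add[of "u - v" v w] by simp

lemma ip_right [simp]:
  shows "u \<in> V \<Longrightarrow> v \<in> V \<Longrightarrow> w \<in> V \<Longrightarrow> ip w (u + v) = ip w u + ip w v"
    and "u \<in> V \<Longrightarrow> v \<in> V \<Longrightarrow> w \<in> V \<Longrightarrow> ip w (u - v) = ip w u - ip w v"
    and "u \<in> V \<Longrightarrow> w \<in> V \<Longrightarrow> ip w (sc a u) = a * ip w u"
  by (simp_all add: ip_sym[of w])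

lemma q_nonneg [simp]: "u \<in> V \<Longrightarrow> 0 \<le> q u" and q_sq: "u \<in> V \<Longrightarrow> (q u)\<^sup>2 = ip u u"
  by (simp_all add: q_def)

lemma q_le_0D: "u \<in> V \<Longrightarrow> q u \<le> 0 \<Longrightarrow> q u = 0"
  by (rule antisym) simp_all

lemma q_sc [simp]: "u \<in> V \<Longrightarrow> q (sc a u) = \<bar>a\<bar> * q u"
  by (simp add: q_def real_sqrt_mult[symmetric] power2_eq_square[symmetric] mult.assoc[symmetric])
     (simp add: real_sqrt_mult)

text \<open>The discriminant argument, with one extra case: \<open>ip\<close> is only semidefinite,
  so \<open>v\<close> may be null without being 0. Then the quadratic inequality becomes affine in
  \<open>r\<close> and forces \<open>ip u v = 0\<close>.\<close>

lemma Cauchy_Schwarz: assumes [simp]: "u \<in> V" "v \<in> V" shows "\<bar>ip u v\<bar> \<le> q u * q v"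
proof -
  have quad: "0 \<le> ip u u - 2 * r * ip u v + r\<^sup>2 * ip v v" for r
    using ip_pos[of "u - sc r v"] by (simp add: ip_sym[of v u] power2_eq_square algebra_simps)
  have "(ip u v)\<^sup>2 \<le> ip u u * ip v v"
  proof (cases "ip v v = 0")
    case True
    have "ip u v = 0"
    proof (rule ccontr)
      assume "ip u v \<noteq> 0"
      \<comment> \<open>At this \<open>r\<close> the affine expression takes the value -1.\<close>
      with quad[of "(ip u u + 1) / (2 * ip u v)"] True show False by simp
    qed
    then show ?thesis using True by simp
  next
    case False
    then have pos: "ip v v > 0" using ip_pos[of v] by (simp add: less_le del: ip_pos)
    show ?thesis using quad[of "ip u v / ip v v"] pos by (simp add: field_simps power2_eq_square)
  qed
  then have "sqrt ((ip u v)\<^sup>2) \<le> sqrt (ip u u * ip v v)" by (rule real_sqrt_le_mono)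
  then show ?thesis by (simp add: q_def real_sqrt_mult)
qed

lemma triangle: assumes [simp]: "u \<in> V" "v \<in> V" shows "q (u + v) \<le> q u + q v"
proof (rule power2_le_imp_le)
  have "(q (u + v))\<^sup>2 = (q u)\<^sup>2 + 2 * ip u v + (q v)\<^sup>2"
    by (simp add: q_sq ip_sym[of v u])
  also have "\<dots> \<le> (q u + q v)\<^sup>2"
    using Cauchy_Schwarz[of u v] by (simp add: power2_sum)
  finally show "(q (u + v))\<^sup>2 \<le> (q u + q v)\<^sup>2" .
qed simp

lemma q_minus_commute: assumes "u \<in> V" "v \<in> V" shows "q (u - v) = q (v - u)"
  using assms by (simp add: q_def)

lemma triangle_diff: assumes "u \<in> V" "v \<in> V" "w \<in> V" shows "q (u - w) \<le> q (u - v) + q (v - w)"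
  using triangle[of "u - v" "v - w"] assms by simp

lemma abs_q_diff: assumes [simp]: "u \<in> V" "v \<in> V" shows "\<bar>q u - q v\<bar> \<le> q (u - v)"
  using triangle[of "u - v" v] triangle[of "v - u" u] q_minus_commute[of u v] by simp

text \<open>Equality modulo null vectors is phrased through pairings because the bilinear
  simplification rules then settle identities between vectors; \<open>eqv_iff\<close> returns to the
  seminorm.\<close>

definition eqv :: "'v \<Rightarrow> 'v \<Rightarrow> bool" (infix \<open>\<simeq>\<close> 50)
  where "u \<simeq> v \<longleftrightarrow> (\<forall>w\<in>V. ip u w = ip v w)"

lemma eqvI: "(\<And>w. w \<in> V \<Longrightarrow> ip u w = ip v w) \<Longrightarrow> u \<simeq> v"
  by (simp add: eqv_def)

lemma eqvD: "u \<simeq> v \<Longrightarrow> w \<in> V \<Longrightarrow> ip u w = ip v w"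
  by (simp add: eqv_def)

lemma eqv_iff: assumes [simp]: "u \<in> V" "v \<in> V" shows "u \<simeq> v \<longleftrightarrow> q (u - v) = 0"
proof
  assume "u \<simeq> v"
  from eqvD[OF this, of "u - v"] show "q (u - v) = 0" by (simp add: q_def del: ip_right)
next
  assume *: "q (u - v) = 0"
  show "u \<simeq> v"
  proof (rule eqvI)
    fix w assume [simp]: "w \<in> V"
    show "ip u w = ip v w" using Cauchy_Schwarz[of "u - v" w] * by simp
  qed
qed

lemma q_cong: assumes [simp]: "u \<in> V" "v \<in> V" and "u \<simeq> v" shows "q u = q v"
  using eqvD[OF \<open>u \<simeq> v\<close>, of u] eqvD[OF \<open>u \<simeq> v\<close>, of v] by (simp add: q_def ip_sym[of u v])

end


text \<open>Vectors are determined modulo the null space of \<open>ip\<close>, so identities between them are stated after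
  pairing with an arbitrary vector. The last assumption excludes eigenvalues on the imaginary axis: the pair
  \<open>(u, v)\<close> stands for \<open>u + \<i> v\<close>.\<close>

locale stable_op = semi_inner +
  fixes D :: "'a set" and A :: "'a \<Rightarrow> 'a" and M :: real
  assumes D_V [simp, intro]: "u \<in> D \<Longrightarrow> u \<in> V"
    and A_in [simp, intro]: "u \<in> D \<Longrightarrow> A u \<in> V"
    and D_diff [simp, intro]: "u \<in> D \<Longrightarrow> v \<in> D \<Longrightarrow> u - v \<in> D"
    and D_sc [simp, intro]: "u \<in> D \<Longrightarrow> sc a u \<in> D"
    and A_diff [simp]: "u \<in> D \<Longrightarrow> v \<in> D \<Longrightarrow> w \<in> V \<Longrightarrow> ip (A (u - v)) w = ip (A u) w - ip (A v) w"
    and A_sc [simp]: "u \<in> D \<Longrightarrow> w \<in> V \<Longrightarrow> ip (A (sc a u)) w = a * ip (A u) w"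
    and dissipative: "u \<in> D \<Longrightarrow> ip (A u) u \<le> 0"
    and onto: "w \<in> V \<Longrightarrow> \<exists>u\<in>D. A u \<simeq> w"
    and below: "u \<in> D \<Longrightarrow> q u \<le> M * q (A u)"
    and compactness: "(\<And>n. X n \<in> D) \<Longrightarrow> (\<And>n::nat. q (A (X n)) \<le> C) \<Longrightarrow>
      \<exists>z\<in>V. \<exists>r. strict_mono r \<and> (\<lambda>n. q (X (r n) - z)) \<longlonglongrightarrow> 0"
    and no_imaginary_eigenvalue: "u \<in> D \<Longrightarrow> v \<in> D \<Longrightarrow> A u \<simeq> sc (- \<beta>) v \<Longrightarrow> A v \<simeq> sc \<beta> u \<Longrightarrow> q u = 0"

locale stable_semigroup = stable_op V sc ip D A M
  for V :: "'a::ab_group_add set" and sc ip D A M +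
  fixes T :: "real \<Rightarrow> 'a \<Rightarrow> 'a"
  assumes T_in [simp, intro]: "0 \<le> t \<Longrightarrow> u \<in> V \<Longrightarrow> T t u \<in> V"
    and T_add [simp]: "0 \<le> t \<Longrightarrow> u \<in> V \<Longrightarrow> v \<in> V \<Longrightarrow> w \<in> V \<Longrightarrow>
      ip (T t (u + v)) w = ip (T t u) w + ip (T t v) w"
    and T_sc [simp]: "0 \<le> t \<Longrightarrow> u \<in> V \<Longrightarrow> w \<in> V \<Longrightarrow> ip (T t (sc a u)) w = a * ip (T t u) w"
    and T_bdd: "0 \<le> t \<Longrightarrow> \<exists>K. \<forall>u\<in>V. q (T t u) \<le> K * q u"
    and T_zero [simp]: "u \<in> V \<Longrightarrow> w \<in> V \<Longrightarrow> ip (T 0 u) w = ip u w"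
    and T_semi: "0 \<le> s \<Longrightarrow> 0 \<le> t \<Longrightarrow> u \<in> V \<Longrightarrow> w \<in> V \<Longrightarrow> ip (T (s + t) u) w = ip (T s (T t u)) w"
    and T_cont: "u \<in> V \<Longrightarrow> ((\<lambda>t. q (T t u - u)) \<longlongrightarrow> 0) (at_right 0)"
    and gen: "u \<in> V \<Longrightarrow> w \<in> V \<Longrightarrow>
      ((\<lambda>h. q (sc (1 / h) (T h u - u) - w)) \<longlongrightarrow> 0) (at_right 0) \<longleftrightarrow> u \<in> D \<and> A u \<simeq> w"
begin

section \<open>Orbits: continuity, energy and contraction\<close>

lemma T_diff [simp]: "0 \<le> t \<Longrightarrow> u \<in> V \<Longrightarrow> v \<in> V \<Longrightarrow> w \<in> V \<Longrightarrow> ip (T t (u - v)) w = ip (T t u) w - ip (T t v) w"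
  using T_add[of t "u - v" v w] by simp

text \<open>Boundedness makes \<open>T t\<close> well defined on classes: the null vector
  \<open>u - v\<close> has a null image.\<close>

lemma T_eqv: assumes "0 \<le> t" "u \<in> V" "v \<in> V" "u \<simeq> v" shows "T t u \<simeq> T t v"
proof -
  obtain K where K: "\<And>u. u \<in> V \<Longrightarrow> q (T t u) \<le> K * q u" using T_bdd assms(1) by blast
  have "q (T t u - T t v) = q (T t (u - v))" using assms by (intro q_cong eqvI) auto
  also have "\<dots> \<le> K * q (u - v)" using assms by (intro K) auto
  also have "q (u - v) = 0" using assms eqv_iff by blast
  finally have "q (T t u - T t v) \<le> 0" by simp
  moreover have "0 \<le> q (T t u - T t v)" using assms by auto
  ultimately show ?thesis using assms by (subst eqv_iff) auto
qed

lemma eventually_pos: "eventually (\<lambda>h::real. 0 < h) (at_right 0)"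
  by (auto simp: eventually_at_filter)

lemma tendsto_q0_le:
  assumes "((\<lambda>h. f h) \<longlongrightarrow> 0) F" and "eventually (\<lambda>h. 0 \<le> g h \<and> g h \<le> K * f h) F"
  shows "((\<lambda>h::real. g h :: real) \<longlongrightarrow> 0) F"
proof (rule tendsto_sandwich)
  show "eventually (\<lambda>h. 0 \<le> g h) F" "eventually (\<lambda>h. g h \<le> K * f h) F"
    using assms(2) by (auto elim: eventually_mono)
  show "((\<lambda>h. K * f h) \<longlongrightarrow> 0) F" using tendsto_mult_left[OF assms(1), of K] by simp
qed simp

text \<open>The bounded operator \<open>T t\<close> carries the convergent difference quotients of
  \<open>u\<close> to those of \<open>T t u\<close>. Since \<open>gen\<close> is an equivalence, the
  limit identifies both membership in \<open>D\<close> and the value of \<open>A\<close>.\<close>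

lemma generator_commutes:
  assumes t: "0 \<le> t" and u: "u \<in> D"
  shows "T t u \<in> D" "A (T t u) \<simeq> T t (A u)"
proof -
  obtain K where K: "\<And>u. u \<in> V \<Longrightarrow> q (T t u) \<le> K * q u" using T_bdd t by blast
  have lim: "((\<lambda>h. q (sc (1 / h) (T h u - u) - A u)) \<longlongrightarrow> 0) (at_right 0)"
    using gen[of u "A u"] u by (auto simp: eqv_def)
  have "((\<lambda>h. q (sc (1 / h) (T h (T t u) - T t u) - T t (A u))) \<longlongrightarrow> 0) (at_right 0)"
  proof (rule tendsto_q0_le[OF lim], rule eventually_mono[OF eventually_pos], intro conjI)
    fix h :: real assume h: "0 < h"
    show "0 \<le> q (sc (1 / h) (T h (T t u) - T t u) - T t (A u))" using h t u by auto
    have "q (sc (1 / h) (T h (T t u) - T t u) - T t (A u)) = q (T t (sc (1 / h) (T h u - u) - A u))"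
    proof (intro q_cong eqvI)
      fix w assume "w \<in> V"
      then show "ip (sc (1 / h) (T h (T t u) - T t u) - T t (A u)) w = ip (T t (sc (1 / h) (T h u - u) - A u)) w"
        using h t u T_semi[of h t u w] T_semi[of t h u w] by (simp add: add.commute)
    qed (use h t u in auto)
    also have "\<dots> \<le> K * q (sc (1 / h) (T h u - u) - A u)" using h u by (intro K) auto
    finally show "q (sc (1 / h) (T h (T t u) - T t u) - T t (A u)) \<le> K * q (sc (1 / h) (T h u - u) - A u)" .
  qed
  then show "T t u \<in> D" "A (T t u) \<simeq> T t (A u)" using gen[of "T t u" "T t (A u)"] t u by auto
qed

lemma T_right: 
  assumes t: "0 \<le> t" and u: "u \<in> V"
  shows "((\<lambda>s. q (T t u - T s u)) \<longlongrightarrow> 0) (at_right t)"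
proof -
  obtain K where K: "\<And>u. u \<in> V \<Longrightarrow> q (T t u) \<le> K * q u" using T_bdd t by blast
  have "((\<lambda>h. q (T t u - T (h + t) u)) \<longlongrightarrow> 0) (at_right 0)"
  proof (rule tendsto_q0_le[OF T_cont[OF u]], rule eventually_mono[OF eventually_pos], intro conjI)
    fix h :: real assume h: "0 < h"
    show "0 \<le> q (T t u - T (h + t) u)" using h t u by auto
    have "q (T t u - T (h + t) u) = q (T (t + h) u - T t u)" using h t u by (subst q_minus_commute) (auto simp: add.commute)
    also have "\<dots> = q (T t (T h u - u))"
      using h t u T_semi[of t h u] by (intro q_cong eqvI) auto
    also have "\<dots> \<le> K * q (T h u - u)" using h u by (intro K) auto
    finally show "q (T t u - T (h + t) u) \<le> K * q (T h u - u)" .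
  qed
  then show ?thesis by (subst filterlim_at_right_to_0) (simp add: add.commute)
qed

lemma T_continuous:
  assumes u: "u \<in> V" and t: "0 < t"
  shows "((\<lambda>s. q (T t u - T s u)) \<longlongrightarrow> 0) (at t)"
proof -
  \<comment> \<open>Extension by 0 to negative times makes \<open>d\<close> symmetric and
    nonnegative for all arguments, as the lemma on continuity points requires.\<close>
  define d where "d s r = (if 0 \<le> s \<and> 0 \<le> r then q (T s u - T r u) else 0)" for s r
  obtain t0 where t0: "0 < t0" "t0 < t" "((\<lambda>s. d t0 s) \<longlongrightarrow> 0) (at t0)"
  proof (rule right_continuous_continuity_point[of d t])
    fix r assume r: "(0::real) \<le> r"
    have "eventually (\<lambda>s. q (T r u - T s u) = d r s) (at_right r)"
      using r by (auto simp: eventually_at_filter d_def)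
    then show "((\<lambda>s. d r s) \<longlongrightarrow> 0) (at_right r)"
      using T_right[OF r u] tendsto_cong by force
  qed (use u t triangle_diff q_minus_commute in \<open>auto simp: d_def\<close>)
  obtain K where K: "\<And>u. u \<in> V \<Longrightarrow> q (T (t - t0) u) \<le> K * q u"
    using T_bdd[of "t - t0"] t0 by auto
  have lim: "((\<lambda>s. d t0 (s - (t - t0))) \<longlongrightarrow> 0) (at t)"
  proof (rule tendsto_compose_filtermap[THEN iffD1, unfolded o_def] | rule filterlim_compose[OF t0(3)])+
    have "filterlim (\<lambda>s. s - (t - t0)) (nhds t0) (at t)"
      by (rule tendsto_eq_intros refl | simp)+
    then show "filterlim (\<lambda>s. s - (t - t0)) (at t0) (at t)"
      by (auto simp: filterlim_at eventually_at_filter)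
  qed
  show ?thesis
  proof (rule tendsto_q0_le[OF lim])
    have "eventually (\<lambda>s. s \<in> {t - t0<..}) (at t)"
      using t0 by (intro eventually_at_in_open') auto
    then show "\<forall>\<^sub>F s in at t. 0 \<le> q (T t u - T s u) \<and> q (T t u - T s u) \<le> K * d t0 (s - (t - t0))"
    proof eventually_elim
      case (elim s)
      then have s: "0 \<le> s - (t - t0)" "0 \<le> s" using t0 by auto
      have "q (T t u - T s u) = q (T (t - t0) (T t0 u - T (s - (t - t0)) u))"
        using T_semi[of "t - t0" t0 u] T_semi[of "t - t0" "s - (t - t0)" u] s t0 u t
        by (intro q_cong eqvI) auto
      also have "\<dots> \<le> K * q (T t0 u - T (s - (t - t0)) u)" using s t0 u by (intro K) auto
      finally show ?case using s t0 t u by (auto simp: d_def)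
    qed
  qed
qed

lemma continuous_norm:
  assumes u: "u \<in> V"
  shows "continuous_on {0..} (\<lambda>t. q (T t u))"
  unfolding continuous_on_def
proof
  fix t :: real assume t: "t \<in> {0..}"
  have lim: "((\<lambda>s. q (T t u - T s u)) \<longlongrightarrow> 0) (at t within {0..})"
  proof (cases "t = 0")
    case True
    then show ?thesis using T_right[of 0 u] u by (simp add: at_within_Ici_at_right)
  next
    case False
    with t T_continuous[OF u, of t] show ?thesis by (auto intro: tendsto_within_subset)
  qed
  have "((\<lambda>s. q (T s u) - q (T t u)) \<longlongrightarrow> 0) (at t within {0..})"
  proof (rule Lim_null_comparison[OF _ lim])
    show "\<forall>\<^sub>F s in at t within {0..}. norm (q (T s u) - q (T t u)) \<le> q (T t u - T s u)"
      using abs_q_diff[of "T _ u" "T t u"] u t q_minus_commute[of "T _ u" "T t u"]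
      by (auto simp: eventually_at_filter)
  qed
  then show "((\<lambda>t. q (T t u)) \<longlongrightarrow> q (T t u)) (at t within {0..})"
    by (simp add: LIM_zero_iff)
qed

text \<open>Expand the square of \<open>T h v\<close>, which is
  \<open>v + h (\<delta> h + A v)\<close> modulo null vectors, where the error
  \<open>\<delta> h\<close> tends to 0. The derivative is stated with \<open>T t (A u)\<close>
  rather than \<open>A (T t u)\<close>, because for isometric \<open>A u\<close> the pairing is then
  constant in time.\<close>

lemma energy_right_derivative:
  assumes u: "u \<in> D" and t: "0 \<le> t"
  shows "((\<lambda>h. ((q (T (t + h) u))\<^sup>2 - (q (T t u))\<^sup>2) / h) \<longlongrightarrow> 2 * ip (T t (A u)) (T t u)) (at_right 0)"
proof -
  define v where "v = T t u"
  have v: "v \<in> D" "A v \<simeq> T t (A u)" using generator_commutes[OF t u] by (auto simp: v_def)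
  define \<delta> where "\<delta> h = sc (1 / h) (T h v - v) - A v" for h
  have \<delta>V: "h > 0 \<Longrightarrow> \<delta> h \<in> V" for h using v by (auto simp: \<delta>_def)
  have l1: "((\<lambda>h. q (\<delta> h)) \<longlongrightarrow> 0) (at_right 0)"
    using gen[of v "A v"] v by (auto simp: eqv_def \<delta>_def)
  have l2: "((\<lambda>h. ip (\<delta> h) v) \<longlongrightarrow> 0) (at_right 0)"
  proof (rule Lim_null_comparison)
    show "\<forall>\<^sub>F h in at_right 0. norm (ip (\<delta> h) v) \<le> q (\<delta> h) * q v"
      using Cauchy_Schwarz[of "\<delta> _" v] \<delta>V v by (auto intro!: eventually_mono[OF eventually_pos])
    show "((\<lambda>h. q (\<delta> h) * q v) \<longlongrightarrow> 0) (at_right 0)" using tendsto_mult_right[OF l1] by simp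
  qed
  have l3: "((\<lambda>h. h * (q (\<delta> h + A v))\<^sup>2) \<longlongrightarrow> 0) (at_right 0)"
  proof (rule Lim_null_comparison)
    show "\<forall>\<^sub>F h in at_right 0. norm (h * (q (\<delta> h + A v))\<^sup>2) \<le> h * (q (\<delta> h) + q (A v))\<^sup>2"
    proof (rule eventually_mono[OF eventually_pos])
      fix h :: real assume h: "0 < h"
      have "(q (\<delta> h + A v))\<^sup>2 \<le> (q (\<delta> h) + q (A v))\<^sup>2"
        using h \<delta>V v by (intro power_mono triangle q_nonneg) auto
      then show "norm (h * (q (\<delta> h + A v))\<^sup>2) \<le> h * (q (\<delta> h) + q (A v))\<^sup>2"
        using h by (simp add: abs_mult)
    qed
    show "((\<lambda>h. h * (q (\<delta> h) + q (A v))\<^sup>2) \<longlongrightarrow> 0) (at_right 0)"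
      by (rule tendsto_eq_intros l1 refl | simp)+
  qed
  have "((\<lambda>h. 2 * ip (A v) v + 2 * ip (\<delta> h) v + h * (q (\<delta> h + A v))\<^sup>2) \<longlongrightarrow> 2 * ip (A v) v + 2 * 0 + 0) (at_right 0)"
    by (intro tendsto_intros l2 l3)
  moreover have "eventually (\<lambda>h. 2 * ip (A v) v + 2 * ip (\<delta> h) v + h * (q (\<delta> h + A v))\<^sup>2 = ((q (T (t + h) u))\<^sup>2 - (q v)\<^sup>2) / h) (at_right 0)"
  proof (rule eventually_mono[OF eventually_pos])
    fix h :: real assume h: "0 < h"
    define y where "y = T h v"
    have y: "y \<in> V" "v \<in> V" using v h by (auto simp: y_def)
    have "q (T (t + h) u) = q y" using T_semi[of h t u] h t u
      unfolding y_def v_def by (intro q_cong eqvI) (auto simp: add.commute)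
    moreover have "(q (\<delta> h + A v))\<^sup>2 = (q (y - v))\<^sup>2 / h\<^sup>2"
      using y v h by (simp add: \<delta>_def y_def[symmetric] power_mult_distrib power_divide)
    then have "(q (\<delta> h + A v))\<^sup>2 = (ip y y - 2 * ip y v + ip v v) / h\<^sup>2"
      using y by (simp add: q_sq ip_sym[of v y])
    moreover have "ip (\<delta> h) v = (ip y v - ip v v) / h - ip (A v) v"
      using y v h by (simp add: \<delta>_def y_def[symmetric])
    ultimately show "2 * ip (A v) v + 2 * ip (\<delta> h) v + h * (q (\<delta> h + A v))\<^sup>2 = ((q (T (t + h) u))\<^sup>2 - (q v)\<^sup>2) / h"
      using y v h q_sq[of v] q_sq[of y] by (simp add: field_simps power2_eq_square)
  qed
  ultimately have "((\<lambda>h. ((q (T (t + h) u))\<^sup>2 - (q v)\<^sup>2) / h) \<longlongrightarrow> 2 * ip (A v) v) (at_right 0)"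
    using tendsto_cong by force
  moreover have "ip (A v) v = ip (T t (A u)) (T t u)" using eqvD[OF v(2), of v] v by (simp add: v_def)
  ultimately show ?thesis by (simp add: v_def)
qed

text \<open>Contractivity is a consequence of dissipativity: the energy is continuous and its right
  derivative is nonpositive.\<close>

lemma contraction_D: assumes u: "u \<in> D" and t: "0 \<le> t" shows "q (T t u) \<le> q u"
proof -
  have "(q (T t u))\<^sup>2 \<le> (q (T 0 u))\<^sup>2"
  proof (rule right_derivative_nonpos_decreasing[OF t])
    show "continuous_on {0..t} (\<lambda>t. (q (T t u))\<^sup>2)"
      using u by (intro continuous_intros continuous_on_subset[OF continuous_norm]) auto
    fix s :: real assume s: "0 \<le> s" "s < t"
    show "((\<lambda>h. ((q (T (s + h) u))\<^sup>2 - (q (T s u))\<^sup>2) / h) \<longlongrightarrow> 2 * ip (T s (A u)) (T s u)) (at_right 0)"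
      by (rule energy_right_derivative[OF u s(1)])
    show "2 * ip (T s (A u)) (T s u) \<le> 0"
      using dissipative[of "T s u"] generator_commutes[OF s(1) u] s u
      by (simp add: eqv_def)
  qed
  moreover have "q (T 0 u) = q u" using u by (intro q_cong eqvI) auto
  ultimately show ?thesis using u t by (auto intro: power2_le_imp_le)
qed

text \<open>Every vector is a value \<open>A y\<close> up to a null vector, and the difference
  quotients of \<open>y\<close>, which lie in \<open>D\<close>, converge to \<open>A y\<close>. So
  surjectivity of \<open>A\<close> replaces the usual averaging of orbits.\<close>

lemma dense_D:
  assumes u: "u \<in> V" and e: "0 < e"
  obtains v where "v \<in> D" "q (v - u) < e"
proof -
  obtain y where y: "y \<in> D" "A y \<simeq> u" using onto[OF u] by blast
  then have "((\<lambda>h. q (sc (1 / h) (T h y - y) - u)) \<longlongrightarrow> 0) (at_right 0)" using gen[of y u] u by auto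
  then have "eventually (\<lambda>h. q (sc (1 / h) (T h y - y) - u) < e) (at_right 0)"
    using order_tendstoD(2) e by blast
  with eventually_pos have "eventually (\<lambda>h. 0 < h \<and> q (sc (1 / h) (T h y - y) - u) < e) (at_right 0)"
    by (rule eventually_conj)
  then obtain h where "0 < h" "q (sc (1 / h) (T h y - y) - u) < e"
    using eventually_happens[of _ "at_right (0::real)"] by auto
  then show ?thesis using y generator_commutes[of h y] by (intro that[of "sc (1 / h) (T h y - y)"]) auto
qed

text \<open>The bound \<open>K\<close> of the single operator \<open>T t\<close> may exceed 1, but
  it is applied only to the small vector \<open>u - v\<close>; on \<open>D\<close> contractivity is
  known already.\<close>

lemma contraction: assumes u: "u \<in> V" and t: "0 \<le> t" shows "q (T t u) \<le> q u"
proof (rule field_le_epsilon)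
  fix e :: real assume e: "0 < e"
  obtain K where K: "\<And>u. u \<in> V \<Longrightarrow> q (T t u) \<le> K * q u" using T_bdd t by blast
  define K' where "K' = max K 0"
  have K': "q (T t u) \<le> K' * q u" if "u \<in> V" for u
    using K[OF that] mult_right_mono[of K K' "q u"] q_nonneg[OF that] by (simp add: K'_def)
  have K'0: "0 \<le> K'" by (simp add: K'_def)
  \<comment> \<open>The error enters with factor \<open>K'\<close> through \<open>T t\<close> and
    with factor 1 when \<open>q v\<close> is compared with \<open>q u\<close>.\<close>
  obtain v where v: "v \<in> D" "q (v - u) < e / (K' + 1)"
    using dense_D[OF u, of "e / (K' + 1)"] e K'0 by auto
  have "q (T t u) \<le> q (T t u - T t v) + q (T t v)"
    using triangle[of "T t u - T t v" "T t v"] u t v by simp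
  also have "q (T t u - T t v) = q (T t (u - v))" using u v t by (intro q_cong eqvI) auto
  also have "\<dots> \<le> K' * q (u - v)" using u v by (intro K') auto
  also have "q (T t v) \<le> q v" by (rule contraction_D[OF v(1) t])
  also have "q v \<le> q (v - u) + q u" using triangle[of "v - u" u] u v by simp
  also have "q (u - v) = q (v - u)" using u v by (intro q_minus_commute) auto
  also have "K' * q (v - u) + (q (v - u) + q u) = (K' + 1) * q (v - u) + q u" by (simp add: algebra_simps)
  also have "(K' + 1) * q (v - u) \<le> e" using v(2) K'0 by (simp add: field_simps)
  finally show "q (T t u) \<le> q u + e" by simp
qed

lemma norm_decreasing:
  assumes u: "u \<in> V" and t: "0 \<le> s" "s \<le> t" shows "q (T t u) \<le> q (T s u)"
proof -
  have "q (T t u) = q (T (t - s) (T s u))" using T_semi[of "t - s" s u] u t by (intro q_cong eqvI) auto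
  also have "\<dots> \<le> q (T s u)" using u t by (intro contraction) auto
  finally show ?thesis .
qed

section \<open>The isometric part of the semigroup\<close>

definition isometric :: "'a set" where "isometric = {u \<in> V. \<forall>t\<ge>0. q (T t u) = q u}"

lemma isometric_iff: "u \<in> isometric \<longleftrightarrow> u \<in> V \<and> (\<forall>t\<ge>0. q (T t u) = q u)"
  by (simp add: isometric_def)

text \<open>The energy loss \<open>E\<close> is a positive semidefinite form because
  \<open>T t\<close> is a contraction, and \<open>E u u = 0\<close>. By the Cauchy-Schwarz principle
  \<open>u\<close> is then orthogonal to everything with respect to \<open>E\<close>; only one of
  the two vectors has to be isometric.\<close>

lemma isometric_ip:
  assumes u: "u \<in> isometric" and v: "v \<in> V" and t: "0 \<le> t"
  shows "ip (T t u) (T t v) = ip u v"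
proof -
  define E where "E x y = ip x y - ip (T t x) (T t y)" for x y
  have [simp]: "u \<in> V" using u by (simp add: isometric_iff)
  have E0: "E u u = 0" using u t by (simp add: E_def isometric_iff q_sq[symmetric])
  have Epos: "0 \<le> E x x" if "x \<in> V" for x
    using power_mono[OF contraction[OF that t], of 2] that t by (simp add: E_def q_sq)
  have quad: "0 \<le> 2 * r * E u v + r\<^sup>2 * E v v" for r
  proof -
    have r: "ip x (T t (u + sc r v)) = ip x (T t u) + r * ip x (T t v)" if "x \<in> V" for x
      using v t that by (simp add: ip_sym[of x])
    have "E (u + sc r v) (u + sc r v) = E u u + 2 * r * E u v + r\<^sup>2 * E v v"
      using v t by (simp add: E_def r ip_sym[of v u] ip_sym[of "T t v" "T t u"] algebra_simps power2_eq_square)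
    then show ?thesis using Epos[of "u + sc r v"] E0 v by simp
  qed
  have "E u v = 0"
  proof (rule ccontr)
    assume *: "E u v \<noteq> 0"
    \<comment> \<open>The minimiser of the quadratic with \<open>E v v\<close> replaced by
      \<open>E v v + 1\<close>, which cannot vanish.\<close>
    define r where "r = - E u v / (E v v + 1)"
    have pos: "0 < E v v + 1" using Epos[OF v] by simp
    have "2 * r * E u v + r\<^sup>2 * E v v < 0"
    proof -
      have "2 * r * E u v + r\<^sup>2 * E v v \<le> 2 * r * E u v + r\<^sup>2 * (E v v + 1)" by (simp add: mult_left_mono)
      also have "\<dots> = - (E u v)\<^sup>2 / (E v v + 1)" using pos by (simp add: r_def power2_eq_square divide_simps)
      also have "\<dots> < 0" using pos * by (simp add: divide_neg_pos)
      finally show ?thesis .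
    qed
    with quad[of r] show False by simp
  qed
  then show ?thesis by (simp add: E_def)
qed

lemma isometric_diff: assumes u: "u \<in> isometric" and v: "v \<in> isometric" shows "u - v \<in> isometric"
proof -
  have "q (T t (u - v)) = q (u - v)" if t: "0 \<le> t" for t
  proof -
    have uv: "u \<in> V" "v \<in> V" using u v by (auto simp: isometric_iff)
    have "ip (T t (u - v)) (T t (u - v)) = ip (u - v) (u - v)"
      using uv t isometric_ip[OF u, of "u - v" t] isometric_ip[OF v, of "u - v" t] by simp
    then show ?thesis by (simp add: q_def)
  qed
  then show ?thesis using u v by (simp add: isometric_iff)
qed

lemma isometric_sc: assumes u: "u \<in> isometric" shows "sc a u \<in> isometric"
proof -
  have "q (T t (sc a u)) = q (sc a u)" if t: "0 \<le> t" for t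
  proof -
    have uV: "u \<in> V" using u by (simp add: isometric_iff)
    have "q (T t (sc a u)) = q (sc a (T t u))" using uV t by (intro q_cong eqvI) auto
    also have "\<dots> = q (sc a u)" using u t by (simp add: isometric_iff)
    finally show ?thesis .
  qed
  then show ?thesis using u by (simp add: isometric_iff)
qed

text \<open>By \<open>isometric_ip\<close> the energy of \<open>T t y\<close> has the constant right
  derivative \<open>2 * ip u y\<close>, so it is affine in \<open>t\<close>. It is also
  nonincreasing and bounded below by 0; hence the slope is 0.\<close>

lemma isometric_preimage:
  assumes y: "y \<in> D" and u: "A y \<simeq> u" "u \<in> isometric"
  shows "y \<in> isometric" "ip u y = 0"
proof -
  have uV: "u \<in> V" using u by (simp add: isometric_iff)
  have const: "ip (T s (A y)) (T s y) = ip u y" if s: "0 \<le> s" for s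
  proof -
    have "T s (A y) \<simeq> T s u" using T_eqv[OF s _ uV u(1)] y by auto
    then have "ip (T s (A y)) (T s y) = ip (T s u) (T s y)" using y s by (intro eqvD) auto
    also have "\<dots> = ip u y" using isometric_ip[OF u(2) _ s] y by auto
    finally show ?thesis .
  qed
  have q0: "q (T 0 y) = q y" using y by (intro q_cong eqvI) auto
  have line: "(q (T t y))\<^sup>2 = (q y)\<^sup>2 + 2 * t * ip u y" if t: "0 \<le> t" for t
  proof (rule antisym)
    have cont: "continuous_on {0..t} (\<lambda>t. (q (T t y))\<^sup>2)"
      using y by (intro continuous_intros continuous_on_subset[OF continuous_norm]) auto
    have der: "((\<lambda>h. \<sigma> * ((q (T (s + h) y))\<^sup>2 - (q (T s y))\<^sup>2) / h - \<sigma> * 2 * ip u y) \<longlongrightarrow> 0) (at_right 0)"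
      if "0 \<le> s" for s \<sigma>
      using tendsto_diff[OF tendsto_mult_left[OF energy_right_derivative[OF y that], of \<sigma>] tendsto_const[of "\<sigma> * 2 * ip u y"]]
      by (simp add: const[OF that] mult.assoc)
    \<comment> \<open>Taking \<open>\<sigma> = 1\<close> and \<open>\<sigma> = -1\<close> gives the
      two inequalities of \<open>line\<close>.\<close>
    have mono: "\<sigma> * (q (T t y))\<^sup>2 - \<sigma> * 2 * ip u y * t \<le> \<sigma> * (q (T 0 y))\<^sup>2 - \<sigma> * 2 * ip u y * 0" for \<sigma>
    proof (rule right_derivative_nonpos_decreasing[OF t, of "\<lambda>t. \<sigma> * (q (T t y))\<^sup>2 - \<sigma> * 2 * ip u y * t" "\<lambda>_. 0"])
      show "continuous_on {0..t} (\<lambda>t. \<sigma> * (q (T t y))\<^sup>2 - \<sigma> * 2 * ip u y * t)"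
        by (intro continuous_intros cont)
      fix s :: real assume "0 \<le> s" "s < t"
      show "((\<lambda>h. (\<sigma> * (q (T (s + h) y))\<^sup>2 - \<sigma> * 2 * ip u y * (s + h) - (\<sigma> * (q (T s y))\<^sup>2 - \<sigma> * 2 * ip u y * s)) / h) \<longlongrightarrow> 0) (at_right 0)"
      proof (rule Lim_transform_eventually[OF der[OF \<open>0 \<le> s\<close>, of \<sigma>]], rule eventually_mono[OF eventually_pos])
        fix h :: real assume "0 < h"
        then show "\<sigma> * ((q (T (s + h) y))\<^sup>2 - (q (T s y))\<^sup>2) / h - \<sigma> * 2 * ip u y =
          (\<sigma> * (q (T (s + h) y))\<^sup>2 - \<sigma> * 2 * ip u y * (s + h) - (\<sigma> * (q (T s y))\<^sup>2 - \<sigma> * 2 * ip u y * s)) / h"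
          by (simp add: field_simps)
      qed
    qed simp
    show "(q (T t y))\<^sup>2 \<le> (q y)\<^sup>2 + 2 * t * ip u y" using mono[of 1] q0 by (simp add: algebra_simps)
    show "(q y)\<^sup>2 + 2 * t * ip u y \<le> (q (T t y))\<^sup>2" using mono[of "-1"] q0 by (simp add: algebra_simps)
  qed
  have "(q (T t y))\<^sup>2 \<le> (q y)\<^sup>2" if "0 \<le> t" for t
    using contraction_D[OF y that] y that by (intro power_mono) auto
  from this[of 1] line[of 1] have le: "ip u y \<le> 0" by simp
  show *: "ip u y = 0"
  proof (rule ccontr)
    assume "ip u y \<noteq> 0"
    with le have neg: "ip u y < 0" by simp
    \<comment> \<open>At this time the affine energy would equal -1.\<close>
    define t where "t = ((q y)\<^sup>2 + 1) / (- 2 * ip u y)"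
    have t: "0 \<le> t" using neg unfolding t_def by (intro divide_nonneg_pos) auto
    have "2 * t * ip u y = - ((q y)\<^sup>2 + 1)" using neg by (simp add: t_def field_simps)
    with line[OF t] have "(q (T t y))\<^sup>2 = -1" by simp
    then show False using zero_le_power2[of "q (T t y)"] by simp
  qed
  have "q (T t y) = q y" if "0 \<le> t" for t
    using line[OF that] * power2_eq_iff_nonneg[of "q (T t y)" "q y"] y that by auto
  then show "y \<in> isometric" using y by (auto simp: isometric_iff)
qed


text \<open>A pointwise choice of preimages. By \<open>below\<close> preimages are unique up to null
  vectors, which makes \<open>S\<close> linear and bounded in the sense of \<open>eqv\<close>
  only.\<close>

definition S :: "'a \<Rightarrow> 'a" where "S w = (SOME u. u \<in> D \<and> A u \<simeq> w)"

lemma S: assumes "w \<in> V" shows "S w \<in> D" "A (S w) \<simeq> w"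
proof -
  have "\<exists>u. u \<in> D \<and> A u \<simeq> w" using onto assms by blast
  from someI_ex[OF this] show "S w \<in> D" "A (S w) \<simeq> w" by (simp_all add: S_def)
qed

lemma S_in [simp]: "w \<in> V \<Longrightarrow> S w \<in> D" "w \<in> V \<Longrightarrow> S w \<in> V"
  using S by auto

lemma S_bound: assumes "w \<in> V" shows "q (S w) \<le> M * q w"
  using below[OF S(1)[OF assms]] q_cong[OF _ assms S(2)[OF assms]] assms by simp

lemma A_inj: assumes "u \<in> D" "v \<in> D" "A u \<simeq> A v" shows "u \<simeq> v"
proof -
  have "q (A (u - v)) = q (A u - A v)" using assms by (intro q_cong eqvI) auto
  also have "\<dots> = 0" using assms eqv_iff[of "A u" "A v"] by auto
  finally have "q (u - v) \<le> 0" using below[of "u - v"] assms by simp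
  moreover have "0 \<le> q (u - v)" using assms by auto
  ultimately show ?thesis using assms by (subst eqv_iff) auto
qed

lemma S_sc: assumes [simp]: "w \<in> V" shows "S (sc a w) \<simeq> sc a (S w)"
proof (rule A_inj)
  show "A (S (sc a w)) \<simeq> A (sc a (S w))"
    using S(2)[of w] S(2)[of "sc a w"] by (simp add: eqv_def)
qed simp_all

lemma S_diff: assumes [simp]: "v \<in> V" "w \<in> V" shows "S (v - w) \<simeq> S v - S w"
proof (rule A_inj)
  show "A (S (v - w)) \<simeq> A (S v - S w)"
    using S(2)[of w] S(2)[of v] S(2)[of "v - w"] by (simp add: eqv_def)
qed simp_all

lemma S_isometric: assumes "u \<in> isometric" shows "S u \<in> isometric" "ip u (S u) = 0"
  using isometric_preimage[OF S assms] assms by (auto simp: isometric_iff)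

lemma M_nonneg: "\<exists>K\<ge>0. \<forall>w\<in>V. q (S w) \<le> K * q w"
proof (intro exI[of _ "max M 0"] conjI ballI)
  fix w assume w: "w \<in> V"
  have "M * q w \<le> max M 0 * q w" using w by (intro mult_right_mono) auto
  with S_bound[OF w] show "q (S w) \<le> max M 0 * q w" by simp
qed simp

text \<open>The inverse \<open>S\<close> of \<open>A\<close> is compact and skew on the isometric part. A maximiser \<open>x\<close> of \<open>q (S x)\<close> on
  its unit sphere satisfies \<open>S (S x) = - s\<^sup>2 x\<close>, which would be an eigenvector for \<open>\<i> / s\<close>.\<close>

lemma isometric_null: assumes z: "z \<in> isometric" shows "q z = 0"
proof (rule ccontr)
  assume z0: "q z \<noteq> 0"
  have iV: "u \<in> isometric \<Longrightarrow> u \<in> V" for u by (simp add: isometric_iff)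
  obtain K where K: "0 \<le> K" "\<And>w. w \<in> V \<Longrightarrow> q (S w) \<le> K * q w" using M_nonneg by blast
  define U where "U = {u \<in> isometric. q u \<le> 1}"
  define s where "s = (SUP u\<in>U. q (S u))"
  have bdd: "bdd_above ((\<lambda>u. q (S u)) ` U)"
  proof (rule bdd_aboveI2)
    fix u assume u: "u \<in> U"
    then have "q (S u) \<le> K * q u" by (intro K(2)) (simp add: U_def iV)
    also have "\<dots> \<le> K * 1" using u K by (intro mult_left_mono) (auto simp: U_def)
    finally show "q (S u) \<le> K" by simp
  qed
  have s_ub: "q (S u) \<le> s * q u" if u: "u \<in> isometric" for u
  proof (cases "q u = 0")
    case True
    then show ?thesis using K(2)[OF iV[OF u]] by simp
  next
    case False
    then have pos: "0 < q u" using q_nonneg[OF iV[OF u]] by simp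
    have "sc (1 / q u) u \<in> U" using pos u iV[OF u] by (simp add: U_def isometric_sc)
    then have "q (S (sc (1 / q u) u)) \<le> s" unfolding s_def by (intro cSUP_upper bdd)
    also have "q (S (sc (1 / q u) u)) = q (sc (1 / q u) (S u))"
      using iV[OF u] by (intro q_cong S_sc) auto
    finally show ?thesis using pos iV[OF u] by (simp add: field_simps)
  qed
  have s0: "0 < s"
  proof -
    \<comment> \<open>If \<open>S z\<close> were null, its difference quotients would be null as
      well, yet they converge to \<open>A (S z)\<close>, that is to \<open>z\<close>, which is not
      null.\<close>
    have qz: "q (S z) > 0"
    proof (rule ccontr)
      assume "\<not> 0 < q (S z)"
      moreover have "0 \<le> q (S z)" using iV[OF z] by simp
      ultimately have "q (S z) = 0" by linarith
      have n: "q (sc (1 / h) (T h (S z) - S z) - z) = q z" if "0 < h" for h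
      proof -
        have "q (T h (S z)) = 0"
          using contraction[of "S z" h] \<open>0 < h\<close> \<open>q (S z) = 0\<close> iV[OF z] by (intro q_le_0D) auto
        have "q (sc (1 / h) (T h (S z) - S z) - z) = q (sc (-1) z)"
        proof (intro q_cong eqvI)
          fix w assume w: "w \<in> V"
          show "ip (sc (1 / h) (T h (S z) - S z) - z) w = ip (sc (-1) z) w"
            using Cauchy_Schwarz[of "S z" w] Cauchy_Schwarz[of "T h (S z)" w] that iV[OF z] w
              \<open>q (S z) = 0\<close> \<open>q (T h (S z)) = 0\<close> by simp
        qed (use that iV[OF z] in auto)
        then show ?thesis using iV[OF z] by simp
      qed
      have "((\<lambda>h. q (sc (1 / h) (T h (S z) - S z) - z)) \<longlongrightarrow> 0) (at_right 0)"
        using gen[of "S z" z] S[of z] iV[OF z] by simp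
      then have "((\<lambda>h::real. q z) \<longlongrightarrow> 0) (at_right 0)"
        by (rule Lim_transform_eventually) (rule eventually_mono[OF eventually_pos n])
      then have "q z = 0" by (simp add: tendsto_const_iff)
      with z0 show False by simp
    qed
    with s_ub[OF z] q_nonneg[OF iV[OF z]] show ?thesis
      by (metis less_le_trans mult_nonpos_nonneg not_le)
  qed
  have "\<exists>x\<in>U. s - 1 / Suc n < q (S x)" for n
  proof -
    have "sc (1 / q z) z \<in> U" using z z0 iV[OF z] q_nonneg[OF iV[OF z]] by (simp add: U_def isometric_sc)
    then have "U \<noteq> {}" by blast
    then show ?thesis using less_cSUP_iff[OF _ bdd, of "s - 1 / Suc n"] by (simp add: s_def)
  qed
  then obtain x where x: "\<And>n. x n \<in> U" "\<And>n. s - 1 / Suc n < q (S (x n))" by metis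
  define a where "a n = S (x n)" for n
  define b where "b n = S (a n)" for n
  have xi: "x n \<in> isometric" and xV [simp]: "x n \<in> V" and x1: "q (x n) \<le> 1" for n
    using x(1)[of n] by (auto simp: U_def iV)
  have ai: "a n \<in> isometric" "ip (x n) (a n) = 0" for n using S_isometric[OF xi] by (auto simp: a_def)
  have aV [simp]: "a n \<in> D" "a n \<in> V" for n by (auto simp: a_def)
  have bi: "b n \<in> isometric" "ip (a n) (b n) = 0" for n using S_isometric[OF ai(1)] by (auto simp: b_def)
  have bV [simp]: "b n \<in> D" "b n \<in> V" for n by (auto simp: b_def)
  \<comment> \<open>Polarisation of \<open>ip u (S u) = 0\<close> at \<open>u = x n - a n\<close>,
    with \<open>a n = S (x n)\<close> and \<open>b n = S (a n)\<close>.\<close>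
  have skew: "ip (x n) (b n) = - ip (a n) (a n)" for n
  proof -
    have "A (a n - b n) \<simeq> x n - a n"
      using S(2)[of "x n"] S(2)[of "a n"] by (simp add: eqv_def a_def[symmetric] b_def[symmetric])
    then have "ip (x n - a n) (a n - b n) = 0"
      using isometric_preimage(2)[of "a n - b n" "x n - a n"] isometric_diff[OF xi ai(1)] by simp
    then show ?thesis using ai(2)[of n] bi(2)[of n] by simp
  qed
  have a_ub: "q (a n) \<le> s" for n
    using s_ub[OF xi[of n]] mult_left_mono[OF x1[of n], of s] s0 unfolding a_def by linarith
  have alim: "(\<lambda>n. q (a n)) \<longlonglongrightarrow> s"
  proof (rule tendsto_sandwich)
    show "(\<lambda>n. s - 1 / Suc n) \<longlonglongrightarrow> s"
      using tendsto_diff[OF tendsto_const[of s] LIMSEQ_Suc[OF lim_1_over_n]] by simp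
  qed (use a_ub x(2) in \<open>auto simp: a_def less_imp_le\<close>)
  \<comment> \<open>By \<open>skew\<close> the square expands to
    \<open>(q b)^2 - 2 s^2 (q a)^2 + s^4 (q x)^2\<close>; with \<open>q b \<le> s * q a\<close> and
    \<open>q x \<le> 1\<close> this is at most \<open>s^2 (s^2 - (q a)^2)\<close>, which tends to 0
    along a maximising sequence.\<close>
  have near: "(q (b n + sc (s\<^sup>2) (x n)))\<^sup>2 \<le> s\<^sup>2 * (s\<^sup>2 - (q (a n))\<^sup>2)" for n
  proof -
    have "(q (b n + sc (s\<^sup>2) (x n)))\<^sup>2 = (q (b n))\<^sup>2 + 2 * s\<^sup>2 * ip (x n) (b n) + s\<^sup>2 * (s\<^sup>2 * (q (x n))\<^sup>2)"
      by (simp add: q_sq ip_sym[of "b n" "x n"] algebra_simps)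
    also have "(q (b n))\<^sup>2 \<le> (s * q (a n))\<^sup>2"
      unfolding b_def using ai by (intro power_mono s_ub) auto
    also have "s\<^sup>2 * (s\<^sup>2 * (q (x n))\<^sup>2) \<le> s\<^sup>2 * (s\<^sup>2 * 1)"
      using x1[of n] by (intro mult_left_mono power_le_one) auto
    finally show ?thesis by (simp add: skew q_sq[symmetric] power_mult_distrib algebra_simps)
  qed
  have nearlim: "(\<lambda>n. q (b n + sc (s\<^sup>2) (x n))) \<longlonglongrightarrow> 0"
  proof -
    have "(\<lambda>n. s\<^sup>2 * (s\<^sup>2 - (q (a n))\<^sup>2)) \<longlonglongrightarrow> s\<^sup>2 * (s\<^sup>2 - s\<^sup>2)"
      by (intro tendsto_intros alim)
    then have "(\<lambda>n. (q (b n + sc (s\<^sup>2) (x n)))\<^sup>2) \<longlonglongrightarrow> 0"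
      by (intro tendsto_zero_squeeze[OF _ _ near]) simp_all
    then have "(\<lambda>n. sqrt ((q (b n + sc (s\<^sup>2) (x n)))\<^sup>2)) \<longlonglongrightarrow> sqrt 0"
      by (rule tendsto_real_sqrt)
    then show ?thesis by simp
  qed
  \<comment> \<open>Compactness applies to \<open>b\<close>, because \<open>A (b n)\<close> is
    equivalent to \<open>a n\<close> and thus bounded by \<open>s\<close>.\<close>
  obtain y r where y: "y \<in> V" "strict_mono r" "(\<lambda>n. q (b (r n) - y)) \<longlonglongrightarrow> 0"
  proof -
    have "q (A (b n)) \<le> s" for n
      using q_cong[OF _ _ S(2)[of "a n"]] a_ub[of n] by (simp add: b_def)
    then show ?thesis using compactness[of b s] that by auto
  qed
  \<comment> \<open>As \<open>b n + s^2 x n\<close> tends to 0 and \<open>b (r n)\<close> to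
    \<open>y\<close>, this is the limit of \<open>x (r n)\<close>.\<close>
  define x0 where "x0 = sc (- 1 / s\<^sup>2) y"
  have [simp]: "x0 \<in> V" using y by (simp add: x0_def)
  have xlim: "(\<lambda>n. q (x (r n) - x0)) \<longlonglongrightarrow> 0"
  proof -
    have *: "q (x (r n) - x0) \<le> (1 / s\<^sup>2) * (q (b (r n) + sc (s\<^sup>2) (x (r n))) + q (b (r n) - y))" for n
    proof -
      have "q (x (r n) - x0) = q (sc (1 / s\<^sup>2) ((b (r n) + sc (s\<^sup>2) (x (r n))) - (b (r n) - y)))"
      proof (intro q_cong eqvI)
        fix w assume w: "w \<in> V"
        have "ip (x (r n) - x0) w = ip (x (r n)) w + 1 / s\<^sup>2 * ip y w"
          using w y(1) by (simp add: x0_def)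
        also have "\<dots> = 1 / s\<^sup>2 * ((ip (b (r n)) w + s\<^sup>2 * ip (x (r n)) w) - (ip (b (r n)) w - ip y w))"
          using s0 by (simp add: field_simps)
        also have "\<dots> = ip (sc (1 / s\<^sup>2) ((b (r n) + sc (s\<^sup>2) (x (r n))) - (b (r n) - y))) w"
          using w y(1) by simp
        finally show "ip (x (r n) - x0) w = ip (sc (1 / s\<^sup>2) ((b (r n) + sc (s\<^sup>2) (x (r n))) - (b (r n) - y))) w" .
      qed (use y(1) in auto)
      also have "\<dots> = 1 / s\<^sup>2 * q ((b (r n) + sc (s\<^sup>2) (x (r n))) - (b (r n) - y))"
        using y(1) by (subst q_sc) auto
      also have "q ((b (r n) + sc (s\<^sup>2) (x (r n))) - (b (r n) - y)) = q ((b (r n) + sc (s\<^sup>2) (x (r n))) + (y - b (r n)))"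
        by (rule arg_cong[of _ _ q]) simp
      also have "\<dots> \<le> q (b (r n) + sc (s\<^sup>2) (x (r n))) + q (y - b (r n))"
        using y(1) by (intro triangle) auto
      finally show ?thesis using y(1) q_minus_commute[of y "b (r n)"] s0 by (simp add: divide_right_mono)
    qed
    have "(\<lambda>n. (1 / s\<^sup>2) * (q (b (r n) + sc (s\<^sup>2) (x (r n))) + q (b (r n) - y))) \<longlonglongrightarrow> (1 / s\<^sup>2) * (0 + 0)"
      by (intro tendsto_intros y LIMSEQ_subseq_LIMSEQ[OF nearlim y(2), unfolded o_def])
    then show ?thesis by (intro tendsto_zero_squeeze[OF _ _ *]) simp_all
  qed
  have Slim: "(\<lambda>n. q (S (x (r n)) - S x0)) \<longlonglongrightarrow> 0" and SSlim: "(\<lambda>n. q (S (S (x (r n))) - S (S x0))) \<longlonglongrightarrow> 0"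
  proof -
    have S_lip: "q (S v - S w) \<le> K * q (v - w)" if "v \<in> V" "w \<in> V" for v w
      using K(2)[of "v - w"] q_cong[OF _ _ S_diff[OF that]] that by simp
    have "(\<lambda>n. K * q (x (r n) - x0)) \<longlonglongrightarrow> K * 0" by (intro tendsto_intros xlim)
    then show *: "(\<lambda>n. q (S (x (r n)) - S x0)) \<longlonglongrightarrow> 0"
      by (intro tendsto_zero_squeeze[OF _ _ S_lip]) simp_all
    have "(\<lambda>n. K * q (S (x (r n)) - S x0)) \<longlonglongrightarrow> K * 0" by (intro tendsto_intros *)
    then show "(\<lambda>n. q (S (S (x (r n))) - S (S x0))) \<longlonglongrightarrow> 0"
      by (intro tendsto_zero_squeeze[OF _ _ S_lip]) simp_all
  qed
  have x0_pos: "q x0 \<noteq> 0"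
  proof
    assume "q x0 = 0"
    then have "q (S x0) = 0" using K(2)[of x0] by (intro q_le_0D) auto
    have "(\<lambda>n. q (a (r n))) \<longlonglongrightarrow> 0"
    proof (rule tendsto_sandwich[OF _ _ tendsto_const[of 0] Slim])
      show "\<forall>\<^sub>F n in sequentially. q (a (r n)) \<le> q (S (x (r n)) - S x0)"
        using triangle[of "S (x (r _)) - S x0" "S x0"] \<open>q (S x0) = 0\<close> by (simp add: a_def)
    qed simp
    moreover have "(\<lambda>n. q (a (r n))) \<longlonglongrightarrow> s"
      using LIMSEQ_subseq_LIMSEQ[OF alim y(2)] by (simp add: o_def)
    ultimately show False using LIMSEQ_unique s0 by blast
  qed
  have yS: "S (S x0) \<simeq> y"
  proof (subst eqv_iff)
    have "(\<lambda>n. q (S (S (x (r n))) - S (S x0)) + q (b (r n) - y)) \<longlonglongrightarrow> 0 + 0"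
      by (intro tendsto_intros SSlim y)
    moreover have "q (S (S x0) - y) \<le> q (S (S (x (r n))) - S (S x0)) + q (b (r n) - y)" for n
      using triangle_diff[of "S (S x0)" "b (r n)" y] y(1) q_minus_commute[of "S (S x0)" "b (r n)"]
      by (simp add: b_def a_def)
    ultimately have "q (S (S x0) - y) \<le> 0" by (intro LIMSEQ_le_const) auto
    then show "q (S (S x0) - y) = 0" using y(1) by (intro q_le_0D) auto
  qed (use y in auto)
  \<comment> \<open>The maximiser \<open>x0\<close> need not lie in \<open>D\<close>;
    \<open>u\<close> is an equivalent vector that does. Then \<open>A u\<close> is
    \<open>- v / s\<close> and \<open>A v\<close> is \<open>u / s\<close> modulo null
    vectors.\<close>
  define u where "u = sc (- 1 / s\<^sup>2) (S (S x0))"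
  define v where "v = sc (1 / s) (S x0)"
  have uV: "u \<in> V" by (simp add: u_def)
  have ux: "u \<simeq> x0" using yS y(1) by (simp add: u_def x0_def eqv_def)
  have "q u = 0"
  proof (rule no_imaginary_eigenvalue[of u v "1 / s"])
    show "A u \<simeq> sc (- (1 / s)) v"
    proof (rule eqvI)
      fix w assume w: "w \<in> V"
      then have "ip (A (S (S x0))) w = ip (S x0) w" by (intro eqvD[OF S(2)]) simp_all
      then show "ip (A u) w = ip (sc (- (1 / s)) v) w"
        using w by (simp add: u_def v_def power2_eq_square)
    qed
    show "A v \<simeq> sc (1 / s) u"
    proof (rule eqvI)
      fix w assume w: "w \<in> V"
      then have "ip (A (S x0)) w = ip x0 w" "ip u w = ip x0 w" by (intro eqvD[OF S(2)] eqvD[OF ux]; simp)+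
      then show "ip (A v) w = ip (sc (1 / s) u) w"
        using w by (simp add: v_def uV)
    qed
  qed (simp_all add: u_def v_def)
  moreover have "q u = q x0" using ux by (intro q_cong) (simp_all add: u_def)
  ultimately show False using x0_pos by simp
qed

text \<open>The norms along the orbit decrease to some \<open>Q\<close>, and a time shift does not
  change this limit. Hence every limit point \<open>z\<close> satisfies \<open>q (T s z) = Q\<close>
  for all \<open>s\<close>; so \<open>z\<close> is isometric, thus null, and
  \<open>Q = 0\<close>.\<close>

lemma stable_on_D: assumes u: "u \<in> D" shows "((\<lambda>t. q (T t u)) \<longlongrightarrow> 0) at_top"
proof -
  have uV [simp]: "u \<in> V" using u by simp
  have A_orbit: "q (A (T (real n) u)) \<le> q (A u)" for n
    using q_cong[OF _ _ generator_commutes(2)[of "real n" u]] generator_commutes(1)[of "real n" u] contraction[of "A u" "real n"] u by simp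
  obtain z r where z: "z \<in> V" "strict_mono r" "(\<lambda>n. q (T (real (r n)) u - z)) \<longlonglongrightarrow> 0"
    using compactness[of "\<lambda>n. T (real n) u" "q (A u)"] A_orbit generator_commutes(1)[of _ u] u by auto
  define Q where "Q = (INF n. q (T (real n) u))"
  have dec: "decseq (\<lambda>n. q (T (real n) u))"
    by (intro decseq_SucI norm_decreasing) auto
  have lim: "(\<lambda>n. q (T (real n) u)) \<longlonglongrightarrow> Q"
    unfolding Q_def by (intro LIMSEQ_decseq_INF dec bdd_belowI2[of _ 0]) auto
  \<comment> \<open>The norm at time \<open>s + r n\<close> lies between those at
    \<open>r n + k\<close> and \<open>r n\<close>, for an integer \<open>k\<close> above
    \<open>s\<close>.\<close>
  have shift: "(\<lambda>n. q (T (s + real (r n)) u)) \<longlonglongrightarrow> Q" if s: "0 \<le> s" for s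
  proof -
    obtain k where k: "s \<le> real k" using real_arch_simple by blast
    show ?thesis
  proof (rule tendsto_sandwich)
    show "\<forall>\<^sub>F n in sequentially. q (T (real (r n + k)) u) \<le> q (T (s + real (r n)) u)"
      using s k by (intro always_eventually allI norm_decreasing) auto
    show "\<forall>\<^sub>F n in sequentially. q (T (s + real (r n)) u) \<le> q (T (real (r n)) u)"
      using s by (intro always_eventually allI norm_decreasing) auto
    show "(\<lambda>n. q (T (real (r n + k)) u)) \<longlonglongrightarrow> Q"
    proof -
      have "filterlim (\<lambda>n. r n + k) sequentially sequentially"
        using z(2) by (intro filterlim_at_top_mono[OF filterlim_subseq[OF z(2)]]) auto
      from filterlim_compose[OF lim this] show ?thesis by simp
    qed
    show "(\<lambda>n. q (T (real (r n)) u)) \<longlonglongrightarrow> Q" using LIMSEQ_subseq_LIMSEQ[OF lim z(2)] by (simp add: o_def)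
  qed
  qed
  have Tz: "q (T s z) = Q" if s: "0 \<le> s" for s
  proof -
    have "(\<lambda>n. q (T (s + real (r n)) u) - q (T s z)) \<longlonglongrightarrow> 0"
    proof (rule Lim_null_comparison[OF _ z(3)], rule always_eventually, rule allI)
      fix n
      have "q (T (s + real (r n)) u) = q (T s (T (real (r n)) u))"
        using T_semi[of s "real (r n)" u] s by (intro q_cong eqvI) auto
      then have "norm (q (T (s + real (r n)) u) - q (T s z)) \<le> q (T s (T (real (r n)) u) - T s z)"
        using abs_q_diff[of "T s (T (real (r n)) u)" "T s z"] s z(1) by simp
      also have "\<dots> = q (T s (T (real (r n)) u - z))" using s z(1) by (intro q_cong eqvI) auto
      also have "\<dots> \<le> q (T (real (r n)) u - z)" using s z(1) by (intro contraction) auto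
      finally show "norm (q (T (s + real (r n)) u) - q (T s z)) \<le> q (T (real (r n)) u - z)" .
    qed
    then have "(\<lambda>n. q (T (s + real (r n)) u)) \<longlonglongrightarrow> q (T s z)" by (simp add: LIM_zero_iff)
    with shift[OF s] show ?thesis using LIMSEQ_unique by blast
  qed
  have qz: "q z = Q"
  proof -
    have "q (T 0 z) = q z" using z(1) by (intro q_cong eqvI) auto
    then show ?thesis using Tz[of 0] by simp
  qed
  have "z \<in> isometric" using z(1) Tz qz by (simp add: isometric_iff)
  from isometric_null[OF this] qz have Q0: "Q = 0" by simp
  show ?thesis
  proof (rule tendstoI)
    fix e :: real assume "0 < e"
    then obtain n where n: "q (T (real n) u) < e"
      using order_tendstoD(2)[OF lim, of e] Q0 eventually_sequentially by auto
    show "\<forall>\<^sub>F t in at_top. dist (q (T t u)) 0 < e"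
      using eventually_ge_at_top[of "real n"]
    proof eventually_elim
      case (elim t)
      have "q (T t u) \<le> q (T (real n) u)" using elim by (intro norm_decreasing) auto
      then show ?case using n elim by simp
    qed
  qed
qed

theorem asymptotically_stable: assumes u: "u \<in> V" shows "((\<lambda>t. q (T t u)) \<longlongrightarrow> 0) at_top"
proof (rule tendstoI)
  fix e :: real assume e: "0 < e"
  obtain v where v: "v \<in> D" "q (v - u) < e / 2" using dense_D[OF u, of "e / 2"] e by auto
  have "\<forall>\<^sub>F t in at_top. q (T t v) < e / 2"
    using order_tendstoD(2)[OF stable_on_D[OF v(1)], of "e / 2"] e by simp
  then show "\<forall>\<^sub>F t in at_top. dist (q (T t u)) 0 < e"
    using eventually_ge_at_top[of 0]
  proof eventually_elim
    case (elim t)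
    have "q (T t u) \<le> q (T t u - T t v) + q (T t v)"
      using triangle[of "T t u - T t v" "T t v"] u elim v by simp
    also have "q (T t u - T t v) = q (T t (u - v))" using u v elim by (intro q_cong eqvI) auto
    also have "\<dots> \<le> q (u - v)" using u v elim by (intro contraction) auto
    also have "q (u - v) = q (v - u)" using u v by (intro q_minus_commute) auto
    finally show ?case using elim v u q_nonneg[of "T t u"] by simp
  qed
qed

end

section \<open>Sobolev functions on an interval\<close>

abbreviation ioo :: "real \<Rightarrow> real \<Rightarrow> real measure" where
  "ioo a b \<equiv> lebesgue_on {a<..<b}"

lemma finite_measure_ioo: "finite_measure (ioo a b)"
  by (rule finite_measure_lebesgue_on) simp

lemma integrable_bounded_ioo:
  fixes f :: "real \<Rightarrow> 'b::{banach, second_countable_topology}"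
  assumes "f \<in> borel_measurable (ioo a b)" "\<And>x. a < x \<Longrightarrow> x < b \<Longrightarrow> norm (f x) \<le> B"
  shows "integrable (ioo a b) f"
  by (rule finite_measure.integrable_const_bound[OF finite_measure_ioo _ assms(1), of B])
     (rule AE_I2, use assms(2) in simp)

lemma indicator_measurable_ioo [measurable]:
  "(\<lambda>x. indicator {s<..<t} x :: real) \<in> borel_measurable (ioo a b)"
  by (intro measurable_restrict_space1 borel_measurable_indicator) simp

lemma continuous_measurable_ioo: "continuous_on {a<..<b} f \<Longrightarrow> f \<in> borel_measurable (ioo a b)"
  by (rule continuous_imp_measurable_on_sets_lebesgue) simp_all

lemma integrable_continuous_ioo:
  fixes f :: "real \<Rightarrow> 'b::{banach, second_countable_topology}"
  assumes "continuous_on {a..b} f"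
  shows "integrable (ioo a b) f"
proof -
  have "bounded (f ` {a..b})" using assms by (intro compact_imp_bounded compact_continuous_image) auto
  then obtain B where "\<And>x. x \<in> {a..b} \<Longrightarrow> norm (f x) \<le> B" unfolding bounded_iff by blast
  then show ?thesis
    by (intro integrable_bounded_ioo[of _ _ _ B] continuous_measurable_ioo continuous_on_subset[OF assms]) auto
qed

lemma integrable_scaleR_bounded:
  fixes f :: "real \<Rightarrow> 'b::{banach, second_countable_topology}"
  assumes f: "integrable (ioo a b) f" and c: "c \<in> borel_measurable (ioo a b)"
    and "\<And>x. a < x \<Longrightarrow> x < b \<Longrightarrow> \<bar>c x\<bar> \<le> B"
  shows "integrable (ioo a b) (\<lambda>x. c x *\<^sub>R f x)"
proof (rule Bochner_Integration.integrable_bound[of _ "\<lambda>x. B *\<^sub>R norm (f x)"])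
  show "integrable (ioo a b) (\<lambda>x. B *\<^sub>R norm (f x))" using f by (intro integrable_scaleR_right integrable_norm)
  show "(\<lambda>x. c x *\<^sub>R f x) \<in> borel_measurable (ioo a b)" using c f by measurable
  show "AE x in ioo a b. norm (c x *\<^sub>R f x) \<le> norm (B *\<^sub>R norm (f x))"
  proof (rule AE_I2)
    fix x assume "x \<in> space (ioo a b)"
    then have "\<bar>c x\<bar> \<le> B" using assms(3) by simp
    moreover from this have "\<bar>c x\<bar> \<le> \<bar>B\<bar>" by simp
    ultimately show "norm (c x *\<^sub>R f x) \<le> norm (B *\<^sub>R norm (f x))" by (simp add: mult_right_mono abs_mult)
  qed
qed

lemma subinterval_ioo:
  fixes f :: "real \<Rightarrow> 'b::{banach, second_countable_topology}"
  assumes "a \<le> s" "t \<le> b"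
  shows "integrable (ioo a b) f \<Longrightarrow> integrable (ioo s t) f"
    and "integral\<^sup>L (ioo s t) f = (LINT x|ioo a b. indicator {s<..<t} x *\<^sub>R f x)"
proof -
  have *: "indicat_real {a<..<b} x * indicator {s<..<t} x = indicator {s<..<t} x" for x
    using assms by (auto simp: indicator_def)
  have i: "integrable (ioo s t) f = integrable (ioo a b) (\<lambda>x. indicator {s<..<t} x *\<^sub>R f x)"
    by (simp add: integrable_restrict_space *)
  show "integral\<^sup>L (ioo s t) f = (LINT x|ioo a b. indicator {s<..<t} x *\<^sub>R f x)"
    by (simp add: integral_restrict_space *)
  show "integrable (ioo s t) f" if "integrable (ioo a b) f"
    unfolding i using that by (intro integrable_scaleR_bounded[of _ _ _ _ 1]) (auto simp: abs_indicator indicator_le_1)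
qed

lemma AE_subinterval:
  assumes "AE x in ioo a b. P x" "a \<le> s" "t \<le> b"
  shows "AE x in ioo s t. P x"
  using assms by (auto simp: AE_restrict_space_iff elim!: eventually_mono)

lemma AE_ioo_ex:
  assumes "AE x in ioo a b. P x" "s < t" "a \<le> s" "t \<le> b"
  shows "\<exists>x\<in>{s<..<t}. P x"
proof (rule ccontr)
  assume "\<not> ?thesis"
  then have neg: "\<And>x. x \<in> {s<..<t} \<Longrightarrow> \<not> P x" by blast
  have "AE x in ioo s t. P x" using AE_subinterval assms by blast
  then have "AE x in ioo s t. False" by (rule lebesgue_on_mono) (use neg in auto)
  then have "emeasure (ioo s t) (space (ioo s t)) = 0"
    by (subst (asm) AE_iff_measurable[OF sets.top]) auto
  then show False using \<open>s < t\<close> by (simp add: emeasure_restrict_space)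
qed

text \<open>A difference at \<open>x\<close> persists near \<open>x\<close>, hence on a nonempty
  open interval inside \<open>(a, b)\<close>, and almost everywhere equality supplies a point of
  agreement there. The endpoints are included, which makes \<open>bdry_trace\<close> well
  defined.\<close>

lemma continuous_AE_eq:
  fixes f g :: "real \<Rightarrow> 'b::real_normed_vector"
  assumes ab: "a < b" and f: "continuous_on {a..b} f" and g: "continuous_on {a..b} g"
    and ae: "AE x in ioo a b. f x = g x" and x: "x \<in> {a..b}"
  shows "f x = g x"
proof (rule ccontr)
  assume "f x \<noteq> g x"
  define h where "h y = norm (f y - g y)" for y
  have h: "continuous_on {a..b} h" unfolding h_def by (intro continuous_intros f g)
  have "0 < h x" using \<open>f x \<noteq> g x\<close> by (simp add: h_def)
  with h x obtain d where d: "0 < d" "\<And>y. y \<in> {a..b} \<Longrightarrow> dist y x < d \<Longrightarrow> dist (h y) (h x) < h x"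
    unfolding continuous_on_iff by metis
  define s where "s = max a (x - d)"
  define t where "t = min b (x + d)"
  have "s < t" "a \<le> s" "t \<le> b" using ab d x by (auto simp: s_def t_def)
  from AE_ioo_ex[OF ae this] obtain y where y: "y \<in> {s<..<t}" "f y = g y" by blast
  then have "dist (h y) (h x) < h x" by (intro d(2)) (auto simp: s_def t_def dist_real_def)
  with y \<open>0 < h x\<close> show False by (simp add: h_def dist_real_def)
qed

text \<open>For \<open>t < a\<close> the interval is empty and the value is 0. Hence several rules
  below only require \<open>t \<le> b\<close>.\<close>

definition prim :: "real \<Rightarrow> (real \<Rightarrow> 'b::{banach, second_countable_topology}) \<Rightarrow> real \<Rightarrow> 'b" where
  "prim a f t = (LINT s|ioo a t. f s)"

lemma prim_refl [simp]: "prim a f a = 0"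
  by (simp add: prim_def integral_restrict_space)

lemma prim_cong_AE:
  assumes "AE x in ioo a b. f x = g x" "f \<in> borel_measurable (ioo a b)" "g \<in> borel_measurable (ioo a b)" "t \<le> b"
  shows "prim a f t = prim a g t"
  unfolding prim_def using assms AE_subinterval[OF assms(1), of a t]
  by (intro integral_cong_AE) (auto intro: measurable_restrict_mono)

lemma prim_lin:
  fixes f g :: "real \<Rightarrow> 'k::{real_normed_field, banach, second_countable_topology}"
  assumes "integrable (ioo a b) f" "integrable (ioo a b) g" "t \<le> b"
  shows "prim a (\<lambda>x. c * f x + g x) t = c * prim a f t + prim a g t"
  using subinterval_ioo(1)[OF order_refl assms(3) assms(1)] subinterval_ioo(1)[OF order_refl assms(3) assms(2)]
  by (simp add: prim_def)

lemma prim_split: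
  assumes f: "integrable (ioo a b) f" and "a \<le> s" "s \<le> t" "t \<le> b"
  shows "prim a f t = prim a f s + prim s f t"
proof -
  have i: "integrable (ioo a t) f" using subinterval_ioo(1) f assms by blast
  have "prim a f s + prim s f t = (LINT x|ioo a t. indicator {a<..<s} x *\<^sub>R f x + indicator {s<..<t} x *\<^sub>R f x)"
    unfolding prim_def using assms subinterval_ioo(2)[of a a s t f] subinterval_ioo(2)[of a s t t f]
      subinterval_ioo(1)[of a a s t f] subinterval_ioo(1)[of a s t t f] i
    by (subst Bochner_Integration.integral_add)
       (auto intro!: integrable_scaleR_bounded[of _ _ _ _ 1] simp: abs_indicator indicator_le_1)
  also have "\<dots> = prim a f t" unfolding prim_def
  proof (rule integral_cong_AE)
    \<comment> \<open>The point \<open>s\<close> belongs to neither of the two open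
      subintervals.\<close>
    have "AE x in lebesgue. x \<noteq> s" by (rule AE_completion[OF AE_lborel_singleton])
    then have "AE x in ioo a t. x \<noteq> s" by (auto simp: AE_restrict_space_iff)
    then show "AE x in ioo a t. indicator {a<..<s} x *\<^sub>R f x + indicator {s<..<t} x *\<^sub>R f x = f x"
      by (rule lebesgue_on_mono) (use assms in \<open>auto simp: indicator_def\<close>)
    show "f \<in> borel_measurable (ioo a t)" using i by simp
    then show "(\<lambda>x. indicator {a<..<s} x *\<^sub>R f x + indicator {s<..<t} x *\<^sub>R f x) \<in> borel_measurable (ioo a t)"
      by measurable
  qed
  finally show ?thesis by simp
qed

lemma norm_prim_le:
  assumes f: "integrable (ioo a b) f" and "a \<le> s" "s \<le> t" "t \<le> b" and "\<And>x. s < x \<Longrightarrow> x < t \<Longrightarrow> norm (f x) \<le> B"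
  shows "norm (prim s f t) \<le> B * (t - s)"
proof -
  have "norm (prim s f t) \<le> (LINT x|ioo s t. norm (f x))" unfolding prim_def by (rule integral_norm_bound)
  also have "\<dots> \<le> (LINT x|ioo s t. B)"
    using assms subinterval_ioo(1)[of a s t b f]
    by (intro integral_mono integrable_norm integrable_bounded_ioo[of "\<lambda>_. B" _ _ "\<bar>B\<bar>"]) auto
  also have "\<dots> = B * (t - s)" using assms by (simp add: measure_restrict_space)
  finally show ?thesis .
qed

text \<open>Dominated convergence with majorant \<open>norm (f x)\<close>: the indicators of
  \<open>(a, u n)\<close> converge to that of \<open>(a, t)\<close> at every \<open>x\<close> except
  possibly \<open>x = t\<close>.\<close>

lemma continuous_prim:
  fixes f :: "real \<Rightarrow> 'b::{banach, second_countable_topology}"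
  assumes f: "integrable (ioo a b) f"
  shows "continuous_on {a..b} (prim a f)"
  unfolding continuous_on_sequentially comp_def
proof (intro allI ballI impI)
  fix u t assume t: "t \<in> {a..b}" and u: "(\<forall>n. u n \<in> {a..b}) \<and> u \<longlonglongrightarrow> t"
  have eq: "prim a f r = (LINT x|ioo a b. indicator {a<..<r} x *\<^sub>R f x)" if "r \<in> {a..b}" for r
    using that subinterval_ioo(2)[of a a r b f] by (simp add: prim_def)
  have m: "(\<lambda>x. indicator {a<..<r} x *\<^sub>R f x) \<in> borel_measurable (ioo a b)" if "r \<in> {a..b}" for r
    using f by (intro borel_measurable_scaleR) auto
  have "(\<lambda>n. LINT x|ioo a b. indicator {a<..<u n} x *\<^sub>R f x) \<longlonglongrightarrow> (LINT x|ioo a b. indicator {a<..<t} x *\<^sub>R f x)"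
  proof (rule integral_dominated_convergence[where w="\<lambda>x. norm (f x)"])
    have "AE x in lebesgue. x \<noteq> t" by (rule AE_completion[OF AE_lborel_singleton])
    then have "AE x in ioo a b. x \<noteq> t" by (auto simp: AE_restrict_space_iff)
    then show "AE x in ioo a b. (\<lambda>n. indicator {a<..<u n} x *\<^sub>R f x) \<longlonglongrightarrow> indicator {a<..<t} x *\<^sub>R f x"
    proof (rule lebesgue_on_mono)
      fix x assume x: "x \<noteq> t" "x \<in> {a<..<b}"
      have "eventually (\<lambda>n. indicator {a<..<u n} x *\<^sub>R f x = indicator {a<..<t} x *\<^sub>R f x) sequentially"
      proof (cases "x < t")
        case True
        then have "eventually (\<lambda>n. x < u n) sequentially" using u order_tendstoD(1) by blast
        then show ?thesis by eventually_elim (use True x in \<open>auto simp: indicator_def\<close>)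
      next
        case False
        then have "t < x" using x by simp
        then have "eventually (\<lambda>n. u n < x) sequentially" using u order_tendstoD(2) by blast
        then show ?thesis by eventually_elim (use False x in \<open>auto simp: indicator_def\<close>)
      qed
      then show "(\<lambda>n. indicator {a<..<u n} x *\<^sub>R f x) \<longlonglongrightarrow> indicator {a<..<t} x *\<^sub>R f x"
        by (rule tendsto_eventually)
    qed
  qed (use f m t u in \<open>auto simp: indicator_def\<close>)
  then show "(\<lambda>n. prim a f (u n)) \<longlonglongrightarrow> prim a f t" using eq t u by simp
qed

section \<open>Test functions and weak derivatives of primitives\<close>

lemma test_functionD:
  assumes "test_function a b \<phi> \<phi>'"
  shows "continuous_on S \<phi>" "continuous_on S \<phi>'"
    "\<exists>B. \<forall>x\<in>{a<..<b}. \<bar>\<phi> x\<bar> \<le> B \<and> \<bar>\<phi>' x\<bar> \<le> B"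
    "\<phi> a = 0" "\<phi> b = 0"
proof -
  have c: "continuous_on UNIV \<phi>" "continuous_on UNIV \<phi>'"
    using assms by (auto simp: test_function_def intro!: DERIV_continuous_on)
  then show c': "continuous_on S \<phi>" "continuous_on S \<phi>'" for S using continuous_on_subset by blast+
  have "bounded (\<phi> ` {a..b})" "bounded (\<phi>' ` {a..b})"
    using c' by (auto intro!: compact_imp_bounded compact_continuous_image)
  then obtain B1 B2 where "\<forall>x\<in>{a..b}. \<bar>\<phi> x\<bar> \<le> B1" "\<forall>x\<in>{a..b}. \<bar>\<phi>' x\<bar> \<le> B2"
    unfolding bounded_iff by auto
  then show "\<exists>B. \<forall>x\<in>{a<..<b}. \<bar>\<phi> x\<bar> \<le> B \<and> \<bar>\<phi>' x\<bar> \<le> B"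
    by (intro exI[of _ "max B1 B2"]) (auto simp: le_max_iff_disj)
  show "\<phi> a = 0" "\<phi> b = 0" using assms by (auto simp: test_function_def)
qed

lemma test_function_integrable:
  fixes g :: "real \<Rightarrow> 'b::{banach, second_countable_topology}"
  assumes "test_function a b \<phi> \<phi>'" "integrable (ioo a b) g"
  shows "integrable (ioo a b) (\<lambda>x. \<phi> x *\<^sub>R g x)" "integrable (ioo a b) (\<lambda>x. \<phi>' x *\<^sub>R g x)"
proof -
  obtain B where "\<forall>x\<in>{a<..<b}. \<bar>\<phi> x\<bar> \<le> B \<and> \<bar>\<phi>' x\<bar> \<le> B" using test_functionD(3)[OF assms(1)] by blast
  then show "integrable (ioo a b) (\<lambda>x. \<phi> x *\<^sub>R g x)" "integrable (ioo a b) (\<lambda>x. \<phi>' x *\<^sub>R g x)"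
    using assms test_functionD(1,2)[OF assms(1)]
    by (auto intro!: integrable_scaleR_bounded[of _ _ _ _ B] continuous_measurable_ioo)
qed

lemma integral_ioo_FTC:
  fixes \<phi> :: "real \<Rightarrow> real"
  assumes "s \<le> t" "\<And>x. (\<phi> has_real_derivative \<phi>' x) (at x)" "continuous_on UNIV \<phi>'"
  shows "integral\<^sup>L (ioo s t) \<phi>' = \<phi> t - \<phi> s"
proof -
  have "(\<phi>' has_integral (\<phi> t - \<phi> s)) {s..t}"
    using assms by (intro fundamental_theorem_of_calculus)
      (auto simp flip: has_real_derivative_iff_has_vector_derivative intro: has_field_derivative_at_within)
  then have "integral {s<..<t} \<phi>' = \<phi> t - \<phi> s" by (simp add: integral_open_interval_real[symmetric] integral_unique)
  moreover have "integrable (ioo s t) \<phi>'"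
    using assms(3) by (intro integrable_continuous_ioo) (rule continuous_on_subset, auto)
  ultimately show ?thesis by (simp add: lebesgue_integral_eq_integral)
qed

text \<open>Fubini on the triangle \<open>s < t\<close>: integrating \<open>\<phi>'\<close> over
  \<open>(s, b)\<close> first leaves \<open>- \<phi> s\<close>, because \<open>\<phi>\<close>
  vanishes at \<open>b\<close>.\<close>

lemma weak_derivative_prim:
  fixes w :: "real \<Rightarrow> 'b::{banach, second_countable_topology}"
  assumes ab: "a < b" and w: "integrable (ioo a b) w" and \<phi>: "test_function a b \<phi> \<phi>'"
  shows "(LINT t|ioo a b. \<phi>' t *\<^sub>R prim a w t) = - (LINT t|ioo a b. \<phi> t *\<^sub>R w t)"
proof -
  let ?M = "ioo a b"
  interpret finite_measure ?M by (rule finite_measure_ioo)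
  interpret P: pair_sigma_finite ?M ?M ..
  have wm[measurable]: "w \<in> borel_measurable ?M" using w by simp
  have \<phi>m[measurable]: "\<phi>' \<in> borel_measurable ?M" using test_functionD(2)[OF \<phi>] by (rule continuous_measurable_ioo)
  have idm[measurable]: "(\<lambda>x. x) \<in> borel_measurable ?M" using id_borel_measurable_lebesgue_on by (simp add: id_def)
  obtain B where B: "\<And>x. x \<in> {a<..<b} \<Longrightarrow> \<bar>\<phi>' x\<bar> \<le> B" using test_functionD(3)[OF \<phi>] by blast
  define F where "F = (\<lambda>(t, s). (if s < t then \<phi>' t else 0) *\<^sub>R w s)"
  have Fm[measurable]: "F \<in> borel_measurable (?M \<Otimes>\<^sub>M ?M)" unfolding F_def by measurable
  have int1: "integrable ?M (\<lambda>s. F (t, s))" if "t \<in> {a<..<b}" for t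
    unfolding F_def prod.case using that B[OF that] abs_ge_zero[of "\<phi>' t"]
    by (intro integrable_scaleR_bounded[OF w, of _ B]) auto
  have "integrable ?M (\<lambda>t. LINT s|?M. norm (F (t, s)))"
  proof (rule integrable_bounded_ioo[of _ _ _ "LINT s|?M. B * norm (w s)"])
    fix t assume t: "a < t" "t < b"
    have "(LINT s|?M. norm (F (t, s))) \<le> (LINT s|?M. B * norm (w s))"
    proof (rule integral_mono)
      fix s
      show "norm (F (t, s)) \<le> B * norm (w s)" using B[of t] t by (auto simp: F_def mult_right_mono intro!: mult_nonneg_nonneg order_trans[OF abs_ge_zero])
    qed (use t int1 w in auto)
    then show "norm (LINT s|?M. norm (F (t, s))) \<le> (LINT s|?M. B * norm (w s))" by simp
  qed measurable
  then have int: "integrable (?M \<Otimes>\<^sub>M ?M) (\<lambda>(t, s). F (t, s))"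
    unfolding case_prod_eta by (rule P.Fubini_integrable[OF Fm]) (rule AE_I2, use int1 in simp)
  have l: "(LINT s|?M. F (t, s)) = \<phi>' t *\<^sub>R prim a w t" if "t \<in> {a<..<b}" for t
  proof -
    have "(LINT s|?M. F (t, s)) = (LINT s|?M. \<phi>' t *\<^sub>R indicator {a<..<t} s *\<^sub>R w s)"
      by (rule Bochner_Integration.integral_cong) (auto simp: F_def indicator_def)
    also have "\<dots> = \<phi>' t *\<^sub>R prim a w t" using that subinterval_ioo(2)[of a a t b w] by (subst integral_scaleR_right) (auto simp: prim_def)
    finally show ?thesis .
  qed
  have r: "(LINT t|?M. F (t, s)) = - (\<phi> s *\<^sub>R w s)" if s: "s \<in> {a<..<b}" for s
  proof -
    have i: "integrable (ioo s b) \<phi>'" using test_functionD(2)[OF \<phi>] by (rule integrable_continuous_ioo)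
    have "(LINT t|?M. F (t, s)) = (LINT t|?M. indicator {s<..<b} t *\<^sub>R (\<phi>' t *\<^sub>R w s))"
      by (rule Bochner_Integration.integral_cong) (auto simp: F_def indicator_def)
    also have "\<dots> = (LINT t|ioo s b. \<phi>' t *\<^sub>R w s)" using s by (subst subinterval_ioo(2)[of a s b b]) auto
    also have "\<dots> = integral\<^sup>L (ioo s b) \<phi>' *\<^sub>R w s" using i by simp
    also have "integral\<^sup>L (ioo s b) \<phi>' = - \<phi> s"
      using \<phi> s test_functionD(5)[OF \<phi>] by (subst integral_ioo_FTC[of s b \<phi>]) (auto simp: test_function_def)
    finally show ?thesis by simp
  qed
  have "(LINT t|?M. \<phi>' t *\<^sub>R prim a w t) = (LINT t|?M. LINT s|?M. F (t, s))"
    by (rule Bochner_Integration.integral_cong) (auto simp: l)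
  also have "\<dots> = (LINT s|?M. LINT t|?M. F (t, s))" by (rule P.Fubini_integral[OF int, symmetric])
  also have "\<dots> = (LINT s|?M. - (\<phi> s *\<^sub>R w s))"
    by (rule Bochner_Integration.integral_cong) (auto simp: r)
  finally show ?thesis by simp
qed

text \<open>The squared positive part of a parabola is positive exactly inside the interval and of
  class C^1, the regularity that \<open>test_function\<close> asks for.\<close>

definition bump :: "real \<Rightarrow> real \<Rightarrow> real \<Rightarrow> real" where
  "bump s t x = (max 0 ((x - s) * (t - x)))\<^sup>2"

definition bump' :: "real \<Rightarrow> real \<Rightarrow> real \<Rightarrow> real" where
  "bump' s t x = 2 * max 0 ((x - s) * (t - x)) * (s + t - 2 * x)"

lemma has_derivative_max_sq: "((\<lambda>y::real. (max 0 y)\<^sup>2) has_real_derivative 2 * max 0 y) (at y)"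
proof -
  consider "y < 0" | "y = 0" | "y > 0" by linarith
  then show ?thesis
  proof cases
    case 1
    have "((\<lambda>y::real. 0) has_real_derivative 0) (at y)" by simp
    then have "((\<lambda>y::real. (max 0 y)\<^sup>2) has_real_derivative 0) (at y)"
      by (rule has_field_derivative_transform_within_open[of _ _ _ "{..<0}"]) (use 1 in auto)
    with 1 show ?thesis by simp
  next
    case 2
    have "((\<lambda>h::real. (max 0 h)\<^sup>2 / h) \<longlongrightarrow> 0) (at 0)"
    proof (rule Lim_null_comparison[of _ "\<lambda>h. \<bar>h\<bar>"])
      show "\<forall>\<^sub>F h in at 0. norm ((max 0 h)\<^sup>2 / h) \<le> \<bar>h::real\<bar>"
        by (rule always_eventually) (auto simp: max_def power2_eq_square)
    qed (rule tendsto_eq_intros | simp)+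
    then show ?thesis using 2 by (simp add: DERIV_def)
  next
    case 3
    have "((\<lambda>y::real. y\<^sup>2) has_real_derivative 2 * y) (at y)" by (auto intro!: derivative_eq_intros)
    then have "((\<lambda>y::real. (max 0 y)\<^sup>2) has_real_derivative 2 * y) (at y)"
      by (rule has_field_derivative_transform_within_open[of _ _ _ "{0<..}"]) (use 3 in auto)
    with 3 show ?thesis by simp
  qed
qed

lemma bump_deriv: "(bump s t has_real_derivative bump' s t x) (at x)"
proof -
  have *: "((\<lambda>x. (x - s) * (t - x)) has_real_derivative (s + t - 2 * x)) (at x)"
    by (auto intro!: derivative_eq_intros)
  show ?thesis unfolding bump_def bump'_def
    using DERIV_chain2[OF has_derivative_max_sq *] by (simp add: mult.assoc)
qed

lemma bump_zero: "x \<notin> {s<..<t} \<Longrightarrow> s \<le> t \<Longrightarrow> bump s t x = 0"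
proof -
  assume "x \<notin> {s<..<t}" "s \<le> t"
  then have "(x - s) * (t - x) \<le> 0" by (cases "x \<le> s") (auto simp: mult_nonpos_nonneg mult_nonneg_nonpos)
  then show ?thesis by (simp add: bump_def)
qed

lemma bump_pos: "x \<in> {s<..<t} \<Longrightarrow> 0 < bump s t x"
  by (simp add: bump_def)

lemma bump_nonneg [simp]: "0 \<le> bump s t x"
  by (simp add: bump_def)

lemma test_function_bump: "a < s \<Longrightarrow> s \<le> t \<Longrightarrow> t < b \<Longrightarrow> test_function a b (bump s t) (bump' s t)"
  unfolding test_function_def
  by (intro conjI allI bump_deriv exI[of _ s] exI[of _ t] impI bump_zero)
     (auto simp: bump'_def[abs_def] intro!: continuous_intros)

text \<open>The map \<open>y / (1 + y)\<close> takes \<open>[0, \<infinity>)\<close> into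
  \<open>[0, 1)\<close>, so these functions are uniformly bounded and tend for growing
  \<open>n\<close> to the indicator of the set where the bump is positive.\<close>

lemma test_function_bump_quotient:
  assumes "a < s" "s \<le> t" "t < b" "0 \<le> n"
  shows "test_function a b (\<lambda>x. n * bump s t x / (1 + n * bump s t x)) (\<lambda>x. n * bump' s t x / (1 + n * bump s t x)\<^sup>2)"
proof -
  have pos: "1 + n * bump s t x > 0" for x using assms(4) by (simp add: add_pos_nonneg)
  have c: "continuous_on UNIV (bump s t)" "continuous_on UNIV (bump' s t)"
    using test_functionD(1,2)[OF test_function_bump[OF assms(1-3)]] by auto
  show ?thesis unfolding test_function_def
  proof (intro conjI allI)
    fix x
    show "((\<lambda>x. n * bump s t x / (1 + n * bump s t x)) has_real_derivative n * bump' s t x / (1 + n * bump s t x)\<^sup>2) (at x)"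
      using pos[of x] by (auto intro!: derivative_eq_intros bump_deriv simp: power2_eq_square field_simps)
    show "continuous_on UNIV (\<lambda>x. n * bump' s t x / (1 + n * bump s t x)\<^sup>2)"
      using pos by (intro continuous_intros c) (auto simp: less_imp_neq[symmetric])
    show "\<exists>c d. a < c \<and> d < b \<and> (\<forall>\<zeta>. \<zeta> \<notin> {c..d} \<longrightarrow> n * bump s t \<zeta> / (1 + n * bump s t \<zeta>) = 0)"
      using assms bump_zero[of _ s t] by (intro exI[of _ s] exI[of _ t]) auto
  qed
qed


text \<open>Bump quotients approximate indicators of intervals, so the integral of \<open>g\<close>
  over every open interval vanishes. A Dynkin argument extends this to Borel sets and completion to
  Lebesgue sets; a function whose integrals over all measurable sets vanish is 0 almost
  everywhere.\<close>

lemma fundamental_lemma: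
  fixes g :: "real \<Rightarrow> 'b::{banach, second_countable_topology}"
  assumes g: "integrable (ioo a b) g"
    and zero: "\<And>\<phi> \<phi>'. test_function a b \<phi> \<phi>' \<Longrightarrow> (LINT x|ioo a b. \<phi> x *\<^sub>R g x) = 0"
  shows "AE x in ioo a b. g x = 0"
proof -
  let ?M = "ioo a b"
  interpret finite_measure ?M by (rule finite_measure_ioo)
  have gm[measurable]: "g \<in> borel_measurable ?M" using g by simp
  have inner: "(LINT x|?M. indicator {s<..<t} x *\<^sub>R g x) = 0" if st: "a \<le> s" "s < t" "t \<le> b" for s t
  proof (rule LIMSEQ_unique)
    \<comment> \<open>The supports have to stay strictly inside \<open>(a, b)\<close> although
      \<open>(s, t)\<close> may touch its ends. The summand 3 keeps
      \<open>s + e n \<le> t - e n\<close> valid from \<open>n = 0\<close> on.\<close>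
    define e where "e n = (t - s) / (real n + 3)" for n
    have e: "0 < e n" for n
      using st by (simp_all add: e_def)
    have e2: "s + e n \<le> t - e n" for n
    proof -
      have "e n \<le> (t - s) / 2" unfolding e_def using st by (intro divide_left_mono) auto
      then show ?thesis by simp
    qed
    define \<phi> where "\<phi> n x = real n * bump (s + e n) (t - e n) x / (1 + real n * bump (s + e n) (t - e n) x)" for n x
    have test: "test_function a b (\<phi> n) (\<lambda>x. real n * bump' (s + e n) (t - e n) x / (1 + real n * bump (s + e n) (t - e n) x)\<^sup>2)" for n
      unfolding \<phi>_def using e[of n] e2[of n] st by (intro test_function_bump_quotient) auto
    have elim: "e \<longlonglongrightarrow> 0"
      unfolding e_def by (intro real_tendsto_divide_at_top tendsto_const)
        (auto intro!: filterlim_tendsto_add_at_top[OF tendsto_const] filterlim_real_sequentially simp: add.commute[of _ 3])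
    show "(\<lambda>n. LINT x|?M. \<phi> n x *\<^sub>R g x) \<longlonglongrightarrow> 0" using zero[OF test] by simp
    show "(\<lambda>n. LINT x|?M. \<phi> n x *\<^sub>R g x) \<longlonglongrightarrow> (LINT x|?M. indicator {s<..<t} x *\<^sub>R g x)"
    proof (rule integral_dominated_convergence[where w="\<lambda>x. norm (g x)"])
      show "(\<lambda>x. \<phi> n x *\<^sub>R g x) \<in> borel_measurable ?M" for n
        using test_function_integrable(1)[OF test[of n] g] by simp
      have "(\<lambda>n. \<phi> n x) \<longlonglongrightarrow> indicator {s<..<t} x" for x
      proof (cases "x \<in> {s<..<t}")
        case True
        have l: "(\<lambda>n. bump (s + e n) (t - e n) x) \<longlonglongrightarrow> bump s t x"
          unfolding bump_def by (rule tendsto_eq_intros elim refl | simp)+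
        have "filterlim (\<lambda>n. real n * bump (s + e n) (t - e n) x) at_top sequentially"
          by (rule filterlim_at_top_mult_tendsto_pos[OF l bump_pos[OF True] filterlim_real_sequentially])
        then have "filterlim (\<lambda>n. 1 + real n * bump (s + e n) (t - e n) x) at_top sequentially"
          by (rule filterlim_tendsto_add_at_top[OF tendsto_const])
        then have "(\<lambda>n. 1 - 1 / (1 + real n * bump (s + e n) (t - e n) x)) \<longlonglongrightarrow> 1 - 0"
          by (intro tendsto_diff tendsto_const real_tendsto_divide_at_top[OF tendsto_const])
        moreover have "1 - 1 / (1 + real n * bump (s + e n) (t - e n) x) = \<phi> n x" for n
        proof -
          have "1 + real n * bump (s + e n) (t - e n) x > 0" by (simp add: add_pos_nonneg)
          then show ?thesis by (simp add: \<phi>_def field_simps)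
        qed
        ultimately show ?thesis using True by simp
      next
        case False
        have "bump (s + e n) (t - e n) x = 0" for n using e[of n] e2[of n] False by (intro bump_zero) auto
        then show ?thesis using False by (simp add: \<phi>_def)
      qed
      then show "AE x in ?M. (\<lambda>n. \<phi> n x *\<^sub>R g x) \<longlonglongrightarrow> indicator {s<..<t} x *\<^sub>R g x"
        by (intro AE_I2 tendsto_intros)
      have "\<bar>\<phi> n x\<bar> \<le> 1" for n x
      proof -
        have "0 \<le> real n * bump (s + e n) (t - e n) x" by simp
        moreover have "\<bar>y / (1 + y)\<bar> \<le> 1" if "0 \<le> y" for y :: real using that by (auto simp: divide_le_eq_1)
        ultimately show ?thesis unfolding \<phi>_def by blast
      qed
      then show "AE x in ?M. norm (\<phi> n x *\<^sub>R g x) \<le> norm (g x)" for n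
        by (intro AE_I2) (auto intro: mult_left_le_one_le)
    qed (use g in auto)
  qed
  have ioo: "(LINT x|?M. indicator {s<..<t} x *\<^sub>R g x) = 0" for s t
  proof -
    have "(LINT x|?M. indicator {s<..<t} x *\<^sub>R g x) = (LINT x|?M. indicator {max a s<..<min b t} x *\<^sub>R g x)"
      by (rule Bochner_Integration.integral_cong) (auto simp: indicator_def)
    also have "\<dots> = 0"
    proof (cases "max a s < min b t")
      case True
      then show ?thesis by (intro inner) auto
    next
      case False
      then have "{max a s<..<min b t} = {}" by (auto simp del: min_less_iff_conj max_less_iff_conj)
      then show ?thesis by simp
    qed
    finally show ?thesis .
  qed
  have bm: "A \<in> sets borel \<Longrightarrow> indicat_real A \<in> borel_measurable ?M" for A
    by (intro measurable_restrict_space1 borel_measurable_indicator) auto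
  have ib: "integrable ?M (\<lambda>x. indicat_real A x *\<^sub>R g x)" if "A \<in> sets borel" for A
    using bm[OF that] by (intro integrable_scaleR_bounded[OF g, of _ 1]) (auto simp: abs_indicator indicator_le_1)
  have borel0: "(LINT x|?M. indicat_real A x *\<^sub>R g x) = 0" if "A \<in> sets borel" for A
  proof -
    \<comment> \<open>Open intervals form an intersection-stable generator of the Borel sets, so
      complements and disjoint unions suffice.\<close>
    let ?G = "range (\<lambda>(a, b). {a<..<b::real})"
    have sb: "sets (borel :: real measure) = sigma_sets UNIV ?G"
      by (subst borel_eq_box) (simp add: box_real[abs_def])
    have "Int_stable ?G" by (auto simp: Int_stable_def)
    moreover have "?G \<subseteq> Pow UNIV" by simp
    moreover have "A \<in> sigma_sets UNIV ?G" using that sb by simp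
    ultimately show ?thesis
    proof (induction rule: sigma_sets_induct_disjoint)
      case (basic A)
      then show ?case using ioo by auto
    next
      case empty
      then show ?case by simp
    next
      case (compl A)
      have A: "A \<in> sets borel" using compl sb by simp
      have U: "(LINT x|?M. g x) = 0"
      proof -
        have "(LINT x|?M. g x) = (LINT x|?M. indicator {a<..<b} x *\<^sub>R g x)"
          by (rule Bochner_Integration.integral_cong) auto
        with ioo show ?thesis by simp
      qed
      have "(LINT x|?M. indicat_real (UNIV - A) x *\<^sub>R g x) = (LINT x|?M. g x - indicat_real A x *\<^sub>R g x)"
        by (rule Bochner_Integration.integral_cong) (auto simp: indicator_def)
      also have "\<dots> = 0" using U compl ib[OF A] g by simp
      finally show ?case .
    next
      case (union A)
      have A: "A i \<in> sets borel" for i using union sb by auto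
      have lim: "(\<lambda>n. LINT x|?M. (\<Sum>i<n. indicat_real (A i) x) *\<^sub>R g x) \<longlonglongrightarrow> (LINT x|?M. indicat_real (\<Union>i. A i) x *\<^sub>R g x)"
      proof (rule integral_dominated_convergence[where w="\<lambda>x. norm (g x)"])
        have s: "(\<lambda>i. indicat_real (A i) x) sums indicat_real (\<Union>i. A i) x" for x
          using union(1) by (intro indicator_sums) (auto simp: disjoint_family_on_def)
        then show "AE x in ?M. (\<lambda>n. (\<Sum>i<n. indicat_real (A i) x) *\<^sub>R g x) \<longlonglongrightarrow> indicat_real (\<Union>i. A i) x *\<^sub>R g x"
          by (intro AE_I2 tendsto_intros) (simp add: sums_def)
        have "(\<Sum>i<n. indicat_real (A i) x) \<le> 1" for n x
        proof -
          have "(\<Sum>i<n. indicat_real (A i) x) \<le> (\<Sum>i. indicat_real (A i) x)"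
            using sums_summable[OF s] by (intro sum_le_suminf) auto
          also have "\<dots> = indicat_real (\<Union>i. A i) x" using sums_unique[OF s] by metis
          finally show ?thesis using indicator_le_1[of "\<Union>i. A i" x] by (meson order_trans)
        qed
        then show "AE x in ?M. norm ((\<Sum>i<n. indicat_real (A i) x) *\<^sub>R g x) \<le> norm (g x)" for n
          by (intro AE_I2) (auto simp: sum_nonneg intro!: mult_left_le_one_le)
        show "(\<lambda>x. (\<Sum>i<n. indicat_real (A i) x) *\<^sub>R g x) \<in> borel_measurable ?M" for n
          using bm[OF A] by measurable
        show "(\<lambda>x. indicat_real (\<Union>i. A i) x *\<^sub>R g x) \<in> borel_measurable ?M"
          using bm[of "\<Union>i. A i"] A by measurable
      qed (use g in auto)
      have z: "(LINT x|?M. (\<Sum>i<n. indicat_real (A i) x) *\<^sub>R g x) = 0" for n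
        unfolding scaleR_sum_left by (subst Bochner_Integration.integral_sum) (use ib[OF A] union(3) in auto)
      show ?case using lim unfolding z by (simp add: LIMSEQ_const_iff)
    qed
  qed
  show ?thesis
  proof (rule density_zero[OF g])
    fix A assume "A \<in> sets ?M"
    then have "A \<in> sets lebesgue" by (auto simp: sets_restrict_space)
    \<comment> \<open>A Lebesgue set is a Borel set up to a subset of a null set.\<close>
    then obtain S N N' where A: "A = S \<union> N" "N \<subseteq> N'" "N' \<in> null_sets lborel" "S \<in> sets lborel"
      by (rule sets_completionE)
    have "AE x in lebesgue. x \<notin> N'" by (intro AE_completion AE_not_in A)
    then have ae: "AE x in ?M. indicat_real A x *\<^sub>R g x = indicat_real S x *\<^sub>R g x"
      using A by (auto simp: AE_restrict_space_iff indicator_def elim!: eventually_mono)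
    have "(LINT x|?M. indicat_real A x *\<^sub>R g x) = (LINT x|?M. indicat_real S x *\<^sub>R g x)"
      using \<open>A \<in> sets ?M\<close> bm[of S] A(4) by (intro integral_cong_AE ae borel_measurable_scaleR gm) auto
    with borel0[of S] A(4) show "set_lebesgue_integral ?M A g = 0"
      by (simp add: set_lebesgue_integral_def)
  qed
qed


section \<open>Weak derivatives determine a function up to a constant\<close>

lemma weak_derivative_unique:
  assumes g: "integrable (ioo a b) g1" "integrable (ioo a b) g2"
    and w: "is_weak_derivative a b f g1" "is_weak_derivative a b f g2"
  shows "AE x in ioo a b. g1 x = g2 x"
proof -
  have "AE x in ioo a b. g1 x - g2 x = 0"
  proof (rule fundamental_lemma)
    fix \<phi> \<phi>' assume t: "test_function a b \<phi> \<phi>'"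
    have "(LINT x|ioo a b. \<phi> x *\<^sub>R g1 x) = (LINT x|ioo a b. \<phi> x *\<^sub>R g2 x)"
      using w t unfolding is_weak_derivative_def by fastforce
    then show "(LINT x|ioo a b. \<phi> x *\<^sub>R (g1 x - g2 x)) = 0"
      using test_function_integrable(1)[OF t g(1)] test_function_integrable(1)[OF t g(2)]
      by (simp add: scaleR_diff_right)
  qed (use g in auto)
  then show ?thesis by simp
qed

lemma integral_test_function_deriv:
  assumes "a < b" "test_function a b \<phi> \<phi>'"
  shows "integral\<^sup>L (ioo a b) \<phi>' = 0"
  using assms test_functionD(4,5)[OF assms(2)] integral_ioo_FTC[of a b \<phi> \<phi>'] by (simp add: test_function_def)

lemma is_weak_derivative_prim:
  fixes g :: "real \<Rightarrow> 'k::real_or_complex"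
  assumes ab: "a < b" and h': "integrable (ioo a b) h'"
    and h: "\<And>t. t \<in> {a..b} \<Longrightarrow> prim a h' t = h t - h a"
    and g: "AE x in ioo a b. g x = h x" "g \<in> borel_measurable (ioo a b)"
  shows "is_weak_derivative a b g h'"
  unfolding is_weak_derivative_def
proof (intro allI impI)
  fix \<phi> \<phi>' assume t: "test_function a b \<phi> \<phi>'"
  have c: "continuous_on {a..b} (prim a h')" by (rule continuous_prim[OF h'])
  then have i: "integrable (ioo a b) (prim a h')" by (rule integrable_continuous_ioo)
  have \<phi>m[measurable]: "\<phi>' \<in> borel_measurable (ioo a b)"
    using test_functionD(2)[OF t] by (rule continuous_measurable_ioo)
  have [measurable]: "g \<in> borel_measurable (ioo a b)" "prim a h' \<in> borel_measurable (ioo a b)"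
    using g i by auto
  have "(LINT x|ioo a b. \<phi>' x *\<^sub>R g x) = (LINT x|ioo a b. \<phi>' x *\<^sub>R h a + \<phi>' x *\<^sub>R prim a h' x)"
  proof (rule integral_cong_AE)
    show "AE x in ioo a b. \<phi>' x *\<^sub>R g x = \<phi>' x *\<^sub>R h a + \<phi>' x *\<^sub>R prim a h' x"
      using g(1)
    proof (rule lebesgue_on_mono)
      fix x assume "g x = h x" "x \<in> {a<..<b}"
      then show "\<phi>' x *\<^sub>R g x = \<phi>' x *\<^sub>R h a + \<phi>' x *\<^sub>R prim a h' x"
        using h[of x] by (simp flip: scaleR_add_right)
    qed
  qed measurable
  also have "\<dots> = integral\<^sup>L (ioo a b) \<phi>' *\<^sub>R h a + (LINT x|ioo a b. \<phi>' x *\<^sub>R prim a h' x)"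
    using test_function_integrable(2)[OF t i] test_functionD(2)[OF t]
      integral_scaleR_left[OF integrable_continuous_ioo[OF test_functionD(2)[OF t, of "{a..b}"]], of "h a"]
    by (subst Bochner_Integration.integral_add)
       (auto intro!: integrable_continuous_ioo continuous_intros)
  also have "\<dots> = - (LINT x|ioo a b. \<phi> x *\<^sub>R h' x)"
    using integral_test_function_deriv[OF ab t] weak_derivative_prim[OF ab h' t] by simp
  finally show "(LINT x|ioo a b. \<phi>' x *\<^sub>R g x) = - (LINT x|ioo a b. \<phi> x *\<^sub>R h' x)" .
qed

text \<open>An antiderivative is constant to the left of \<open>c\<close> and to the right of
  \<open>d\<close>. Normalised to vanish at \<open>a\<close>, it also vanishes at \<open>b\<close>
  because the integral is 0, so both constants are 0 and the support is compact.\<close>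

lemma test_function_antiderivative:
  assumes ab: "a < b" and \<psi>: "continuous_on UNIV \<psi>" and cd: "a < c" "d < b" "\<And>x. x \<notin> {c..d} \<Longrightarrow> \<psi> x = 0"
    and int: "integral\<^sup>L (ioo a b) \<psi> = 0"
  shows "\<exists>\<Psi>. test_function a b \<Psi> \<psi>"
proof -
  obtain F where F: "\<And>x. (F has_real_derivative \<psi> x) (at x)"
    using einterval_antiderivative[of "-\<infinity>" "\<infinity>" \<psi>] \<psi>
    by (auto simp: continuous_on_eq_continuous_at simp flip: has_real_derivative_iff_has_vector_derivative)
  define \<Psi> where "\<Psi> x = F x - F a" for x
  have d: "(\<Psi> has_real_derivative \<psi> x) (at x)" for x
    unfolding \<Psi>_def using F[of x] by (auto intro!: derivative_eq_intros)
  have "\<Psi> b - \<Psi> a = 0" using integral_ioo_FTC[of a b \<Psi> \<psi>] ab d \<psi> int by simp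
  then have ends: "\<Psi> a = 0" "\<Psi> b = 0" by (simp_all add: \<Psi>_def)
  define c' where "c' = min c b"
  define d' where "d' = max d a"
  have l: "\<Psi> x = 0" if "x < c" for x
  proof -
    have "\<exists>k. \<forall>y\<in>{..<c}. \<Psi> y = k"
      proof (rule has_field_derivative_zero_constant)
      fix y assume "y \<in> {..<c}"
      then have "\<psi> y = 0" by (intro cd(3)) auto
      then show "(\<Psi> has_field_derivative 0) (at y within {..<c})"
        using d[of y] has_field_derivative_at_within by metis
    qed simp
    then show ?thesis using ends that cd by (metis lessThan_iff)
  qed
  have r: "\<Psi> x = 0" if "x > d" for x
  proof -
    have "\<exists>k. \<forall>y\<in>{d<..}. \<Psi> y = k"
      proof (rule has_field_derivative_zero_constant)
      fix y assume "y \<in> {d<..}"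
      then have "\<psi> y = 0" by (intro cd(3)) auto
      then show "(\<Psi> has_field_derivative 0) (at y within {d<..})"
        using d[of y] has_field_derivative_at_within by metis
    qed simp
    then show ?thesis using ends that cd by (metis greaterThan_iff)
  qed
  have "test_function a b \<Psi> \<psi>"
    unfolding test_function_def
  proof (intro conjI allI d \<psi>)
    have "\<Psi> x = 0" if "x \<notin> {c..d}" for x using that l[of x] r[of x] by force
    then show "\<exists>c d. a < c \<and> d < b \<and> (\<forall>x. x \<notin> {c..d} \<longrightarrow> \<Psi> x = 0)" using cd(1,2) by blast
  qed
  then show ?thesis by blast
qed

text \<open>The du Bois-Reymond lemma. Subtracting from a test function the multiple of a fixed bump
  with the same integral leaves the derivative of a test function, to which the hypothesis
  applies.\<close>

lemma weakly_constant:
  fixes g :: "real \<Rightarrow> 'b::{banach, second_countable_topology}"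
  assumes ab: "a < b" and g: "integrable (ioo a b) g"
    and zero: "\<And>\<phi> \<phi>'. test_function a b \<phi> \<phi>' \<Longrightarrow> (LINT x|ioo a b. \<phi>' x *\<^sub>R g x) = 0"
  shows "\<exists>c. AE x in ioo a b. g x = c"
proof -
  define s t where "s = a + (b - a) / 3" and "t = a + (b - a) / 2"
  have st: "a < s" "s < t" "t < b" using ab by (auto simp: s_def t_def field_simps)
  have \<chi>: "test_function a b (bump s t) (bump' s t)" using st by (intro test_function_bump) auto
  have \<chi>c: "continuous_on UNIV (bump s t)" using test_functionD(1)[OF \<chi>] .
  have \<chi>i: "integrable (ioo a b) (bump s t)" by (intro integrable_continuous_ioo test_functionD(1)[OF \<chi>])
  define I where "I = integral\<^sup>L (ioo a b) (bump s t)"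
  have I: "I \<noteq> 0"
  proof
    assume "I = 0"
    then have "AE x in ioo a b. bump s t x = 0"
      using integral_nonneg_eq_0_iff_AE[OF \<chi>i] by (simp add: I_def)
    from AE_ioo_ex[OF this, of s t] st bump_pos[of _ s t] show False by force
  qed
  \<comment> \<open>The only possible constant: the mean of \<open>g\<close> with the bump as
    weight.\<close>
  define c where "c = (1 / I) *\<^sub>R (LINT x|ioo a b. bump s t x *\<^sub>R g x)"
  have "AE x in ioo a b. g x - c = 0"
  proof (rule fundamental_lemma)
    show "integrable (ioo a b) (\<lambda>x. g x - c)"
      using g by (intro Bochner_Integration.integrable_diff integrable_bounded_ioo[of "\<lambda>_. c" _ _ "norm c"]) auto
    fix \<phi> \<phi>' assume \<phi>: "test_function a b \<phi> \<phi>'"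
    define J where "J = integral\<^sup>L (ioo a b) \<phi>"
    have \<phi>i: "integrable (ioo a b) \<phi>" by (intro integrable_continuous_ioo test_functionD(1)[OF \<phi>])
    define \<psi> where "\<psi> x = \<phi> x - (J / I) * bump s t x" for x
    obtain c0 d0 where cd: "a < c0" "d0 < b" "\<And>x. x \<notin> {c0..d0} \<Longrightarrow> \<phi> x = 0"
      using \<phi> unfolding test_function_def by blast
    have "\<exists>\<Psi>. test_function a b \<Psi> \<psi>"
    proof (rule test_function_antiderivative[OF ab, of _ "min c0 s" "max d0 t"])
      show "continuous_on UNIV \<psi>" unfolding \<psi>_def[abs_def]
        by (intro continuous_intros test_functionD(1)[OF \<phi>] \<chi>c)
      fix x assume "x \<notin> {min c0 s..max d0 t}"
      then have "\<phi> x = 0" "bump s t x = 0" using st by (auto intro!: cd(3) bump_zero)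
      then show "\<psi> x = 0" by (simp add: \<psi>_def)
    next
      show "integral\<^sup>L (ioo a b) \<psi> = 0"
        unfolding \<psi>_def[abs_def] using \<phi>i \<chi>i I by (simp add: I_def[symmetric] J_def[symmetric])
    qed (use cd st in auto)
    then have "(LINT x|ioo a b. \<psi> x *\<^sub>R g x) = 0" using zero by blast
    moreover have "(LINT x|ioo a b. \<psi> x *\<^sub>R g x) = (LINT x|ioo a b. \<phi> x *\<^sub>R g x - (J / I) *\<^sub>R (bump s t x *\<^sub>R g x))"
      by (rule Bochner_Integration.integral_cong) (auto simp: \<psi>_def scaleR_diff_left)
    ultimately have "(LINT x|ioo a b. \<phi> x *\<^sub>R g x) = J *\<^sub>R c"
      using test_function_integrable(1)[OF \<phi> g] test_function_integrable(1)[OF \<chi> g] by (simp add: c_def del: scaleR_scaleR) simp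
    moreover have "(LINT x|ioo a b. \<phi> x *\<^sub>R c) = J *\<^sub>R c" using \<phi>i by (simp add: J_def)
    ultimately show "(LINT x|ioo a b. \<phi> x *\<^sub>R (g x - c)) = 0"
      using test_function_integrable(1)[OF \<phi> g] \<phi>i by (simp add: scaleR_diff_right J_def)
  qed
  then show ?thesis by (intro exI[of _ c]) simp
qed

text \<open>The primitive of \<open>g'\<close> has weak derivative \<open>g'\<close>, so its
  difference from \<open>g\<close> is weakly constant.\<close>

lemma weak_derivative_prim_ex:
  fixes g :: "real \<Rightarrow> 'k::real_or_complex"
  assumes ab: "a < b" and g: "integrable (ioo a b) g" "integrable (ioo a b) g'" "is_weak_derivative a b g g'"
  shows "\<exists>c. AE x in ioo a b. g x = c + prim a g' x"
proof -
  have i: "integrable (ioo a b) (prim a g')" by (intro integrable_continuous_ioo continuous_prim g)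
  have "\<exists>c. AE x in ioo a b. g x - prim a g' x = c"
  proof (rule weakly_constant[OF ab])
    fix \<phi> \<phi>' assume t: "test_function a b \<phi> \<phi>'"
    then show "(LINT x|ioo a b. \<phi>' x *\<^sub>R (g x - prim a g' x)) = 0"
      using weak_derivative_prim[OF ab g(2) t] g(3) test_function_integrable(2)[OF t g(1)] test_function_integrable(2)[OF t i]
      by (simp add: is_weak_derivative_def scaleR_diff_right)
  qed (use g i in auto)
  then show ?thesis by (auto simp: diff_eq_eq)
qed

section \<open>Square integrable functions\<close>

lemma L2_measurable: "L2_on a b g \<Longrightarrow> g \<in> borel_measurable (ioo a b)"
  by (simp add: L2_on_def)

lemma L2_integrable:
  fixes g :: "real \<Rightarrow> 'k::real_or_complex"
  assumes "L2_on a b g" shows "integrable (ioo a b) g"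
proof (rule Bochner_Integration.integrable_bound[of _ "\<lambda>x. 1 + (norm (g x))\<^sup>2"])
  show "integrable (ioo a b) (\<lambda>x. 1 + (norm (g x))\<^sup>2)"
    using assms by (intro Bochner_Integration.integrable_add integrable_bounded_ioo[of "\<lambda>_. 1::real" _ _ 1]) (auto simp: L2_on_def)
  have "r \<le> 1 + r\<^sup>2" for r :: real
    using zero_le_power2[of "r - 1 / 2"] by (simp add: power2_eq_square algebra_simps)
  then show "AE x in ioo a b. norm (g x) \<le> norm (1 + (norm (g x))\<^sup>2)" by (intro AE_I2) simp
qed (use assms in \<open>auto simp: L2_on_def\<close>)

lemma L2_bound:
  fixes g f :: "real \<Rightarrow> 'k::real_or_complex"
  assumes "L2_on a b f" "g \<in> borel_measurable (ioo a b)" "\<And>x. x \<in> {a<..<b} \<Longrightarrow> norm (g x) \<le> C * norm (f x)"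
  shows "L2_on a b g"
  unfolding L2_on_def
proof
  show "integrable (ioo a b) (\<lambda>x. (norm (g x))\<^sup>2)"
  proof (rule Bochner_Integration.integrable_bound[of _ "\<lambda>x. C\<^sup>2 * (norm (f x))\<^sup>2"])
    show "AE x in ioo a b. norm ((norm (g x))\<^sup>2) \<le> norm (C\<^sup>2 * (norm (f x))\<^sup>2)"
    proof (rule AE_I2)
      fix x assume "x \<in> space (ioo a b)"
      then have "(norm (g x))\<^sup>2 \<le> (C * norm (f x))\<^sup>2" using assms(3)[of x] by (intro power_mono) auto
      then show "norm ((norm (g x))\<^sup>2) \<le> norm (C\<^sup>2 * (norm (f x))\<^sup>2)" by (simp add: power_mult_distrib)
    qed
  qed (use assms in \<open>auto simp: L2_on_def\<close>)
qed (use assms in auto)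

lemma L2_add:
  fixes f g :: "real \<Rightarrow> 'k::real_or_complex"
  assumes "L2_on a b f" "L2_on a b g" shows "L2_on a b (\<lambda>x. f x + g x)"
  unfolding L2_on_def
proof
  have m: "f \<in> borel_measurable (ioo a b)" "g \<in> borel_measurable (ioo a b)" using assms by (auto simp: L2_on_def)
  then show "(\<lambda>x. f x + g x) \<in> borel_measurable (ioo a b)" by measurable
  show "integrable (ioo a b) (\<lambda>x. (norm (f x + g x))\<^sup>2)"
  proof (rule Bochner_Integration.integrable_bound[of _ "\<lambda>x. 2 * (norm (f x))\<^sup>2 + 2 * (norm (g x))\<^sup>2"])
    show "AE x in ioo a b. norm ((norm (f x + g x))\<^sup>2) \<le> norm (2 * (norm (f x))\<^sup>2 + 2 * (norm (g x))\<^sup>2)"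
    proof (rule AE_I2)
      fix x
      have "(norm (f x + g x))\<^sup>2 \<le> (norm (f x) + norm (g x))\<^sup>2" by (intro power_mono norm_triangle_ineq) simp
      also have "\<dots> \<le> 2 * (norm (f x))\<^sup>2 + 2 * (norm (g x))\<^sup>2"
        using zero_le_power2[of "norm (f x) - norm (g x)"] by (simp add: power2_eq_square algebra_simps)
      finally show "norm ((norm (f x + g x))\<^sup>2) \<le> norm (2 * (norm (f x))\<^sup>2 + 2 * (norm (g x))\<^sup>2)" by simp
    qed
  qed (use assms m in \<open>auto simp: L2_on_def\<close>)
qed

lemma L2_cmult:
  fixes f :: "real \<Rightarrow> 'k::real_or_complex"
  assumes "L2_on a b f" shows "L2_on a b (\<lambda>x. c * f x)"
  using assms by (intro L2_bound[OF assms, of _ "norm c"]) (auto simp: L2_on_def norm_mult)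

lemma L2_scaleR_bounded:
  fixes f :: "real \<Rightarrow> 'k::real_or_complex"
  assumes "L2_on a b f" "c \<in> borel_measurable (ioo a b)" "\<And>x. x \<in> {a<..<b} \<Longrightarrow> \<bar>c x\<bar> \<le> C"
  shows "L2_on a b (\<lambda>x. c x *\<^sub>R f x)"
  using assms by (intro L2_bound[OF assms(1), of _ C]) (auto simp: L2_on_def intro!: mult_right_mono)

lemma L2_bounded:
  fixes f :: "real \<Rightarrow> 'k::real_or_complex"
  assumes "f \<in> borel_measurable (ioo a b)" "\<And>x. x \<in> {a<..<b} \<Longrightarrow> norm (f x) \<le> C"
  shows "L2_on a b f"
  unfolding L2_on_def
proof
  have "(norm (f x))\<^sup>2 \<le> C\<^sup>2" if "x \<in> {a<..<b}" for x using assms(2)[OF that] by (intro power_mono) auto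
  then show "integrable (ioo a b) (\<lambda>x. (norm (f x))\<^sup>2)"
    using assms(1) by (intro integrable_bounded_ioo[of _ _ _ "C\<^sup>2"]) auto
qed (rule assms)

lemma L2_continuous:
  fixes f :: "real \<Rightarrow> 'k::real_or_complex"
  assumes "continuous_on {a..b} f" shows "L2_on a b f"
proof -
  have "bounded (f ` {a..b})" using assms by (intro compact_imp_bounded compact_continuous_image) auto
  then obtain B where "\<forall>x\<in>{a..b}. norm (f x) \<le> B" unfolding bounded_iff by blast
  then show ?thesis
    by (intro L2_bounded[of _ _ _ B] continuous_measurable_ioo continuous_on_subset[OF assms]) auto
qed

lemma L2_subinterval:
  fixes f :: "real \<Rightarrow> 'k::real_or_complex"
  assumes "L2_on a b f" "a \<le> s" "t \<le> b" shows "L2_on s t f"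
  using assms subinterval_ioo(1)[of a s t b "\<lambda>x. (norm (f x))\<^sup>2"]
  by (auto simp: L2_on_def intro: measurable_restrict_mono)

text \<open>The cut \<open>b\<close> belongs to neither open piece and is restored by the indicator
  of \<open>{b}\<close>, in the measurability proof as well as in the integral.\<close>

lemma L2_join:
  fixes f :: "real \<Rightarrow> 'k::real_or_complex"
  assumes "L2_on a b f" "L2_on b c f" "a \<le> b" "b \<le> c" shows "L2_on a c f"
proof -
  have m: "(\<lambda>x. indicator {s<..<t} x *\<^sub>R f x) \<in> borel_measurable lebesgue" if "L2_on s t f" for s t
    using that by (auto simp: L2_on_def borel_measurable_restrict_space_iff)
  have i: "integrable lebesgue (\<lambda>x. indicator {s<..<t} x *\<^sub>R (norm (f x))\<^sup>2)" if "L2_on s t f" for s t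
    using that by (auto simp: L2_on_def integrable_restrict_space)
  have ib: "indicat_real {b} \<in> borel_measurable lebesgue" by (rule borel_measurable_indicator) simp
  have cases: "indicat_real {a<..<c} x = indicator {a<..<b} x + indicator {b<..<c} x + (if a < b \<and> b < c then indicator {b} x else 0)" for x
    using assms(3,4) by (auto simp: indicator_def)
  have "(\<lambda>x. indicator {a<..<c} x *\<^sub>R f x) \<in> borel_measurable lebesgue"
  proof -
    have "(\<lambda>x. indicator {a<..<c} x *\<^sub>R f x) = (\<lambda>x. indicator {a<..<b} x *\<^sub>R f x + indicator {b<..<c} x *\<^sub>R f x
      + (if a < b \<and> b < c then indicator {b} x else 0) *\<^sub>R f b)"
      unfolding cases by (auto simp: fun_eq_iff scaleR_add_left indicator_def)
    also have "\<dots> \<in> borel_measurable lebesgue"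
      using m[OF assms(1)] m[OF assms(2)] ib by measurable
    finally show ?thesis .
  qed
  moreover have "integrable lebesgue (\<lambda>x. indicator {a<..<c} x *\<^sub>R (norm (f x))\<^sup>2)"
  proof -
    have "(\<lambda>x. indicator {a<..<c} x *\<^sub>R (norm (f x))\<^sup>2) = (\<lambda>x. indicator {a<..<b} x *\<^sub>R (norm (f x))\<^sup>2 + indicator {b<..<c} x *\<^sub>R (norm (f x))\<^sup>2
      + (if a < b \<and> b < c then indicator {b} x else 0) *\<^sub>R (norm (f b))\<^sup>2)"
      unfolding cases by (auto simp: fun_eq_iff scaleR_add_left indicator_def)
    moreover have "integrable lebesgue (indicat_real {b})" by (rule integrable_real_indicator) auto
    ultimately show ?thesis
      using i[OF assms(1)] i[OF assms(2)] by (cases "a < b \<and> b < c") (simp_all only: if_True if_False, auto)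
  qed
  ultimately show ?thesis by (auto simp: L2_on_def borel_measurable_restrict_space_iff integrable_restrict_space)
qed

text \<open>\<open>h0\<close> and \<open>h1\<close> are the continuous representatives of \<open>g\<close> and of its weak derivative, and \<open>h2\<close>
  is the second weak derivative.\<close>

definition rep2 ::
  "real \<Rightarrow> real \<Rightarrow> (real \<Rightarrow> 'k::real_or_complex) \<Rightarrow> (real \<Rightarrow> 'k) \<Rightarrow> (real \<Rightarrow> 'k) \<Rightarrow> (real \<Rightarrow> 'k) \<Rightarrow> bool" where
  "rep2 a b g h0 h1 h2 \<longleftrightarrow> L2_on a b g \<and> L2_on a b h2 \<and> (AE x in ioo a b. g x = h0 x) \<and>
     (\<forall>t\<in>{a..b}. prim a h1 t = h0 t - h0 a) \<and> (\<forall>t\<in>{a..b}. prim a h2 t = h1 t - h1 a)"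

section \<open>Continuous representatives, traces and H^2\<close>

lemma continuous_prim_eq:
  fixes f :: "real \<Rightarrow> 'b::{banach, second_countable_topology}"
  assumes "integrable (ioo a b) f" "\<forall>t\<in>{a..b}. prim a f t = h t - h a"
  shows "continuous_on {a..b} h"
proof -
  have "continuous_on {a..b} (\<lambda>t. h a + prim a f t)" by (intro continuous_intros continuous_prim assms)
  then show ?thesis by (rule continuous_on_eq) (use assms(2) in auto)
qed

lemma rep2_continuous:
  assumes "rep2 a b g h0 h1 h2"
  shows "continuous_on {a..b} h0" "continuous_on {a..b} h1"
proof -
  show c: "continuous_on {a..b} h1"
    using assms by (intro continuous_prim_eq[of _ _ h2] L2_integrable) (auto simp: rep2_def)
  show "continuous_on {a..b} h0"
    using assms by (intro continuous_prim_eq[of _ _ h1] integrable_continuous_ioo[OF c]) (auto simp: rep2_def)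
qed

text \<open>Continuous representatives are unique up to the endpoints, so any one of them evaluates
  the trace.\<close>

lemma bdry_trace_eq:
  assumes "a < b" "continuous_on {a..b} h" "AE x in ioo a b. g x = h x" "c \<in> {a..b}"
  shows "bdry_trace a b g c = h c"
  unfolding bdry_trace_def
proof (rule the_equality)
  show "\<exists>h'. continuous_on {a..b} h' \<and> (AE \<zeta> in ioo a b. h' \<zeta> = g \<zeta>) \<and> h' c = h c"
    using assms by (intro exI[of _ h]) (auto elim: eventually_mono)
next
  fix v assume "\<exists>h'. continuous_on {a..b} h' \<and> (AE \<zeta> in ioo a b. h' \<zeta> = g \<zeta>) \<and> h' c = v"
  then obtain h' where h': "continuous_on {a..b} h'" "AE \<zeta> in ioo a b. h' \<zeta> = g \<zeta>" "h' c = v" by blast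
  have "AE \<zeta> in ioo a b. h' \<zeta> = h \<zeta>" using h'(2) assms(3) by eventually_elim simp
  from continuous_AE_eq[OF assms(1) h'(1) assms(2) this assms(4)] h'(3) show "v = h c" by simp
qed

text \<open>\<open>weak_deriv\<close> is a choice; all that is known of it is its class modulo null
  sets.\<close>

lemma weak_deriv_AE:
  fixes g :: "real \<Rightarrow> 'k::real_or_complex"
  assumes "L2_on a b g'" "is_weak_derivative a b g g'"
  shows "L2_on a b (weak_deriv a b g)" "is_weak_derivative a b g (weak_deriv a b g)"
    "AE x in ioo a b. weak_deriv a b g x = g' x"
proof -
  have "\<exists>g'. L2_on a b g' \<and> is_weak_derivative a b g g'" using assms by blast
  from someI_ex[OF this] show 1: "L2_on a b (weak_deriv a b g)" "is_weak_derivative a b g (weak_deriv a b g)"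
    by (simp_all add: weak_deriv_def)
  show "AE x in ioo a b. weak_deriv a b g x = g' x"
    by (rule weak_derivative_unique[OF L2_integrable[OF 1(1)] L2_integrable[OF assms(1)] 1(2) assms(2)])
qed

text \<open>The second derivative is taken of whatever representative \<open>weak_deriv\<close> has
  chosen. This is harmless because being a weak derivative only depends on the class, which contains
  the continuous \<open>h1\<close>.\<close>

lemma rep2_H2:
  assumes ab: "a < b" and r: "rep2 a b g h0 h1 h2"
  shows "H2_on a b g" "AE x in ioo a b. weak_deriv a b g x = h1 x"
    "AE x in ioo a b. weak_deriv a b (weak_deriv a b g) x = h2 x"
    "L2_on a b (weak_deriv a b (weak_deriv a b g))"
proof -
  note c = rep2_continuous[OF r]
  have w1: "is_weak_derivative a b g h1"
    using r by (intro is_weak_derivative_prim[OF ab integrable_continuous_ioo[OF c(2)], of h0])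
      (auto simp: rep2_def L2_on_def)
  note d1 = weak_deriv_AE[OF L2_continuous[OF c(2)] w1]
  then show "AE x in ioo a b. weak_deriv a b g x = h1 x" by simp
  have w2: "is_weak_derivative a b (weak_deriv a b g) h2"
    using r d1 by (intro is_weak_derivative_prim[OF ab _ _ d1(3)] L2_integrable) (auto simp: rep2_def L2_on_def)
  have L2: "L2_on a b h2" using r by (simp add: rep2_def)
  note d2 = weak_deriv_AE[OF L2 w2]
  then show "AE x in ioo a b. weak_deriv a b (weak_deriv a b g) x = h2 x"
    "L2_on a b (weak_deriv a b (weak_deriv a b g))" by simp_all
  show "H2_on a b g"
    using r L2_continuous[OF c(2)] w1 w2 d1(1) L2 by (auto simp: H2_on_def H1_on_def rep2_def)
qed

lemma rep2_trace:
  assumes ab: "a < b" and r: "rep2 a b g h0 h1 h2" and c: "c \<in> {a..b}"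
  shows "bdry_trace a b g c = h0 c" "bdry_trace a b (weak_deriv a b g) c = h1 c"
  using r rep2_continuous[OF r] rep2_H2[OF ab r] c
  by (auto intro!: bdry_trace_eq[OF ab] simp: rep2_def)

text \<open>The primitive representation is used twice, first for the weak derivative and then for
  \<open>g\<close>; inside the second primitive the weak derivative may be replaced by the
  continuous \<open>h1\<close>.\<close>

lemma H2_rep2:
  fixes g :: "real \<Rightarrow> 'k::real_or_complex"
  assumes ab: "a < b" and H: "H2_on a b g"
  shows "\<exists>h0 h1 h2. rep2 a b g h0 h1 h2"
proof -
  obtain g1 g2 where g: "L2_on a b g" "L2_on a b g1" "is_weak_derivative a b g g1"
    "L2_on a b g2" "is_weak_derivative a b (weak_deriv a b g) g2"
    using H by (auto simp: H2_on_def H1_on_def)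
  note d = weak_deriv_AE[OF g(2,3)]
  obtain c1 where c1: "AE x in ioo a b. weak_deriv a b g x = c1 + prim a g2 x"
    using weak_derivative_prim_ex[OF ab L2_integrable[OF d(1)] L2_integrable[OF g(4)] g(5)] by blast
  obtain c0 where c0: "AE x in ioo a b. g x = c0 + prim a (weak_deriv a b g) x"
    using weak_derivative_prim_ex[OF ab L2_integrable[OF g(1)] L2_integrable[OF d(1)] d(2)] by blast
  define h1 where "h1 x = c1 + prim a g2 x" for x
  have h1c: "continuous_on {a..b} h1" unfolding h1_def
    by (intro continuous_intros continuous_prim L2_integrable g)
  have p: "prim a (weak_deriv a b g) t = prim a h1 t" if "t \<le> b" for t
    using c1 d(1) h1c by (intro prim_cong_AE[OF _ _ _ that])
      (auto simp: h1_def[symmetric] L2_on_def intro!: continuous_measurable_ioo intro: continuous_on_subset)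
  have "AE x in ioo a b. g x = c0 + prim a h1 x"
    using c0 by (rule lebesgue_on_mono) (simp add: p)
  then have "rep2 a b g (\<lambda>x. c0 + prim a h1 x) h1 g2"
    using g by (simp add: rep2_def) (simp add: h1_def)
  then show ?thesis by blast
qed

lemma rep2_lin:
  fixes g :: "real \<Rightarrow> 'k::real_or_complex"
  assumes r: "rep2 a b g h0 h1 h2" and r': "rep2 a b g' h0' h1' h2'"
  shows "rep2 a b (\<lambda>x. c * g x + g' x) (\<lambda>x. c * h0 x + h0' x) (\<lambda>x. c * h1 x + h1' x) (\<lambda>x. c * h2 x + h2' x)"
proof -
  have i: "integrable (ioo a b) h1" "integrable (ioo a b) h1'"
    using rep2_continuous[OF r] rep2_continuous[OF r'] by (auto intro: integrable_continuous_ioo)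
  have i2: "integrable (ioo a b) h2" "integrable (ioo a b) h2'"
    using r r' by (auto simp: rep2_def L2_integrable)
  have "AE x in ioo a b. c * g x + g' x = c * h0 x + h0' x"
  proof -
    have "AE x in ioo a b. g x = h0 x" "AE x in ioo a b. g' x = h0' x" using r r' by (simp_all add: rep2_def)
    then show ?thesis by eventually_elim simp
  qed
  then show ?thesis using r r' unfolding rep2_def
    by (auto simp: prim_lin[OF i] prim_lin[OF i2] right_diff_distrib intro!: L2_add L2_cmult)
qed

section \<open>Linear Volterra systems\<close>

text \<open>Against the weight \<open>exp (l (x - a))\<close> an integration gains the factor
  \<open>1 / l\<close>. A large \<open>l\<close> makes Volterra operators contractive on intervals
  of any length.\<close>

lemma norm_prim_le_exp:
  assumes f: "integrable (ioo a b) f" and t: "a \<le> t" "t \<le> b" and l: "0 < l"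
    and bound: "\<And>x. a < x \<Longrightarrow> x < t \<Longrightarrow> norm (f x) \<le> B * exp (l * (x - a))" and B: "0 \<le> B"
  shows "norm (prim a f t) \<le> B / l * exp (l * (t - a))"
proof -
  have d: "((\<lambda>x. B / l * exp (l * (x - a))) has_real_derivative B * exp (l * (x - a))) (at x)" for x
    using l by (auto intro!: derivative_eq_intros)
  have c: "continuous_on S (\<lambda>x. B * exp (l * (x - a)))" for S by (intro continuous_intros)
  have "norm (prim a f t) \<le> (LINT x|ioo a t. norm (f x))" unfolding prim_def by (rule integral_norm_bound)
  also have "\<dots> \<le> (LINT x|ioo a t. B * exp (l * (x - a)))"
  proof (rule integral_mono)
    show "integrable (ioo a t) (\<lambda>x. norm (f x))" using subinterval_ioo(1)[of a a t b f] f t by auto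
    show "integrable (ioo a t) (\<lambda>x. B * exp (l * (x - a)))" by (rule integrable_continuous_ioo[OF c])
  qed (use bound in auto)
  also have "\<dots> = B / l * exp (l * (t - a)) - B / l * exp (l * (a - a))"
    by (rule integral_ioo_FTC[OF t(1) d c])
  also have "\<dots> \<le> B / l * exp (l * (t - a))" using B l by simp
  finally show ?thesis .
qed

text \<open>Let \<open>m\<close> be the maximum of \<open>v\<close> against the weight with rate
  \<open>2 * K\<close>. At the maximising point the integral term contributes at most half of
  \<open>m\<close>, so \<open>m \<le> 2 * A\<close>. The constants 2 are the price for this short
  argument.\<close>

lemma Gronwall:
  fixes v :: "real \<Rightarrow> real"
  assumes v: "continuous_on {a..b} v" "\<And>t. t \<in> {a..b} \<Longrightarrow> 0 \<le> v t"
    and ineq: "\<And>t. t \<in> {a..b} \<Longrightarrow> v t \<le> A + K * prim a v t" and A: "0 \<le> A" and K: "0 < K"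
    and t: "t \<in> {a..b}"
  shows "v t \<le> 2 * A * exp (2 * K * (b - a))"
proof -
  define g where "g t = v t * exp (- (2 * K * (t - a)))" for t
  have "continuous_on {a..b} g" unfolding g_def by (intro continuous_intros v)
  then obtain t0 where t0: "t0 \<in> {a..b}" "\<And>s. s \<in> {a..b} \<Longrightarrow> g s \<le> g t0"
    using continuous_attains_sup[of "{a..b}" g] t by auto
  define m where "m = g t0"
  have m0: "0 \<le> m" using v(2)[OF t0(1)] by (simp add: m_def g_def)
  have vm: "v s \<le> m * exp (2 * K * (s - a))" if "s \<in> {a..b}" for s
  proof -
    have "v s = g s * exp (2 * K * (s - a))" by (simp add: g_def exp_minus)
    also have "\<dots> \<le> m * exp (2 * K * (s - a))" using t0(2)[OF that] by (simp add: m_def)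
    finally show ?thesis .
  qed
  have "norm (prim a v t0) \<le> m / (2 * K) * exp (2 * K * (t0 - a))"
    using t0(1) K m0 vm v(2) by (intro norm_prim_le_exp[OF integrable_continuous_ioo[OF v(1)]]) auto
  then have "K * prim a v t0 \<le> K * (m / (2 * K) * exp (2 * K * (t0 - a)))" using K by (intro mult_left_mono) auto
  then have "v t0 \<le> A + m / 2 * exp (2 * K * (t0 - a))" using ineq[OF t0(1)] K by simp
  moreover have "v t0 = m * exp (2 * K * (t0 - a))" by (simp add: m_def g_def exp_minus)
  moreover have "A \<le> A * exp (2 * K * (t0 - a))" using A K t0(1) by (simp add: mult_le_cancel_left1)
  ultimately have "m * exp (2 * K * (t0 - a)) \<le> (A + m / 2) * exp (2 * K * (t0 - a))" by (simp add: algebra_simps)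
  then have "m \<le> 2 * A" by simp
  have "v t \<le> m * exp (2 * K * (t - a))" by (rule vm[OF t])
  also have "\<dots> \<le> 2 * A * exp (2 * K * (b - a))"
    using \<open>m \<le> 2 * A\<close> m0 t K by (intro mult_mono) auto
  finally show ?thesis .
qed

section \<open>Existence and bounds for Volterra systems\<close>

lemma norm_vec_le_sum: "norm (x :: 'a::real_normed_vector ^ 'n) \<le> (\<Sum>i\<in>UNIV. norm (x $ i))"
  by (simp add: norm_vec_def L2_set_le_sum)

text \<open>With bounded measurable coefficients a solution has a derivative only almost everywhere;
  therefore \<open>solution\<close> below is an integral equation for a continuous function.\<close>

locale linear_volterra =
  fixes a b C :: real and N :: "'i::finite \<Rightarrow> 'i \<Rightarrow> real \<Rightarrow> 'k::real_or_complex"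
  assumes ab: "a < b" and N: "\<And>i k. N i k \<in> borel_measurable (ioo a b)"
    and NC: "\<And>i k x. x \<in> {a<..<b} \<Longrightarrow> norm (N i k x) \<le> C"
begin

definition field :: "('i \<Rightarrow> real \<Rightarrow> 'k) \<Rightarrow> (real \<Rightarrow> 'k ^ 'i) \<Rightarrow> 'i \<Rightarrow> real \<Rightarrow> 'k" where
  "field r y i s = (\<Sum>k\<in>UNIV. N i k s * y s $ k) + r i s"

definition solution :: "'k ^ 'i \<Rightarrow> ('i \<Rightarrow> real \<Rightarrow> 'k) \<Rightarrow> (real \<Rightarrow> 'k ^ 'i) \<Rightarrow> bool" where
  "solution y0 r y \<longleftrightarrow> continuous_on {a..b} y \<and> (\<forall>t\<in>{a..b}. \<forall>i. y t $ i = y0 $ i + prim a (field r y i) t)"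

lemma C0: "0 \<le> C"
  using order_trans[OF norm_ge_zero NC[of "(a + b) / 2"]] ab by simp

lemma integrable_N_mult:
  assumes "continuous_on {a..b} g"
  shows "integrable (ioo a b) (\<lambda>s. N i k s * g s)"
proof -
  have "bounded (g ` {a..b})" using assms by (intro compact_imp_bounded compact_continuous_image) auto
  then obtain B where B: "\<forall>x\<in>{a..b}. norm (g x) \<le> B" unfolding bounded_iff by blast
  have [measurable]: "g \<in> borel_measurable (ioo a b)"
    by (intro continuous_measurable_ioo continuous_on_subset[OF assms]) auto
  show ?thesis
  proof (rule integrable_bounded_ioo[of _ _ _ "C * B"])
    show "(\<lambda>s. N i k s * g s) \<in> borel_measurable (ioo a b)" using N by measurable
    show "norm (N i k x * g x) \<le> C * B" if "a < x" "x < b" for x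
      using NC[of x] B that C0 by (auto simp: norm_mult intro!: mult_mono)
  qed
qed

lemma integrable_field:
  assumes "continuous_on {a..b} y" "\<And>i. integrable (ioo a b) (r i)"
  shows "integrable (ioo a b) (field r y i)"
  unfolding field_def using assms
  by (intro Bochner_Integration.integrable_add Bochner_Integration.integrable_sum integrable_N_mult continuous_intros)

lemma norm_field_diff_le:
  assumes "s \<in> {a<..<b}" "\<And>k. norm (y s $ k - z s $ k) \<le> d"
  shows "norm (field r y i s - field r z i s) \<le> CARD('i) * C * d"
proof -
  have "field r y i s - field r z i s = (\<Sum>k\<in>UNIV. N i k s * (y s $ k - z s $ k))"
    by (simp add: field_def sum_subtractf algebra_simps)
  also have "norm \<dots> \<le> (\<Sum>k\<in>(UNIV::'i set). C * d)"
    using NC[OF assms(1)] C0 assms(2) by (intro sum_norm_le) (auto simp: norm_mult intro!: mult_mono)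
  finally show ?thesis by simp
qed

text \<open>The integral operator is a contraction for an exponentially weighted supremum norm, and
  Banach's fixed point theorem applies on the whole interval at once.\<close>

lemma solution_exists:
  assumes r: "\<And>i. integrable (ioo a b) (r i)"
  shows "\<exists>y. solution y0 r y"
proof -
  define n where "n = real CARD('i)"
  \<comment> \<open>One factor \<open>n\<close> comes from the sum in \<open>field\<close>, the
    other from bounding the norm of a vector by the sum of its components. This \<open>l\<close>
    makes the contraction factor at most 1/2, and the summand 1 makes \<open>l\<close>
    positive.\<close>
  define l where "l = 2 * n * n * C + 1"
  have n1: "n > 0" by (simp add: n_def)
  have l0: "0 < l" using C0 n1 by (simp add: l_def add_nonneg_pos)
  define w where "w s = exp (l * (s - a))" for s
  have w0: "0 < w s" for s by (simp add: w_def)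
  have wc: "continuous_on S w" for S unfolding w_def by (intro continuous_intros)
  \<comment> \<open>The unknown \<open>z\<close> is the solution divided by the weight, so the plain
    supremum norm of \<open>z\<close> is the weighted norm of the solution.\<close>
  define up where "up z s = w s *\<^sub>R apply_bcontfun z s" for z :: "real \<Rightarrow>\<^sub>C ('k ^ 'i)" and s
  have upc: "continuous_on S (up z)" for z S unfolding up_def
    by (intro continuous_intros wc continuous_on_apply_bcontfun)
  \<comment> \<open>Bounded continuous functions live on the whole line; clamping the time extends
    functions from \<open>{a..b}\<close> continuously and boundedly.\<close>
  define cl where "cl t = min b (max a t)" for t
  have cl: "cl t \<in> {a..b}" "t \<in> {a..b} \<Longrightarrow> cl t = t" for t using ab by (auto simp: cl_def)
  define G where "G z t = (\<chi> i. y0 $ i + prim a (field r (up z) i) t)" for z t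
  define F where "F z t = (1 / w (cl t)) *\<^sub>R G z (cl t)" for z t
  have fi: "integrable (ioo a b) (field r (up z) i)" for z i by (intro integrable_field upc r)
  have Gc: "continuous_on {a..b} (G z)" for z unfolding G_def
    by (intro continuous_on_vec_lambda continuous_intros continuous_prim fi)
  have clc: "continuous_on UNIV cl" unfolding cl_def by (intro continuous_intros)
  have Fc: "F z \<in> bcontfun" for z
  proof -
    define h where "h t = (1 / w t) *\<^sub>R G z t" for t
    have hc: "continuous_on {a..b} h" unfolding h_def using w0
      by (intro continuous_intros Gc wc) (auto simp: less_imp_neq[symmetric])
    have "continuous_on UNIV (\<lambda>t. h (cl t))"
      by (rule continuous_on_compose2[OF hc clc]) (use cl in auto)
    moreover have "bounded (range (\<lambda>t. h (cl t)))"
      by (rule bounded_subset[OF compact_imp_bounded[OF compact_continuous_image[OF hc compact_Icc]]]) (use cl in auto)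
    ultimately show ?thesis by (simp add: bcontfun_def F_def[abs_def] h_def)
  qed
  have F_dist: "dist (F z t) (F z' t) \<le> 1 / 2 * dist z z'" for z z' t
  proof -
    let ?t = "cl t"
    have "norm (G z ?t $ i - G z' ?t $ i) \<le> n * C * dist z z' / l * w ?t" for i
    proof -
      have "prim a (field r (up z) i) ?t - prim a (field r (up z') i) ?t = prim a (\<lambda>s. field r (up z) i s - field r (up z') i s) ?t"
        using fi subinterval_ioo(1)[OF order_refl _ fi, of ?t] cl(1)[of t] by (simp add: prim_def)
      also have "norm \<dots> \<le> n * C * dist z z' / l * exp (l * (?t - a))"
      proof (rule norm_prim_le_exp[OF Bochner_Integration.integrable_diff[OF fi fi]])
        fix x assume x: "a < x" "x < ?t"
        have "norm (up z x $ k - up z' x $ k) \<le> w x * dist z z'" for k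
        proof -
          have "norm ((apply_bcontfun z x - apply_bcontfun z' x) $ k) \<le> norm (apply_bcontfun z x - apply_bcontfun z' x)"
            by (rule Finite_Cartesian_Product.norm_nth_le)
          also have "\<dots> \<le> dist z z'" unfolding dist_norm[symmetric] by (rule dist_bounded)
          finally have "w x * norm (apply_bcontfun z x $ k - apply_bcontfun z' x $ k) \<le> w x * dist z z'"
            using w0[of x] by simp
          then show ?thesis using w0[of x] by (simp add: up_def flip: scaleR_diff_right)
        qed
        then have "norm (field r (up z) i x - field r (up z') i x) \<le> n * C * (w x * dist z z')"
          unfolding n_def using x cl(1)[of t] by (intro norm_field_diff_le) auto
        then show "norm (field r (up z) i x - field r (up z') i x) \<le> n * C * dist z z' * exp (l * (x - a))"
          by (simp add: w_def mult_ac)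
      qed (use cl(1)[of t] l0 n1 C0 in auto)
      finally show ?thesis by (simp add: G_def w_def)
    qed
    then have "(\<Sum>i\<in>UNIV. norm (G z ?t $ i - G z' ?t $ i)) \<le> (\<Sum>i\<in>(UNIV::'i set). n * C * dist z z' / l * w ?t)"
      by (intro sum_mono)
    also have "\<dots> = n * n * C / l * dist z z' * w ?t" by (simp add: n_def)
    also have "\<dots> \<le> 1 / 2 * dist z z' * w ?t"
    proof (intro mult_right_mono)
      have "2 * (n * n * C) \<le> l" by (simp add: l_def)
      then show "n * n * C / l \<le> 1 / 2" using l0 by (simp add: field_simps)
    qed (use w0[of ?t] in auto)
    finally have "norm (G z ?t - G z' ?t) \<le> 1 / 2 * dist z z' * w ?t"
      using norm_vec_le_sum[of "G z ?t - G z' ?t"] by simp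
    then have "(1 / w ?t) * norm (G z ?t - G z' ?t) \<le> 1 / 2 * dist z z'"
      using w0[of ?t] by (simp add: field_simps)
    then show ?thesis using w0[of ?t] by (simp add: F_def dist_norm flip: scaleR_diff_right)
  qed
  define \<Phi> where "\<Phi> z = Bcontfun (F z)" for z
  have ap: "apply_bcontfun (\<Phi> z) = F z" for z unfolding \<Phi>_def by (rule Bcontfun_inverse[OF Fc])
  have "\<exists>!z\<in>UNIV. \<Phi> z = z"
  proof (rule Banach_fix)
    show "complete (UNIV :: (real \<Rightarrow>\<^sub>C ('k ^ 'i)) set)" by (simp add: complete_UNIV)
    show "dist (\<Phi> z) (\<Phi> z') \<le> 1 / 2 * dist z z'" for z z'
      by (rule dist_bound) (simp add: ap F_dist[simplified])
  qed auto
  then obtain z where z: "\<Phi> z = z" by blast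
  have eq: "up z t = G z t" if "t \<in> {a..b}" for t
  proof -
    have "apply_bcontfun z t = F z t" using ap[of z] z by simp
    then show ?thesis using w0[of t] cl(2)[OF that] by (simp add: up_def F_def)
  qed
  have "solution y0 r (up z)" unfolding solution_def using eq upc by (simp add: G_def)
  then show ?thesis by blast
qed

text \<open>The constant depends on the coefficients only. The load enters through its integral
  norm, which the energy norm controls on a bounded interval.\<close>

lemma solution_bound:
  "\<exists>K\<ge>0. \<forall>y0 r y. (\<forall>i. integrable (ioo a b) (r i)) \<longrightarrow> solution y0 r y \<longrightarrow>
     (\<forall>t\<in>{a..b}. (\<Sum>i\<in>UNIV. norm (y t $ i)) \<le> K * ((\<Sum>i\<in>UNIV. norm (y0 $ i)) + (\<Sum>i\<in>UNIV. LINT s|ioo a b. norm (r i s))))"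
proof -
  define n where "n = real CARD('i)"
  \<comment> \<open>The summand 1 provides the positive rate that \<open>Gronwall\<close> requires
    even if \<open>C = 0\<close>.\<close>
  define k where "k = n * C + 1"
  have k0: "0 < k" using C0 by (simp add: k_def n_def add_nonneg_pos)
  show ?thesis
  proof (intro exI[of _ "2 * exp (2 * k * (b - a))"] conjI allI impI ballI)
    fix y0 r y t assume r: "\<forall>i. integrable (ioo a b) (r i)" and sol: "solution y0 r y" and t: "t \<in> {a..b}"
    define A where "A = (\<Sum>i\<in>UNIV. norm (y0 $ i)) + (\<Sum>i\<in>UNIV. LINT s|ioo a b. norm (r i s))"
    define v where "v t = (\<Sum>i\<in>UNIV. norm (y t $ i))" for t
    have yc: "continuous_on {a..b} y" using sol by (simp add: solution_def)
    have vc: "continuous_on {a..b} v" unfolding v_def by (intro continuous_intros yc)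
    have v0: "0 \<le> v t" for t by (simp add: v_def sum_nonneg)
    have vi: "integrable (ioo a b) v" by (rule integrable_continuous_ioo[OF vc])
    have "v t \<le> 2 * A * exp (2 * k * (b - a))"
    proof (rule Gronwall[OF vc v0 _ _ k0 t])
      show "0 \<le> A" unfolding A_def by (intro add_nonneg_nonneg sum_nonneg) auto
      fix t assume t: "t \<in> {a..b}"
      have sub: "integrable (ioo a t) f" if "integrable (ioo a b) f" for f :: "real \<Rightarrow> 'z::{banach, second_countable_topology}"
        using subinterval_ioo(1)[OF order_refl _ that] t by simp
      have "norm (y t $ i) \<le> norm (y0 $ i) + (LINT s|ioo a b. norm (r i s)) + C * prim a v t" for i
      proof -
        have "norm (prim a (field r y i) t) \<le> (LINT s|ioo a t. norm (field r y i s))"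
          unfolding prim_def by (rule integral_norm_bound)
        also have "\<dots> \<le> (LINT s|ioo a t. C * v s + norm (r i s))"
        proof (rule integral_mono)
          fix s assume "s \<in> space (ioo a t)"
          then have s: "s \<in> {a<..<b}" using t by auto
          have "norm (\<Sum>k\<in>UNIV. N i k s * y s $ k) \<le> (\<Sum>k\<in>UNIV. C * norm (y s $ k))"
            using NC[OF s] by (intro sum_norm_le) (auto simp: norm_mult mult_right_mono)
          then show "norm (field r y i s) \<le> C * v s + norm (r i s)"
            unfolding field_def v_def sum_distrib_left by (intro norm_triangle_le) simp
        qed (use r vi integrable_field[OF yc] in \<open>auto intro!: sub\<close>)
        also have "\<dots> = C * prim a v t + (LINT s|ioo a t. norm (r i s))"
          using sub[OF vi] sub[OF integrable_norm[OF r[rule_format, of i]]] by (simp add: prim_def)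
        also have "(LINT s|ioo a t. norm (r i s)) \<le> (LINT s|ioo a b. norm (r i s))"
        proof -
          have "(LINT s|ioo a t. norm (r i s)) = (LINT s|ioo a b. indicator {a<..<t} s *\<^sub>R norm (r i s))"
            using t by (intro subinterval_ioo(2)) auto
          also have "\<dots> \<le> (LINT s|ioo a b. norm (r i s))"
            using r by (intro integral_mono integrable_scaleR_bounded[of _ _ _ _ 1]) (auto simp: abs_indicator indicator_le_1 intro!: mult_left_le_one_le)
          finally show ?thesis .
        qed
        finally have "norm (prim a (field r y i) t) \<le> C * prim a v t + (LINT s|ioo a b. norm (r i s))" by simp
        moreover have "y t $ i = y0 $ i + prim a (field r y i) t" using sol t by (simp add: solution_def)
        ultimately show ?thesis using norm_triangle_ineq[of "y0 $ i" "prim a (field r y i) t"] by simp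
      qed
      then have "v t \<le> (\<Sum>i\<in>UNIV. norm (y0 $ i) + (LINT s|ioo a b. norm (r i s)) + C * prim a v t)"
        unfolding v_def[of t] by (intro sum_mono)
      also have "\<dots> = A + n * C * prim a v t" by (simp add: A_def sum.distrib n_def)
      also have "\<dots> \<le> A + k * prim a v t"
        unfolding k_def using v0 by (intro add_left_mono mult_right_mono) (auto simp: prim_def)
      finally show "v t \<le> A + k * prim a v t" .
    qed
    then show "(\<Sum>i\<in>UNIV. norm (y t $ i)) \<le> 2 * exp (2 * k * (b - a)) * ((\<Sum>i\<in>UNIV. norm (y0 $ i)) + (\<Sum>i\<in>UNIV. LINT s|ioo a b. norm (r i s)))"
      by (simp only: v_def A_def mult_ac)
  qed simp
qed

end

section \<open>Scalars and finite-dimensional inner product spaces\<close>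

lemma to_complex_0 [simp]: "to_complex (0::'k::real_or_complex) = 0"
  using to_complex_add[of 0 "0::'k"] by simp

lemma to_complex_minus [simp]: "to_complex (- x) = - to_complex (x::'k::real_or_complex)"
  using to_complex_add[of x "- x"] by (simp add: eq_neg_iff_add_eq_0 add.commute)

lemma to_complex_diff [simp]: "to_complex (x - y) = to_complex x - to_complex (y::'k::real_or_complex)"
  using to_complex_add[of x "- y"] by simp

lemma to_complex_eq_0_iff [simp]: "to_complex x = 0 \<longleftrightarrow> (x::'k::real_or_complex) = 0"
  using norm_to_complex[of x] by (metis norm_eq_zero)

lemma to_complex_inject [simp]: "to_complex x = to_complex y \<longleftrightarrow> (x::'k::real_or_complex) = y"
  using to_complex_eq_0_iff[of "x - y"] by (simp del: to_complex_eq_0_iff)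

lemma to_complex_1 [simp]: "to_complex (1::'k::real_or_complex) = 1"
proof -
  have "to_complex (1::'k) * (to_complex (1::'k) - 1) = 0"
    using to_complex_mult[of 1 "1::'k"] by (simp add: algebra_simps)
  then show ?thesis by (metis mult_eq_0_iff to_complex_eq_0_iff zero_neq_one eq_iff_diff_eq_0)
qed

lemma to_complex_of_real [simp]: "to_complex (of_real r :: 'k::real_or_complex) = of_real r"
  by (simp add: of_real_def to_complex_scaleR)

declare to_complex_add [simp] to_complex_mult [simp] to_complex_scaleR [simp] norm_to_complex [simp]

lemma to_complex_sum [simp]: "to_complex (sum f A) = (\<Sum>i\<in>A. to_complex (f i :: 'k::real_or_complex))"
  by (induction A rule: infinite_finite_induct) auto

lemma bounded_linear_to_complex: "bounded_linear (to_complex :: 'k::real_or_complex \<Rightarrow> complex)"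
  by (rule bounded_linear_intro[of _ 1]) simp_all

text \<open>By injectivity the rows of \<open>G\<close> are linearly independent. There are at least
  as many rows as columns, so they span all functions on \<open>J\<close>; expanding the unit
  vectors yields \<open>H\<close>. The solution is given by a matrix because its entries later
  provide bounds.\<close>

lemma square_system_inverse:
  fixes G :: "'a \<Rightarrow> 'b \<Rightarrow> 'k::field"
  assumes fin: "finite I" "finite J" and card: "card J \<le> card I"
    and inj: "\<And>c. (\<And>k. k \<in> J \<Longrightarrow> (\<Sum>i\<in>I. c i * G i k) = 0) \<Longrightarrow> \<forall>i\<in>I. c i = 0"
  shows "\<exists>H. \<forall>r. \<forall>k\<in>J. (\<Sum>i\<in>I. (\<Sum>l\<in>J. H i l * r l) * G i k) = r k"
proof -
  \<comment> \<open>The index sets are finite sets rather than types, so vectors are functions, set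
    to 0 outside \<open>J\<close>.\<close>
  interpret F: vector_space "\<lambda>(c::'k) (f::'b \<Rightarrow> 'k) x. c * f x"
    by unfold_locales (auto simp: fun_eq_iff algebra_simps)
  define v where "v i = (\<lambda>k. if k \<in> J then G i k else 0)" for i
  define e where "e k = (\<lambda>l. if l = k then 1 else 0 :: 'k)" for k :: 'b
  have sum_apply: "(\<Sum>i\<in>A. f i) x = (\<Sum>i\<in>A. f i x)" for A :: "'z set" and f :: "'z \<Rightarrow> 'b \<Rightarrow> 'k" and x
    by (induction A rule: infinite_finite_induct) auto
  have inj_v: "inj_on v I"
  proof (rule inj_onI, rule ccontr)
    fix i j assume ij: "i \<in> I" "j \<in> I" "v i = v j" "i \<noteq> j"
    have eq: "G i k = G j k" if "k \<in> J" for k using fun_cong[OF ij(3), of k] that by (simp add: v_def)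
    \<comment> \<open>Two equal rows would satisfy the relation with coefficients 1 and -1.\<close>
    have "\<forall>l\<in>I. (if l = i then 1 else if l = j then -1 else 0 :: 'k) = 0"
    proof (rule inj)
      fix k assume k: "k \<in> J"
      have "(\<Sum>l\<in>I. (if l = i then 1 else if l = j then -1 else 0) * G l k) = (\<Sum>l\<in>I. (if l = i then G i k else 0) + (if l = j then - G j k else 0))"
        using ij(4) by (intro sum.cong) auto
      also have "\<dots> = 0" using ij fin eq[OF k] by (simp add: sum.distrib)
      finally show "(\<Sum>l\<in>I. (if l = i then 1 else if l = j then -1 else 0) * G l k) = 0" .
    qed
    with ij show False by auto
  qed
  have indep: "F.independent (v ` I)"
  proof
    assume "F.dependent (v ` I)"
    then obtain u where u: "\<exists>x\<in>v ` I. u x \<noteq> 0" "(\<Sum>x\<in>v ` I. (\<lambda>k. u x * x k)) = 0"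
      using F.dependent_finite[of "v ` I"] fin by auto
    have "\<forall>i\<in>I. u (v i) = 0"
    proof (rule inj)
      fix k assume k: "k \<in> J"
      have "(\<Sum>i\<in>I. u (v i) * v i k) = 0"
        using fun_cong[OF u(2), of k] by (simp add: sum.reindex[OF inj_v] sum_apply)
      then show "(\<Sum>i\<in>I. u (v i) * G i k) = 0" using k by (simp add: v_def)
    qed
    with u(1) show False by auto
  qed
  have v_span: "v i \<in> F.span (e ` J)" for i
  proof -
    have "v i = (\<Sum>k\<in>J. (\<lambda>x. G i k * e k x))"
      by (rule ext) (auto simp: sum_apply v_def e_def fin if_distrib[of "(*) _"] cong: if_cong)
    also have "\<dots> \<in> F.span (e ` J)"
      by (intro F.span_sum F.span_scale F.span_base) auto
    finally show ?thesis .
  qed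
  have e_span: "e k \<in> F.span (v ` I)" if k: "k \<in> J" for k
  proof (rule ccontr)
    assume *: "e k \<notin> F.span (v ` I)"
    \<comment> \<open>Otherwise one vector more than \<open>card I\<close> would be independent
      inside a space spanned by \<open>card J\<close> vectors.\<close>
    then have "F.independent (insert (e k) (v ` I))" using indep by (simp add: F.independent_insert)
    then have "card (insert (e k) (v ` I)) \<le> card (e ` J)"
      using F.independent_span_bound[of "e ` J" "insert (e k) (v ` I)"] v_span k fin by (auto intro: F.span_base)
    also have "\<dots> \<le> card J" by (rule card_image_le[OF fin(2)])
    finally have "card (insert (e k) (v ` I)) \<le> card J" .
    moreover have "e k \<notin> v ` I" using * F.span_base by auto
    ultimately show False using card fin inj_v by (simp add: card_image)
  qed
  have "\<exists>c. \<forall>l\<in>J. (\<Sum>i\<in>I. c i * G i l) = (if l = k then 1 else 0)" if k: "k \<in> J" for k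
  proof -
    obtain u where u: "e k = (\<Sum>x\<in>v ` I. (\<lambda>l. u x * x l))"
      using e_span[OF k] F.span_finite[of "v ` I"] fin by auto
    have "(\<Sum>i\<in>I. u (v i) * G i l) = (if l = k then 1 else 0)" if "l \<in> J" for l
    proof -
      have "(\<Sum>i\<in>I. u (v i) * v i l) = e k l"
        unfolding u by (simp add: sum.reindex[OF inj_v] sum_apply)
      moreover have "v i l = G i l" for i using that by (simp add: v_def)
      ultimately show ?thesis by (simp add: e_def)
    qed
    then show ?thesis by (intro exI[of _ "\<lambda>i. u (v i)"] ballI)
  qed
  then have "\<forall>k\<in>J. \<exists>c. \<forall>l\<in>J. (\<Sum>i\<in>I. c i * G i l) = (if l = k then 1 else 0)" by blast
  from bchoice[OF this] obtain c where c: "\<And>k l. k \<in> J \<Longrightarrow> l \<in> J \<Longrightarrow> (\<Sum>i\<in>I. c k i * G i l) = (if l = k then 1 else 0)" by blast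
  show ?thesis
  proof (intro exI[of _ "\<lambda>i l. c l i"] allI ballI)
    fix r k assume k: "k \<in> J"
    have "(\<Sum>i\<in>I. (\<Sum>l\<in>J. c l i * r l) * G i k) = (\<Sum>i\<in>I. \<Sum>l\<in>J. r l * (c l i * G i k))"
      by (simp add: sum_distrib_right sum_distrib_left mult_ac)
    also have "\<dots> = (\<Sum>l\<in>J. r l * (\<Sum>i\<in>I. c l i * G i k))"
      by (subst sum.swap) (simp add: sum_distrib_left)
    also have "\<dots> = (\<Sum>l\<in>J. if l = k then r k else 0)" using k c by (intro sum.cong) auto
    also have "\<dots> = r k" using k fin by simp
    finally show "(\<Sum>i\<in>I. (\<Sum>l\<in>J. c l i * r l) * G i k) = r k" .
  qed
qed

text \<open>Gram-Schmidt by induction on \<open>S\<close>. The property that is carried along, that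
  a vector equals its own expansion, defines a subspace; so it has to be checked only on
  generators.\<close>

lemma orthonormal_basis_span:
  fixes sc :: "'k::real_or_complex \<Rightarrow> 'c::ab_group_add \<Rightarrow> 'c"
  assumes vs: "vector_space sc" and ipV: "inner_product_on V sc ip" and V: "module.subspace sc V"
    and S: "finite S" "S \<subseteq> V"
  shows "\<exists>B. finite B \<and> B \<subseteq> V \<and> (\<forall>b\<in>B. \<forall>b'\<in>B. ip b b' = (if b = b' then 1 else 0)) \<and>
    (\<forall>v\<in>module.span sc S. v = (\<Sum>b\<in>B. sc (ip v b) b))"
proof -
  interpret vector_space sc by (rule vs)
  note D = ipV[unfolded inner_product_on_def]
  have ip_add: "ip (x + y) z = ip x z + ip y z" if "x \<in> V" "y \<in> V" "z \<in> V" for x y z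
    by (rule D[THEN conjunct1, rule_format, OF that])
  have ip_sc: "ip (sc a x) y = a * ip x y" if "x \<in> V" "y \<in> V" for a x y
    by (rule D[THEN conjunct2, THEN conjunct1, rule_format, OF that])
  have ip_cnj: "to_complex (ip y x) = cnj (to_complex (ip x y))" if "x \<in> V" "y \<in> V" for x y
    by (rule D[THEN conjunct2, THEN conjunct2, THEN conjunct1, rule_format, OF that])
  have ip_pos: "0 < Re (to_complex (ip x x))" if "x \<in> V" "x \<noteq> 0" for x
    by (rule D[THEN conjunct2, THEN conjunct2, THEN conjunct2, rule_format, OF that])
  have V0: "0 \<in> V" using subspace_0[OF V] .
  have ip_0: "ip 0 z = 0" if "z \<in> V" for z using ip_add[OF V0 V0 that] by simp
  have ip_diff: "ip (x - y) z = ip x z - ip y z" if "x \<in> V" "y \<in> V" "z \<in> V" for x y z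
    using ip_add[OF subspace_diff[OF V that(1,2)] that(2,3)] by simp
  have ip_sum: "ip (\<Sum>b\<in>B. f b) z = (\<Sum>b\<in>B. ip (f b) z)" if "\<And>b. b \<in> B \<Longrightarrow> f b \<in> V" "z \<in> V" for B f z
    using that by (induction B rule: infinite_finite_induct)
      (auto simp: ip_0 ip_add subspace_sum[OF V])
  show ?thesis
    using S
  proof (induction S rule: finite_induct)
    case empty
    then show ?case by (intro exI[of _ "{}"]) simp
  next
    case (insert s S)
    have "S \<subseteq> V" using insert.prems by simp
    from insert.IH[OF this] obtain B where B0: "finite B \<and> B \<subseteq> V \<and> (\<forall>b\<in>B. \<forall>b'\<in>B. ip b b' = (if b = b' then 1 else 0)) \<and>
      (\<forall>v\<in>span S. v = (\<Sum>b\<in>B. sc (ip v b) b))" ..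
    have B: "finite B" "B \<subseteq> V" "\<And>b b'. b \<in> B \<Longrightarrow> b' \<in> B \<Longrightarrow> ip b b' = (if b = b' then 1 else 0)"
      by (rule B0[THEN conjunct1], rule B0[THEN conjunct2, THEN conjunct1],
        rule B0[THEN conjunct2, THEN conjunct2, THEN conjunct1, rule_format])
    note B4 = B0[THEN conjunct2, THEN conjunct2, THEN conjunct2, rule_format]
    have sV: "s \<in> V" using insert.prems by simp
    define p where "p = (\<Sum>b\<in>B. sc (ip s b) b)"
    have pV: "p \<in> V" unfolding p_def using B by (intro subspace_sum[OF V] subspace_scale[OF V]) auto
    define e where "e = s - p"
    have eV: "e \<in> V" unfolding e_def by (rule subspace_diff[OF V sV pV])
    have eB: "ip e b = 0" if b: "b \<in> B" for b
    proof -
      have bV: "b \<in> V" using b B by auto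
      have "ip p b = (\<Sum>b'\<in>B. ip s b' * ip b' b)"
        unfolding p_def using B bV by (subst ip_sum) (auto simp: ip_sc subspace_scale[OF V] intro!: sum.cong)
      also have "\<dots> = (\<Sum>b'\<in>B. if b' = b then ip s b else 0)" using B(3) b by (intro sum.cong) auto
      also have "\<dots> = ip s b" using b B by simp
      finally show ?thesis unfolding e_def using ip_diff[OF sV pV bV] by simp
    qed
    have sub: "subspace {v \<in> V. v = (\<Sum>b\<in>C. sc (ip v b) b)}" if C: "C \<subseteq> V" for C
    proof (rule subspaceI)
      show "0 \<in> {v \<in> V. v = (\<Sum>b\<in>C. sc (ip v b) b)}" using V0 C by (auto simp: ip_0 subset_iff)
    next
      fix x y assume "x \<in> {v \<in> V. v = (\<Sum>b\<in>C. sc (ip v b) b)}" and "y \<in> {v \<in> V. v = (\<Sum>b\<in>C. sc (ip v b) b)}"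
      then have xy: "x \<in> V" "y \<in> V" and eq: "x = (\<Sum>b\<in>C. sc (ip x b) b)" "y = (\<Sum>b\<in>C. sc (ip y b) b)" by blast+
      have "(\<Sum>b\<in>C. sc (ip (x + y) b) b) = (\<Sum>b\<in>C. sc (ip x b) b) + (\<Sum>b\<in>C. sc (ip y b) b)"
        unfolding sum.distrib[symmetric] using xy C by (intro sum.cong) (auto simp: ip_add scale_left_distrib subset_iff)
      also have "\<dots> = x + y" by (rule arg_cong2[of _ _ _ _ "(+)", OF eq[symmetric]])
      finally show "x + y \<in> {v \<in> V. v = (\<Sum>b\<in>C. sc (ip v b) b)}" using subspace_add[OF V xy] by simp
    next
      fix c x assume "x \<in> {v \<in> V. v = (\<Sum>b\<in>C. sc (ip v b) b)}"
      then have xV: "x \<in> V" and eq: "x = (\<Sum>b\<in>C. sc (ip x b) b)" by blast+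
      have "(\<Sum>b\<in>C. sc (ip (sc c x) b) b) = sc c (\<Sum>b\<in>C. sc (ip x b) b)"
        unfolding scale_sum_right using xV C by (intro sum.cong) (auto simp: ip_sc subset_iff)
      also have "\<dots> = sc c x" by (rule arg_cong[OF eq[symmetric]])
      finally show "sc c x \<in> {v \<in> V. v = (\<Sum>b\<in>C. sc (ip v b) b)}" using subspace_scale[OF V xV] by simp
    qed
    have SV: "span S \<subseteq> V" using insert by (intro span_minimal V) auto
    show ?case
    proof (cases "e = 0")
      case True
      then have "s = (\<Sum>b\<in>B. sc (ip s b) b)" by (simp add: e_def p_def)
      then have "insert s S \<subseteq> {v \<in> V. v = (\<Sum>b\<in>B. sc (ip v b) b)}"
        using sV insert.prems B4[OF span_base] by blast
      then have "span (insert s S) \<subseteq> {v \<in> V. v = (\<Sum>b\<in>B. sc (ip v b) b)}"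
        by (rule span_minimal[OF _ sub[OF B(2)]])
      then show ?thesis using B by (intro exI[of _ B] conjI ballI) auto
    next
      case False
      \<comment> \<open>The length of the part \<open>e\<close> of \<open>s\<close> orthogonal to
        \<open>B\<close>; dividing by it gives the new basis vector \<open>n\<close>.\<close>
      define r where "r = sqrt (Re (to_complex (ip e e)))"
      have r0: "0 < r" using ip_pos[OF eV False] by (simp add: r_def)
      define n where "n = sc (of_real (1 / r)) e"
      have nV: "n \<in> V" unfolding n_def by (rule subspace_scale[OF V eV])
      have nB: "ip n b = 0" "ip b n = 0" if b: "b \<in> B" for b
      proof -
        have bV: "b \<in> V" using b B by auto
        show 1: "ip n b = 0" unfolding n_def using eB[OF b] ip_sc[OF eV bV] by simp
        have "to_complex (ip b n) = 0" using ip_cnj[OF nV bV] 1 by simp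
        then show "ip b n = 0" by simp
      qed
      have tee: "to_complex (ip e e) = of_real (r\<^sup>2)"
        using ip_cnj[OF eV eV] ip_pos[OF eV False] by (simp add: r_def complex_eq_iff)
      have ten: "to_complex (ip e n) = of_real r"
      proof -
        have "to_complex (ip e n) = cnj (to_complex (ip n e))" by (rule ip_cnj[OF nV eV])
        also have "ip n e = of_real (1 / r) * ip e e" unfolding n_def by (rule ip_sc[OF eV eV])
        also have "cnj (to_complex (of_real (1 / r) * ip e e)) = of_real (1 / r * r\<^sup>2)"
          unfolding to_complex_mult to_complex_of_real tee by simp
        also have "1 / r * r\<^sup>2 = r" using r0 by (simp add: power2_eq_square)
        finally show ?thesis .
      qed
      then have en: "ip e n = of_real r" by (metis to_complex_inject to_complex_of_real)
      have "ip n n = of_real (1 / r) * of_real r"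
        using ip_sc[OF eV nV, of "of_real (1 / r)"] unfolding n_def[symmetric] en .
      then have nn: "ip n n = 1" using r0 by (simp flip: of_real_mult)
      have nB': "n \<notin> B" using nB(1)[of n] nn by auto
      have ev: "e = sc (of_real r) n" using r0 by (simp add: n_def of_real_mult[symmetric] del: of_real_mult)
      have orth: "ip v n = 0" if "v = (\<Sum>b\<in>B. sc (ip v b) b)" for v
      proof -
        have "ip v n = ip (\<Sum>b\<in>B. sc (ip v b) b) n" by (rule arg_cong[OF that, of "\<lambda>v. ip v n"])
        also have "\<dots> = (\<Sum>b\<in>B. ip (sc (ip v b) b) n)"
          using B nV by (intro ip_sum subspace_scale[OF V]) auto
        also have "\<dots> = 0" using B nV nB by (intro sum.neutral) (auto simp: ip_sc)
        finally show ?thesis .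
      qed
      have pn: "ip p n = 0"
      proof -
        have "ip p n = (\<Sum>b\<in>B. ip (sc (ip s b) b) n)"
          unfolding p_def using B nV by (intro ip_sum subspace_scale[OF V]) auto
        also have "\<dots> = 0" using B nV nB by (intro sum.neutral) (auto simp: ip_sc)
        finally show ?thesis .
      qed
      have sn: "ip s n = of_real r" using ip_diff[OF sV pV nV] pn en by (simp add: e_def[symmetric])
      have "(\<Sum>b\<in>insert n B. sc (ip s b) b) = sc (ip s n) n + p"
        using nB' B(1) by (simp add: p_def)
      also have "\<dots> = s" unfolding sn ev[symmetric] by (simp add: e_def)
      finally have "s = (\<Sum>b\<in>insert n B. sc (ip s b) b)" by (rule sym)
      moreover have "v = (\<Sum>b\<in>insert n B. sc (ip v b) b)" if "v \<in> S" for v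
      proof -
        note v = B4[OF span_base[OF that]]
        have "(\<Sum>b\<in>insert n B. sc (ip v b) b) = sc (ip v n) n + (\<Sum>b\<in>B. sc (ip v b) b)"
          using nB' B(1) by simp
        also have "\<dots> = (\<Sum>b\<in>B. sc (ip v b) b)" unfolding orth[OF v] by simp
        also have "\<dots> = v" by (rule v[symmetric])
        finally show ?thesis by (rule sym)
      qed
      ultimately have "insert s S \<subseteq> {v \<in> V. v = (\<Sum>b\<in>insert n B. sc (ip v b) b)}"
        using insert.prems by blast
      then have "span (insert s S) \<subseteq> {v \<in> V. v = (\<Sum>b\<in>insert n B. sc (ip v b) b)}"
        using nV B(2) by (intro span_minimal sub) auto
      moreover have "ip b b' = (if b = b' then 1 else 0)" if "b \<in> insert n B" "b' \<in> insert n B" for b b'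
        using that nn nB nB' B(3) by (cases "b = n"; cases "b' = n") auto
      ultimately show ?thesis using B(1,2) nV by (intro exI[of _ "insert n B"] conjI ballI) auto
    qed
  qed
qed

section \<open>The beam on its segments\<close>

lemma L2_cong: "(\<And>x. x \<in> {a<..<b} \<Longrightarrow> f x = g x) \<Longrightarrow> L2_on a b f = L2_on a b g"
  unfolding L2_on_def
  by (intro arg_cong2[of _ _ _ _ "(\<and>)"] measurable_cong Bochner_Integration.integrable_cong) auto

lemma vector_4 [simp]:
  "(vector [w, x, y, z] :: 'a::zero ^ 4) $ 1 = w" "(vector [w, x, y, z] :: 'a ^ 4) $ 2 = x"
  "(vector [w, x, y, z] :: 'a ^ 4) $ 3 = y" "(vector [w, x, y, z] :: 'a ^ 4) $ 4 = z"
  by (simp_all add: vector_def)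

lemma stack_nth:
  "stack u v $ (1::4) = u $ 1" "stack u v $ (2::4) = u $ 2" "stack u v $ (3::4) = v $ 1" "stack u v $ (4::4) = v $ 2"
  by (simp_all add: stack_def)

text \<open>\<open>coef i\<close> is the i-th diagonal entry of the energy density matrix. Common
  bounds \<open>m0\<close> and \<open>m1\<close> let both components of the state be treated
  alike.\<close>

locale beam_ctx =
  fixes b :: "'k::real_or_complex beam" and m0 m1 :: real and coef :: "2 \<Rightarrow> real \<Rightarrow> real"
  assumes setting: "beam_setting b"
    and coef_def: "coef = (\<lambda>i \<zeta>. if i = 1 then inverse (rho b \<zeta>) else EI b \<zeta>)"
    and m0: "0 < m0"
    and coef_bounds: "\<And>i \<zeta>. \<zeta> \<in> {0<..<len b} \<Longrightarrow> m0 \<le> coef i \<zeta> \<and> coef i \<zeta> \<le> m1"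
begin

abbreviation "n \<equiv> n_seg b"
abbreviation "nd \<equiv> node b"
text \<open>Segments are counted from 0 here, whereas \<open>seg_deriv\<close> and
  \<open>val_left\<close> address the same interval by its right end \<open>Suc j\<close>.\<close>

abbreviation "seg j \<equiv> ioo (nd j) (nd (Suc j))"

lemma n1: "1 \<le> n" and nd0: "nd 0 = 0" and nd_n: "nd n = len b" and nd_Suc: "j < n \<Longrightarrow> nd j < nd (Suc j)"
  using setting by (auto simp: beam_setting_def len_def)

lemma nd_mono: "i \<le> j \<Longrightarrow> j \<le> n \<Longrightarrow> nd i \<le> nd j"
proof (induction j rule: dec_induct)
  case (step k)
  then show ?case using nd_Suc[of k] by simp
qed simp

lemma seg_bounds: "j < n \<Longrightarrow> 0 \<le> nd j" "j < n \<Longrightarrow> nd (Suc j) \<le> len b"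
  using nd_mono[of 0 j] nd_mono[of "Suc j" n] nd0 nd_n by auto

lemma seg_in: "j < n \<Longrightarrow> \<zeta> \<in> {nd j<..<nd (Suc j)} \<Longrightarrow> \<zeta> \<in> {0<..<len b}"
  using seg_bounds[of j] by auto

lemma seg_disjoint:
  assumes "j < n" "k < n" "\<zeta> \<in> {nd j<..<nd (Suc j)}" "\<zeta> \<in> {nd k<..<nd (Suc k)}"
  shows "j = k"
proof (rule ccontr)
  assume "j \<noteq> k"
  then have "Suc j \<le> k \<or> Suc k \<le> j" by auto
  then show False using nd_mono[of "Suc j" k] nd_mono[of "Suc k" j] assms by auto
qed

lemma seg_sum:
  assumes "j < n" "\<zeta> \<in> {nd j<..<nd (Suc j)}"
  shows "(\<Sum>k<n. indicator {nd k<..<nd (Suc k)} \<zeta> *\<^sub>R F k) = (F j :: 'z::real_vector)"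
proof -
  have "(\<Sum>k<n. indicator {nd k<..<nd (Suc k)} \<zeta> *\<^sub>R F k) = (\<Sum>k<n. if k = j then F j else 0)"
  proof (rule sum.cong)
    fix k assume "k \<in> {..<n}"
    then have "\<zeta> \<in> {nd k<..<nd (Suc k)} \<longleftrightarrow> k = j" using seg_disjoint[OF _ assms(1) _ assms(2), of k] assms(2) by blast
    then show "indicator {nd k<..<nd (Suc k)} \<zeta> *\<^sub>R F k = (if k = j then F j else 0)"
      by (simp only: indicator_def) simp
  qed simp
  then show ?thesis using assms by simp
qed

lemma AE_segs:
  assumes "\<And>j. j < n \<Longrightarrow> AE \<zeta> in seg j. P \<zeta>"
  shows "AE \<zeta> in ioo 0 (len b). P \<zeta>"
proof -
  have cover: "\<exists>j<n. \<zeta> \<in> {nd j<..<nd (Suc j)}" if "\<zeta> \<in> {0<..<len b}" "\<zeta> \<notin> nd ` {..n}" for \<zeta>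
  proof -
    \<comment> \<open>The first node beyond \<open>\<zeta>\<close>. It is not the node 0, and its
      predecessor is the left end of the segment sought.\<close>
    define j where "j = (LEAST k. \<zeta> < nd k)"
    have ex: "\<zeta> < nd n" using that nd_n by simp
    have j: "\<zeta> < nd j" "j \<le> n" unfolding j_def by (rule LeastI[of _ n], rule ex, rule Least_le, rule ex)
    have "j \<noteq> 0" using j that nd0 by (intro notI) simp
    then obtain k where k: "j = Suc k" using not0_implies_Suc by blast
    have "\<not> \<zeta> < nd k" using not_less_Least[of k "\<lambda>k. \<zeta> < nd k"] k by (simp add: j_def)
    moreover have "\<zeta> \<noteq> nd k" using that(2) j k by auto
    ultimately show ?thesis using j k by (intro exI[of _ k]) auto
  qed
  have "AE \<zeta> in lebesgue. \<forall>j\<in>{..<n}. \<zeta> \<in> {nd j<..<nd (Suc j)} \<longrightarrow> P \<zeta>"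
    using assms by (intro AE_finite_allI) (auto simp: AE_restrict_space_iff)
  moreover have "AE \<zeta> in lebesgue. \<zeta> \<notin> nd ` {..n}"
    by (intro AE_not_in) (auto intro: negligible_iff_null_sets[THEN iffD1] negligible_finite)
  ultimately have "AE \<zeta> in lebesgue. \<zeta> \<in> {0<..<len b} \<longrightarrow> P \<zeta>"
    by eventually_elim (use cover in blast)
  then show ?thesis by (simp add: AE_restrict_space_iff)
qed

lemma AE_seg: "AE \<zeta> in ioo 0 (len b). P \<zeta> \<Longrightarrow> j < n \<Longrightarrow> AE \<zeta> in seg j. P \<zeta>"
  using AE_subinterval seg_bounds by blast

lemma L2_segs:
  fixes g :: "real \<Rightarrow> 'k"
  assumes "\<And>j. j < n \<Longrightarrow> L2_on (nd j) (nd (Suc j)) g"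
  shows "L2_on 0 (len b) g"
proof -
  have "L2_on 0 (nd j) g" if "j \<le> n" for j
    using that
  proof (induction j)
    case 0
    then show ?case by (simp add: nd0 L2_on_def integrable_restrict_space borel_measurable_restrict_space_iff)
  next
    case (Suc j)
    have "0 \<le> nd j" "nd j \<le> nd (Suc j)" using nd_mono[of 0 j] nd_Suc[of j] nd0 Suc.prems by auto
    moreover have "L2_on 0 (nd j) g" "L2_on (nd j) (nd (Suc j)) g" using Suc assms[of j] by auto
    ultimately show ?case by (metis L2_join)
  qed
  from this[of n] nd_n show ?thesis by simp
qed

lemma coef_pos: "\<zeta> \<in> {0<..<len b} \<Longrightarrow> 0 < coef i \<zeta>"
  using coef_bounds[of \<zeta> i] m0 by auto

lemma co_energy_coef: "co_energy b x \<zeta> $ i = coef i \<zeta> *\<^sub>R x \<zeta> $ i"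
  using exhaust_2[of i] by (auto simp: co_energy_def coef_def)

lemma coef_measurable: "coef i \<in> borel_measurable (ioo 0 (len b))"
  using setting by (auto simp: beam_setting_def coef_def intro!: borel_measurable_inverse)

lemma coef_measurable_seg: "j < n \<Longrightarrow> coef i \<in> borel_measurable (seg j)"
  using seg_bounds[of j] by (intro measurable_restrict_mono[OF coef_measurable]) auto

section \<open>Domain and maximal operator through representatives\<close>

definition seg_rep :: "(real \<Rightarrow> 'k ^ 2) \<Rightarrow> nat \<Rightarrow> 2 \<Rightarrow> (real \<Rightarrow> 'k) \<Rightarrow> (real \<Rightarrow> 'k) \<Rightarrow> (real \<Rightarrow> 'k) \<Rightarrow> bool" where
  "seg_rep x j i h0 h1 h2 \<longleftrightarrow> rep2 (nd j) (nd (Suc j)) (\<lambda>\<zeta>. co_energy b x \<zeta> $ i) h0 h1 h2"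

lemma X_space_coord: "x \<in> X_space b \<longleftrightarrow> (\<forall>i. L2_on 0 (len b) (\<lambda>\<zeta>. x \<zeta> $ i))"
  by (simp add: X_space_def)

lemma dom_max_iff: "x \<in> dom_max b \<longleftrightarrow> x \<in> X_space b \<and> (\<forall>j<n. \<forall>i. \<exists>h0 h1 h2. seg_rep x j i h0 h1 h2)"
proof -
  have "(\<forall>j\<in>{1..n}. \<forall>i. H2_on (nd (j - 1)) (nd j) (\<lambda>\<zeta>. co_energy b x \<zeta> $ i)) \<longleftrightarrow>
    (\<forall>j<n. \<forall>i. H2_on (nd j) (nd (Suc j)) (\<lambda>\<zeta>. co_energy b x \<zeta> $ i))"
  proof -
    have "{1..n} = Suc ` {..<n}" by (simp add: image_Suc_lessThan)
    then show ?thesis by (simp only: ball_simps diff_Suc_1) auto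
  qed
  moreover have "H2_on (nd j) (nd (Suc j)) (\<lambda>\<zeta>. co_energy b x \<zeta> $ i) \<longleftrightarrow> (\<exists>h0 h1 h2. seg_rep x j i h0 h1 h2)" if "j < n" for j i
    unfolding seg_rep_def using H2_rep2[OF nd_Suc[OF that]] rep2_H2(1)[OF nd_Suc[OF that]] by blast
  ultimately show ?thesis by (auto simp: dom_max_def)
qed

text \<open>On each segment \<open>x\<close> is recovered from its co-energy by division by
  \<open>coef\<close>, which is bounded away from 0; so square integrability comes for free.\<close>

lemma X_space_segI:
  assumes "\<And>j i. j < n \<Longrightarrow> \<exists>h0 h1 h2. seg_rep x j i h0 h1 h2"
  shows "x \<in> dom_max b"
proof -
  have "L2_on (nd j) (nd (Suc j)) (\<lambda>\<zeta>. x \<zeta> $ i)" if j: "j < n" for j i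
  proof -
    have "L2_on (nd j) (nd (Suc j)) (\<lambda>\<zeta>. (1 / coef i \<zeta>) *\<^sub>R (co_energy b x \<zeta> $ i))"
    proof (rule L2_scaleR_bounded)
      show "L2_on (nd j) (nd (Suc j)) (\<lambda>\<zeta>. co_energy b x \<zeta> $ i)"
        using assms[OF j, of i] by (auto simp: seg_rep_def rep2_def)
      show "(\<lambda>\<zeta>. 1 / coef i \<zeta>) \<in> borel_measurable (seg j)" using coef_measurable_seg[OF j] by measurable
      fix \<zeta> assume "\<zeta> \<in> {nd j<..<nd (Suc j)}"
      then have "m0 \<le> coef i \<zeta>" using seg_in[OF j] coef_bounds by blast
      then show "\<bar>1 / coef i \<zeta>\<bar> \<le> 1 / m0" using m0 by (simp add: frac_le)
    qed
    then show ?thesis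
    proof (rule L2_cong[THEN iffD1, rotated])
      fix \<zeta> assume "\<zeta> \<in> {nd j<..<nd (Suc j)}"
      then have "0 < coef i \<zeta>" using seg_in[OF j] coef_pos by blast
      then show "(1 / coef i \<zeta>) *\<^sub>R (co_energy b x \<zeta> $ i) = x \<zeta> $ i" by (simp add: co_energy_coef)
    qed
  qed
  then have "x \<in> X_space b" unfolding X_space_coord using L2_segs by blast
  with assms show ?thesis by (simp add: dom_max_iff)
qed

lemma seg_rep_vals:
  assumes j: "j < n" and r: "seg_rep x j i h0 h1 h2"
  shows "val_right b 0 x j $ i = h0 (nd j)" "val_right b 1 x j $ i = h1 (nd j)"
    "val_left b 0 x (Suc j) $ i = h0 (nd (Suc j))" "val_left b 1 x (Suc j) $ i = h1 (nd (Suc j))"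
    "AE \<zeta> in seg j. seg_deriv b 2 x (Suc j) i \<zeta> = h2 \<zeta>" "L2_on (nd j) (nd (Suc j)) (seg_deriv b 2 x (Suc j) i)"
proof -
  note ab = nd_Suc[OF j]
  note r' = r[unfolded seg_rep_def]
  show "val_right b 0 x j $ i = h0 (nd j)" "val_right b 1 x j $ i = h1 (nd j)"
    "val_left b 0 x (Suc j) $ i = h0 (nd (Suc j))" "val_left b 1 x (Suc j) $ i = h1 (nd (Suc j))"
    using rep2_trace[OF ab r'] ab by (simp_all add: val_right_def val_left_def seg_deriv_def)
  show "AE \<zeta> in seg j. seg_deriv b 2 x (Suc j) i \<zeta> = h2 \<zeta>" "L2_on (nd j) (nd (Suc j)) (seg_deriv b 2 x (Suc j) i)"
    using rep2_H2[OF ab r'] by (simp_all add: seg_deriv_def numeral_2_eq_2)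
qed

lemma P_mat_mult: "P_mat *v v = vector [- (v $ 2), v $ 1 :: 'z::real_or_complex]"
  by (simp add: vec_eq_iff forall_2 matrix_vector_mult_def sum_2 P_mat_def)

lemma op_max_seg:
  assumes "j < n" "\<zeta> \<in> {nd j<..<nd (Suc j)}"
  shows "op_max b x \<zeta> = vector [- seg_deriv b 2 x (Suc j) 2 \<zeta>, seg_deriv b 2 x (Suc j) 1 \<zeta>]"
proof -
  have "op_max b x \<zeta> = (\<Sum>k<n. indicator {nd k<..<nd (Suc k)} \<zeta> *\<^sub>R (P_mat *v (\<chi> i. seg_deriv b 2 x (Suc k) i \<zeta>)))"
    by (simp only: op_max_def One_nat_def sum.atLeast1_atMost_eq diff_Suc_Suc diff_zero)
  also have "\<dots> = P_mat *v (\<chi> i. seg_deriv b 2 x (Suc j) i \<zeta>)" by (rule seg_sum[OF assms])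
  finally show ?thesis by (simp add: P_mat_mult)
qed

lemma op_max_AE:
  assumes "j < n" "seg_rep x j 1 h0 h1 h2" "seg_rep x j 2 k0 k1 k2"
  shows "AE \<zeta> in seg j. op_max b x \<zeta> = vector [- k2 \<zeta>, h2 \<zeta>]"
proof -
  have "AE \<zeta> in seg j. seg_deriv b 2 x (Suc j) 1 \<zeta> = h2 \<zeta> \<and> seg_deriv b 2 x (Suc j) 2 \<zeta> = k2 \<zeta>"
    using seg_rep_vals(5)[OF assms(1,2)] seg_rep_vals(5)[OF assms(1,3)] by eventually_elim simp
  then show ?thesis by (rule lebesgue_on_mono) (simp add: op_max_seg[OF assms(1)])
qed

lemma op_max_in: assumes "x \<in> dom_max b" shows "op_max b x \<in> X_space b"
  unfolding X_space_coord
proof (intro allI L2_segs)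
  fix i :: 2 and j assume j: "j < n"
  have L: "L2_on (nd j) (nd (Suc j)) (seg_deriv b 2 x (Suc j) i')" for i'
    using assms j seg_rep_vals(6)[OF j] unfolding dom_max_iff by blast
  have "L2_on (nd j) (nd (Suc j)) (\<lambda>\<zeta>. if i = 1 then (- 1) * seg_deriv b 2 x (Suc j) 2 \<zeta> else seg_deriv b 2 x (Suc j) 1 \<zeta>)"
    using L2_cmult[OF L[of 2], of "-1"] L[of 1] by (cases "i = 1") simp_all
  then show "L2_on (nd j) (nd (Suc j)) (\<lambda>\<zeta>. op_max b x \<zeta> $ i)"
    by (rule L2_cong[THEN iffD1, rotated]) (use exhaust_2[of i] in \<open>auto simp: op_max_seg[OF j]\<close>)
qed

text \<open>One number bounds the continuous representatives of \<open>f\<close> and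
  \<open>f'\<close>. This controls every trace and also gives a Lipschitz constant for
  \<open>f\<close>, the ingredient for Arzela-Ascoli.\<close>

definition bounded_rep :: "(real \<Rightarrow> 'k ^ 2) \<Rightarrow> real \<Rightarrow> bool" where
  "bounded_rep x Q \<longleftrightarrow> (\<forall>j<n. \<forall>i. \<exists>h0 h1 h2. seg_rep x j i h0 h1 h2 \<and>
     (\<forall>t\<in>{nd j..nd (Suc j)}. norm (h0 t) \<le> Q \<and> norm (h1 t) \<le> Q))"

text \<open>The single operation \<open>c x + y\<close> covers sums, differences and multiples, so
  each linearity property is proved once.\<close>

definition lc :: "'k \<Rightarrow> (real \<Rightarrow> 'k ^ 2) \<Rightarrow> (real \<Rightarrow> 'k ^ 2) \<Rightarrow> real \<Rightarrow> 'k ^ 2" where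
  "lc c x y = (\<lambda>\<zeta>. c *s x \<zeta>) + y"

lemma lc_nth [simp]: "lc c x y \<zeta> $ i = c * x \<zeta> $ i + y \<zeta> $ i"
  by (simp add: lc_def)

lemma lc_seg_rep:
  assumes "seg_rep x j i h0 h1 h2" "seg_rep y j i k0 k1 k2"
  shows "seg_rep (lc c x y) j i (\<lambda>\<zeta>. c * h0 \<zeta> + k0 \<zeta>) (\<lambda>\<zeta>. c * h1 \<zeta> + k1 \<zeta>) (\<lambda>\<zeta>. c * h2 \<zeta> + k2 \<zeta>)"
proof -
  have "co_energy b (lc c x y) \<zeta> $ i = c * co_energy b x \<zeta> $ i + co_energy b y \<zeta> $ i" for \<zeta>
    by (simp add: co_energy_coef scaleR_add_right)
  then show ?thesis using rep2_lin[OF assms[unfolded seg_rep_def]] by (simp add: seg_rep_def)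
qed

lemma X_space_lc: "x \<in> X_space b \<Longrightarrow> y \<in> X_space b \<Longrightarrow> lc c x y \<in> X_space b"
  by (simp add: X_space_coord L2_add L2_cmult)

lemma dom_max_lc: "x \<in> dom_max b \<Longrightarrow> y \<in> dom_max b \<Longrightarrow> lc c x y \<in> dom_max b"
  using lc_seg_rep by (simp add: dom_max_iff X_space_lc) blast

lemma bounded_rep_lc:
  assumes x: "bounded_rep x Q" and y: "bounded_rep y Q'"
  shows "bounded_rep (lc c x y) (norm c * Q + Q')"
  unfolding bounded_rep_def
proof (intro allI impI)
  fix j i assume j: "j < n"
  from x j obtain h0 h1 h2 where h: "seg_rep x j i h0 h1 h2"
    "\<forall>t\<in>{nd j..nd (Suc j)}. norm (h0 t) \<le> Q \<and> norm (h1 t) \<le> Q" unfolding bounded_rep_def by blast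
  from y j obtain k0 k1 k2 where k: "seg_rep y j i k0 k1 k2"
    "\<forall>t\<in>{nd j..nd (Suc j)}. norm (k0 t) \<le> Q' \<and> norm (k1 t) \<le> Q'" unfolding bounded_rep_def by blast
  have "norm (c * u + v) \<le> norm c * Q + Q'" if "norm u \<le> Q" "norm v \<le> Q'" for u v :: 'k
  proof -
    have "norm (c * u + v) \<le> norm c * norm u + norm v" using norm_triangle_ineq[of "c * u" v] by (simp add: norm_mult)
    also have "\<dots> \<le> norm c * Q + Q'" using that by (intro add_mono mult_left_mono) auto
    finally show ?thesis .
  qed
  note bd = this
  show "\<exists>h0 h1 h2. seg_rep (lc c x y) j i h0 h1 h2 \<and>
     (\<forall>t\<in>{nd j..nd (Suc j)}. norm (h0 t) \<le> norm c * Q + Q' \<and> norm (h1 t) \<le> norm c * Q + Q')"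
  proof (intro exI conjI)
    show "seg_rep (lc c x y) j i (\<lambda>\<zeta>. c * h0 \<zeta> + k0 \<zeta>) (\<lambda>\<zeta>. c * h1 \<zeta> + k1 \<zeta>) (\<lambda>\<zeta>. c * h2 \<zeta> + k2 \<zeta>)"
      by (rule lc_seg_rep[OF h(1) k(1)])
    show "\<forall>t\<in>{nd j..nd (Suc j)}. norm (c * h0 t + k0 t) \<le> norm c * Q + Q' \<and> norm (c * h1 t + k1 t) \<le> norm c * Q + Q'"
      using bd h(2) k(2) by blast
  qed
qed

text \<open>Linearity holds almost everywhere only, because the weak derivatives in
  \<open>op_max\<close> are chosen separately for each function.\<close>

lemma op_max_lc:
  assumes "x \<in> dom_max b" "y \<in> dom_max b"
  shows "AE \<zeta> in ioo 0 (len b). op_max b (lc c x y) \<zeta> = c *s op_max b x \<zeta> + op_max b y \<zeta>"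
proof (rule AE_segs)
  fix j assume j: "j < n"
  obtain h0 h1 h2 where h: "\<And>i. seg_rep x j i (h0 i) (h1 i) (h2 i)"
    using assms(1) j unfolding dom_max_iff by metis
  obtain k0 k1 k2 where k: "\<And>i. seg_rep y j i (k0 i) (k1 i) (k2 i)"
    using assms(2) j unfolding dom_max_iff by metis
  from op_max_AE[OF j h h] op_max_AE[OF j k k] op_max_AE[OF j lc_seg_rep[OF h k] lc_seg_rep[OF h k]]
  show "AE \<zeta> in seg j. op_max b (lc c x y) \<zeta> = c *s op_max b x \<zeta> + op_max b y \<zeta>"
    by eventually_elim (simp add: vec_eq_iff forall_2)
qed

text \<open>The functionals that boundary and junction conditions are made of: linear on the maximal
  domain and bounded by the values of \<open>f\<close> and \<open>f'\<close>.\<close>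

definition bfun :: "((real \<Rightarrow> 'k ^ 2) \<Rightarrow> 'k) \<Rightarrow> bool" where
  "bfun F \<longleftrightarrow> (\<forall>x\<in>dom_max b. \<forall>y\<in>dom_max b. \<forall>c. F (lc c x y) = c * F x + F y) \<and>
     (\<exists>C\<ge>0. \<forall>x\<in>dom_max b. \<forall>Q. bounded_rep x Q \<longrightarrow> norm (F x) \<le> C * Q)"

lemma bfun_add: assumes "bfun F" "bfun G" shows "bfun (\<lambda>x. F x + G x)"
proof -
  obtain C C' where C: "0 \<le> C" "\<And>x Q. x \<in> dom_max b \<Longrightarrow> bounded_rep x Q \<Longrightarrow> norm (F x) \<le> C * Q"
    "0 \<le> C'" "\<And>x Q. x \<in> dom_max b \<Longrightarrow> bounded_rep x Q \<Longrightarrow> norm (G x) \<le> C' * Q"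
    using assms unfolding bfun_def by blast
  have "norm (F x + G x) \<le> (C + C') * Q" if "x \<in> dom_max b" "bounded_rep x Q" for x Q
    using C(2)[OF that] C(4)[OF that] norm_triangle_ineq[of "F x" "G x"] by (simp add: algebra_simps)
  moreover have "0 \<le> C + C'" using C by simp
  moreover have "\<forall>x\<in>dom_max b. \<forall>y\<in>dom_max b. \<forall>c. F (lc c x y) + G (lc c x y) = c * (F x + G x) + (F y + G y)"
    using assms unfolding bfun_def by (simp add: algebra_simps)
  ultimately show ?thesis unfolding bfun_def by blast
qed

lemma bfun_cmult: assumes "bfun F" shows "bfun (\<lambda>x. d * F x)"
proof -
  obtain C where C: "0 \<le> C" "\<And>x Q. x \<in> dom_max b \<Longrightarrow> bounded_rep x Q \<Longrightarrow> norm (F x) \<le> C * Q"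
    using assms unfolding bfun_def by blast
  have "norm (d * F x) \<le> (norm d * C) * Q" if "x \<in> dom_max b" "bounded_rep x Q" for x Q
    using C(2)[OF that] mult_left_mono[of "norm (F x)" "C * Q" "norm d"] by (simp add: norm_mult mult.assoc)
  moreover have "0 \<le> norm d * C" using C by simp
  moreover have "\<forall>x\<in>dom_max b. \<forall>y\<in>dom_max b. \<forall>c. d * F (lc c x y) = c * (d * F x) + d * F y"
    using assms unfolding bfun_def by (simp add: algebra_simps)
  ultimately show ?thesis unfolding bfun_def by blast
qed

lemma bfun_minus: "bfun F \<Longrightarrow> bfun (\<lambda>x. - F x)"
  using bfun_cmult[of F "- 1"] by simp

lemma bfun_diff: "bfun F \<Longrightarrow> bfun G \<Longrightarrow> bfun (\<lambda>x. F x - G x)"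
  using bfun_add[of F "\<lambda>x. - G x"] bfun_minus by simp

section \<open>Traces as bounded linear functionals\<close>

lemma bfun_vals:
  assumes j: "j < n" and k: "k = 0 \<or> k = 1"
  shows "bfun (\<lambda>x. val_right b k x j $ i)" "bfun (\<lambda>x. val_left b k x (Suc j) $ i)"
proof -
  have ex: "\<exists>h0 h1 h2. seg_rep x j i h0 h1 h2" if "x \<in> dom_max b" for x
    using that j unfolding dom_max_iff by blast
  have lin: "val_right b k (lc c x y) j $ i = c * val_right b k x j $ i + val_right b k y j $ i \<and>
    val_left b k (lc c x y) (Suc j) $ i = c * val_left b k x (Suc j) $ i + val_left b k y (Suc j) $ i"
    if xy: "x \<in> dom_max b" "y \<in> dom_max b" for x y c
  proof -
    obtain h0 h1 h2 where h: "seg_rep x j i h0 h1 h2" using ex[OF xy(1)] by blast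
    obtain k0 k1 k2 where k': "seg_rep y j i k0 k1 k2" using ex[OF xy(2)] by blast
    show ?thesis using k seg_rep_vals(1-4)[OF j h] seg_rep_vals(1-4)[OF j k'] seg_rep_vals(1-4)[OF j lc_seg_rep[OF h k', of c]]
      by auto
  qed
  have bd: "norm (val_right b k x j $ i) \<le> Q \<and> norm (val_left b k x (Suc j) $ i) \<le> Q"
    if "bounded_rep x Q" for x Q
  proof -
    obtain h0 h1 h2 where h: "seg_rep x j i h0 h1 h2"
      "\<forall>t\<in>{nd j..nd (Suc j)}. norm (h0 t) \<le> Q \<and> norm (h1 t) \<le> Q" using \<open>bounded_rep x Q\<close> j unfolding bounded_rep_def by blast
    then show ?thesis using k seg_rep_vals(1-4)[OF j h(1)] nd_Suc[OF j] by auto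
  qed
  show "bfun (\<lambda>x. val_right b k x j $ i)" "bfun (\<lambda>x. val_left b k x (Suc j) $ i)"
    unfolding bfun_def using lin bd by (auto intro!: exI[of _ 1])
qed

lemma bfun_val_left: "1 \<le> j \<Longrightarrow> j \<le> n \<Longrightarrow> k = 0 \<or> k = 1 \<Longrightarrow> bfun (\<lambda>x. val_left b k x j $ i)"
  using bfun_vals(2)[of "j - 1"] by simp

lemma bfun_junction:
  assumes j: "1 \<le> j" "j < n"
  shows "bfun (\<lambda>x. junction_B0 b x j $ i)" "bfun (\<lambda>x. junction_B b x j $ i)" "bfun (\<lambda>x. junction_C b x j $ i)"
proof -
  have vr: "bfun (\<lambda>x. val_right b k x j $ i)" "bfun (\<lambda>x. val_left b k x j $ i)" if "k = 0 \<or> k = 1" for k i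
    using bfun_vals(1)[OF j(2) that] bfun_val_left[of j k] that j by auto
  have ju: "bfun (\<lambda>x. jump b k x j $ i)" if "k = 0 \<or> k = 1" for k i
    unfolding jump_def using vr[OF that] by (simp add: bfun_diff)
  have me: "bfun (\<lambda>x. mean b k x j $ i)" if "k = 0 \<or> k = 1" for k i
  proof -
    have "(\<lambda>x. mean b k x j $ i) = (\<lambda>x. of_real (1 / 2) * (val_left b k x j $ i + val_right b k x j $ i))"
      by (rule ext) (simp only: mean_def vector_scaleR_component vector_add_component scaleR_conv_of_real[of _ "_ :: 'k"])
    then show ?thesis using bfun_cmult[OF bfun_add[OF vr(2)[OF that, of i] vr(1)[OF that, of i]], of "of_real (1 / 2)"]
      by (simp only:)
  qed
  show "bfun (\<lambda>x. junction_B0 b x j $ i)" "bfun (\<lambda>x. junction_B b x j $ i)" "bfun (\<lambda>x. junction_C b x j $ i)"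
    using exhaust_2[of i] ju me
    by (cases "junction b j"; auto simp: junction_B0_def junction_B_def junction_C_def intro: bfun_minus)+
qed

lemma bfun_matrix: "(\<And>k. bfun (\<lambda>x. v x $ k)) \<Longrightarrow> bfun (\<lambda>x. ((W :: 'k ^ 4 ^ 2) *v v x) $ i)"
  by (simp add: matrix_vector_mult_def sum_4 bfun_add bfun_cmult)

lemma bfun_end_trace: assumes "j = 0 \<or> j = n" shows "bfun (\<lambda>x. end_trace b x j $ k)"
proof -
  have st: "stack u v $ (1::4) = u $ 1" "stack u v $ 2 = u $ 2" "stack u v $ 3 = v $ 1" "stack u v $ 4 = v $ 2" for u v :: "'k ^ 2"
    by (simp_all add: stack_nth)
  have n0: "0 < n" using n1 by simp
  have "\<forall>k. bfun (\<lambda>x. end_trace b x j $ k)"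
  proof (cases "j = 0")
    case True
    have v: "bfun (\<lambda>x. val_right b 0 x 0 $ i)" "bfun (\<lambda>x. val_right b 1 x 0 $ i)" for i
      using bfun_vals(1)[OF n0] by simp_all
    have "end_trace b x j $ 1 = val_right b 0 x 0 $ 1" "end_trace b x j $ 2 = val_right b 0 x 0 $ 2"
      "end_trace b x j $ 3 = val_right b 1 x 0 $ 2" "end_trace b x j $ 4 = - val_right b 1 x 0 $ 1" for x
      using True by (simp_all add: end_trace_def st P_mat_mult)
    then show ?thesis unfolding forall_4 using v by (simp add: bfun_minus del: One_nat_def)
  next
    case False
    have v: "bfun (\<lambda>x. val_left b 0 x j $ i)" "bfun (\<lambda>x. val_left b 1 x j $ i)" for i
      using bfun_val_left[of j] assms False n0 by auto
    have "end_trace b x j $ 1 = val_left b 0 x j $ 1" "end_trace b x j $ 2 = val_left b 0 x j $ 2"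
      "end_trace b x j $ 3 = - val_left b 1 x j $ 2" "end_trace b x j $ 4 = val_left b 1 x j $ 1" for x
      using False by (simp_all add: end_trace_def st P_mat_mult)
    then show ?thesis unfolding forall_4 using v by (simp add: bfun_minus del: One_nat_def)
  qed
  then show ?thesis by blast
qed

lemma bfun_maps:
  assumes "j \<le> n"
  shows "bfun (\<lambda>x. map_B b x j $ i)" "bfun (\<lambda>x. map_C b x j $ i)"
  using assms bfun_matrix[OF bfun_end_trace] bfun_junction[of j]
  by (cases "j = 0 \<or> j = n"; auto simp: map_B_def map_C_def)+

end

section \<open>Initial value problems\<close>

lemma rep2I:
  fixes g :: "real \<Rightarrow> 'k::real_or_complex"
  assumes "\<And>x. x \<in> {a<..<b} \<Longrightarrow> g x = h0 x" "L2_on a b h2"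
    "\<And>t. t \<in> {a..b} \<Longrightarrow> prim a h1 t = h0 t - h0 a" "\<And>t. t \<in> {a..b} \<Longrightarrow> prim a h2 t = h1 t - h1 a"
  shows "rep2 a b g h0 h1 h2"
proof -
  have c1: "continuous_on {a..b} h1" using assms(4) by (intro continuous_prim_eq[OF L2_integrable[OF assms(2)]]) blast
  have c0: "continuous_on {a..b} h0" using assms(3) by (intro continuous_prim_eq[OF integrable_continuous_ioo[OF c1]]) blast
  have "L2_on a b g" using L2_continuous[OF c0] L2_cong[of a b g h0] assms(1) by blast
  moreover have "AE x in ioo a b. g x = h0 x" using assms(1) by (intro AE_I2) simp
  ultimately show ?thesis using assms by (simp add: rep2_def)
qed

lemma L2_sum:
  fixes f :: "'i \<Rightarrow> real \<Rightarrow> 'k::real_or_complex"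
  assumes "\<And>i. i \<in> A \<Longrightarrow> L2_on a b (f i)" "finite A"
  shows "L2_on a b (\<lambda>x. \<Sum>i\<in>A. f i x)"
  using assms(2,1) by (induction A rule: finite_induct) (auto intro: L2_add L2_bounded[of _ _ _ 0])

context beam_ctx
begin

text \<open>Coefficients of the first-order system for \<open>f\<close> and \<open>f'\<close>. In an
  index \<open>(p, ord, i)\<close> the entry \<open>p\<close> is the component of the pair,
  \<open>ord\<close> tells whether the derivative is meant, and \<open>i\<close> is the component of
  \<open>f\<close>. As \<open>P\<close> exchanges components with a sign, the equation reads
  \<open>f1'' = \<theta> x2 - w2\<close> and \<open>f2'' = w1 - \<theta> x1\<close>.\<close>

definition flow :: "(bool \<Rightarrow> bool \<Rightarrow> 'k) \<Rightarrow> bool \<times> bool \<times> 2 \<Rightarrow> bool \<times> bool \<times> 2 \<Rightarrow> real \<Rightarrow> 'k" where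
  "flow \<theta> = (\<lambda>(p, ord, i) (p', ord', i') \<zeta>.
     if \<not> ord then (if ord' \<and> p = p' \<and> i = i' then 1 else 0)
     else if \<not> ord' \<and> i \<noteq> i' then (if i = 1 then \<theta> p p' else - \<theta> p p') * of_real (1 / coef i' \<zeta>) else 0)"

definition load :: "(bool \<Rightarrow> real \<Rightarrow> 'k ^ 2) \<Rightarrow> bool \<times> bool \<times> 2 \<Rightarrow> real \<Rightarrow> 'k" where
  "load w = (\<lambda>(p, ord, i) \<zeta>. if ord then (if i = 1 then - (w p \<zeta> $ 2) else w p \<zeta> $ 1) else 0)"

lemma flow_volterra:
  assumes j: "j < n"
  shows "linear_volterra (nd j) (nd (Suc j)) (1 + (\<Sum>p\<in>UNIV. \<Sum>p'\<in>UNIV. norm (\<theta> p p')) / m0) (flow \<theta>)"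
proof
  show "nd j < nd (Suc j)" by (rule nd_Suc[OF j])
  fix k k' :: "bool \<times> bool \<times> 2"
  obtain p ord i where k: "k = (p, ord, i)" by (metis prod_cases3)
  obtain p' ord' i' where k': "k' = (p', ord', i')" by (metis prod_cases3)
  have [measurable]: "coef i' \<in> borel_measurable (seg j)" by (rule coef_measurable_seg[OF j])
  have [measurable]: "(\<lambda>\<zeta>. (of_real (1 / coef i' \<zeta>) :: 'k)) \<in> borel_measurable (seg j)"
    unfolding of_real_def by measurable
  show "flow \<theta> k k' \<in> borel_measurable (seg j)"
    unfolding flow_def k k' prod.case by measurable
  fix \<zeta> assume \<zeta>: "\<zeta> \<in> {nd j<..<nd (Suc j)}"
  have c: "m0 \<le> coef i' \<zeta>" using coef_bounds seg_in[OF j \<zeta>] by blast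
  have th: "norm (\<theta> p p') \<le> (\<Sum>p\<in>UNIV. \<Sum>p'\<in>UNIV. norm (\<theta> p p'))"
    using member_le_sum[of p' UNIV "\<lambda>p'. norm (\<theta> p p')"] member_le_sum[of p UNIV "\<lambda>p. \<Sum>p'\<in>UNIV. norm (\<theta> p p')"]
    by (simp add: sum_nonneg)
  have "norm (\<theta> p p') * (1 / coef i' \<zeta>) \<le> (\<Sum>p\<in>UNIV. \<Sum>p'\<in>UNIV. norm (\<theta> p p')) * (1 / m0)"
    using th c m0 by (intro mult_mono) (auto simp: frac_le sum_nonneg)
  moreover have "0 \<le> (\<Sum>p\<in>UNIV. \<Sum>p'\<in>UNIV. norm (\<theta> p p')) / m0" using m0 by (simp add: sum_nonneg)
  moreover define z :: 'k where "z = of_real (1 / coef i' \<zeta>)"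
  have "norm z = 1 / coef i' \<zeta>" unfolding z_def using c m0 by (simp add: norm_divide)
  ultimately show "norm (flow \<theta> k k' \<zeta>) \<le> 1 + (\<Sum>p\<in>UNIV. \<Sum>p'\<in>UNIV. norm (\<theta> p p')) / m0"
    unfolding flow_def k k' prod.case z_def[symmetric] by (auto simp: norm_mult)
qed

lemma sum_index: "(\<Sum>k\<in>(UNIV :: (bool \<times> bool \<times> 2) set). F k) =
    (\<Sum>p\<in>UNIV. (F (p, False, 1) + F (p, False, 2)) + (F (p, True, 1) + F (p, True, 2)) :: 'z::comm_monoid_add)"
proof -
  have "(\<Sum>k\<in>(UNIV :: (bool \<times> bool \<times> 2) set). F k) = (\<Sum>p\<in>UNIV. \<Sum>q\<in>UNIV. \<Sum>i\<in>UNIV. F (p, q, i))"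
    by (simp add: sum.cartesian_product)
  then show ?thesis by (simp add: UNIV_bool sum_2)
qed

text \<open>The last clause uses one majorant \<open>Q\<close> for all initial values and all
  integrals of the load. The factor \<open>K\<close> stands outside and will be independent of the
  data.\<close>

definition seg_sol :: "(bool \<Rightarrow> bool \<Rightarrow> 'k) \<Rightarrow> nat \<Rightarrow> real \<Rightarrow> (bool \<Rightarrow> bool \<Rightarrow> 2 \<Rightarrow> 'k) \<Rightarrow> (bool \<Rightarrow> real \<Rightarrow> 'k ^ 2) \<Rightarrow>
  (bool \<Rightarrow> 2 \<Rightarrow> real \<Rightarrow> 'k) \<Rightarrow> (bool \<Rightarrow> 2 \<Rightarrow> real \<Rightarrow> 'k) \<Rightarrow> (bool \<Rightarrow> 2 \<Rightarrow> real \<Rightarrow> 'k) \<Rightarrow> bool" where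
  "seg_sol \<theta> j K c w h0 h1 h2 \<longleftrightarrow> (\<forall>p.
     (\<forall>i. L2_on (nd j) (nd (Suc j)) (h2 p i) \<and>
       (\<forall>t\<in>{nd j..nd (Suc j)}. prim (nd j) (h1 p i) t = h0 p i t - h0 p i (nd j)) \<and>
       (\<forall>t\<in>{nd j..nd (Suc j)}. prim (nd j) (h2 p i) t = h1 p i t - h1 p i (nd j)) \<and>
       h0 p i (nd j) = c p False i \<and> h1 p i (nd j) = c p True i) \<and>
     (\<forall>\<zeta>\<in>{nd j<..<nd (Suc j)}.
       h2 p 1 \<zeta> = (\<Sum>p'\<in>UNIV. \<theta> p p' * (of_real (1 / coef 2 \<zeta>) * h0 p' 2 \<zeta>)) - w p \<zeta> $ 2 \<and>
       h2 p 2 \<zeta> = w p \<zeta> $ 1 - (\<Sum>p'\<in>UNIV. \<theta> p p' * (of_real (1 / coef 1 \<zeta>) * h0 p' 1 \<zeta>))) \<and>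
     (\<forall>Q. (\<forall>p ord i. norm (c p ord i) \<le> Q) \<longrightarrow> (\<forall>p i. (LINT \<zeta>|ioo 0 (len b). norm (w p \<zeta> $ i)) \<le> Q) \<longrightarrow>
       (\<forall>i. \<forall>t\<in>{nd j..nd (Suc j)}. norm (h0 p i t) \<le> K * Q \<and> norm (h1 p i t) \<le> K * Q)))"

lemma solve_segment:
  fixes \<theta> :: "bool \<Rightarrow> bool \<Rightarrow> 'k"
  assumes j: "j < n"
  shows "\<exists>K\<ge>0. \<forall>c w. (\<forall>p. w p \<in> X_space b) \<longrightarrow> (\<exists>h0 h1 h2. seg_sol \<theta> j K c w h0 h1 h2)"
proof -
  interpret linear_volterra "nd j" "nd (Suc j)" "1 + (\<Sum>p\<in>UNIV. \<Sum>p'\<in>UNIV. norm (\<theta> p p')) / m0" "flow \<theta>"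
    by (rule flow_volterra[OF j])
  obtain K where K: "0 \<le> K" "\<And>y0 r y t. (\<forall>i. integrable (seg j) (r i)) \<Longrightarrow> solution y0 r y \<Longrightarrow> t \<in> {nd j..nd (Suc j)} \<Longrightarrow>
     (\<Sum>i\<in>UNIV. norm (y t $ i)) \<le> K * ((\<Sum>i\<in>UNIV. norm (y0 $ i)) + (\<Sum>i\<in>UNIV. LINT s|seg j. norm (r i s)))"
    using solution_bound by blast
  show ?thesis
  \<comment> \<open>There are eight indices, each contributing one initial value and one load, all
    bounded by \<open>Q\<close>.\<close>
  proof (intro exI[of _ "K * 16"] conjI allI impI)
    show "0 \<le> K * 16" using K by simp
    fix c :: "bool \<Rightarrow> bool \<Rightarrow> 2 \<Rightarrow> 'k" and w :: "bool \<Rightarrow> real \<Rightarrow> 'k ^ 2" assume w: "\<forall>p. w p \<in> X_space b"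
    have wL: "L2_on 0 (len b) (\<lambda>\<zeta>. w p \<zeta> $ i)" for p i using w by (auto simp: X_space_coord)
    have wLs: "L2_on (nd j) (nd (Suc j)) (\<lambda>\<zeta>. w p \<zeta> $ i)" for p i
      by (rule L2_subinterval[OF wL seg_bounds[OF j]])
    have rL: "L2_on (nd j) (nd (Suc j)) (load w k)" for k
    proof (cases k)
      case (fields p ord i)
      have "L2_on (nd j) (nd (Suc j)) (\<lambda>\<zeta>. - 1 * w p \<zeta> $ 2)" by (rule L2_cmult[OF wLs])
      then show ?thesis using wLs[of p 1] L2_bounded[of "\<lambda>_. 0 :: 'k" "nd j" "nd (Suc j)" 0] unfolding fields load_def
        by (cases ord; cases "i = 1") simp_all
    qed
    define y0 where "y0 = (\<chi> k. case k of (p, ord, i) \<Rightarrow> c p ord i)"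
    obtain y where y: "solution y0 (load w) y" using solution_exists[of "load w" y0] L2_integrable[OF rL] by blast
    have yc: "continuous_on {nd j..nd (Suc j)} y" using y by (simp add: solution_def)
    have yeq: "prim (nd j) (field (load w) y k) t = y t $ k - y0 $ k" if "t \<in> {nd j..nd (Suc j)}" for t k
    proof -
      have "y t $ k = y0 $ k + prim (nd j) (field (load w) y k) t" using y that unfolding solution_def by blast
      then show ?thesis by simp
    qed
    have y_init: "y (nd j) $ k = y0 $ k" for k using yeq[of "nd j" k] nd_Suc[OF j] by simp
    have fieldL: "L2_on (nd j) (nd (Suc j)) (field (load w) y k)" for k
    proof -
      have "L2_on (nd j) (nd (Suc j)) (\<lambda>s. flow \<theta> k k' s * y s $ k')" for k'
      proof (rule L2_bound[of _ _ "\<lambda>s. y s $ k'"])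
        have c': "continuous_on {nd j..nd (Suc j)} (\<lambda>s. y s $ k')" by (intro continuous_intros yc)
        show L: "L2_on (nd j) (nd (Suc j)) (\<lambda>s. y s $ k')" by (rule L2_continuous[OF c'])
        show "(\<lambda>s. flow \<theta> k k' s * y s $ k') \<in> borel_measurable (seg j)"
          using N[of k k'] L2_measurable[OF L] by measurable
        show "norm (flow \<theta> k k' x * y x $ k') \<le> (1 + (\<Sum>p\<in>UNIV. \<Sum>p'\<in>UNIV. norm (\<theta> p p')) / m0) * norm (y x $ k')"
          if "x \<in> {nd j<..<nd (Suc j)}" for x using NC[OF that] by (simp add: norm_mult mult_right_mono)
      qed
      then show ?thesis unfolding field_def[abs_def] by (intro L2_add L2_sum rL) auto
    qed
    \<comment> \<open>The rows with \<open>ord\<close> false only say that \<open>f'\<close> is the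
      derivative of \<open>f\<close>.\<close>
    have f0: "field (load w) y (p, False, i) = (\<lambda>\<zeta>. y \<zeta> $ (p, True, i))" for p i
    proof
      fix \<zeta>
      have "(\<Sum>k\<in>UNIV. flow \<theta> (p, False, i) k \<zeta> * y \<zeta> $ k) = (\<Sum>k\<in>UNIV. if k = (p, True, i) then y \<zeta> $ k else 0)"
        by (intro sum.cong) (auto simp: flow_def split: if_splits)
      then show "field (load w) y (p, False, i) \<zeta> = y \<zeta> $ (p, True, i)" by (simp add: field_def load_def)
    qed
    show "\<exists>h0 h1 h2. seg_sol \<theta> j (K * 16) c w h0 h1 h2"
      unfolding seg_sol_def
    proof (rule exI[of _ "\<lambda>p i \<zeta>. y \<zeta> $ (p, False, i)"], rule exI[of _ "\<lambda>p i \<zeta>. y \<zeta> $ (p, True, i)"],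
        rule exI[of _ "\<lambda>p i. field (load w) y (p, True, i)"], intro allI conjI ballI impI)
      fix p i
      show "L2_on (nd j) (nd (Suc j)) (field (load w) y (p, True, i))" by (rule fieldL)
      show "y (nd j) $ (p, False, i) = c p False i" "y (nd j) $ (p, True, i) = c p True i"
        by (simp_all add: y_init y0_def)
      fix t assume t: "t \<in> {nd j..nd (Suc j)}"
      show "prim (nd j) (\<lambda>\<zeta>. y \<zeta> $ (p, True, i)) t = y t $ (p, False, i) - y (nd j) $ (p, False, i)"
        using yeq[OF t, of "(p, False, i)"] by (simp add: f0 y_init)
      show "prim (nd j) (field (load w) y (p, True, i)) t = y t $ (p, True, i) - y (nd j) $ (p, True, i)"
        using yeq[OF t] by (simp add: y_init)
    next
      fix p \<zeta>
      show "field (load w) y (p, True, 1) \<zeta> = (\<Sum>p'\<in>UNIV. \<theta> p p' * (of_real (1 / coef 2 \<zeta>) * y \<zeta> $ (p', False, 2))) - w p \<zeta> $ 2"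
        unfolding field_def sum_index by (simp add: flow_def load_def mult.assoc)
      show "field (load w) y (p, True, 2) \<zeta> = w p \<zeta> $ 1 - (\<Sum>p'\<in>UNIV. \<theta> p p' * (of_real (1 / coef 1 \<zeta>) * y \<zeta> $ (p', False, 1)))"
        unfolding field_def sum_index by (simp add: flow_def load_def mult.assoc sum_negf)
    next
      fix p Q i t
      assume Q: "\<forall>p ord i. norm (c p ord i) \<le> Q" "\<forall>p i. (LINT \<zeta>|ioo 0 (len b). norm (w p \<zeta> $ i)) \<le> Q"
        and t: "t \<in> {nd j..nd (Suc j)}"
      have Q0: "0 \<le> Q" using Q(1) norm_ge_zero order_trans by blast
      have wseg: "(LINT s|seg j. norm (w p s $ i)) \<le> Q" for p i
      proof -
        have "(LINT s|seg j. norm (w p s $ i)) = (LINT s|ioo 0 (len b). indicator {nd j<..<nd (Suc j)} s *\<^sub>R norm (w p s $ i))"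
          using seg_bounds[OF j] by (intro subinterval_ioo(2)) auto
        also have "\<dots> \<le> (LINT s|ioo 0 (len b). norm (w p s $ i))"
          using L2_integrable[OF wL]
          by (intro integral_mono integrable_scaleR_bounded[of _ _ _ _ 1]) (auto simp: abs_indicator indicator_le_1 intro!: mult_left_le_one_le)
        finally show ?thesis using Q(2) order_trans by blast
      qed
      have r: "(LINT s|seg j. norm (load w k s)) \<le> Q" for k
      proof (cases k)
        case (fields p ord i)
        show ?thesis using wseg[of p 1] wseg[of p 2] Q0 unfolding fields load_def by (cases ord; cases "i = 1") simp_all
      qed
      have "(\<Sum>k\<in>UNIV. norm (y t $ k)) \<le> K * ((\<Sum>k\<in>UNIV. norm (y0 $ k)) + (\<Sum>k\<in>UNIV. LINT s|seg j. norm (load w k s)))"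
        using L2_integrable[OF rL] by (intro K(2) y t) auto
      also have "\<dots> \<le> K * ((\<Sum>k\<in>(UNIV :: (bool \<times> bool \<times> 2) set). Q) + (\<Sum>k\<in>(UNIV :: (bool \<times> bool \<times> 2) set). Q))"
        using Q(1) r K(1) by (intro mult_left_mono add_mono sum_mono) (auto simp: y0_def split: prod.split)
      also have "\<dots> = K * 16 * Q" by (simp add: card_cartesian_product flip: UNIV_Times_UNIV)
      finally have s: "(\<Sum>k\<in>UNIV. norm (y t $ k)) \<le> K * 16 * Q" .
      show "norm (y t $ (p, False, i)) \<le> K * 16 * Q" "norm (y t $ (p, True, i)) \<le> K * 16 * Q"
        using s member_le_sum[of _ UNIV "\<lambda>k. norm (y t $ k)"] by (meson UNIV_I finite norm_ge_zero order_trans)+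
    qed
  qed
qed

text \<open>The index \<^typ>\<open>bool\<close> distinguishes the components of a pair of states and \<open>\<theta>\<close> mixes them. Scalar
  matrices \<open>\<theta>\<close> give the resolvent problem for \<open>\<bbbK> = \<complex>\<close>, rotation matrices that of the complexification.\<close>

definition eqn :: "(bool \<Rightarrow> bool \<Rightarrow> 'k) \<Rightarrow> (bool \<Rightarrow> real \<Rightarrow> 'k ^ 2) \<Rightarrow> (bool \<Rightarrow> real \<Rightarrow> 'k ^ 2) \<Rightarrow> bool" where
  "eqn \<theta> x w \<longleftrightarrow> (\<forall>p. AE \<zeta> in ioo 0 (len b). (\<Sum>p'\<in>UNIV. \<theta> p p' *s x p' \<zeta>) - op_max b (x p) \<zeta> = w p \<zeta>)"

lemma bounded_rep_mono: "bounded_rep x Q \<Longrightarrow> Q \<le> Q' \<Longrightarrow> bounded_rep x Q'"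
  unfolding bounded_rep_def by (meson order_trans)

text \<open>The segments are solved independently, with free values of \<open>f\<close> and
  \<open>f'\<close> at the left end of each; junction conditions are left to the linear system
  further below.\<close>

lemma solve_initial_value:
  fixes \<theta> :: "bool \<Rightarrow> bool \<Rightarrow> 'k"
  shows "\<exists>K\<ge>0. \<forall>c w. (\<forall>p::bool. w p \<in> X_space b) \<longrightarrow> (\<exists>x. (\<forall>p. x p \<in> dom_max b) \<and> eqn \<theta> x w \<and>
     (\<forall>p. \<forall>j<n. \<forall>i. val_right b 0 (x p) j $ i = c p j False i \<and> val_right b 1 (x p) j $ i = c p j True i) \<and>
     (\<forall>Q. (\<forall>p. \<forall>j<n. \<forall>ord i. norm (c p j ord i) \<le> Q) \<longrightarrow> (\<forall>p i. (LINT \<zeta>|ioo 0 (len b). norm (w p \<zeta> $ i)) \<le> Q) \<longrightarrow>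
       (\<forall>p. bounded_rep (x p) (K * Q))))"
proof -
  have "\<exists>K. j < n \<longrightarrow> K \<ge> 0 \<and> (\<forall>c w. (\<forall>p. w p \<in> X_space b) \<longrightarrow> (\<exists>h0 h1 h2. seg_sol \<theta> j K c w h0 h1 h2))" for j
    using solve_segment[of j \<theta>] by blast
  then obtain K where K: "\<And>j. j < n \<Longrightarrow> K j \<ge> 0 \<and> (\<forall>c w. (\<forall>p. w p \<in> X_space b) \<longrightarrow> (\<exists>h0 h1 h2. seg_sol \<theta> j (K j) c w h0 h1 h2))"
    by metis
  show ?thesis
  proof (intro exI[of _ "\<Sum>j<n. K j"] conjI allI impI)
    show "0 \<le> (\<Sum>j<n. K j)" using K by (intro sum_nonneg) auto
    fix c :: "bool \<Rightarrow> nat \<Rightarrow> bool \<Rightarrow> 2 \<Rightarrow> 'k" and w :: "bool \<Rightarrow> real \<Rightarrow> 'k ^ 2" assume w: "\<forall>p. w p \<in> X_space b"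
    have "\<exists>h0 h1 h2. j < n \<longrightarrow> seg_sol \<theta> j (K j) (\<lambda>p. c p j) w h0 h1 h2" for j
      using K[of j] w by blast
    then obtain h0 h1 h2 where H: "\<And>j. j < n \<Longrightarrow> seg_sol \<theta> j (K j) (\<lambda>p. c p j) w (h0 j) (h1 j) (h2 j)"
      by metis
    have Hp: "prim (nd j) (h1 j p i) t = h0 j p i t - h0 j p i (nd j)" "prim (nd j) (h2 j p i) t = h1 j p i t - h1 j p i (nd j)"
      if "j < n" "t \<in> {nd j..nd (Suc j)}" for j p i t
      using H[OF that(1)] that(2) unfolding seg_sol_def by blast+
    have HL: "L2_on (nd j) (nd (Suc j)) (h2 j p i)" "h0 j p i (nd j) = c p j False i" "h1 j p i (nd j) = c p j True i"
      if "j < n" for j p i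
      using H[OF that(1)] unfolding seg_sol_def by blast+
    \<comment> \<open>The solutions on the segments are glued with indicators and divided by
      \<open>coef\<close>, which turns co-energy back into the state. At the nodes the value is
      0.\<close>
    define x where "x p \<zeta> = (\<chi> i. \<Sum>j<n. indicator {nd j<..<nd (Suc j)} \<zeta> *\<^sub>R ((1 / coef i \<zeta>) *\<^sub>R h0 j p i \<zeta>))" for p \<zeta>
    have xseg: "x p \<zeta> $ i = (1 / coef i \<zeta>) *\<^sub>R h0 j p i \<zeta>" if "j < n" "\<zeta> \<in> {nd j<..<nd (Suc j)}" for j \<zeta> p i
      using seg_sum[OF that, of "\<lambda>j. (1 / coef i \<zeta>) *\<^sub>R h0 j p i \<zeta>"] by (simp only: x_def vec_lambda_beta)
    have rep: "seg_rep (x p) j i (h0 j p i) (h1 j p i) (h2 j p i)" if j: "j < n" for j p i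
      unfolding seg_rep_def
    proof (rule rep2I)
      fix \<zeta> assume \<zeta>: "\<zeta> \<in> {nd j<..<nd (Suc j)}"
      then show "co_energy b (x p) \<zeta> $ i = h0 j p i \<zeta>"
        using coef_pos[OF seg_in[OF j \<zeta>], of i] by (simp add: co_energy_coef xseg[OF j])
    qed (use HL[OF j] Hp[OF j] in blast)+
    have xd: "x p \<in> dom_max b" for p using rep by (intro X_space_segI) blast
    show "\<exists>x. (\<forall>p. x p \<in> dom_max b) \<and> eqn \<theta> x w \<and>
     (\<forall>p. \<forall>j<n. \<forall>i. val_right b 0 (x p) j $ i = c p j False i \<and> val_right b 1 (x p) j $ i = c p j True i) \<and>
     (\<forall>Q. (\<forall>p. \<forall>j<n. \<forall>ord i. norm (c p j ord i) \<le> Q) \<longrightarrow> (\<forall>p i. (LINT \<zeta>|ioo 0 (len b). norm (w p \<zeta> $ i)) \<le> Q) \<longrightarrow>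
       (\<forall>p. bounded_rep (x p) ((\<Sum>j<n. K j) * Q)))"
    proof (intro exI[of _ x] conjI allI impI xd)
      show "eqn \<theta> x w" unfolding eqn_def
      proof (intro allI AE_segs)
        fix p j assume j: "j < n"
        show "AE \<zeta> in seg j. (\<Sum>p'\<in>UNIV. \<theta> p p' *s x p' \<zeta>) - op_max b (x p) \<zeta> = w p \<zeta>"
          using op_max_AE[OF j rep[OF j, of p 1] rep[OF j, of p 2]]
        proof (rule lebesgue_on_mono)
          fix \<zeta> assume o: "op_max b (x p) \<zeta> = vector [- h2 j p 2 \<zeta>, h2 j p 1 \<zeta>]" and \<zeta>: "\<zeta> \<in> {nd j<..<nd (Suc j)}"
          have "h2 j p 1 \<zeta> = (\<Sum>p'\<in>UNIV. \<theta> p p' * (of_real (1 / coef 2 \<zeta>) * h0 j p' 2 \<zeta>)) - w p \<zeta> $ 2"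
            "h2 j p 2 \<zeta> = w p \<zeta> $ 1 - (\<Sum>p'\<in>UNIV. \<theta> p p' * (of_real (1 / coef 1 \<zeta>) * h0 j p' 1 \<zeta>))"
            using H[OF j] \<zeta> unfolding seg_sol_def by blast+
          then show "(\<Sum>p'\<in>UNIV. \<theta> p p' *s x p' \<zeta>) - op_max b (x p) \<zeta> = w p \<zeta>"
            by (simp add: o vec_eq_iff forall_2 xseg[OF j \<zeta>] scaleR_conv_of_real)
        qed
      qed
    next
      fix p j i assume j: "j < n"
      show "val_right b 0 (x p) j $ i = c p j False i" "val_right b 1 (x p) j $ i = c p j True i"
        using seg_rep_vals(1,2)[OF j rep[OF j]] HL[OF j] by (simp_all del: One_nat_def)
    next
      fix Q p assume Q: "\<forall>p. \<forall>j<n. \<forall>ord i. norm (c p j ord i) \<le> Q" "\<forall>p i. (LINT \<zeta>|ioo 0 (len b). norm (w p \<zeta> $ i)) \<le> Q"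
      have Q0: "0 \<le> Q" using Q(1) n1 norm_ge_zero[of "c p 0 False 1"] by (metis less_le_trans order_trans zero_less_one)
      show "bounded_rep (x p) ((\<Sum>j<n. K j) * Q)" unfolding bounded_rep_def
      proof (intro allI impI)
        fix j i assume j: "j < n"
        have le: "K j * Q \<le> (\<Sum>j<n. K j) * Q"
          using K j Q0 by (intro mult_right_mono member_le_sum) auto
        have bd: "\<forall>t\<in>{nd j..nd (Suc j)}. norm (h0 j p i t) \<le> K j * Q \<and> norm (h1 j p i t) \<le> K j * Q"
        proof -
          have "\<forall>p ord i. norm (c p j ord i) \<le> Q" using Q(1) j by blast
          then show ?thesis using H[OF j] Q(2) unfolding seg_sol_def by blast
        qed
        show "\<exists>h0 h1 h2. seg_rep (x p) j i h0 h1 h2 \<and> (\<forall>t\<in>{nd j..nd (Suc j)}. norm (h0 t) \<le> (\<Sum>j<n. K j) * Q \<and> norm (h1 t) \<le> (\<Sum>j<n. K j) * Q)"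
          using rep[OF j, of p i] bd le order_trans by blast
      qed
    qed
  qed
qed

lemma zero_dom_max: "0 \<in> dom_max b"
proof -
  have "L2_on 0 (len b) (\<lambda>_. 0 :: 'k)" by (rule L2_bounded[of _ _ _ 0]) auto
  then have "(0 :: real \<Rightarrow> 'k ^ 2) \<in> X_space b" by (simp add: X_space_coord)
  then obtain x where "\<forall>p::bool. x p \<in> dom_max b"
    using solve_initial_value[of "\<lambda>_ _. 0"] by meson
  \<comment> \<open>The solver guarantees some element of the domain, and its difference with itself
    is the zero function.\<close>
  then have "lc (- 1) (x True) (x True) \<in> dom_max b" by (intro dom_max_lc) auto
  moreover have "lc (- 1) (x True) (x True) = 0" by (auto simp: fun_eq_iff vec_eq_iff)
  ultimately show ?thesis by simp
qed

text \<open>Traces only depend on the class modulo null sets: constant zero representatives serve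
  for any function that vanishes almost everywhere.\<close>

lemma AE_zero_vals:
  assumes x: "x \<in> dom_max b" and "AE \<zeta> in ioo 0 (len b). x \<zeta> = 0" and j: "j < n"
  shows "val_right b 0 x j = 0" "val_right b 1 x j = 0" "val_left b 0 x (Suc j) = 0" "val_left b 1 x (Suc j) = 0"
proof -
  have "seg_rep x j i (\<lambda>_. 0) (\<lambda>_. 0) (\<lambda>_. 0)" for i
    unfolding seg_rep_def rep2_def
  proof (intro conjI)
    show "L2_on (nd j) (nd (Suc j)) (\<lambda>\<zeta>. co_energy b x \<zeta> $ i)"
      using x j unfolding dom_max_iff seg_rep_def rep2_def by blast
    show "L2_on (nd j) (nd (Suc j)) (\<lambda>_. 0 :: 'k)" by (rule L2_bounded[of _ _ _ 0]) auto
    show "AE \<zeta> in seg j. co_energy b x \<zeta> $ i = 0"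
      using AE_seg[OF assms(2) j] by eventually_elim (simp add: co_energy_coef)
  qed (simp_all add: prim_def)
  from seg_rep_vals(1-4)[OF j this] show "val_right b 0 x j = 0" "val_right b 1 x j = 0"
    "val_left b 0 x (Suc j) = 0" "val_left b 1 x (Suc j) = 0"
    by (auto simp: vec_eq_iff)
qed

lemma eqn_lc:
  assumes x: "\<And>p. x p \<in> dom_max b" and y: "\<And>p. y p \<in> dom_max b" and "eqn \<theta> x v" "eqn \<theta> y w"
  shows "eqn \<theta> (\<lambda>p. lc c (x p) (y p)) (\<lambda>p. lc c (v p) (w p))"
  unfolding eqn_def
proof
  fix p
  have "AE \<zeta> in ioo 0 (len b). (\<Sum>p'\<in>UNIV. \<theta> p p' *s x p' \<zeta>) - op_max b (x p) \<zeta> = v p \<zeta>"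
    "AE \<zeta> in ioo 0 (len b). (\<Sum>p'\<in>UNIV. \<theta> p p' *s y p' \<zeta>) - op_max b (y p) \<zeta> = w p \<zeta>"
    using assms(3,4) by (auto simp: eqn_def)
  with op_max_lc[OF x[of p] y[of p], of c]
  show "AE \<zeta> in ioo 0 (len b). (\<Sum>p'\<in>UNIV. \<theta> p p' *s lc c (x p') (y p') \<zeta>) - op_max b (lc c (x p) (y p)) \<zeta> = lc c (v p) (w p) \<zeta>"
  proof eventually_elim
    case (elim \<zeta>)
    have "(\<Sum>p'\<in>UNIV. \<theta> p p' *s lc c (x p') (y p') \<zeta>) = c *s (\<Sum>p'\<in>UNIV. \<theta> p p' *s x p' \<zeta>) + (\<Sum>p'\<in>UNIV. \<theta> p p' *s y p' \<zeta>)"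
      by (simp add: vec_eq_iff sum_distrib_left sum.distrib algebra_simps)
    then have "(\<Sum>p'\<in>UNIV. \<theta> p p' *s lc c (x p') (y p') \<zeta>) - op_max b (lc c (x p) (y p)) \<zeta> =
      c *s ((\<Sum>p'\<in>UNIV. \<theta> p p' *s x p' \<zeta>) - op_max b (x p) \<zeta>) + ((\<Sum>p'\<in>UNIV. \<theta> p p' *s y p' \<zeta>) - op_max b (y p) \<zeta>)"
      unfolding elim(1) by (simp add: vec_eq_iff algebra_simps)
    then show ?case unfolding elim(2,3) by (simp add: lc_def)
  qed
qed

lemma eqn_zero: "eqn \<theta> (\<lambda>_. 0) (\<lambda>_. 0)"
proof -
  have "lc (- 1) 0 0 = (0 :: real \<Rightarrow> 'k ^ 2)" by (auto simp: fun_eq_iff vec_eq_iff)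
  then have "AE \<zeta> in ioo 0 (len b). op_max b 0 \<zeta> = 0"
    using op_max_lc[OF zero_dom_max zero_dom_max, of "- 1"] by simp
  then show ?thesis by (simp add: eqn_def)
qed

end

section \<open>The Fredholm alternative for the closed loop\<close>

text \<open>The inhomogeneous term \<open>y\<close> is carried through the induction, as the
  combinations used are a particular solution plus multiples of homogeneous ones.\<close>

lemma sum_closed:
  fixes sc :: "'k \<Rightarrow> 'v::ab_group_add \<Rightarrow> 'v"
  assumes closed: "\<And>c u v. P u \<Longrightarrow> P v \<Longrightarrow> P (sc c u + v)" and "finite I" "\<And>i. i \<in> I \<Longrightarrow> P (e i)" "P y"
  shows "P ((\<Sum>i\<in>I. sc (c i) (e i)) + y)"
  using assms(2,3)
proof (induction I rule: finite_induct)
  case (insert i I)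
  then have "P (sc (c i) (e i) + ((\<Sum>i\<in>I. sc (c i) (e i)) + y))" by (intro closed) auto
  then show ?case using insert by (simp add: add.assoc)
qed (use assms(4) in simp)

lemma sum_linear:
  fixes sc :: "'k::comm_ring_1 \<Rightarrow> 'v::ab_group_add \<Rightarrow> 'v"
  assumes closed: "\<And>c u v. P u \<Longrightarrow> P v \<Longrightarrow> P (sc c u + v)" and "finite I" "\<And>i. i \<in> I \<Longrightarrow> P (e i)" "P y"
    and lin: "\<And>c u v. P u \<Longrightarrow> P v \<Longrightarrow> F (sc c u + v) = c * F u + F v"
  shows "F ((\<Sum>i\<in>I. sc (c i) (e i)) + y) = (\<Sum>i\<in>I. c i * F (e i)) + F y"
  using assms(2,3)
proof (induction I rule: finite_induct)
  case (insert i I)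
  have "P ((\<Sum>i\<in>I. sc (c i) (e i)) + y)" using insert by (intro sum_closed[where P = P and sc = sc] closed assms(4)) auto
  then have "F (sc (c i) (e i) + ((\<Sum>i\<in>I. sc (c i) (e i)) + y)) = c i * F (e i) + F ((\<Sum>i\<in>I. sc (c i) (e i)) + y)"
    using insert by (intro lin) auto
  then show ?case using insert by (simp add: add.assoc)
qed simp

lemma linear_functional_2_bound:
  fixes l :: "'k::real_or_complex ^ 2 \<Rightarrow> 'k"
  assumes "\<And>c u v. l (c *s u + v) = c * l u + l v"
  shows "\<exists>C\<ge>0. \<forall>u. norm (l u) \<le> C * (norm (u $ 1) + norm (u $ 2))"
proof -
  have l0: "l 0 = 0" using assms[of "-1" 0 0] by simp
  have u: "u = u $ 1 *s axis 1 1 + (u $ 2 *s axis 2 1 + 0)" for u :: "'k ^ 2"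
    by (simp add: vec_eq_iff forall_2 axis_def)
  have lu: "l u = u $ 1 * l (axis 1 1) + u $ 2 * l (axis 2 1)" for u
    by (subst u) (simp only: assms l0, simp)
  show ?thesis
  proof (intro exI[of _ "norm (l (axis 1 1)) + norm (l (axis 2 1))"] conjI allI)
    fix u
    have "norm (l u) \<le> norm (u $ 1) * norm (l (axis 1 1)) + norm (u $ 2) * norm (l (axis 2 1))"
      unfolding lu[of u] by (rule norm_triangle_le) (simp add: norm_mult)
    also have "\<dots> \<le> (norm (l (axis 1 1)) + norm (l (axis 2 1))) * (norm (u $ 1) + norm (u $ 2))"
      by (simp add: algebra_simps)
    finally show "norm (l u) \<le> (norm (l (axis 1 1)) + norm (l (axis 2 1))) * (norm (u $ 1) + norm (u $ 2))" .
  qed simp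
qed

text \<open>The orthonormal bases \<open>Bs\<close> turn controller states into finitely many
  scalars, so that the whole problem becomes a scalar linear system.\<close>

locale loop_ctx = beam_ctx b m0 m1 coef
  for b :: "'k::real_or_complex beam" and m0 m1 coef +
  fixes \<Sigma> :: "nat \<Rightarrow> ('k, 'c::ab_group_add) controller" and Bs :: "nat \<Rightarrow> 'c set"
  assumes ctrl: "j \<le> n_seg b \<Longrightarrow> is_controller (\<Sigma> j)"
    and Bs_fin: "j \<le> n_seg b \<Longrightarrow> finite (Bs j)"
    and Bs_sub: "j \<le> n_seg b \<Longrightarrow> \<beta> \<in> Bs j \<Longrightarrow> \<beta> \<in> cspace (\<Sigma> j)"
    and Bs_orth: "j \<le> n_seg b \<Longrightarrow> \<beta> \<in> Bs j \<Longrightarrow> \<gamma> \<in> Bs j \<Longrightarrow> cip (\<Sigma> j) \<beta> \<gamma> = (if \<beta> = \<gamma> then 1 else 0)"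
    and Bs_expand: "j \<le> n_seg b \<Longrightarrow> v \<in> cspace (\<Sigma> j) \<Longrightarrow> (\<Sum>\<beta>\<in>Bs j. cscale (\<Sigma> j) (cip (\<Sigma> j) v \<beta>) \<beta>) = v"
begin

abbreviation "cs j \<equiv> cspace (\<Sigma> j)"
abbreviation "csc j \<equiv> cscale (\<Sigma> j)"

lemma ctrl_vs: "j \<le> n \<Longrightarrow> vector_space (csc j)"
  using ctrl by (simp add: is_controller_def)

lemma cs_subspace: "j \<le> n \<Longrightarrow> module.subspace (csc j) (cs j)"
proof -
  assume j: "j \<le> n"
  interpret vector_space "csc j" by (rule ctrl_vs[OF j])
  obtain S where "span S = cs j" using ctrl[OF j] by (auto simp: is_controller_def)
  then show ?thesis using subspace_span[of S] by simp
qed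

lemma cs_lin: assumes "j \<le> n" "x \<in> cs j" "y \<in> cs j" shows "csc j c x + y \<in> cs j"
proof -
  interpret vector_space "csc j" by (rule ctrl_vs[OF assms(1)])
  show ?thesis using cs_subspace[OF assms(1)] assms by (intro subspace_add subspace_scale)
qed

lemma cs_zero: assumes "j \<le> n" shows "0 \<in> cs j"
proof -
  interpret vector_space "csc j" by (rule ctrl_vs[OF assms(1)])
  show ?thesis using cs_subspace[OF assms(1)] by (intro subspace_0)
qed

lemma cs_scale: assumes "j \<le> n" "x \<in> cs j" shows "csc j c x \<in> cs j"
  using cs_lin[OF assms cs_zero[OF assms(1)], of c] by simp

lemma cs_add: assumes "j \<le> n" "x \<in> cs j" "y \<in> cs j" shows "x + y \<in> cs j"
proof -
  interpret vector_space "csc j" by (rule ctrl_vs[OF assms(1)])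
  show ?thesis using cs_subspace[OF assms(1)] assms by (intro subspace_add)
qed

lemma cs_diff: assumes "j \<le> n" "x \<in> cs j" "y \<in> cs j" shows "x - y \<in> cs j"
proof -
  interpret vector_space "csc j" by (rule ctrl_vs[OF assms(1)])
  show ?thesis using cs_subspace[OF assms(1)] assms by (intro subspace_diff)
qed

lemma ctrl_maps:
  assumes j: "j \<le> n"
  shows "x \<in> cs j \<Longrightarrow> cA (\<Sigma> j) x \<in> cs j"
    and "x \<in> cs j \<Longrightarrow> y \<in> cs j \<Longrightarrow> cA (\<Sigma> j) (csc j c x + y) = csc j c (cA (\<Sigma> j) x) + cA (\<Sigma> j) y"
    and "cB (\<Sigma> j) u \<in> cs j"
    and "cB (\<Sigma> j) (c *s u + v) = csc j c (cB (\<Sigma> j) u) + cB (\<Sigma> j) v"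
    and "x \<in> cs j \<Longrightarrow> y \<in> cs j \<Longrightarrow> cC (\<Sigma> j) (csc j c x + y) = c *s cC (\<Sigma> j) x + cC (\<Sigma> j) y"
    and "cD (\<Sigma> j) (c *s u + v) = c *s cD (\<Sigma> j) u + cD (\<Sigma> j) v"
  using ctrl[OF j] cs_scale[OF j, of _ c] unfolding is_controller_def linear_map_on_def by auto

lemma cip_lin: "j \<le> n \<Longrightarrow> x \<in> cs j \<Longrightarrow> y \<in> cs j \<Longrightarrow> z \<in> cs j \<Longrightarrow> cip (\<Sigma> j) (csc j c x + y) z = c * cip (\<Sigma> j) x z + cip (\<Sigma> j) y z"
  using ctrl[of j] cs_scale[of j x c] unfolding is_controller_def inner_product_on_def by simp

lemma cs_eq_0I: assumes "j \<le> n" "v \<in> cs j" "\<And>\<beta>. \<beta> \<in> Bs j \<Longrightarrow> cip (\<Sigma> j) v \<beta> = 0" shows "v = 0"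
proof -
  interpret vector_space "csc j" by (rule ctrl_vs[OF assms(1)])
  show ?thesis using Bs_expand[OF assms(1,2)] assms(3) by simp
qed

section \<open>Pairs of states and their residuals\<close>

type_synonym ('a, 'b) pair_state = "(bool \<Rightarrow> real \<Rightarrow> 'a ^ 2) \<times> (bool \<Rightarrow> nat \<Rightarrow> 'b)"

text \<open>For \<open>j > n\<close> nothing is known about \<open>csc j\<close>, so these
  components are set to 0.\<close>

definition ssc :: "'k \<Rightarrow> ('k, 'c) pair_state \<Rightarrow> ('k, 'c) pair_state" where
  "ssc c u = (\<lambda>p \<zeta>. c *s fst u p \<zeta>, \<lambda>p j. if j \<le> n then csc j c (snd u p j) else 0)"

lemma fst_ssc: "fst (ssc c u + v) p = lc c (fst u p) (fst v p)"
  by (simp add: ssc_def lc_def fun_eq_iff)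

lemma snd_ssc: "j \<le> n \<Longrightarrow> snd (ssc c u + v) p j = csc j c (snd u p j) + snd v p j"
  by (simp add: ssc_def)

definition st :: "('k, 'c) pair_state \<Rightarrow> bool" where
  "st u \<longleftrightarrow> (\<forall>p. fst u p \<in> dom_max b) \<and> (\<forall>p. \<forall>j\<le>n. snd u p j \<in> cs j)"

lemma st_lin: "st u \<Longrightarrow> st v \<Longrightarrow> st (ssc c u + v)"
  by (auto simp: st_def fst_ssc snd_ssc simp del: fst_add snd_add intro: dom_max_lc cs_lin)

lemma st_zero: "st 0"
  by (simp add: st_def zero_dom_max cs_zero)

definition cres :: "(bool \<Rightarrow> bool \<Rightarrow> 'k) \<Rightarrow> ('k, 'c) pair_state \<Rightarrow> bool \<Rightarrow> nat \<Rightarrow> 'c" where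
  "cres \<theta> u p j = csc j (\<theta> p True) (snd u True j) + csc j (\<theta> p False) (snd u False j)
     - (cB (\<Sigma> j) (map_C b (fst u p) j) + cA (\<Sigma> j) (snd u p j))"

definition bres :: "('k, 'c) pair_state \<Rightarrow> bool \<Rightarrow> nat \<Rightarrow> 'k ^ 2" where
  "bres u p j = map_B b (fst u p) j + (cC (\<Sigma> j) (snd u p j) + cD (\<Sigma> j) (map_C b (fst u p) j))"

type_synonym 'b idx = "(bool \<times> nat \<times> bool \<times> 2) + (bool \<times> nat \<times> 'b)"

text \<open>The scalar residuals by which the membership of a solution in the domain and the
  controller part of the resolvent equation are tested. The beam part is absent because the
  solutions on the segments satisfy it by construction.\<close>

definition res :: "(bool \<Rightarrow> bool \<Rightarrow> 'k) \<Rightarrow> 'c idx \<Rightarrow> ('k, 'c) pair_state \<Rightarrow> 'k" where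
  "res \<theta> l u = (case l of
     Inl (p, j, s, i) \<Rightarrow> (if s then bres u p j $ i else junction_B0 b (fst u p) j $ i)
   | Inr (p, j, \<beta>) \<Rightarrow> cip (\<Sigma> j) (cres \<theta> u p j) \<beta>)"

text \<open>The unknowns are the values of \<open>f\<close> and \<open>f'\<close> at the left end of each segment and the coordinates of the
  controller states. There are no more boundary, junction and controller equations than unknowns, so that
  uniqueness of solutions implies existence.\<close>

definition unknowns :: "'c idx set" where
  "unknowns = Inl ` (UNIV \<times> {..<n} \<times> UNIV \<times> UNIV) \<union> Inr ` (UNIV \<times> Sigma {..n} Bs)"

definition equations :: "'c idx set" where
  "equations = Inl ` (UNIV \<times> {..n} \<times> {True} \<times> UNIV \<union> UNIV \<times> {1..<n} \<times> {False} \<times> UNIV) \<union> Inr ` (UNIV \<times> Sigma {..n} Bs)"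

lemma finite_idx: "finite unknowns" "finite equations"
  unfolding unknowns_def equations_def
  by (intro finite_UnI finite_imageI finite_cartesian_product finite_SigmaI; auto intro: Bs_fin)+

text \<open>Per component of the pair: two boundary or feedback conditions at each of the
  \<open>n + 1\<close> nodes and two continuity conditions at each of the \<open>n - 1\<close>
  interior ones make \<open>4 n\<close>, the number of values of \<open>f\<close> and
  \<open>f'\<close> at the left ends. The controller coordinates match one to one.\<close>

lemma card_idx: "card equations \<le> card unknowns"
proof -
  let ?S = "(UNIV :: bool set) \<times> Sigma {..n} Bs"
  have fS: "finite ?S" by (intro finite_cartesian_product finite_SigmaI) (auto intro: Bs_fin)
  have U: "card unknowns = 2 * (n * 4) + card ?S"
    unfolding unknowns_def using fS
    by (subst card_Un_disjoint) (auto simp: card_image card_cartesian_product)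
  have "card equations \<le> card (Inl ` ((UNIV :: bool set) \<times> {..n} \<times> {True} \<times> (UNIV :: 2 set)) :: 'c idx set) +
      card (Inl ` ((UNIV :: bool set) \<times> {1..<n} \<times> {False} \<times> (UNIV :: 2 set)) :: 'c idx set) + card (Inr ` ?S :: 'c idx set)"
    unfolding equations_def image_Un by (intro order_trans[OF card_Un_le] add_mono card_Un_le order_refl)
  also have "\<dots> = 2 * (Suc n * 2) + 2 * ((n - 1) * 2) + card ?S"
    by (simp add: card_image card_cartesian_product)
  also have "\<dots> = 2 * (n * 4) + card ?S" using n1 by simp
  finally show ?thesis using U by simp
qed

lemma map_lc:
  assumes "x \<in> dom_max b" "y \<in> dom_max b"
  shows "j \<le> n \<Longrightarrow> map_B b (lc c x y) j = c *s map_B b x j + map_B b y j"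
    and "j \<le> n \<Longrightarrow> map_C b (lc c x y) j = c *s map_C b x j + map_C b y j"
    and "1 \<le> j \<Longrightarrow> j < n \<Longrightarrow> junction_B0 b (lc c x y) j = c *s junction_B0 b x j + junction_B0 b y j"
  using assms bfun_maps[of j] bfun_junction(1)[of j] unfolding bfun_def by (auto simp: vec_eq_iff)

lemma cres_in: assumes "st u" "j \<le> n" shows "cres \<theta> u p j \<in> cs j"
  using assms unfolding cres_def st_def
  by (intro cs_diff cs_add cs_scale ctrl_maps) auto

lemma cres_lin:
  assumes u: "st u" and v: "st v" and j: "j \<le> n"
  shows "cres \<theta> (ssc c u + v) p j = csc j c (cres \<theta> u p j) + cres \<theta> v p j"
proof -
  interpret vector_space "csc j" by (rule ctrl_vs[OF j])
  have uv: "\<And>p. fst u p \<in> dom_max b" "\<And>p. fst v p \<in> dom_max b" "\<And>p. snd u p j \<in> cs j" "\<And>p. snd v p j \<in> cs j"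
    using u v j by (auto simp: st_def)
  show ?thesis
    unfolding cres_def fst_ssc snd_ssc[OF j] map_lc(2)[OF uv(1,2) j] ctrl_maps(4)[OF j] ctrl_maps(2)[OF j uv(3,4)]
    by (simp add: scale_right_distrib scale_right_diff_distrib mult.commute algebra_simps)
qed

lemma bres_lin:
  assumes u: "st u" and v: "st v" and j: "j \<le> n"
  shows "bres (ssc c u + v) p j = c *s bres u p j + bres v p j"
proof -
  have uv: "\<And>p. fst u p \<in> dom_max b" "\<And>p. fst v p \<in> dom_max b" "\<And>p. snd u p j \<in> cs j" "\<And>p. snd v p j \<in> cs j"
    using u v j by (auto simp: st_def)
  show ?thesis
    unfolding bres_def fst_ssc snd_ssc[OF j] map_lc(1,2)[OF uv(1,2) j] ctrl_maps(6)[OF j] ctrl_maps(5)[OF j uv(3,4)]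
    by (simp add: vec_eq_iff algebra_simps)
qed

lemma res_lin:
  assumes l: "l \<in> equations" and u: "st u" and v: "st v"
  shows "res \<theta> l (ssc c u + v) = c * res \<theta> l u + res \<theta> l v"
proof -
  have uv: "\<And>p. fst u p \<in> dom_max b" "\<And>p. fst v p \<in> dom_max b" using u v by (auto simp: st_def)
  from l consider p j i where "l = Inl (p, j, True, i)" "j \<le> n" | p j i where "l = Inl (p, j, False, i)" "1 \<le> j" "j < n"
    | p j \<beta> where "l = Inr (p, j, \<beta>)" "j \<le> n" "\<beta> \<in> Bs j"
    unfolding equations_def by auto
  then show ?thesis
  proof cases
    case 1
    then show ?thesis using bres_lin[OF u v] by (simp add: res_def)
  next
    case 2
    then show ?thesis using map_lc(3)[OF uv] by (simp add: res_def fst_ssc del: fst_add)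
  next
    case 3
    then show ?thesis using cres_lin[OF u v, of j \<theta> c p] cip_lin[of j] cres_in[OF u] cres_in[OF v] Bs_sub by (simp add: res_def)
  qed
qed

text \<open>Stated for zero controller states, since it serves to estimate the residuals of the
  particular solution, which has none.\<close>

lemma res_bounded:
  assumes l: "l \<in> equations"
  shows "\<exists>C\<ge>0. \<forall>x Q. (\<forall>p. x p \<in> dom_max b) \<longrightarrow> (\<forall>p. bounded_rep (x p) Q) \<longrightarrow> norm (res \<theta> l (x, 0)) \<le> C * Q"
proof -
  have bnd: "\<exists>C\<ge>0. \<forall>x\<in>dom_max b. \<forall>Q. bounded_rep x Q \<longrightarrow> norm (F x) \<le> C * Q" if "bfun F" for F
    using that by (simp add: bfun_def)
  have mapC: "\<exists>C\<ge>0. \<forall>x\<in>dom_max b. \<forall>Q. bounded_rep x Q \<longrightarrow> norm (L (map_C b x j)) \<le> C * Q"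
    if L: "\<And>c u v. L (c *s u + v) = c * L u + L v" and j: "j \<le> n" for L :: "'k ^ 2 \<Rightarrow> 'k" and j
  proof -
    obtain C where C: "0 \<le> C" "\<And>u. norm (L u) \<le> C * (norm (u $ 1) + norm (u $ 2))"
      using linear_functional_2_bound[of L] L by blast
    obtain C1 where C1: "0 \<le> C1" "\<And>x Q. x \<in> dom_max b \<Longrightarrow> bounded_rep x Q \<Longrightarrow> norm (map_C b x j $ 1) \<le> C1 * Q"
      using bnd[OF bfun_maps(2)[OF j]] by blast
    obtain C2 where C2: "0 \<le> C2" "\<And>x Q. x \<in> dom_max b \<Longrightarrow> bounded_rep x Q \<Longrightarrow> norm (map_C b x j $ 2) \<le> C2 * Q"
      using bnd[OF bfun_maps(2)[OF j]] by blast
    have "norm (L (map_C b x j)) \<le> (C * (C1 + C2)) * Q" if "x \<in> dom_max b" "bounded_rep x Q" for x Q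
    proof -
      have "norm (L (map_C b x j)) \<le> C * (norm (map_C b x j $ 1) + norm (map_C b x j $ 2))" by (rule C)
      also have "\<dots> \<le> C * (C1 * Q + C2 * Q)" using C1(2)[OF that] C2(2)[OF that] C(1) by (intro mult_left_mono add_mono)
      finally show ?thesis by (simp add: algebra_simps)
    qed
    moreover have "0 \<le> C * (C1 + C2)" using C C1 C2 by simp
    ultimately show ?thesis by blast
  qed
  from l consider p j i where "l = Inl (p, j, True, i)" "j \<le> n" | p j i where "l = Inl (p, j, False, i)" "1 \<le> j" "j < n"
    | p j \<beta> where "l = Inr (p, j, \<beta>)" "j \<le> n" "\<beta> \<in> Bs j"
    unfolding equations_def by auto
  then show ?thesis
  proof cases
    case 1
    have c0: "cC (\<Sigma> j) 0 = 0"
    proof -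
      interpret vector_space "csc j" by (rule ctrl_vs[OF 1(2)])
      show ?thesis using ctrl_maps(5)[OF 1(2) cs_zero[OF 1(2)] cs_zero[OF 1(2)], of "-1"] by simp
    qed
    obtain C where C: "0 \<le> C" "\<And>x Q. x \<in> dom_max b \<Longrightarrow> bounded_rep x Q \<Longrightarrow> norm (cD (\<Sigma> j) (map_C b x j) $ i) \<le> C * Q"
      using mapC[of "\<lambda>u. cD (\<Sigma> j) u $ i" j] ctrl_maps(6)[OF 1(2)] 1(2) by auto
    obtain C' where C': "0 \<le> C'" "\<And>x Q. x \<in> dom_max b \<Longrightarrow> bounded_rep x Q \<Longrightarrow> norm (map_B b x j $ i) \<le> C' * Q"
      using bnd[OF bfun_maps(1)[OF 1(2)]] by blast
    have "norm (res \<theta> l (x, 0)) \<le> (C' + C) * Q" if "\<forall>p. x p \<in> dom_max b" "\<forall>p. bounded_rep (x p) Q" for x Q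
    proof -
      have "norm (res \<theta> l (x, 0)) \<le> norm (map_B b (x p) j $ i) + norm (cD (\<Sigma> j) (map_C b (x p) j) $ i)"
        using 1 by (simp add: res_def bres_def c0 norm_triangle_ineq)
      also have "\<dots> \<le> (C' + C) * Q" using C(2)[of "x p" Q] C'(2)[of "x p" Q] that by (simp add: algebra_simps)
      finally show ?thesis .
    qed
    moreover have "0 \<le> C' + C" using C C' by simp
    ultimately show ?thesis by blast
  next
    case 2
    obtain C where C: "0 \<le> C" "\<And>x Q. x \<in> dom_max b \<Longrightarrow> bounded_rep x Q \<Longrightarrow> norm (junction_B0 b x j $ i) \<le> C * Q"
      using bnd[OF bfun_junction(1)[OF 2(2,3)]] by blast
    then show ?thesis using 2 by (intro exI[of _ C]) (auto simp: res_def)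
  next
    case 3
    interpret vector_space "csc j" by (rule ctrl_vs[OF 3(2)])
    have a0: "cA (\<Sigma> j) 0 = 0"
      using ctrl_maps(2)[OF 3(2) cs_zero[OF 3(2)] cs_zero[OF 3(2)], of "-1"] by simp
    have \<beta>: "\<beta> \<in> cs j" by (rule Bs_sub[OF 3(2,3)])
    obtain C where C: "0 \<le> C" "\<And>x Q. x \<in> dom_max b \<Longrightarrow> bounded_rep x Q \<Longrightarrow> norm (cip (\<Sigma> j) (cB (\<Sigma> j) (map_C b x j)) \<beta>) \<le> C * Q"
      using mapC[of "\<lambda>u. cip (\<Sigma> j) (cB (\<Sigma> j) u) \<beta>" j] ctrl_maps(4)[OF 3(2)] cip_lin[OF 3(2) ctrl_maps(3)[OF 3(2)] ctrl_maps(3)[OF 3(2)] \<beta>] 3(2) by auto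
    have neg: "cip (\<Sigma> j) (- w) \<beta> = - cip (\<Sigma> j) w \<beta>" if "w \<in> cs j" for w
    proof -
      have z: "cip (\<Sigma> j) 0 \<beta> = 0"
        using cip_lin[OF 3(2) cs_zero[OF 3(2)] cs_zero[OF 3(2)] \<beta>, of "-1"] by simp
      show ?thesis using cip_lin[OF 3(2) that cs_zero[OF 3(2)] \<beta>, of "-1"] z by simp
    qed
    have "norm (res \<theta> l (x, 0)) \<le> C * Q" if "\<forall>p. x p \<in> dom_max b" "\<forall>p. bounded_rep (x p) Q" for x Q
      using C(2)[of "x p" Q] that 3 neg[OF ctrl_maps(3)[OF 3(2)]] by (simp add: res_def cres_def a0)
    with C(1) show ?thesis by blast
  qed
qed

definition in_dom :: "('k, 'c) pair_state \<Rightarrow> bool" where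
  "in_dom u \<longleftrightarrow> (\<forall>p. fst u p \<in> dom_open b \<and> (\<forall>j\<le>n. snd u p j \<in> cs j) \<and>
     (\<forall>j\<le>n. map_B b (fst u p) j = - (cC (\<Sigma> j) (snd u p j) + cD (\<Sigma> j) (map_C b (fst u p) j))))"

lemma Inl_in_equations: "Inl (p, j, s, i) \<in> equations \<longleftrightarrow> (if s then j \<le> n else 1 \<le> j \<and> j < n)"
  by (auto simp: equations_def image_iff)

text \<open>\<open>\<theta>\<close> is arbitrary, because boundary and junction residuals do not
  involve it.\<close>

lemma in_dom_iff: "in_dom u \<longleftrightarrow> st u \<and> (\<forall>p s i j. Inl (p, j, s, i) \<in> equations \<longrightarrow> res \<theta> (Inl (p, j, s, i)) u = 0)"
proof -
  have 1: "(\<forall>p s i j. Inl (p, j, s, i) \<in> equations \<longrightarrow> res \<theta> (Inl (p, j, s, i)) u = 0) \<longleftrightarrow>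
    (\<forall>p. (\<forall>j\<le>n. bres u p j = 0) \<and> (\<forall>j\<in>{1..<n}. junction_B0 b (fst u p) j = 0))"
    unfolding Inl_in_equations res_def vec_eq_iff by (simp add: all_bool_eq Ball_def) blast
  have 2: "bres u p j = 0 \<longleftrightarrow> map_B b (fst u p) j = - (cC (\<Sigma> j) (snd u p j) + cD (\<Sigma> j) (map_C b (fst u p) j))" for p j
    unfolding bres_def by (rule eq_neg_iff_add_eq_0[symmetric])
  show ?thesis unfolding 1 2 in_dom_def st_def dom_open_def by blast
qed

text \<open>Superposition: a particular solution with zero left values is corrected by basis
  solutions of the homogeneous beam equation. The coefficients solve the residual system, whose
  matrix is injective because a combination with zero residuals is a homogeneous solution in the
  domain. Explicit coefficients then give the bounds.\<close>

theorem solvable: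
  assumes inj: "\<And>u. in_dom u \<Longrightarrow> eqn \<theta> (fst u) (\<lambda>_. 0) \<Longrightarrow> (\<And>p j. j \<le> n \<Longrightarrow> cres \<theta> u p j = 0) \<Longrightarrow>
    \<forall>p. (AE \<zeta> in ioo 0 (len b). fst u p \<zeta> = 0) \<and> (\<forall>j\<le>n. snd u p j = 0)"
  shows "\<exists>K\<ge>0. \<forall>w wc. (\<forall>p. w p \<in> X_space b) \<longrightarrow> (\<forall>p. \<forall>j\<le>n. wc p j \<in> cs j) \<longrightarrow>
    (\<exists>u. in_dom u \<and> eqn \<theta> (fst u) w \<and> (\<forall>p. \<forall>j\<le>n. cres \<theta> u p j = wc p j) \<and>
      (\<forall>Q. (\<forall>p i. (LINT \<zeta>|ioo 0 (len b). norm (w p \<zeta> $ i)) \<le> Q) \<longrightarrow> (\<forall>p. \<forall>j\<le>n. \<forall>\<beta>\<in>Bs j. norm (cip (\<Sigma> j) (wc p j) \<beta>) \<le> Q) \<longrightarrow>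
        (\<forall>p. bounded_rep (fst u p) (K * Q)) \<and> (\<forall>p. \<forall>j\<le>n. \<forall>\<beta>\<in>Bs j. norm (cip (\<Sigma> j) (snd u p j) \<beta>) \<le> K * Q)))"
proof -
  obtain K0 where K0: "0 \<le> K0" "\<And>c w. (\<forall>p. w p \<in> X_space b) \<Longrightarrow> \<exists>x. (\<forall>p. x p \<in> dom_max b) \<and> eqn \<theta> x w \<and>
     (\<forall>p. \<forall>j<n. \<forall>i. val_right b 0 (x p) j $ i = c p j False i \<and> val_right b 1 (x p) j $ i = c p j True i) \<and>
     (\<forall>Q. (\<forall>p. \<forall>j<n. \<forall>ord i. norm (c p j ord i) \<le> Q) \<longrightarrow> (\<forall>p i. (LINT \<zeta>|ioo 0 (len b). norm (w p \<zeta> $ i)) \<le> Q) \<longrightarrow>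
       (\<forall>p. bounded_rep (x p) (K0 * Q)))"
    using solve_initial_value[of \<theta>] by blast
  have zX: "(0 :: real \<Rightarrow> 'k ^ 2) \<in> X_space b" using zero_dom_max by (simp add: dom_max_def)
  \<comment> \<open>Initial data of the basis solution \<open>ex k\<close>: a single value 1 at the
    left end of one segment.\<close>
  define unit where "unit k p' j' ord' i' = (if k = (p', j', ord', i') then 1 else 0 :: 'k)"
    for k :: "bool \<times> nat \<times> bool \<times> 2" and p' j' ord' i'
  have "\<exists>x. (\<forall>p. x p \<in> dom_max b) \<and> eqn \<theta> x (\<lambda>_. 0) \<and>
     (\<forall>p. \<forall>j<n. \<forall>i. val_right b 0 (x p) j $ i = unit k p j False i \<and> val_right b 1 (x p) j $ i = unit k p j True i) \<and>
     (\<forall>p. bounded_rep (x p) K0)" for k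
  proof -
    obtain x where x: "\<forall>p. x p \<in> dom_max b" "eqn \<theta> x (\<lambda>_. 0)"
     "\<forall>p. \<forall>j<n. \<forall>i. val_right b 0 (x p) j $ i = unit k p j False i \<and> val_right b 1 (x p) j $ i = unit k p j True i"
     "\<forall>Q. (\<forall>p. \<forall>j<n. \<forall>ord i. norm (unit k p j ord i) \<le> Q) \<longrightarrow> (\<forall>p i. (LINT \<zeta>|ioo 0 (len b). norm (((\<lambda>_. 0) :: bool \<Rightarrow> real \<Rightarrow> 'k ^ 2) p \<zeta> $ i)) \<le> Q) \<longrightarrow>
       (\<forall>p. bounded_rep (x p) (K0 * Q))"
      using K0(2)[of "\<lambda>_. 0" "unit k"] zX by blast
    have "bounded_rep (x p) (K0 * 1)" for p
      by (rule x(4)[rule_format]) (auto simp: unit_def)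
    with x(1-3) show ?thesis by auto
  qed
  then obtain ex where ex: "\<And>k p. ex k p \<in> dom_max b" "\<And>k. eqn \<theta> (ex k) (\<lambda>_. 0)"
    "\<And>k p j i. j < n \<Longrightarrow> val_right b 0 (ex k p) j $ i = unit k p j False i \<and> val_right b 1 (ex k p) j $ i = unit k p j True i"
    "\<And>k p. bounded_rep (ex k p) K0" by metis
  \<comment> \<open>One basis state per unknown: a beam solution with one unit left value, or a
    single basis vector of one controller.\<close>
  define e :: "'c idx \<Rightarrow> ('k, 'c) pair_state" where
    "e l = (case l of Inl k \<Rightarrow> (ex k, 0) | Inr (p, j, \<beta>) \<Rightarrow> (0, \<lambda>p' j'. if p' = p \<and> j' = j then \<beta> else 0))" for l
  define P where "P u \<longleftrightarrow> st u \<and> eqn \<theta> (fst u) (\<lambda>_. 0)" for u :: "('k, 'c) pair_state"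
  have lc0: "lc c 0 0 = 0" for c by (simp add: fun_eq_iff vec_eq_iff lc_def)
  have P_lin: "P (ssc c u + v)" if "P u" "P v" for c u v
  proof -
    have "eqn \<theta> (\<lambda>p. lc c (fst u p) (fst v p)) (\<lambda>p. lc c 0 0)"
      using that by (intro eqn_lc) (auto simp: P_def st_def)
    moreover have "(\<lambda>p. lc c (fst u p) (fst v p)) = fst (ssc c u + v)" by (rule ext) (simp only: fst_ssc)
    ultimately show ?thesis using that st_lin[of u v c] unfolding P_def lc0 by (simp del: fst_add)
  qed
  have P_e: "P (e l)" if "l \<in> unknowns" for l
    using that ex(1,2) Bs_sub zero_dom_max eqn_zero cs_zero
    by (auto simp: P_def e_def unknowns_def st_def zero_fun_def)
  have P_0: "P 0" using st_zero eqn_zero by (simp add: P_def zero_fun_def)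
  have st_e: "st (e l)" if "l \<in> unknowns" for l using P_e[OF that] by (simp add: P_def)
  define comb where "comb c y = (\<Sum>l\<in>unknowns. ssc (c l) (e l)) + y" for c y
  have comb_st: "st (comb c y)" if "st y" for c y
    unfolding comb_def using st_e that by (intro sum_closed[where P = st and sc = ssc] st_lin finite_idx)
  have comb_lin: "F (comb c y) = (\<Sum>l\<in>unknowns. c l * F (e l)) + F y"
    if "st y" "\<And>c u v. st u \<Longrightarrow> st v \<Longrightarrow> F (ssc c u + v) = c * F u + F v" for F c y
    unfolding comb_def using st_e that by (intro sum_linear[where P = st and sc = ssc] st_lin finite_idx)
  have coord: "cip (\<Sigma> j) (snd (ssc c u + v) p j) \<beta> = c * cip (\<Sigma> j) (snd u p j) \<beta> + cip (\<Sigma> j) (snd v p j) \<beta>"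
    if "j \<le> n" "\<beta> \<in> Bs j" "st u" "st v" for j \<beta> c u v p
    using that Bs_sub by (simp add: snd_ssc cip_lin st_def del: snd_add)
  have z0: "cip (\<Sigma> j) 0 \<beta> = 0" if "j \<le> n" "\<beta> \<in> Bs j" for j \<beta>
  proof -
    interpret vector_space "csc j" by (rule ctrl_vs[OF that(1)])
    show ?thesis using cip_lin[OF that(1) cs_zero[OF that(1)] cs_zero[OF that(1)] Bs_sub[OF that], of "-1"] by simp
  qed
  have v0: "val_right b 0 0 j $ i = 0" "val_right b 1 0 j $ i = 0" if "j < n" for j i
    using AE_zero_vals(1,2)[OF zero_dom_max _ that] by simp_all
  have "\<exists>H. \<forall>r. \<forall>k\<in>equations. (\<Sum>i\<in>unknowns. (\<Sum>l\<in>equations. H i l * r l) * res \<theta> k (e i)) = r k"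
  proof (rule square_system_inverse[OF finite_idx card_idx])
    fix c assume c: "\<And>k. k \<in> equations \<Longrightarrow> (\<Sum>i\<in>unknowns. c i * res \<theta> k (e i)) = 0"
    define u where "u = comb c 0"
    have stu: "st u" unfolding u_def by (rule comb_st[OF st_zero])
    have "res \<theta> k 0 = 0" if "k \<in> equations" for k
    proof -
      have "ssc (- 1) 0 + 0 = (0 :: ('k, 'c) pair_state)"
      proof -
        have "csc j (- 1) 0 = 0" if "j \<le> n" for j
        proof -
          interpret vector_space "csc j" by (rule ctrl_vs[OF that])
          show ?thesis by simp
        qed
        then show ?thesis by (simp add: ssc_def prod_eq_iff fun_eq_iff vec_eq_iff)
      qed
      then show ?thesis using res_lin[OF that st_zero st_zero, of \<theta> "- 1"] by simp
    qed
    then have r0: "res \<theta> k u = 0" if "k \<in> equations" for k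
      unfolding u_def using comb_lin[OF st_zero, of "res \<theta> k"] res_lin[OF that] c that by simp
    have "in_dom u" unfolding in_dom_iff[of _ \<theta>] using stu r0 by blast
    moreover have "eqn \<theta> (fst u) (\<lambda>_. 0)"
      using sum_closed[of P ssc unknowns e 0, OF P_lin finite_idx(1) P_e P_0] by (simp add: P_def u_def comb_def)
    moreover have "cres \<theta> u p j = 0" if j: "j \<le> n" for p j
    proof (rule cs_eq_0I[OF j cres_in[OF stu j]])
      fix \<beta> assume "\<beta> \<in> Bs j"
      then have "Inr (p, j, \<beta>) \<in> equations" using j by (auto simp: equations_def)
      from r0[OF this] show "cip (\<Sigma> j) (cres \<theta> u p j) \<beta> = 0" by (simp add: res_def)
    qed
    ultimately have zero: "AE \<zeta> in ioo 0 (len b). fst u p \<zeta> = 0" "j \<le> n \<Longrightarrow> snd u p j = 0" for p j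
      using inj by blast+
    \<comment> \<open>The unknowns are the coordinates of \<open>u\<close>: \<open>c l\<close> is
      recovered from \<open>u\<close> as a left value or a controller coordinate, and both vanish on
      null states.\<close>
    show "\<forall>l\<in>unknowns. c l = 0"
    proof
      fix l assume l: "l \<in> unknowns"
      show "c l = 0"
      proof (cases l)
        case (Inl k)
        obtain p j ord i where k: "k = (p, j, ord, i)" by (metis prod_cases4)
        have j: "j < n" using l Inl k by (auto simp: unknowns_def)
        define F where "F u = (if ord then val_right b 1 (fst u p) j $ i else val_right b 0 (fst u p) j $ i)" for u :: "('k, 'c) pair_state"
        have F_lin: "F (ssc c u + v) = c * F u + F v" if "st u" "st v" for c u v
          using bfun_vals(1)[OF j, of 0 i] bfun_vals(1)[OF j, of 1 i] that
          by (simp add: F_def fst_ssc bfun_def st_def del: One_nat_def fst_add)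
        have Fe: "F (e l') = (if l' = l then 1 else 0)" if "l' \<in> unknowns" for l'
        proof (cases l')
          case (Inl k')
          then show ?thesis using ex(3)[OF j, of k' p i] \<open>l = Inl k\<close> k
            by (auto simp: F_def e_def unit_def)
        next
          case (Inr t)
          then show ?thesis using v0[OF j] \<open>l = Inl k\<close> by (auto simp: F_def e_def split: prod.split)
        qed
        have "F u = (\<Sum>l'\<in>unknowns. c l' * F (e l')) + F 0"
          unfolding u_def by (rule comb_lin[OF st_zero F_lin])
        also have "F 0 = 0" using v0[OF j] by (simp add: F_def)
        also have "(\<Sum>l'\<in>unknowns. c l' * F (e l')) = (\<Sum>l'\<in>unknowns. if l' = l then c l else 0)"
          using Fe by (intro sum.cong) auto
        also have "\<dots> = c l" using l finite_idx by simp
        finally have "F u = c l" by simp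
        moreover have "F u = 0" using AE_zero_vals(1,2)[OF _ zero(1) j, of p] stu by (simp add: F_def st_def)
        ultimately show ?thesis by simp
      next
        case (Inr t)
        obtain p j \<beta> where t: "t = (p, j, \<beta>)" by (metis prod_cases3)
        have j: "j \<le> n" "\<beta> \<in> Bs j" using l Inr t by (auto simp: unknowns_def)
        define F where "F u = cip (\<Sigma> j) (snd u p j) \<beta>" for u :: "('k, 'c) pair_state"
        have F_lin: "F (ssc c u + v) = c * F u + F v" if "st u" "st v" for c u v
          unfolding F_def by (rule coord[OF j that])
        have Fe: "F (e l') = (if l' = l then 1 else 0)" if "l' \<in> unknowns" for l'
        proof (cases l')
          case (Inl k')
          then show ?thesis using z0[OF j] \<open>l = Inr t\<close> by (simp add: F_def e_def)
        next
          case (Inr t')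
          obtain p' j' \<beta>' where t': "t' = (p', j', \<beta>')" by (metis prod_cases3)
          have j': "\<beta>' \<in> Bs j'" using that Inr t' by (auto simp: unknowns_def)
          show ?thesis using z0[OF j] Bs_orth[OF j(1) _ j(2), of \<beta>'] j' \<open>l = Inr t\<close> t t' Inr by (auto simp: F_def e_def)
        qed
        have "F u = (\<Sum>l'\<in>unknowns. c l' * F (e l')) + F 0"
          unfolding u_def by (rule comb_lin[OF st_zero F_lin])
        also have "F 0 = 0" using z0[OF j] by (simp add: F_def)
        also have "(\<Sum>l'\<in>unknowns. c l' * F (e l')) = (\<Sum>l'\<in>unknowns. if l' = l then c l else 0)"
          using Fe by (intro sum.cong) auto
        also have "\<dots> = c l" using l finite_idx by simp
        finally have "F u = c l" by simp
        moreover have "F u = 0" using zero(2)[OF j(1), of p] z0[OF j] by (simp add: F_def)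
        ultimately show ?thesis by simp
      qed
    qed
  qed
  then obtain H where H: "\<And>r k. k \<in> equations \<Longrightarrow> (\<Sum>i\<in>unknowns. (\<Sum>l\<in>equations. H i l * r l) * res \<theta> k (e i)) = r k" by blast
  have "\<forall>l\<in>equations. \<exists>C\<ge>0. \<forall>x Q. (\<forall>p. x p \<in> dom_max b) \<longrightarrow> (\<forall>p. bounded_rep (x p) Q) \<longrightarrow> norm (res \<theta> l (x, 0)) \<le> C * Q"
    using res_bounded by blast
  from bchoice[OF this] obtain Cr where Cr: "\<And>l. l \<in> equations \<Longrightarrow> Cr l \<ge> 0"
    "\<And>l x Q. l \<in> equations \<Longrightarrow> (\<forall>p. x p \<in> dom_max b) \<Longrightarrow> (\<forall>p. bounded_rep (x p) Q) \<Longrightarrow> norm (res \<theta> l (x, 0)) \<le> Cr l * Q"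
    by blast
  \<comment> \<open>Bounds every coefficient: data of size \<open>Q\<close> give residuals of size
    \<open>(1 + Cr l * K0) * Q\<close>, to which \<open>H\<close> is applied.\<close>
  define Ch where "Ch = (\<Sum>i\<in>unknowns. \<Sum>l\<in>equations. norm (H i l) * (1 + Cr l * K0))"
  \<comment> \<open>The summands account for the basis solutions, the particular solution and the
    controller coordinates.\<close>
  define K where "K = real (card unknowns) * (Ch * K0) + K0 + real (card unknowns) * Ch"
  have Ch0: "0 \<le> Ch" unfolding Ch_def using Cr(1) K0(1) by (intro sum_nonneg mult_nonneg_nonneg) auto
  have KK: "0 \<le> K" unfolding K_def using Ch0 K0(1) by simp
  have main: "(\<exists>u. in_dom u \<and> eqn \<theta> (fst u) w \<and> (\<forall>p. \<forall>j\<le>n. cres \<theta> u p j = wc p j) \<and>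
      (\<forall>Q. (\<forall>p i. (LINT \<zeta>|ioo 0 (len b). norm (w p \<zeta> $ i)) \<le> Q) \<longrightarrow> (\<forall>p. \<forall>j\<le>n. \<forall>\<beta>\<in>Bs j. norm (cip (\<Sigma> j) (wc p j) \<beta>) \<le> Q) \<longrightarrow>
        (\<forall>p. bounded_rep (fst u p) (K * Q)) \<and> (\<forall>p. \<forall>j\<le>n. \<forall>\<beta>\<in>Bs j. norm (cip (\<Sigma> j) (snd u p j) \<beta>) \<le> K * Q)))"
    if w: "\<forall>p. w p \<in> X_space b" and wc: "\<forall>p. \<forall>j\<le>n. wc p j \<in> cs j" for w wc
  proof -
    obtain xw where xw: "\<forall>p. xw p \<in> dom_max b" "eqn \<theta> xw w"
      "\<forall>Q. (\<forall>p i. (LINT \<zeta>|ioo 0 (len b). norm (w p \<zeta> $ i)) \<le> Q) \<longrightarrow> (\<forall>p. bounded_rep (xw p) (K0 * Q))"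
    proof -
      obtain x where x: "\<forall>p. x p \<in> dom_max b" "eqn \<theta> x w"
       "\<forall>Q. (\<forall>p::bool. \<forall>j<n. \<forall>(ord::bool) (i::2). norm ((\<lambda>_ _ _ _. 0 :: 'k) p j ord i) \<le> Q) \<longrightarrow> (\<forall>p i. (LINT \<zeta>|ioo 0 (len b). norm (w p \<zeta> $ i)) \<le> Q) \<longrightarrow>
         (\<forall>p. bounded_rep (x p) (K0 * Q))"
        using K0(2)[OF w, of "\<lambda>_ _ _ _. 0"] by blast
      have "\<forall>p. bounded_rep (x p) (K0 * Q)" if Q: "\<forall>p i. (LINT \<zeta>|ioo 0 (len b). norm (w p \<zeta> $ i)) \<le> Q" for Q
      proof -
        have "0 \<le> (LINT \<zeta>|ioo 0 (len b). norm (w True \<zeta> $ 1))" by simp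
        also have "\<dots> \<le> Q" using Q by blast
        finally show ?thesis using x(3)[rule_format, of Q] Q by simp
      qed
      with x(1,2) that show ?thesis by blast
    qed
    define y :: "('k, 'c) pair_state" where "y = (xw, 0)"
    have sty: "st y" using xw(1) cs_zero by (simp add: y_def st_def)
    define r where "r l = (case l of Inl k \<Rightarrow> 0 | Inr (p, j, \<beta>) \<Rightarrow> cip (\<Sigma> j) (wc p j) \<beta>)" for l :: "'c idx"
    \<comment> \<open>The correction has to change the residuals of the particular solution
      \<open>y\<close> into the prescribed values \<open>r\<close>.\<close>
    define c where "c i = (\<Sum>l\<in>equations. H i l * (r l - res \<theta> l y))" for i
    define u where "u = comb c y"
    have stu: "st u" unfolding u_def by (rule comb_st[OF sty])
    have ru: "res \<theta> l u = r l" if "l \<in> equations" for l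
    proof -
      have "res \<theta> l u = (\<Sum>i\<in>unknowns. c i * res \<theta> l (e i)) + res \<theta> l y"
        unfolding u_def by (rule comb_lin[OF sty res_lin[OF that]])
      also have "(\<Sum>i\<in>unknowns. c i * res \<theta> l (e i)) = r l - res \<theta> l y"
        unfolding c_def by (rule H[OF that, of "\<lambda>l. r l - res \<theta> l y"])
      finally show ?thesis by simp
    qed
    show ?thesis
    proof (rule exI[of _ u], intro conjI allI impI ballI)
      show "in_dom u" unfolding in_dom_iff[of _ \<theta>] using stu ru by (simp add: r_def)
      \<comment> \<open>The homogeneous part of \<open>u\<close> is separated, since the property
        \<open>P\<close> concerns the equation with zero right side.\<close>
      define u0 where "u0 = (\<Sum>l\<in>unknowns. ssc (c l) (e l)) + 0"
      have "P u0" unfolding u0_def by (rule sum_closed[of P ssc, OF P_lin finite_idx(1) P_e P_0])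
      then have "eqn \<theta> (\<lambda>p. lc 1 (fst u0 p) (xw p)) (\<lambda>p. lc 1 0 (w p))"
        using xw by (intro eqn_lc) (auto simp: P_def st_def)
      moreover have "lc 1 (fst u0 p) (xw p) = fst u p" for p
        by (simp add: u_def comb_def u0_def y_def lc_def fun_eq_iff)
      moreover have "lc 1 0 (w p) = w p" for p by (simp add: lc_def fun_eq_iff vec_eq_iff)
      ultimately show "eqn \<theta> (fst u) w" by simp
    next
      fix p j assume j: "j \<le> n"
      have "cres \<theta> u p j - wc p j = 0"
      proof (rule cs_eq_0I[OF j])
        show "cres \<theta> u p j - wc p j \<in> cs j" using cres_in[OF stu j] wc j by (intro cs_diff) auto
        fix \<beta> assume \<beta>: "\<beta> \<in> Bs j"
        then have l: "Inr (p, j, \<beta>) \<in> equations" using j by (auto simp: equations_def)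
        interpret vector_space "csc j" by (rule ctrl_vs[OF j])
        have "csc j (- 1) (wc p j) + cres \<theta> u p j = cres \<theta> u p j - wc p j" by simp
        then show "cip (\<Sigma> j) (cres \<theta> u p j - wc p j) \<beta> = 0"
          using cip_lin[OF j _ cres_in[OF stu j] Bs_sub[OF j \<beta>], of "wc p j" "-1" \<theta> p] wc j ru[OF l]
          by (simp add: res_def r_def)
      qed
      then show "cres \<theta> u p j = wc p j" by simp
    next
      fix Q
      assume Q: "\<forall>p i. (LINT \<zeta>|ioo 0 (len b). norm (w p \<zeta> $ i)) \<le> Q" "\<forall>p. \<forall>j\<le>n. \<forall>\<beta>\<in>Bs j. norm (cip (\<Sigma> j) (wc p j) \<beta>) \<le> Q"
      have "0 \<le> (LINT \<zeta>|ioo 0 (len b). norm (w True \<zeta> $ 1))" by simp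
      also have "\<dots> \<le> Q" using Q by blast
      finally have Q0: "0 \<le> Q" .
      have xwQ: "\<forall>p. bounded_rep (xw p) (K0 * Q)" using xw(3) Q(1) by blast
      have cQ: "norm (c i) \<le> Ch * Q" if i: "i \<in> unknowns" for i
      proof -
        have "norm (c i) \<le> (\<Sum>l\<in>equations. norm (H i l) * (1 + Cr l * K0) * Q)"
          unfolding c_def
        proof (rule sum_norm_le)
          fix l assume l: "l \<in> equations"
          have "norm (r l) \<le> Q" using l Q Q0 unfolding equations_def r_def by auto
          moreover have "norm (res \<theta> l y) \<le> Cr l * (K0 * Q)" unfolding y_def by (rule Cr(2)[OF l xw(1) xwQ])
          ultimately have "norm (r l - res \<theta> l y) \<le> (1 + Cr l * K0) * Q"
            using norm_triangle_ineq4[of "r l" "res \<theta> l y"] by (simp add: algebra_simps)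
          then show "norm (H i l * (r l - res \<theta> l y)) \<le> norm (H i l) * (1 + Cr l * K0) * Q"
            by (simp add: norm_mult mult.assoc mult_left_mono)
        qed
        also have "\<dots> = (\<Sum>l\<in>equations. norm (H i l) * (1 + Cr l * K0)) * Q" by (simp add: sum_distrib_right)
        also have "\<dots> \<le> Ch * Q"
          unfolding Ch_def using i finite_idx Q0 Cr(1) K0(1)
          by (intro mult_right_mono member_le_sum[where f = "\<lambda>i. \<Sum>l\<in>equations. norm (H i l) * (1 + Cr l * K0)"] sum_nonneg mult_nonneg_nonneg) auto
        finally show ?thesis .
      qed
      have KQ: "real (card unknowns) * (Ch * Q * K0) + K0 * Q \<le> K * Q" "real (card unknowns) * (Ch * Q) \<le> K * Q"
        unfolding K_def using Ch0 K0(1) Q0 by (simp_all add: algebra_simps)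
      show "bounded_rep (fst u p) (K * Q)" for p
      proof -
        have z: "bounded_rep 0 0" unfolding bounded_rep_def
        proof (intro allI impI)
          fix j i assume j: "j < n"
          have "seg_rep 0 j i (\<lambda>_. 0) (\<lambda>_. 0) (\<lambda>_. 0)"
            unfolding seg_rep_def by (rule rep2I) (auto simp: co_energy_coef prim_def intro: L2_bounded[of _ _ _ 0])
          then show "\<exists>h0 h1 h2. seg_rep 0 j i h0 h1 h2 \<and> (\<forall>t\<in>{nd j..nd (Suc j)}. norm (h0 t) \<le> 0 \<and> norm (h1 t) \<le> 0)"
            by (intro exI conjI) auto
        qed
        have be: "bounded_rep (fst (e i) p) K0" for i
          using ex(4) bounded_rep_mono[OF z K0(1)] by (auto simp: e_def split: sum.split prod.split)
        have "bounded_rep (fst ((\<Sum>l\<in>L. ssc (c l) (e l)) + y) p) (real (card L) * (Ch * Q * K0) + K0 * Q)"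
          if "finite L" "L \<subseteq> unknowns" for L
          using that
        proof (induction L rule: finite_induct)
          case empty
          then show ?case using xwQ by (simp add: y_def)
        next
          case (insert l L)
          have "bounded_rep (lc (c l) (fst (e l) p) (fst ((\<Sum>l\<in>L. ssc (c l) (e l)) + y) p)) (norm (c l) * K0 + (real (card L) * (Ch * Q * K0) + K0 * Q))"
          proof (intro bounded_rep_lc be)
            show "bounded_rep (fst ((\<Sum>l\<in>L. ssc (c l) (e l)) + y) p) (real (card L) * (Ch * Q * K0) + K0 * Q)"
              by (rule insert.IH) (use insert.prems in blast)
          qed
          moreover have "norm (c l) * K0 \<le> Ch * Q * K0" using cQ[of l] insert K0(1) by (intro mult_right_mono) auto
          ultimately have "bounded_rep (fst (ssc (c l) (e l) + ((\<Sum>l\<in>L. ssc (c l) (e l)) + y)) p) (real (card (insert l L)) * (Ch * Q * K0) + K0 * Q)"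
            unfolding fst_ssc using insert by (elim bounded_rep_mono) (simp add: algebra_simps)
          moreover have "(\<Sum>l\<in>insert l L. ssc (c l) (e l)) + y = ssc (c l) (e l) + ((\<Sum>l\<in>L. ssc (c l) (e l)) + y)"
            using insert by (simp add: add.assoc)
          ultimately show ?case by (simp only:)
        qed
        from this[OF finite_idx(1) order_refl] show ?thesis
          unfolding u_def comb_def by (rule bounded_rep_mono[OF _ KQ(1)])
      qed
      fix p j \<beta> assume j: "j \<le> n" "\<beta> \<in> Bs j"
      define F where "F u = cip (\<Sigma> j) (snd u p j) \<beta>" for u :: "('k, 'c) pair_state"
      have F_lin: "F (ssc c u + v) = c * F u + F v" if "st u" "st v" for c u v
        unfolding F_def by (rule coord[OF j that])
      have "F u = (\<Sum>l\<in>unknowns. c l * F (e l)) + F y" unfolding u_def by (rule comb_lin[OF sty F_lin])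
      also have "F y = 0" using z0[OF j] by (simp add: F_def y_def)
      finally have "norm (F u) \<le> (\<Sum>l\<in>unknowns. Ch * Q * 1)"
      proof (simp only: add_0_right, intro sum_norm_le)
        fix l assume l: "l \<in> unknowns"
        have "norm (F (e l)) \<le> 1"
        proof (cases l)
          case (Inl k)
          then show ?thesis using z0[OF j] by (simp add: F_def e_def)
        next
          case (Inr t)
          obtain p' j' \<beta>' where t: "t = (p', j', \<beta>')" by (metis prod_cases3)
          have "\<beta>' \<in> Bs j'" using l Inr t by (auto simp: unknowns_def)
          then show ?thesis using z0[OF j] Bs_orth[OF j(1) _ j(2), of \<beta>'] t Inr by (auto simp: F_def e_def)
        qed
        then show "norm (c l * F (e l)) \<le> Ch * Q * 1"
          unfolding norm_mult using cQ[OF l] Ch0 Q0 by (intro mult_mono) auto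
      qed
      then show "norm (cip (\<Sigma> j) (snd u p j) \<beta>) \<le> K * Q" using KQ(2) by (simp add: F_def)
    qed
  qed
  show ?thesis using KK main by blast
qed

end

section \<open>Undamped solutions\<close>

text \<open>The coupled equations for \<open>f\<^sub>1\<close> of one component and \<open>f\<^sub>2\<close> of the other form a cooperative system,
  whence nonnegative data at the left end stay nonnegative and nondecreasing.\<close>

lemma cone_monotone:
  fixes p0 p1 r0 r1 \<alpha> \<gamma> :: "real \<Rightarrow> real"
  assumes ab: "a \<le> b"
    and p: "\<And>t. t \<in> {a..b} \<Longrightarrow> prim a p1 t = p0 t - p0 a" "\<And>t. t \<in> {a..b} \<Longrightarrow> prim a p2 t = p1 t - p1 a"
    and r: "\<And>t. t \<in> {a..b} \<Longrightarrow> prim a r1 t = r0 t - r0 a" "\<And>t. t \<in> {a..b} \<Longrightarrow> prim a r2 t = r1 t - r1 a"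
    and i: "integrable (ioo a b) p2" "integrable (ioo a b) r2"
    and p2: "AE t in ioo a b. p2 t = \<alpha> t * r0 t" and r2: "AE t in ioo a b. r2 t = \<gamma> t * p0 t"
    and coef: "\<And>t. t \<in> {a<..<b} \<Longrightarrow> 0 \<le> \<alpha> t \<and> \<alpha> t \<le> C" "\<And>t. t \<in> {a<..<b} \<Longrightarrow> 0 \<le> \<gamma> t \<and> \<gamma> t \<le> C"
    and init: "0 \<le> p0 a" "0 \<le> p1 a" "0 \<le> r0 a" "0 \<le> r1 a" and t: "t \<in> {a..b}"
  shows "p0 a \<le> p0 t" "p1 a \<le> p1 t" "r0 a \<le> r0 t" "r1 a \<le> r1 t"
proof -
  have c: "continuous_on {a..b} p1" "continuous_on {a..b} r1"
    using p(2) r(2) i by (auto intro: continuous_prim_eq)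
  have c0: "continuous_on {a..b} p0" "continuous_on {a..b} r0"
    using p(1) r(1) c by (auto intro: continuous_prim_eq integrable_continuous_ioo)
  \<comment> \<open>At least 1 for the equations \<open>p0' = p1\<close> and
    \<open>r0' = r1\<close>, at least \<open>C\<close> for the other two.\<close>
  define K where "K = max 1 C"
  \<comment> \<open>The largest violation of nonnegativity among the four functions, or 0.\<close>
  define v where "v s = max 0 (max (max (- p0 s) (- p1 s)) (max (- r0 s) (- r1 s)))" for s
  have vc: "continuous_on {a..b} v" unfolding v_def by (intro continuous_intros c c0)
  have vi: "integrable (ioo a b) v" by (rule integrable_continuous_ioo[OF vc])
  have v0: "0 \<le> v s" for s by (simp add: v_def)
  have K: "1 \<le> K" "C \<le> K" by (auto simp: K_def)
  have sub: "integrable (ioo a t) f" if "integrable (ioo a b) f" "t \<le> b" for f :: "real \<Rightarrow> real" and t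
    using subinterval_ioo(1)[OF order_refl that(2) that(1)] .
  have lower: "- (K * prim a v s) \<le> prim a f s"
    if f: "integrable (ioo a b) f" "AE x in ioo a b. - (K * v x) \<le> f x" and s: "s \<in> {a..b}" for f s
  proof -
    have "(LINT x|ioo a s. - (K * v x)) \<le> (LINT x|ioo a s. f x)"
    proof (rule integral_mono_AE)
      show "integrable (ioo a s) (\<lambda>x. - (K * v x))" using sub[OF vi] s by auto
      show "integrable (ioo a s) f" using sub[OF f(1)] s by auto
      show "AE x in ioo a s. - (K * v x) \<le> f x" using AE_subinterval[OF f(2)] s by auto
    qed
    then show ?thesis by (simp add: prim_def)
  qed
  have vK: "v x \<le> K * v x" for x using K v0[of x] by (simp add: mult_le_cancel_right1)
  have b1: "AE x in ioo a b. - (K * v x) \<le> p1 x" "AE x in ioo a b. - (K * v x) \<le> r1 x"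
  proof -
    have "- v x \<le> p1 x" "- v x \<le> r1 x" for x by (auto simp: v_def max_def)
    then show "AE x in ioo a b. - (K * v x) \<le> p1 x" "AE x in ioo a b. - (K * v x) \<le> r1 x"
      using vK by (auto intro!: AE_I2 intro: order_trans[OF le_imp_neg_le])
  qed
  have mult: "- (K * v x) \<le> c * y" if "0 \<le> c" "c \<le> C" "- v x \<le> y" for c x y
  proof -
    have "- (c * v x) \<le> c * y" using mult_left_mono[OF that(3,1)] by simp
    moreover have "c * v x \<le> K * v x" using that K v0[of x] by (intro mult_right_mono) auto
    ultimately show ?thesis by simp
  qed
  have b2: "AE x in ioo a b. - (K * v x) \<le> p2 x"
    using p2
  proof (rule lebesgue_on_mono)
    fix x assume "p2 x = \<alpha> x * r0 x" "x \<in> {a<..<b}"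
    then show "- (K * v x) \<le> p2 x" using mult[of "\<alpha> x" x "r0 x"] coef(1)[of x] by (simp add: v_def max_def)
  qed
  have b3: "AE x in ioo a b. - (K * v x) \<le> r2 x"
    using r2
  proof (rule lebesgue_on_mono)
    fix x assume "r2 x = \<gamma> x * p0 x" "x \<in> {a<..<b}"
    then show "- (K * v x) \<le> r2 x" using mult[of "\<gamma> x" x "p0 x"] coef(2)[of x] by (simp add: v_def max_def)
  qed
  have bound: "- (K * prim a v s) \<le> p0 s - p0 a \<and> - (K * prim a v s) \<le> p1 s - p1 a \<and>
      - (K * prim a v s) \<le> r0 s - r0 a \<and> - (K * prim a v s) \<le> r1 s - r1 a" if s: "s \<in> {a..b}" for s
    using lower[OF integrable_continuous_ioo[OF c(1)] b1(1) s] lower[OF integrable_continuous_ioo[OF c(2)] b1(2) s]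
      lower[OF i(1) b2 s] lower[OF i(2) b3 s] p[OF s] r[OF s] by simp
  \<comment> \<open>Derivatives are at least \<open>- K v\<close> because the couplings are
    nonnegative. With nonnegative initial values, Gronwall with initial term 0 yields
    \<open>v = 0\<close>.\<close>
  have zero: "v s \<le> 2 * 0 * exp (2 * K * (b - a))" if "s \<in> {a..b}" for s
  proof (rule Gronwall[OF vc v0 _ order_refl _ that])
    fix s assume s: "s \<in> {a..b}"
    have "0 \<le> prim a v s" using v0 by (simp add: prim_def)
    then have "0 \<le> K * prim a v s" using K by simp
    with bound[OF s] init show "v s \<le> 0 + K * prim a v s" by (simp add: v_def)
  qed (use K in simp)
  have "prim a v t = 0"
  proof -
    have "(LINT x|ioo a t. v x) = (LINT x|ioo a t. 0)"
      using zero v0 t by (intro Bochner_Integration.integral_cong) (auto intro: antisym)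
    then show ?thesis by (simp add: prim_def)
  qed
  with bound[OF t] show "p0 a \<le> p0 t" "p1 a \<le> p1 t" "r0 a \<le> r0 t" "r1 a \<le> r1 t" by simp_all
qed

lemma prim_bounded_linear:
  assumes "bounded_linear l" "integrable (ioo a b) f" "t \<le> b"
  shows "prim a (\<lambda>s. l (f s)) t = l (prim a f t)"
  unfolding prim_def using subinterval_ioo(1)[OF order_refl assms(3,2)]
  by (intro integral_bounded_linear[OF assms(1)])

lemma prim_scale: "prim a (\<lambda>s. c * f s) t = c * (prim a f t :: real)"
  by (simp add: prim_def)

context beam_ctx
begin

text \<open>The real form of an eigenfunction \<open>x + i y\<close> for the eigenvalue
  \<open>i \<beta>\<close>, without jumps of \<open>f\<close> and \<open>f'\<close> at the inner
  nodes.\<close>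

definition undamped :: "real \<Rightarrow> (real \<Rightarrow> 'k ^ 2) \<Rightarrow> (real \<Rightarrow> 'k ^ 2) \<Rightarrow> bool" where
  "undamped \<beta> x y \<longleftrightarrow> x \<in> dom_max b \<and> y \<in> dom_max b \<and>
     (AE \<zeta> in ioo 0 (len b). op_max b x \<zeta> = - (\<beta> *\<^sub>R y \<zeta>)) \<and> (AE \<zeta> in ioo 0 (len b). op_max b y \<zeta> = \<beta> *\<^sub>R x \<zeta>) \<and>
     (\<forall>j\<in>{1..<n}. \<forall>k\<in>{0,1}. val_left b k x j = val_right b k x j \<and> val_left b k y j = val_right b k y j)"

text \<open>For \<open>y\<close> the equation gives \<open>f1'' = \<beta> f2(x) / EI\<close>, for
  \<open>x\<close> it gives \<open>f2'' = \<beta> \<rho> f1(y)\<close>. Multiplying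
  \<open>f2\<close> by the sign \<open>\<sigma>\<close> of \<open>\<beta>\<close> makes both
  couplings nonnegative. A real functional \<open>l\<close> reduces values in the scalar field to
  real ones.\<close>

lemma undamped_segment:
  assumes u: "undamped \<beta> x y" and j: "j < n" and l: "bounded_linear l" and \<sigma>: "\<sigma> * \<beta> = \<bar>\<beta>\<bar>" "\<sigma> * \<sigma> = 1"
    and k: "seg_rep y j 1 k0 k1 k2" and h: "seg_rep x j 2 h0 h1 h2"
    and init: "0 \<le> l (k0 (nd j))" "0 \<le> l (k1 (nd j))" "0 \<le> \<sigma> * l (h0 (nd j))" "0 \<le> \<sigma> * l (h1 (nd j))"
    and t: "t \<in> {nd j..nd (Suc j)}"
  shows "l (k0 (nd j)) \<le> l (k0 t)" "l (k1 (nd j)) \<le> l (k1 t)"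
    "\<sigma> * l (h0 (nd j)) \<le> \<sigma> * l (h0 t)" "\<sigma> * l (h1 (nd j)) \<le> \<sigma> * l (h1 t)"
proof -
  obtain k0' k1' k2' where k': "seg_rep y j 2 k0' k1' k2'" using u j unfolding undamped_def dom_max_iff by blast
  obtain h0' h1' h2' where h': "seg_rep x j 1 h0' h1' h2'" using u j unfolding undamped_def dom_max_iff by blast
  have aex: "AE \<zeta> in seg j. op_max b x \<zeta> = - (\<beta> *\<^sub>R y \<zeta>)" and aey: "AE \<zeta> in seg j. op_max b y \<zeta> = \<beta> *\<^sub>R x \<zeta>"
    using u AE_seg[OF _ j] by (auto simp: undamped_def)
  have rx: "AE \<zeta> in seg j. co_energy b x \<zeta> $ 2 = h0 \<zeta>" "AE \<zeta> in seg j. co_energy b y \<zeta> $ 1 = k0 \<zeta>"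
    using h k by (auto simp: seg_rep_def rep2_def)
  interpret l: bounded_linear l by (rule l)
  have i2: "integrable (seg j) k2" "integrable (seg j) h2"
    using k h by (auto simp: seg_rep_def rep2_def L2_integrable)
  have i1: "integrable (seg j) k1" "integrable (seg j) h1"
    using rep2_continuous(2)[OF k[unfolded seg_rep_def]] rep2_continuous(2)[OF h[unfolded seg_rep_def]]
    by (auto intro: integrable_continuous_ioo)
  have *: "AE \<zeta> in seg j. l (k2 \<zeta>) = (\<bar>\<beta>\<bar> / coef 2 \<zeta>) * (\<sigma> * l (h0 \<zeta>)) \<and> \<sigma> * l (h2 \<zeta>) = (\<bar>\<beta>\<bar> / coef 1 \<zeta>) * l (k0 \<zeta>)"
  proof -
    have "AE \<zeta> in seg j. k2 \<zeta> = \<beta> *\<^sub>R x \<zeta> $ 2 \<and> h2 \<zeta> = \<beta> *\<^sub>R y \<zeta> $ 1 \<and> co_energy b x \<zeta> $ 2 = h0 \<zeta> \<and> co_energy b y \<zeta> $ 1 = k0 \<zeta>"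
      using op_max_AE[OF j h' h] op_max_AE[OF j k k'] aex aey rx
    proof eventually_elim
      case (elim \<zeta>)
      then show ?case by (auto simp: vec_eq_iff forall_2)
    qed
    then show ?thesis
    proof (rule lebesgue_on_mono)
      fix \<zeta> assume \<zeta>: "\<zeta> \<in> {nd j<..<nd (Suc j)}" and
        e: "k2 \<zeta> = \<beta> *\<^sub>R x \<zeta> $ 2 \<and> h2 \<zeta> = \<beta> *\<^sub>R y \<zeta> $ 1 \<and> co_energy b x \<zeta> $ 2 = h0 \<zeta> \<and> co_energy b y \<zeta> $ 1 = k0 \<zeta>"
      have cp: "0 < coef 1 \<zeta>" "0 < coef 2 \<zeta>" using coef_pos[OF seg_in[OF j \<zeta>]] by auto
      have x2: "h0 \<zeta> = coef 2 \<zeta> *\<^sub>R x \<zeta> $ 2" "k0 \<zeta> = coef 1 \<zeta> *\<^sub>R y \<zeta> $ 1" using e by (auto simp: co_energy_coef)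
      have "\<bar>\<beta>\<bar> * \<sigma> = \<beta>" using \<sigma> by (metis mult.assoc mult.commute mult.right_neutral)
      then have "l (k2 \<zeta>) = (\<bar>\<beta>\<bar> / coef 2 \<zeta>) * (\<sigma> * l (h0 \<zeta>))"
        using e x2 cp by (simp add: l.scaleR mult.assoc[symmetric])
      moreover have "\<sigma> * l (h2 \<zeta>) = (\<bar>\<beta>\<bar> / coef 1 \<zeta>) * l (k0 \<zeta>)"
        using e x2 cp \<sigma>(1) by (simp add: l.scaleR mult.assoc[symmetric])
      ultimately show "l (k2 \<zeta>) = (\<bar>\<beta>\<bar> / coef 2 \<zeta>) * (\<sigma> * l (h0 \<zeta>)) \<and> \<sigma> * l (h2 \<zeta>) = (\<bar>\<beta>\<bar> / coef 1 \<zeta>) * l (k0 \<zeta>)" by simp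
    qed
  qed
  have cb: "0 \<le> \<bar>\<beta>\<bar> / coef i \<zeta> \<and> \<bar>\<beta>\<bar> / coef i \<zeta> \<le> \<bar>\<beta>\<bar> / m0" if "\<zeta> \<in> {nd j<..<nd (Suc j)}" for \<zeta> i
    using coef_bounds[OF seg_in[OF j that], of i] m0 by (auto intro!: divide_left_mono mult_pos_pos)
  have pk: "prim (nd j) (\<lambda>s. l (k1 s)) t = l (k0 t) - l (k0 (nd j))" "prim (nd j) (\<lambda>s. l (k2 s)) t = l (k1 t) - l (k1 (nd j))"
    "prim (nd j) (\<lambda>s. \<sigma> * l (h1 s)) t = \<sigma> * l (h0 t) - \<sigma> * l (h0 (nd j))"
    "prim (nd j) (\<lambda>s. \<sigma> * l (h2 s)) t = \<sigma> * l (h1 t) - \<sigma> * l (h1 (nd j))"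
    if "t \<in> {nd j..nd (Suc j)}" for t
    using k h that prim_bounded_linear[OF l i1(1), of t] prim_bounded_linear[OF l i1(2), of t]
      prim_bounded_linear[OF l i2(1), of t] prim_bounded_linear[OF l i2(2), of t]
    by (auto simp: seg_rep_def rep2_def prim_scale l.diff right_diff_distrib)
  note cone = cone_monotone[of "nd j" "nd (Suc j)" "\<lambda>s. l (k1 s)" "\<lambda>s. l (k0 s)" "\<lambda>s. l (k2 s)" "\<lambda>s. \<sigma> * l (h1 s)" "\<lambda>s. \<sigma> * l (h0 s)" "\<lambda>s. \<sigma> * l (h2 s)"
      "\<lambda>\<zeta>. \<bar>\<beta>\<bar> / coef 2 \<zeta>" "\<lambda>\<zeta>. \<bar>\<beta>\<bar> / coef 1 \<zeta>" "\<bar>\<beta>\<bar> / m0" t]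
  have il: "integrable (seg j) (\<lambda>s. l (k2 s))" "integrable (seg j) (\<lambda>s. \<sigma> * l (h2 s))"
    using i2 integrable_bounded_linear[OF l] by auto
  have ae: "AE \<zeta> in seg j. l (k2 \<zeta>) = (\<bar>\<beta>\<bar> / coef 2 \<zeta>) * (\<sigma> * l (h0 \<zeta>))"
    "AE \<zeta> in seg j. \<sigma> * l (h2 \<zeta>) = (\<bar>\<beta>\<bar> / coef 1 \<zeta>) * l (k0 \<zeta>)"
    using * by (auto elim: eventually_mono)
  show "l (k0 (nd j)) \<le> l (k0 t)" "l (k1 (nd j)) \<le> l (k1 t)"
    "\<sigma> * l (h0 (nd j)) \<le> \<sigma> * l (h0 t)" "\<sigma> * l (h1 (nd j)) \<le> \<sigma> * l (h1 t)"
    using cone[OF less_imp_le[OF nd_Suc[OF j]] pk il ae cb cb init t] by auto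
qed

text \<open>The four quantities that the cone argument follows from \<open>0\<close> to \<open>L\<close>.\<close>

definition quad :: "(nat \<Rightarrow> (real \<Rightarrow> 'k ^ 2) \<Rightarrow> nat \<Rightarrow> 'k ^ 2) \<Rightarrow> real \<Rightarrow> ('k \<Rightarrow> real) \<Rightarrow> (real \<Rightarrow> 'k ^ 2) \<Rightarrow> (real \<Rightarrow> 'k ^ 2) \<Rightarrow> nat \<Rightarrow> real ^ 4" where
  "quad val \<sigma> l x y j = vector [l (val 0 y j $ 1), l (val 1 y j $ 1), \<sigma> * l (val 0 x j $ 2), \<sigma> * l (val 1 x j $ 2)]"

text \<open>On each segment the four quantities do not decrease as long as they start nonnegative,
  and continuity at the nodes passes them on unchanged.\<close>

lemma undamped_chain:
  assumes u: "undamped \<beta> x y" and l: "bounded_linear l" and \<sigma>: "\<sigma> * \<beta> = \<bar>\<beta>\<bar>" "\<sigma> * \<sigma> = 1"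
    and init: "\<And>i. 0 \<le> quad (val_right b) \<sigma> l x y 0 $ i" and j: "j < n"
  shows "quad (val_right b) \<sigma> l x y 0 $ i \<le> quad (val_right b) \<sigma> l x y j $ i"
    "quad (val_right b) \<sigma> l x y 0 $ i \<le> quad (val_left b) \<sigma> l x y (Suc j) $ i"
proof -
  have step: "\<forall>i. quad (val_right b) \<sigma> l x y 0 $ i \<le> quad (val_left b) \<sigma> l x y (Suc j) $ i"
    if IH: "\<forall>i. quad (val_right b) \<sigma> l x y 0 $ i \<le> quad (val_right b) \<sigma> l x y j $ i" and j: "j < n" for j
  proof -
    obtain k0 k1 k2 where k: "seg_rep y j 1 k0 k1 k2" using u j unfolding undamped_def dom_max_iff by blast
    obtain h0 h1 h2 where h: "seg_rep x j 2 h0 h1 h2" using u j unfolding undamped_def dom_max_iff by blast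
    have pos: "\<forall>i. 0 \<le> quad (val_right b) \<sigma> l x y j $ i" using IH init order_trans by blast
    have t: "nd (Suc j) \<in> {nd j..nd (Suc j)}" using nd_Suc[OF j] by simp
    have "0 \<le> l (k0 (nd j))" "0 \<le> l (k1 (nd j))" "0 \<le> \<sigma> * l (h0 (nd j))" "0 \<le> \<sigma> * l (h1 (nd j))"
      using pos seg_rep_vals(1,2)[OF j k] seg_rep_vals(1,2)[OF j h] unfolding forall_4 quad_def vector_4 by auto
    from undamped_segment[OF u j l \<sigma> k h this t] IH
    show ?thesis unfolding forall_4 quad_def vector_4
      using seg_rep_vals(1-4)[OF j k] seg_rep_vals(1-4)[OF j h] by auto
  qed
  have "\<forall>i. quad (val_right b) \<sigma> l x y 0 $ i \<le> quad (val_right b) \<sigma> l x y j $ i"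
    using j
  proof (induction j)
    case (Suc j)
    then have "\<forall>i. quad (val_right b) \<sigma> l x y 0 $ i \<le> quad (val_left b) \<sigma> l x y (Suc j) $ i" by (intro step) auto
    moreover have "quad (val_left b) \<sigma> l x y (Suc j) = quad (val_right b) \<sigma> l x y (Suc j)"
      using u Suc.prems by (simp add: undamped_def quad_def)
    ultimately show ?case by simp
  qed simp
  with step[OF this j] show "quad (val_right b) \<sigma> l x y 0 $ i \<le> quad (val_right b) \<sigma> l x y j $ i"
    "quad (val_right b) \<sigma> l x y 0 $ i \<le> quad (val_left b) \<sigma> l x y (Suc j) $ i" by blast+
qed

lemma bounded_linear_Re_Im: "bounded_linear (\<lambda>z::'k. Re (to_complex z))" "bounded_linear (\<lambda>z::'k. Im (to_complex z))"
  by (rule bounded_linear_compose[OF bounded_linear_Re bounded_linear_to_complex],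
      rule bounded_linear_compose[OF bounded_linear_Im bounded_linear_to_complex])

lemma eq_0_functionals:
  fixes z :: 'k
  assumes "\<And>l :: 'k \<Rightarrow> real. bounded_linear l \<Longrightarrow> l z = 0" shows "z = 0"
  using assms[OF bounded_linear_Re_Im(1)] assms[OF bounded_linear_Re_Im(2)]
  by (metis complex_eqI to_complex_eq_0_iff zero_complex.simps)

text \<open>The data behind \<open>quad\<close> before signs and functionals are applied; in this
  form the observations of \<open>R\<close> are expressed.\<close>

definition quad0 :: "(nat \<Rightarrow> (real \<Rightarrow> 'k ^ 2) \<Rightarrow> nat \<Rightarrow> 'k ^ 2) \<Rightarrow> (real \<Rightarrow> 'k ^ 2) \<Rightarrow> (real \<Rightarrow> 'k ^ 2) \<Rightarrow> nat \<Rightarrow> 'k ^ 4" where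
  "quad0 val x y j = vector [val 0 y j $ 1, val 1 y j $ 1, val 0 x j $ 2, val 1 x j $ 2]"

text \<open>If the only free datum at 0 were nonzero, some real functional or its negative would
  make it positive while the other data are 0. It could then only grow on its way to
  \<open>L\<close>, where it vanishes. With all data 0, the cone argument for \<open>l\<close> and
  for \<open>- l\<close> leaves only the zero solution.\<close>

lemma undamped_zero:
  assumes u: "undamped \<beta> x y" and zero: "\<And>i. i \<noteq> m \<Longrightarrow> quad0 (val_right b) x y 0 $ i = 0"
    and final: "quad0 (val_left b) x y n $ m = 0"
  shows "AE \<zeta> in ioo 0 (len b). y \<zeta> $ 1 = 0 \<and> x \<zeta> $ 2 = 0"
proof -
  define \<sigma> :: real where "\<sigma> = (if 0 \<le> \<beta> then 1 else -1)"
  have \<sigma>: "\<sigma> * \<beta> = \<bar>\<beta>\<bar>" "\<sigma> * \<sigma> = 1" by (auto simp: \<sigma>_def)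
  \<comment> \<open>Entries 3 and 4 of \<open>quad\<close> belong to \<open>f2\<close> and carry the
    sign \<open>\<sigma>\<close>.\<close>
  define w where "w i = (if i = 1 \<or> i = (2::4) then 1 else \<sigma>)" for i
  have w0: "w i \<noteq> 0" for i by (simp add: w_def \<sigma>_def)
  have quad: "quad val \<sigma> l x y j $ i = w i * l (quad0 val x y j $ i)" for val l j i
    using exhaust_4[of i] by (auto simp: quad_def quad0_def w_def)
  have nS: "Suc (n - 1) = n" "n - 1 < n" using n1 by auto
  have m0: "quad0 (val_right b) x y 0 $ m = 0"
  proof (rule eq_0_functionals)
    fix l :: "'k \<Rightarrow> real" assume l: "bounded_linear l"
    interpret l: bounded_linear l by (rule l)
    have *: "\<not> 0 < w m * l' (quad0 (val_right b) x y 0 $ m)" if l': "bounded_linear l'" for l'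
    proof
      interpret l': bounded_linear l' by (rule l')
      assume pos: "0 < w m * l' (quad0 (val_right b) x y 0 $ m)"
      have "0 \<le> quad (val_right b) \<sigma> l' x y 0 $ i" for i
        using pos zero[of i] by (cases "i = m") (auto simp: quad l'.zero)
      from undamped_chain(2)[OF u l' \<sigma> this nS(2), of m]
      have "quad (val_right b) \<sigma> l' x y 0 $ m \<le> quad (val_left b) \<sigma> l' x y n $ m" unfolding nS .
      then show False using pos final by (simp add: quad l'.zero)
    qed
    have "w m * l (quad0 (val_right b) x y 0 $ m) = 0"
      using *[OF l] *[OF bounded_linear_minus[OF l]] by simp
    then show "l (quad0 (val_right b) x y 0 $ m) = 0" using w0 by simp
  qed
  have q0: "quad0 (val_right b) x y 0 $ i = 0" for i using m0 zero by (cases "i = m") auto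
  show ?thesis
  proof (rule AE_segs)
    fix j assume j: "j < n"
    obtain k0 k1 k2 where k: "seg_rep y j 1 k0 k1 k2" using u j unfolding undamped_def dom_max_iff by blast
    obtain h0 h1 h2 where h: "seg_rep x j 2 h0 h1 h2" using u j unfolding undamped_def dom_max_iff by blast
    \<comment> \<open>The same inequality for \<open>- l\<close> turns nonnegativity into
      equality.\<close>
    have pos: "0 \<le> l (k0 t) \<and> 0 \<le> \<sigma> * l (h0 t)" if l: "bounded_linear l" and t: "t \<in> {nd j..nd (Suc j)}" for l t
    proof -
      interpret l: bounded_linear l by (rule l)
      have i0: "0 \<le> quad (val_right b) \<sigma> l x y 0 $ i" for i by (simp add: quad q0 l.zero)
      have pos: "\<forall>i. 0 \<le> quad (val_right b) \<sigma> l x y j $ i"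
        using undamped_chain(1)[OF u l \<sigma> i0 j] i0 order_trans by blast
      have "0 \<le> l (k0 (nd j))" "0 \<le> l (k1 (nd j))" "0 \<le> \<sigma> * l (h0 (nd j))" "0 \<le> \<sigma> * l (h1 (nd j))"
        using pos seg_rep_vals(1,2)[OF j k] seg_rep_vals(1,2)[OF j h] unfolding forall_4 quad_def vector_4 by auto
      from undamped_segment[OF u j l \<sigma> k h this t] this show ?thesis by auto
    qed
    have z: "k0 t = 0" "h0 t = 0" if t: "t \<in> {nd j..nd (Suc j)}" for t
    proof -
      show "k0 t = 0"
      proof (rule eq_0_functionals)
        fix l :: "'k \<Rightarrow> real" assume l: "bounded_linear l"
        show "l (k0 t) = 0" using pos[OF l t] pos[OF bounded_linear_minus[OF l] t] by simp
      qed
      show "h0 t = 0"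
      proof (rule eq_0_functionals)
        fix l :: "'k \<Rightarrow> real" assume l: "bounded_linear l"
        show "l (h0 t) = 0" using pos[OF l t] pos[OF bounded_linear_minus[OF l] t]
          by (auto simp: \<sigma>_def split: if_splits)
      qed
    qed
    have "AE \<zeta> in seg j. co_energy b x \<zeta> $ 2 = h0 \<zeta> \<and> co_energy b y \<zeta> $ 1 = k0 \<zeta>"
      using h k by (auto simp: seg_rep_def rep2_def)
    then show "AE \<zeta> in seg j. y \<zeta> $ 1 = 0 \<and> x \<zeta> $ 2 = 0"
    proof (rule lebesgue_on_mono)
      fix \<zeta> assume "co_energy b x \<zeta> $ 2 = h0 \<zeta> \<and> co_energy b y \<zeta> $ 1 = k0 \<zeta>" "\<zeta> \<in> {nd j<..<nd (Suc j)}"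
      then show "y \<zeta> $ 1 = 0 \<and> x \<zeta> $ 2 = 0"
        using z[of \<zeta>] coef_pos[OF seg_in[OF j], of \<zeta>] by (simp add: co_energy_coef less_le)
    qed
  qed
qed

text \<open>Multiplication of \<open>x + i y\<close> by \<open>i\<close> gives
  \<open>- y + i x\<close>, again an eigenfunction. It brings the two functions that the first
  coupled system leaves out, \<open>f1\<close> of \<open>x\<close> and \<open>f2\<close> of
  \<open>y\<close>, into the same form.\<close>

lemma undamped_swap:
  assumes u: "undamped \<beta> x y" shows "undamped \<beta> (lc (- 1) y 0) x"
    and "j < n \<Longrightarrow> k = 0 \<or> k = 1 \<Longrightarrow> val_right b k (lc (- 1) y 0) j = - val_right b k y j"
    and "j < n \<Longrightarrow> k = 0 \<or> k = 1 \<Longrightarrow> val_left b k (lc (- 1) y 0) (Suc j) = - val_left b k y (Suc j)"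
proof -
  have d: "x \<in> dom_max b" "y \<in> dom_max b" using u by (auto simp: undamped_def)
  have z: "AE \<zeta> in ioo 0 (len b). (0 :: real \<Rightarrow> 'k ^ 2) \<zeta> = 0" by simp
  have vr: "val_right b k (0 :: real \<Rightarrow> 'k ^ 2) j = 0" if "j < n" "k = 0 \<or> k = 1" for j k
    using AE_zero_vals(1,2)[OF zero_dom_max z that(1)] that(2) by (auto simp del: zero_fun_apply One_nat_def)
  have vl: "val_left b k (0 :: real \<Rightarrow> 'k ^ 2) (Suc j) = 0" if "j < n" "k = 0 \<or> k = 1" for j k
    using AE_zero_vals(3,4)[OF zero_dom_max z that(1)] that(2) by (auto simp del: zero_fun_apply One_nat_def)
  have lc0: "lc (- 1) y 0 \<in> dom_max b" by (rule dom_max_lc[OF d(2) zero_dom_max])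
  show r: "val_right b k (lc (- 1) y 0) j = - val_right b k y j" if "j < n" "k = 0 \<or> k = 1" for j k
    using bfun_vals(1)[OF that] vr[OF that] d zero_dom_max lc0
    by (auto simp: vec_eq_iff bfun_def simp del: zero_fun_apply One_nat_def)
  show l: "val_left b k (lc (- 1) y 0) (Suc j) = - val_left b k y (Suc j)" if "j < n" "k = 0 \<or> k = 1" for j k
    using bfun_vals(2)[OF that] vl[OF that] d zero_dom_max lc0
    by (auto simp: vec_eq_iff bfun_def simp del: zero_fun_apply One_nat_def)
  have "lc 1 0 0 = (0 :: real \<Rightarrow> 'k ^ 2)" "lc (- 1) 0 0 = (0 :: real \<Rightarrow> 'k ^ 2)" by (auto simp: fun_eq_iff vec_eq_iff)
  then have op0: "AE \<zeta> in ioo 0 (len b). op_max b 0 \<zeta> = 0"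
    using op_max_lc[OF zero_dom_max zero_dom_max, of "- 1"] by simp
  have ae: "AE \<zeta> in ioo 0 (len b). op_max b x \<zeta> = - (\<beta> *\<^sub>R y \<zeta>)" "AE \<zeta> in ioo 0 (len b). op_max b y \<zeta> = \<beta> *\<^sub>R x \<zeta>"
    using u by (auto simp: undamped_def)
  have "AE \<zeta> in ioo 0 (len b). op_max b (lc (- 1) y 0) \<zeta> = - (\<beta> *\<^sub>R x \<zeta>)"
    using op_max_lc[OF d(2) zero_dom_max, of "- 1"] op0 ae(2)
    by eventually_elim (simp add: vec_eq_iff)
  moreover have "AE \<zeta> in ioo 0 (len b). op_max b x \<zeta> = \<beta> *\<^sub>R lc (- 1) y 0 \<zeta>"
    using ae(1) by eventually_elim (simp add: vec_eq_iff)
  moreover have "val_left b k (lc (- 1) y 0) j = val_right b k (lc (- 1) y 0) j" if "j \<in> {1..<n}" "k \<in> {0,1}" for j k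
    using r[of j k] l[of "j - 1" k] u that by (auto simp: undamped_def)
  ultimately show "undamped \<beta> (lc (- 1) y 0) x"
    using u dom_max_lc[OF d(2) zero_dom_max] by (simp add: undamped_def)
qed

text \<open>The index \<open>m\<close> is the quantity not observed at 0, which in all four cases is
  the one observed at \<open>L\<close>. The statement is symmetric in \<open>x\<close> and
  \<open>y\<close> because both coupled systems are needed.\<close>

lemma R_maps_cases:
  assumes "R \<in> R_maps b" "R x = 0" "R y = 0"
  shows "\<exists>m. (\<forall>i. i \<noteq> m \<longrightarrow> quad0 (val_right b) x y 0 $ i = 0 \<and> quad0 (val_right b) y x 0 $ i = 0) \<and>
    quad0 (val_left b) x y n $ m = 0 \<and> quad0 (val_left b) y x n $ m = 0"
proof -
  have z: "\<And>z. vector [z1, z2, z3, z4] = (0 :: 'k ^ 4) \<Longrightarrow> z1 = 0 \<and> z2 = 0 \<and> z3 = 0 \<and> z4 = 0" for z1 z2 z3 z4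
    by (simp add: vec_eq_iff forall_4)
  have ex: "\<And>P. P 1 \<or> P 2 \<or> P 3 \<or> P 4 \<Longrightarrow> \<exists>m::4. P m" by blast
  from assms(1) consider "R = (\<lambda>x. vector [val_right b 0 x 0 $ 1, val_right b 1 x 0 $ 1, val_right b 0 x 0 $ 2, val_left b 1 x n $ 2])"
    | "R = (\<lambda>x. vector [val_right b 0 x 0 $ 1, val_right b 1 x 0 $ 1, val_right b 1 x 0 $ 2, val_left b 0 x n $ 2])"
    | "R = (\<lambda>x. vector [val_right b 0 x 0 $ 1, val_right b 0 x 0 $ 2, val_right b 1 x 0 $ 2, val_left b 1 x n $ 1])"
    | "R = (\<lambda>x. vector [val_right b 1 x 0 $ 1, val_right b 0 x 0 $ 2, val_right b 1 x 0 $ 2, val_left b 0 x n $ 1])"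
    unfolding R_maps_def by blast
  then show ?thesis
  proof cases
    case 1
    from assms(2,3) show ?thesis unfolding 1 by (intro exI[of _ 4]) (auto dest!: z simp: forall_4 quad0_def)
  next
    case 2
    from assms(2,3) show ?thesis unfolding 2 by (intro exI[of _ 3]) (auto dest!: z simp: forall_4 quad0_def)
  next
    case 3
    from assms(2,3) show ?thesis unfolding 3 by (intro exI[of _ 2]) (auto dest!: z simp: forall_4 quad0_def)
  next
    case 4
    from assms(2,3) show ?thesis unfolding 4 by (intro exI[of _ 1]) (auto dest!: z simp: forall_4 quad0_def)
  qed
qed

theorem undamped_observed_zero:
  assumes u: "undamped \<beta> x y" and R: "R \<in> R_maps b" "R x = 0" "R y = 0"
  shows "AE \<zeta> in ioo 0 (len b). x \<zeta> = 0 \<and> y \<zeta> = 0"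
proof -
  obtain m where m: "\<And>i. i \<noteq> m \<Longrightarrow> quad0 (val_right b) x y 0 $ i = 0" "\<And>i. i \<noteq> m \<Longrightarrow> quad0 (val_right b) y x 0 $ i = 0"
    "quad0 (val_left b) x y n $ m = 0" "quad0 (val_left b) y x n $ m = 0"
    using R_maps_cases[OF R] by blast
  have n0: "0 < n" "Suc (n - 1) = n" "n - 1 < n" using n1 by auto
  have r: "val_right b 0 (lc (- 1) y 0) 0 = - val_right b 0 y 0" "val_right b 1 (lc (- 1) y 0) 0 = - val_right b 1 y 0"
    using undamped_swap(2)[OF u n0(1)] by auto
  have l: "val_left b 0 (lc (- 1) y 0) n = - val_left b 0 y n" "val_left b 1 (lc (- 1) y 0) n = - val_left b 1 y n"
    using undamped_swap(3)[OF u n0(3)] n0(2) by auto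
  have "quad0 (val_right b) (lc (- 1) y 0) x 0 $ i = 0" if "i \<noteq> m" for i
    using m(2)[OF that] exhaust_4[of i] by (auto simp: quad0_def r simp del: One_nat_def)
  moreover have "quad0 (val_left b) (lc (- 1) y 0) x n $ m = 0"
    using m(4) exhaust_4[of m] by (auto simp: quad0_def l simp del: One_nat_def)
  ultimately have "AE \<zeta> in ioo 0 (len b). x \<zeta> $ 1 = 0 \<and> lc (- 1) y 0 \<zeta> $ 2 = 0"
    by (rule undamped_zero[OF undamped_swap(1)[OF u]])
  moreover have "AE \<zeta> in ioo 0 (len b). y \<zeta> $ 1 = 0 \<and> x \<zeta> $ 2 = 0"
    by (rule undamped_zero[OF u m(1) m(3)])
  ultimately show ?thesis by eventually_elim (simp add: vec_eq_iff forall_2)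
qed

end

section \<open>The energy inner product\<close>

lemma mult_le_sum_squares: "0 \<le> r \<Longrightarrow> 0 \<le> s \<Longrightarrow> r * s \<le> r\<^sup>2 + (s::real)\<^sup>2"
  using sum_squares_bound[of r s] mult_nonneg_nonneg[of r s] by linarith

lemma L2_mult_cnj_integrable:
  fixes f g :: "real \<Rightarrow> 'k::real_or_complex"
  assumes f: "L2_on a b f" and g: "L2_on a b g"
  shows "integrable (ioo a b) (\<lambda>\<zeta>. to_complex (f \<zeta>) * cnj (to_complex (g \<zeta>)))"
proof (rule Bochner_Integration.integrable_bound[of _ "\<lambda>\<zeta>. (norm (f \<zeta>))\<^sup>2 + (norm (g \<zeta>))\<^sup>2"])
  show "integrable (ioo a b) (\<lambda>\<zeta>. (norm (f \<zeta>))\<^sup>2 + (norm (g \<zeta>))\<^sup>2)"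
    using f g by (intro Bochner_Integration.integrable_add) (auto simp: L2_on_def)
  have [measurable]: "(to_complex :: 'k \<Rightarrow> complex) \<in> borel_measurable borel"
    by (intro borel_measurable_continuous_onI linear_continuous_on bounded_linear_to_complex)
  have [measurable]: "cnj \<in> borel_measurable borel"
    by (intro borel_measurable_continuous_onI continuous_intros)
  have [measurable]: "f \<in> borel_measurable (ioo a b)" "g \<in> borel_measurable (ioo a b)"
    using f g by (auto simp: L2_on_def)
  show "(\<lambda>\<zeta>. to_complex (f \<zeta>) * cnj (to_complex (g \<zeta>))) \<in> borel_measurable (ioo a b)"
    by measurable
  show "AE \<zeta> in ioo a b. norm (to_complex (f \<zeta>) * cnj (to_complex (g \<zeta>))) \<le> norm ((norm (f \<zeta>))\<^sup>2 + (norm (g \<zeta>))\<^sup>2)"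
  proof (rule AE_I2)
    fix \<zeta>
    have "norm (f \<zeta>) * norm (g \<zeta>) \<le> (norm (f \<zeta>))\<^sup>2 + (norm (g \<zeta>))\<^sup>2"
      by (intro mult_le_sum_squares) auto
    then show "norm (to_complex (f \<zeta>) * cnj (to_complex (g \<zeta>))) \<le> norm ((norm (f \<zeta>))\<^sup>2 + (norm (g \<zeta>))\<^sup>2)"
      by (simp add: norm_mult norm_to_complex)
  qed
qed

lemma Re_mult_cnj_self: "Re (to_complex x * cnj (to_complex x)) = (norm (x::'k::real_or_complex))\<^sup>2"
  by (simp add: complex_norm_square[symmetric] norm_to_complex flip: of_real_power)

context beam_ctx
begin

lemma X_integrand: "ip_vec (x \<zeta>) (co_energy b y \<zeta>) = (\<Sum>i\<in>UNIV. coef i \<zeta> *\<^sub>R (to_complex (x \<zeta> $ i) * cnj (to_complex (y \<zeta> $ i))))"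
  by (simp add: ip_vec_def co_energy_coef to_complex_scaleR)

lemma X_integrable:
  assumes "x \<in> X_space b" "y \<in> X_space b"
  shows "integrable (ioo 0 (len b)) (\<lambda>\<zeta>. ip_vec (x \<zeta>) (co_energy b y \<zeta>))"
  unfolding X_integrand
proof (intro Bochner_Integration.integrable_sum integrable_scaleR_bounded[where B = m1])
  fix i :: 2
  show "integrable (ioo 0 (len b)) (\<lambda>\<zeta>. to_complex (x \<zeta> $ i) * cnj (to_complex (y \<zeta> $ i)))"
    using assms by (intro L2_mult_cnj_integrable) (auto simp: X_space_coord)
  show "\<bar>coef i \<zeta>\<bar> \<le> m1" if "0 < \<zeta>" "\<zeta> < len b" for \<zeta> using coef_bounds[of \<zeta> i] coef_pos[of \<zeta> i] that by simp
qed (rule coef_measurable)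

lemma X_ip_lc:
  assumes "x \<in> X_space b" "y \<in> X_space b" "z \<in> X_space b"
  shows "X_ip b (lc c x y) z = to_complex c * X_ip b x z + X_ip b y z"
proof -
  have "ip_vec (lc c x y \<zeta>) (co_energy b z \<zeta>) = to_complex c * ip_vec (x \<zeta>) (co_energy b z \<zeta>) + ip_vec (y \<zeta>) (co_energy b z \<zeta>)" for \<zeta>
    by (simp add: ip_vec_def to_complex_add to_complex_mult sum_distrib_left sum.distrib algebra_simps)
  then show ?thesis unfolding X_ip_def
    using X_integrable[OF assms(1,3)] X_integrable[OF assms(2,3)] by simp
qed

lemma X_ip_sym: "X_ip b y x = cnj (X_ip b x y)"
proof -
  have "(\<lambda>\<zeta>. ip_vec (y \<zeta>) (co_energy b x \<zeta>)) = (\<lambda>\<zeta>. cnj (ip_vec (x \<zeta>) (co_energy b y \<zeta>)))"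
    unfolding X_integrand by (simp add: mult.commute)
  from arg_cong[OF this, of "integral\<^sup>L (ioo 0 (len b))"] show ?thesis
    unfolding X_ip_def using integral_bounded_linear'[OF bounded_linear_cnj bounded_linear_cnj, of "ioo 0 (len b)" "\<lambda>\<zeta>. ip_vec (x \<zeta>) (co_energy b y \<zeta>)"] by auto
qed

lemma X_ip_cong:
  assumes "x \<in> X_space b" "x' \<in> X_space b" "y \<in> X_space b" "AE \<zeta> in ioo 0 (len b). x \<zeta> = x' \<zeta>"
  shows "X_ip b x y = X_ip b x' y"
  unfolding X_ip_def
  by (rule integral_cong_AE)
     (use assms(4) X_integrable[OF assms(1,3)] X_integrable[OF assms(2,3)] in \<open>auto elim: eventually_mono\<close>)

lemma Re_X_ip:
  assumes "x \<in> X_space b"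
  shows "integrable (ioo 0 (len b)) (\<lambda>\<zeta>. \<Sum>i\<in>UNIV. coef i \<zeta> * (norm (x \<zeta> $ i))\<^sup>2)"
    and "Re (X_ip b x x) = (LINT \<zeta>|ioo 0 (len b). (\<Sum>i\<in>UNIV. coef i \<zeta> * (norm (x \<zeta> $ i))\<^sup>2))"
proof -
  have e: "Re (ip_vec (x \<zeta>) (co_energy b x \<zeta>)) = (\<Sum>i\<in>UNIV. coef i \<zeta> * (norm (x \<zeta> $ i))\<^sup>2)" for \<zeta>
    unfolding X_integrand by (simp add: Re_mult_cnj_self del: complex_cnj_mult times_complex.sel)
  show "integrable (ioo 0 (len b)) (\<lambda>\<zeta>. \<Sum>i\<in>UNIV. coef i \<zeta> * (norm (x \<zeta> $ i))\<^sup>2)"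
    using integrable_Re[OF X_integrable[OF assms assms]] by (simp only: e)
  show "Re (X_ip b x x) = (LINT \<zeta>|ioo 0 (len b). (\<Sum>i\<in>UNIV. coef i \<zeta> * (norm (x \<zeta> $ i))\<^sup>2))"
    unfolding X_ip_def using integral_Re[OF X_integrable[OF assms assms]] by (simp only: e)
qed

lemma AE_ioo_I: "(\<And>\<zeta>. \<zeta> \<in> {r<..<s} \<Longrightarrow> P \<zeta>) \<Longrightarrow> AE \<zeta> in ioo r s. P \<zeta>"
  by (rule AE_I2) simp

lemma energy_density_nonneg: "\<zeta> \<in> {0<..<len b} \<Longrightarrow> 0 \<le> (\<Sum>i\<in>UNIV. coef i \<zeta> * (norm (x \<zeta> $ i))\<^sup>2)"
  using coef_pos[of \<zeta>] by (intro sum_nonneg mult_nonneg_nonneg) (auto simp: less_imp_le)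

lemma X_ip_nonneg: "x \<in> X_space b \<Longrightarrow> 0 \<le> Re (X_ip b x x)"
  unfolding Re_X_ip(2) by (intro integral_nonneg_AE AE_ioo_I energy_density_nonneg)

lemma X_ip_eq_0_iff:
  assumes "x \<in> X_space b" shows "Re (X_ip b x x) = 0 \<longleftrightarrow> (AE \<zeta> in ioo 0 (len b). x \<zeta> = 0)"
proof -
  have "Re (X_ip b x x) = 0 \<longleftrightarrow> (AE \<zeta> in ioo 0 (len b). (\<Sum>i\<in>UNIV. coef i \<zeta> * (norm (x \<zeta> $ i))\<^sup>2) = 0)"
    unfolding Re_X_ip(2)[OF assms] using Re_X_ip(1)[OF assms]
    by (intro integral_nonneg_eq_0_iff_AE AE_ioo_I energy_density_nonneg)
  also have "\<dots> \<longleftrightarrow> (AE \<zeta> in ioo 0 (len b). x \<zeta> = 0)"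
  proof (rule AE_cong)
    fix \<zeta> assume "\<zeta> \<in> space (ioo 0 (len b))"
    then have c: "0 < coef i \<zeta>" for i using coef_pos[of \<zeta> i] by simp
    have "(\<Sum>i\<in>UNIV. coef i \<zeta> * (norm (x \<zeta> $ i))\<^sup>2) = 0 \<longleftrightarrow> (\<forall>i\<in>UNIV. coef i \<zeta> * (norm (x \<zeta> $ i))\<^sup>2 = 0)"
      by (intro sum_nonneg_eq_0_iff) (auto intro!: mult_nonneg_nonneg less_imp_le[OF c])
    then show "(\<Sum>i\<in>UNIV. coef i \<zeta> * (norm (x \<zeta> $ i))\<^sup>2) = 0 \<longleftrightarrow> x \<zeta> = 0"
      using c by (simp add: vec_eq_iff less_imp_neq[THEN not_sym])
  qed
  finally show ?thesis .
qed

lemma len_pos: "0 < len b"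
  using nd_Suc[of 0] n1 nd_mono[of 1 n] nd0 nd_n by simp

lemma X_ip_le:
  assumes x: "x \<in> X_space b" and e: "AE \<zeta> in ioo 0 (len b). \<forall>i. norm (x \<zeta> $ i) \<le> e"
  shows "Re (X_ip b x x) \<le> 2 * m1 * len b * e\<^sup>2"
proof -
  interpret F: finite_measure "ioo 0 (len b)" by (rule finite_measure_ioo)
  have "Re (X_ip b x x) \<le> (LINT \<zeta>|ioo 0 (len b). 2 * m1 * e\<^sup>2)"
    unfolding Re_X_ip(2)[OF x]
  proof (rule integral_mono_AE[OF Re_X_ip(1)[OF x]])
    have in1: "AE \<zeta> in ioo 0 (len b). \<zeta> \<in> {0<..<len b}" by (rule AE_ioo_I)
    from e in1 show "AE \<zeta> in ioo 0 (len b). (\<Sum>i\<in>UNIV. coef i \<zeta> * (norm (x \<zeta> $ i))\<^sup>2) \<le> 2 * m1 * e\<^sup>2"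
    proof eventually_elim
      case (elim \<zeta>)
      have "(\<Sum>i\<in>UNIV. coef i \<zeta> * (norm (x \<zeta> $ i))\<^sup>2) \<le> (\<Sum>i\<in>(UNIV :: 2 set). m1 * e\<^sup>2)"
        using elim coef_bounds[of \<zeta>] coef_pos[of \<zeta>] order_trans[OF less_imp_le[OF coef_pos[of \<zeta> 1]], of m1]
        by (intro sum_mono mult_mono power_mono) auto
      then show ?case by simp
    qed
  qed simp
  also have "\<dots> = 2 * m1 * len b * e\<^sup>2"
    using len_pos by (simp add: measure_restrict_space)
  finally show ?thesis .
qed

lemma bounded_rep_AE:
  assumes "bounded_rep x Q"
  shows "AE \<zeta> in ioo 0 (len b). \<forall>i. norm (x \<zeta> $ i) \<le> Q / m0"
proof -
  have "AE \<zeta> in ioo 0 (len b). norm (x \<zeta> $ i) \<le> Q / m0" for i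
  proof (rule AE_segs)
    fix j assume j: "j < n"
    obtain h0 h1 h2 where h: "seg_rep x j i h0 h1 h2" "\<forall>t\<in>{nd j..nd (Suc j)}. norm (h0 t) \<le> Q"
      using assms j unfolding bounded_rep_def by blast
    have "AE \<zeta> in seg j. co_energy b x \<zeta> $ i = h0 \<zeta>" using h by (simp add: seg_rep_def rep2_def)
    then show "AE \<zeta> in seg j. norm (x \<zeta> $ i) \<le> Q / m0"
    proof (rule lebesgue_on_mono)
      fix \<zeta> assume a: "co_energy b x \<zeta> $ i = h0 \<zeta>" "\<zeta> \<in> {nd j<..<nd (Suc j)}"
      have c: "m0 \<le> coef i \<zeta>" using coef_bounds seg_in[OF j a(2)] by blast
      have "m0 * norm (x \<zeta> $ i) \<le> coef i \<zeta> * norm (x \<zeta> $ i)" using c by (intro mult_right_mono) auto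
      also have "\<dots> = norm (h0 \<zeta>)" using a(1) c m0 by (simp add: co_energy_coef flip: a(1))
      also have "\<dots> \<le> Q" using h(2) a(2) by simp
      finally show "norm (x \<zeta> $ i) \<le> Q / m0" using m0 by (simp add: field_simps)
    qed
  qed
  then show ?thesis by (simp add: AE_all_countable forall_2)
qed

text \<open>Instead of the Cauchy-Schwarz inequality for integrals the pointwise bound
  \<open>r \<le> r^2 / s + s\<close> is integrated. This needs a strictly positive \<open>s\<close>,
  which is why the estimate is phrased with an upper bound \<open>s\<close> of the norm.\<close>

lemma X_integral_le:
  assumes x: "x \<in> X_space b" and s: "0 < s" "Re (X_ip b x x) \<le> s\<^sup>2"
  shows "(LINT \<zeta>|ioo 0 (len b). norm (x \<zeta> $ i)) \<le> (1 / m0 + len b) * s"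
proof -
  interpret F: finite_measure "ioo 0 (len b)" by (rule finite_measure_ioo)
  have "(LINT \<zeta>|ioo 0 (len b). norm (x \<zeta> $ i)) \<le>
      (LINT \<zeta>|ioo 0 (len b). (1 / (s * m0)) * (\<Sum>i\<in>UNIV. coef i \<zeta> * (norm (x \<zeta> $ i))\<^sup>2) + s)"
  proof (rule integral_mono_AE[OF _ _ AE_ioo_I])
    show "integrable (ioo 0 (len b)) (\<lambda>\<zeta>. norm (x \<zeta> $ i))"
      using x by (intro integrable_norm L2_integrable) (auto simp: X_space_coord)
    show "integrable (ioo 0 (len b)) (\<lambda>\<zeta>. (1 / (s * m0)) * (\<Sum>i\<in>UNIV. coef i \<zeta> * (norm (x \<zeta> $ i))\<^sup>2) + s)"
      by (intro Bochner_Integration.integrable_add integrable_mult_right Re_X_ip(1)[OF x]) simp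
    fix \<zeta> assume \<zeta>: "\<zeta> \<in> {0<..<len b}"
    define r where "r = norm (x \<zeta> $ i)"
    have "m0 * r\<^sup>2 \<le> coef i \<zeta> * r\<^sup>2" using coef_bounds[OF \<zeta>] by (intro mult_right_mono) auto
    also have "\<dots> \<le> (\<Sum>i\<in>UNIV. coef i \<zeta> * (norm (x \<zeta> $ i))\<^sup>2)"
      unfolding r_def by (intro member_le_sum) (auto intro!: mult_nonneg_nonneg less_imp_le[OF coef_pos[OF \<zeta>]])
    finally have 1: "m0 * r\<^sup>2 \<le> (\<Sum>i\<in>UNIV. coef i \<zeta> * (norm (x \<zeta> $ i))\<^sup>2)" .
    have "r * s \<le> r\<^sup>2 + s\<^sup>2" using s by (intro mult_le_sum_squares) (auto simp: r_def)
    then have "r \<le> r\<^sup>2 / s + s" using s by (simp add: field_simps power2_eq_square)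
    also have "r\<^sup>2 / s = (1 / (s * m0)) * (m0 * r\<^sup>2)" using m0 by simp
    also have "\<dots> \<le> (1 / (s * m0)) * (\<Sum>i\<in>UNIV. coef i \<zeta> * (norm (x \<zeta> $ i))\<^sup>2)"
      using 1 s m0 by (intro mult_left_mono) auto
    finally show "norm (x \<zeta> $ i) \<le> (1 / (s * m0)) * (\<Sum>i\<in>UNIV. coef i \<zeta> * (norm (x \<zeta> $ i))\<^sup>2) + s" by (simp add: r_def)
  qed
  also have "\<dots> = (1 / (s * m0)) * Re (X_ip b x x) + s * len b"
    using Re_X_ip[OF x] len_pos by (simp add: measure_restrict_space)
  also have "\<dots> \<le> (1 / (s * m0)) * s\<^sup>2 + s * len b"
    using s m0 by (intro add_mono mult_left_mono) auto
  also have "\<dots> = (1 / m0 + len b) * s" using s m0 by (simp add: field_simps power2_eq_square)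
  finally show ?thesis .
qed

end

section \<open>The resolvent problem on the state space\<close>

context loop_ctx
begin

abbreviation "N \<equiv> cl_norm b \<Sigma>"
abbreviation "ip \<equiv> cl_ip b \<Sigma>"
abbreviation "V \<equiv> cl_space b \<Sigma>"
abbreviation "Dom \<equiv> cl_dom b \<Sigma>"
abbreviation "Op \<equiv> cl_op b \<Sigma>"

lemma ip_eq: "ip u v = X_ip b (fst u) (fst v) + (\<Sum>j\<le>n. to_complex (cip (\<Sigma> j) (snd u j) (snd v j)))"
  by (simp add: cl_ip_def split_beta)

lemma V_iff: "u \<in> V \<longleftrightarrow> fst u \<in> X_space b \<and> (\<forall>j\<le>n. snd u j \<in> cs j)"
  by (auto simp: cl_space_def mem_Times_iff Pi_iff)

lemma Dom_iff: "u \<in> Dom \<longleftrightarrow> fst u \<in> dom_open b \<and> (\<forall>j\<le>n. snd u j \<in> cs j) \<and>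
    (\<forall>j\<le>n. map_B b (fst u) j = - (cC (\<Sigma> j) (snd u j) + cD (\<Sigma> j) (map_C b (fst u) j)))"
  by (auto simp: cl_dom_def Pi_iff split_beta)

lemma fst_Op: "fst (Op u) = op_max b (fst u)" and snd_Op: "snd (Op u) j = cB (\<Sigma> j) (map_C b (fst u) j) + cA (\<Sigma> j) (snd u j)"
  by (simp_all add: cl_op_def split_beta)

section \<open>Linear structure of the closed loop\<close>

definition comb :: "'k \<Rightarrow> ('k, 'c) state \<Rightarrow> ('k, 'c) state \<Rightarrow> ('k, 'c) state \<Rightarrow> bool" where
  "comb c u v z \<longleftrightarrow> fst z = lc c (fst u) (fst v) \<and> (\<forall>j\<le>n. snd z j = csc j c (snd u j) + snd v j)"

lemma comb_add: "comb 1 u v (u + v)"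
  using vector_space.vector_space_assms(4)[OF ctrl_vs] by (simp add: comb_def lc_def)

lemma comb_diff: "comb (- 1) v u (u - v)"
  unfolding comb_def
proof (intro conjI allI impI)
  fix j assume "j \<le> n"
  then interpret vector_space "csc j" by (rule ctrl_vs)
  show "snd (u - v) j = csc j (- 1) (snd v j) + snd u j" by simp
qed (simp add: lc_def fun_eq_iff vec_eq_iff)

lemma comb_scale: "comb c u 0 (cl_scale \<Sigma> c u)"
  by (simp add: comb_def lc_def cl_scale_def split_beta fun_eq_iff)

lemma Dom_V: "u \<in> Dom \<Longrightarrow> u \<in> V"
  by (auto simp: Dom_iff V_iff dom_open_def dom_max_def)

lemma Op_V: "u \<in> Dom \<Longrightarrow> Op u \<in> V"
  using ctrl_maps(1,3) cs_add by (auto simp: Dom_iff V_iff fst_Op snd_Op dom_open_def intro!: op_max_in)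

lemma Dom_zero: "0 \<in> Dom"
proof -
  have "lc (- 1) 0 0 = (0 :: real \<Rightarrow> 'k ^ 2)" by (auto simp: lc_def fun_eq_iff)
  then have "j \<le> n \<Longrightarrow> map_B b (0 :: real \<Rightarrow> 'k ^ 2) j = 0" "j \<le> n \<Longrightarrow> map_C b (0 :: real \<Rightarrow> 'k ^ 2) j = 0"
    "1 \<le> j \<Longrightarrow> j < n \<Longrightarrow> junction_B0 b (0 :: real \<Rightarrow> 'k ^ 2) j = 0" for j
    using map_lc[OF zero_dom_max zero_dom_max, of j "- 1"] by (simp_all del: zero_fun_apply)
  moreover have "j \<le> n \<Longrightarrow> cD (\<Sigma> j) 0 = 0" "j \<le> n \<Longrightarrow> cC (\<Sigma> j) 0 = 0" for j
  proof -
    assume j: "j \<le> n"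
    interpret vector_space "csc j" by (rule ctrl_vs[OF j])
    show "cD (\<Sigma> j) 0 = 0" using ctrl_maps(6)[OF j, of "- 1" 0 0] by simp
    show "cC (\<Sigma> j) 0 = 0" using ctrl_maps(5)[OF j cs_zero[OF j] cs_zero[OF j], of "- 1"] by simp
  qed
  ultimately show ?thesis using zero_dom_max cs_zero unfolding Dom_iff dom_open_def fst_zero snd_zero
    by (auto simp: zero_fun_def[symmetric] simp del: zero_fun_apply) (simp_all)
qed

text \<open>Working with the relation \<open>comb\<close> treats sums, differences and multiples
  uniformly: these agree with \<open>c u + v\<close> only in the components
  \<open>j \<le> n\<close>, where \<open>csc j\<close> is a vector space scaling.\<close>

lemma comb_V: "comb c u v z \<Longrightarrow> u \<in> V \<Longrightarrow> v \<in> V \<Longrightarrow> z \<in> V"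
  by (auto simp: comb_def V_iff X_space_lc cs_lin)

lemma comb_Dom:
  assumes z: "comb c u v z" and u: "u \<in> Dom" and v: "v \<in> Dom" shows "z \<in> Dom"
  unfolding Dom_iff
proof (intro conjI allI impI)
  have d: "fst u \<in> dom_max b" "fst v \<in> dom_max b" using u v by (auto simp: Dom_iff dom_open_def)
  have f: "fst z = lc c (fst u) (fst v)" using z by (simp add: comb_def)
  show "fst z \<in> dom_open b"
    using dom_max_lc[OF d] map_lc(3)[OF d] u v by (auto simp: f Dom_iff dom_open_def)
  fix j assume j: "j \<le> n"
  have s: "snd z j = csc j c (snd u j) + snd v j" using z j by (simp add: comb_def)
  have c: "snd u j \<in> cs j" "snd v j \<in> cs j" using u v j by (auto simp: Dom_iff)
  show "snd z j \<in> cs j" unfolding s by (rule cs_lin[OF j c])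
  have mb: "map_B b (fst u) j = - (cC (\<Sigma> j) (snd u j) + cD (\<Sigma> j) (map_C b (fst u) j))"
    "map_B b (fst v) j = - (cC (\<Sigma> j) (snd v j) + cD (\<Sigma> j) (map_C b (fst v) j))"
    using u v j by (auto simp: Dom_iff)
  show "map_B b (fst z) j = - (cC (\<Sigma> j) (snd z j) + cD (\<Sigma> j) (map_C b (fst z) j))"
    unfolding f s map_lc(1,2)[OF d j] ctrl_maps(5)[OF j c] ctrl_maps(6)[OF j] mb
    by (simp add: vec_eq_iff algebra_simps)
qed

lemma comb_ip:
  assumes z: "comb c u v z" and u: "u \<in> V" and v: "v \<in> V" and w: "w \<in> V"
  shows "ip z w = to_complex c * ip u w + ip v w"
proof -
  have "(\<Sum>j\<le>n. to_complex (cip (\<Sigma> j) (snd z j) (snd w j))) =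
    (\<Sum>j\<le>n. to_complex c * to_complex (cip (\<Sigma> j) (snd u j) (snd w j)) + to_complex (cip (\<Sigma> j) (snd v j) (snd w j)))"
    using z u v w by (intro sum.cong) (auto simp: comb_def V_iff cip_lin to_complex_add to_complex_mult)
  moreover have "X_ip b (fst z) (fst w) = to_complex c * X_ip b (fst u) (fst w) + X_ip b (fst v) (fst w)"
    using z u v w by (simp add: comb_def V_iff X_ip_lc)
  ultimately show ?thesis by (simp add: ip_eq sum.distrib sum_distrib_left algebra_simps)
qed

lemma comb_Op:
  assumes z: "comb c u v z" and u: "u \<in> Dom" and v: "v \<in> Dom" and w: "w \<in> V"
  shows "ip (Op z) w = to_complex c * ip (Op u) w + ip (Op v) w"
proof -
  have d: "fst u \<in> dom_max b" "fst v \<in> dom_max b" using u v by (auto simp: Dom_iff dom_open_def)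
  have f: "fst z = lc c (fst u) (fst v)" using z by (simp add: comb_def)
  \<comment> \<open>The exact linear combination of \<open>Op u\<close> and \<open>Op v\<close> in
    the beam part; \<open>Op z\<close> differs from it only on a null set.\<close>
  define y where "y = (lc c (op_max b (fst u)) (op_max b (fst v)), snd (Op z))"
  have s: "snd (Op z) j = csc j c (snd (Op u) j) + snd (Op v) j" if j: "j \<le> n" for j
  proof -
    interpret vector_space "csc j" by (rule ctrl_vs[OF j])
    have sz: "snd z j = csc j c (snd u j) + snd v j" using z j by (simp add: comb_def)
    have c: "snd u j \<in> cs j" "snd v j \<in> cs j" using u v j by (auto simp: Dom_iff)
    show ?thesis
      unfolding snd_Op f sz map_lc(2)[OF d j] ctrl_maps(4)[OF j] ctrl_maps(2)[OF j c]
      by (simp add: scale_right_distrib)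
  qed
  have y: "comb c (Op u) (Op v) y" using s by (simp add: comb_def y_def fst_Op)
  have "AE \<zeta> in ioo 0 (len b). fst (Op z) \<zeta> = fst y \<zeta>"
    using op_max_lc[OF d, of c] by (simp add: fst_Op f y_def lc_def)
  then have "X_ip b (fst (Op z)) (fst w) = X_ip b (fst y) (fst w)"
    using w Op_V[OF comb_Dom[OF z u v]] comb_V[OF y Op_V[OF u] Op_V[OF v]] by (intro X_ip_cong) (auto simp: V_iff)
  then have "ip (Op z) w = ip y w" by (simp add: ip_eq y_def)
  then show ?thesis using comb_ip[OF y Op_V[OF u] Op_V[OF v] w] by simp
qed

lemma ip_zero: "w \<in> V \<Longrightarrow> ip 0 w = 0" and ip_Op_zero: "w \<in> V \<Longrightarrow> ip (Op 0) w = 0"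
  using comb_ip[OF comb_diff[of 0 0] Dom_V[OF Dom_zero] Dom_V[OF Dom_zero], of w]
    comb_Op[OF comb_diff[of 0 0] Dom_zero Dom_zero, of w] by simp_all

lemma V_closed:
  "u \<in> V \<Longrightarrow> v \<in> V \<Longrightarrow> u + v \<in> V" "u \<in> V \<Longrightarrow> v \<in> V \<Longrightarrow> u - v \<in> V" "u \<in> V \<Longrightarrow> cl_scale \<Sigma> c u \<in> V"
  using comb_V[OF comb_add] comb_V[OF comb_diff] comb_V[OF comb_scale _ Dom_V[OF Dom_zero]] by blast+

lemma Dom_closed:
  "u \<in> Dom \<Longrightarrow> v \<in> Dom \<Longrightarrow> u + v \<in> Dom" "u \<in> Dom \<Longrightarrow> v \<in> Dom \<Longrightarrow> u - v \<in> Dom" "u \<in> Dom \<Longrightarrow> cl_scale \<Sigma> c u \<in> Dom"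
  using comb_Dom[OF comb_add] comb_Dom[OF comb_diff] comb_Dom[OF comb_scale _ Dom_zero] by blast+

lemma ip_lin:
  "u \<in> V \<Longrightarrow> v \<in> V \<Longrightarrow> w \<in> V \<Longrightarrow> ip (u + v) w = ip u w + ip v w"
  "u \<in> V \<Longrightarrow> v \<in> V \<Longrightarrow> w \<in> V \<Longrightarrow> ip (u - v) w = ip u w - ip v w"
  "u \<in> V \<Longrightarrow> w \<in> V \<Longrightarrow> ip (cl_scale \<Sigma> c u) w = to_complex c * ip u w"
  using comb_ip[OF comb_add] comb_ip[OF comb_diff] comb_ip[OF comb_scale _ Dom_V[OF Dom_zero]] ip_zero by simp_all

lemma ip_Op_lin:
  "u \<in> Dom \<Longrightarrow> v \<in> Dom \<Longrightarrow> w \<in> V \<Longrightarrow> ip (Op (u + v)) w = ip (Op u) w + ip (Op v) w"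
  "u \<in> Dom \<Longrightarrow> v \<in> Dom \<Longrightarrow> w \<in> V \<Longrightarrow> ip (Op (u - v)) w = ip (Op u) w - ip (Op v) w"
  "u \<in> Dom \<Longrightarrow> w \<in> V \<Longrightarrow> ip (Op (cl_scale \<Sigma> c u)) w = to_complex c * ip (Op u) w"
  using comb_Op[OF comb_add] comb_Op[OF comb_diff] comb_Op[OF comb_scale _ Dom_zero] ip_Op_zero by simp_all

lemma cip_sym: "j \<le> n \<Longrightarrow> x \<in> cs j \<Longrightarrow> y \<in> cs j \<Longrightarrow> to_complex (cip (\<Sigma> j) y x) = cnj (to_complex (cip (\<Sigma> j) x y))"
  using ctrl[of j] unfolding is_controller_def inner_product_on_def by blast

lemma cip_pos: "j \<le> n \<Longrightarrow> x \<in> cs j \<Longrightarrow> x \<noteq> 0 \<Longrightarrow> 0 < Re (to_complex (cip (\<Sigma> j) x x))"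
  using ctrl[of j] unfolding is_controller_def inner_product_on_def by blast

lemma cip_zero: "j \<le> n \<Longrightarrow> x \<in> cs j \<Longrightarrow> cip (\<Sigma> j) 0 x = 0"
proof -
  assume j: "j \<le> n" "x \<in> cs j"
  interpret vector_space "csc j" by (rule ctrl_vs[OF j(1)])
  show ?thesis using cip_lin[OF j(1) cs_zero[OF j(1)] cs_zero[OF j(1)] j(2), of "- 1"] by simp
qed

lemma cip_nonneg: "j \<le> n \<Longrightarrow> x \<in> cs j \<Longrightarrow> 0 \<le> Re (to_complex (cip (\<Sigma> j) x x))"
  using cip_pos[of j x] cip_zero[of j x] by (cases "x = 0") auto

lemma ip_sym: "u \<in> V \<Longrightarrow> w \<in> V \<Longrightarrow> ip w u = cnj (ip u w)"
proof -
  assume u: "u \<in> V" and w: "w \<in> V"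
  have "(\<Sum>j\<le>n. to_complex (cip (\<Sigma> j) (snd w j) (snd u j))) = (\<Sum>j\<le>n. cnj (to_complex (cip (\<Sigma> j) (snd u j) (snd w j))))"
    using u w by (intro sum.cong cip_sym) (auto simp: V_iff)
  then show ?thesis unfolding ip_eq X_ip_sym[of "fst w" "fst u"] by (simp only: complex_cnj_add cnj_sum)
qed

lemma Re_ip: "Re (ip u u) = Re (X_ip b (fst u) (fst u)) + (\<Sum>j\<le>n. Re (to_complex (cip (\<Sigma> j) (snd u j) (snd u j))))"
  by (simp add: ip_eq)

lemma ip_nonneg: "u \<in> V \<Longrightarrow> 0 \<le> Re (ip u u)"
  unfolding Re_ip by (intro add_nonneg_nonneg sum_nonneg X_ip_nonneg cip_nonneg) (auto simp: V_iff)

lemma N_sq: "u \<in> V \<Longrightarrow> (N u)\<^sup>2 = Re (ip u u)"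
  by (simp add: cl_norm_def ip_nonneg)

lemma N_0_iff:
  assumes "u \<in> V" shows "N u = 0 \<longleftrightarrow> (AE \<zeta> in ioo 0 (len b). fst u \<zeta> = 0) \<and> (\<forall>j\<le>n. snd u j = 0)"
proof -
  have s: "0 \<le> (\<Sum>j\<le>n. Re (to_complex (cip (\<Sigma> j) (snd u j) (snd u j))))" "0 \<le> Re (X_ip b (fst u) (fst u))"
    using assms by (auto simp: V_iff intro!: sum_nonneg cip_nonneg X_ip_nonneg)
  have "N u = 0 \<longleftrightarrow> Re (X_ip b (fst u) (fst u)) = 0 \<and> (\<Sum>j\<le>n. Re (to_complex (cip (\<Sigma> j) (snd u j) (snd u j)))) = 0"
    using s by (simp add: cl_norm_def Re_ip add_nonneg_eq_0_iff del: Re_sum)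
  also have "(\<Sum>j\<le>n. Re (to_complex (cip (\<Sigma> j) (snd u j) (snd u j)))) = 0 \<longleftrightarrow>
      (\<forall>j\<in>{..n}. Re (to_complex (cip (\<Sigma> j) (snd u j) (snd u j))) = 0)"
    using assms by (intro sum_nonneg_eq_0_iff) (auto simp: V_iff intro!: cip_nonneg)
  also have "\<dots> \<longleftrightarrow> (\<forall>j\<le>n. snd u j = 0)"
    using assms cip_pos cip_zero by (fastforce simp: V_iff)
  also have "Re (X_ip b (fst u) (fst u)) = 0 \<longleftrightarrow> (AE \<zeta> in ioo 0 (len b). fst u \<zeta> = 0)"
    using assms by (intro X_ip_eq_0_iff) (simp add: V_iff)
  finally show ?thesis .
qed

text \<open>Only the real part of the inner product and real scalars are kept. The seminorm is
  unchanged, and the abstract stability theorem covers both scalar fields.\<close>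

sublocale SI: semi_inner "cl_space b \<Sigma>" "\<lambda>r. cl_scale \<Sigma> (of_real r)" "\<lambda>u v. Re (cl_ip b \<Sigma> u v)"
proof
  fix u v w :: "('k, 'c) state" and a :: real
  show "u \<in> V \<Longrightarrow> v \<in> V \<Longrightarrow> u + v \<in> V" "u \<in> V \<Longrightarrow> v \<in> V \<Longrightarrow> u - v \<in> V" "u \<in> V \<Longrightarrow> cl_scale \<Sigma> (of_real a) u \<in> V"
    by (rule V_closed; assumption)+
  show "u \<in> V \<Longrightarrow> v \<in> V \<Longrightarrow> w \<in> V \<Longrightarrow> Re (ip (u + v) w) = Re (ip u w) + Re (ip v w)"
    by (subst ip_lin(1)) auto
  show "u \<in> V \<Longrightarrow> w \<in> V \<Longrightarrow> Re (ip (cl_scale \<Sigma> (of_real a) u) w) = a * Re (ip u w)"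
    by (subst ip_lin(3)) auto
  show "u \<in> V \<Longrightarrow> w \<in> V \<Longrightarrow> Re (ip u w) = Re (ip w u)"
    by (subst ip_sym[of u w]) auto
  show "u \<in> V \<Longrightarrow> 0 \<le> Re (ip u u)"
    by (rule ip_nonneg)
qed

lemma q_eq: "SI.q = N"
  by (simp add: SI.q_def cl_norm_def fun_eq_iff)

section \<open>Norm estimates through coordinates\<close>

lemma parseval:
  assumes j: "j \<le> n" and v: "v \<in> cs j"
  shows "Re (to_complex (cip (\<Sigma> j) v v)) = (\<Sum>\<beta>\<in>Bs j. (norm (cip (\<Sigma> j) v \<beta>))\<^sup>2)"
proof -
  have "cip (\<Sigma> j) ((\<Sum>\<beta>\<in>Bs j. csc j (cip (\<Sigma> j) v \<beta>) \<beta>) + 0) v = (\<Sum>\<beta>\<in>Bs j. cip (\<Sigma> j) v \<beta> * cip (\<Sigma> j) \<beta> v) + cip (\<Sigma> j) 0 v"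
    using j v Bs_sub cs_lin cip_lin cs_zero Bs_fin
    by (intro sum_linear[where P = "\<lambda>x. x \<in> cs j" and F = "\<lambda>x. cip (\<Sigma> j) x v"]) auto
  then have "cip (\<Sigma> j) v v = (\<Sum>\<beta>\<in>Bs j. cip (\<Sigma> j) v \<beta> * cip (\<Sigma> j) \<beta> v)"
    unfolding add_0_right Bs_expand[OF j v] cip_zero[OF j v] .
  moreover have "Re (to_complex (cip (\<Sigma> j) v \<beta> * cip (\<Sigma> j) \<beta> v)) = (norm (cip (\<Sigma> j) v \<beta>))\<^sup>2" if "\<beta> \<in> Bs j" for \<beta>
    unfolding to_complex_mult cip_sym[OF j v Bs_sub[OF j that]] by (rule Re_mult_cnj_self)
  ultimately show ?thesis by simp
qed

definition bounded_state :: "('k, 'c) state \<Rightarrow> real \<Rightarrow> bool" where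
  "bounded_state u Q \<longleftrightarrow> (AE \<zeta> in ioo 0 (len b). \<forall>i. norm (fst u \<zeta> $ i) \<le> Q) \<and> (\<forall>j\<le>n. \<forall>\<beta>\<in>Bs j. norm (cip (\<Sigma> j) (snd u j) \<beta>) \<le> Q)"

text \<open>The energy of a state with all entries at most \<open>Q\<close> is at most
  \<open>(Kst - 1) * Q^2\<close>. The summand 1 ensures \<open>Kst \<ge> 1\<close>, so that this is
  below \<open>(Kst * Q)^2\<close>.\<close>

definition Kst :: real where
  "Kst = 1 + (2 * m1 * len b + (\<Sum>j\<le>n. real (card (Bs j))))"

lemma m1_pos: "0 < m1"
  using coef_bounds[of "len b / 2" 1] m0 len_pos by simp

lemma bounded_state_norm:
  assumes u: "u \<in> V" and "bounded_state u Q" and Q: "0 \<le> Q"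
  shows "N u \<le> Kst * Q"
proof -
  have "Re (ip u u) \<le> 2 * m1 * len b * Q\<^sup>2 + (\<Sum>j\<le>n. real (card (Bs j)) * Q\<^sup>2)"
    unfolding Re_ip
  proof (intro add_mono sum_mono)
    show "Re (X_ip b (fst u) (fst u)) \<le> 2 * m1 * len b * Q\<^sup>2"
      using assms by (intro X_ip_le) (auto simp: V_iff bounded_state_def)
    fix j assume j: "j \<in> {..n}"
    have "(\<Sum>\<beta>\<in>Bs j. (norm (cip (\<Sigma> j) (snd u j) \<beta>))\<^sup>2) \<le> real (card (Bs j)) * Q\<^sup>2"
      using assms j by (intro sum_bounded_above power_mono) (auto simp: bounded_state_def)
    then show "Re (to_complex (cip (\<Sigma> j) (snd u j) (snd u j))) \<le> real (card (Bs j)) * Q\<^sup>2"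
      using parseval[of j "snd u j"] u j by (simp add: V_iff)
  qed
  also have "\<dots> = (Kst - 1) * Q\<^sup>2" by (simp add: Kst_def distrib_right flip: sum_distrib_right)
  also have "\<dots> \<le> Kst * Kst * Q\<^sup>2"
  proof (rule mult_right_mono)
    have "1 \<le> Kst" unfolding Kst_def using m1_pos len_pos by (simp add: sum_nonneg)
    then have "Kst * 1 \<le> Kst * Kst" by (intro mult_left_mono) auto
    then show "Kst - 1 \<le> Kst * Kst" by simp
  qed simp
  also have "\<dots> = (Kst * Q)\<^sup>2" by (simp add: power2_eq_square)
  finally have "(N u)\<^sup>2 \<le> (Kst * Q)\<^sup>2" using N_sq[OF u] by simp
  moreover have "0 \<le> Kst * Q" unfolding Kst_def using m1_pos len_pos Q by (simp add: sum_nonneg)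
  ultimately show ?thesis by (rule power2_le_imp_le)
qed

lemma norm_bounds_data:
  assumes w: "w \<in> V" and s: "0 < s" "N w \<le> s"
  shows "(LINT \<zeta>|ioo 0 (len b). norm (fst w \<zeta> $ i)) \<le> (1 + 1 / m0 + len b) * s"
    and "j \<le> n \<Longrightarrow> \<beta> \<in> Bs j \<Longrightarrow> norm (cip (\<Sigma> j) (snd w j) \<beta>) \<le> (1 + 1 / m0 + len b) * s"
proof -
  have wx: "fst w \<in> X_space b" "\<And>j. j \<le> n \<Longrightarrow> snd w j \<in> cs j" using w by (auto simp: V_iff)
  have sq: "Re (ip w w) \<le> s\<^sup>2" using N_sq[OF w] s power_mono[of "N w" s 2] SI.q_nonneg[OF w] by (simp add: q_eq)
  have c0: "0 \<le> (\<Sum>j\<le>n. Re (to_complex (cip (\<Sigma> j) (snd w j) (snd w j))))"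
    using wx by (intro sum_nonneg cip_nonneg) auto
  have "(LINT \<zeta>|ioo 0 (len b). norm (fst w \<zeta> $ i)) \<le> (1 / m0 + len b) * s"
    using sq c0 s wx by (intro X_integral_le) (auto simp: Re_ip)
  then show "(LINT \<zeta>|ioo 0 (len b). norm (fst w \<zeta> $ i)) \<le> (1 + 1 / m0 + len b) * s"
    using s by (simp add: algebra_simps)
  assume j: "j \<le> n" and \<beta>: "\<beta> \<in> Bs j"
  have nn: "0 \<le> Re (to_complex (cip (\<Sigma> i) (snd w i) (snd w i)))" if "i \<in> {..n}" for i
    using that by (intro cip_nonneg wx(2)) simp_all
  have jn: "j \<in> {..n}" using j by simp
  have 1: "(norm (cip (\<Sigma> j) (snd w j) \<beta>))\<^sup>2 \<le> Re (to_complex (cip (\<Sigma> j) (snd w j) (snd w j)))"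
    unfolding parseval[OF j wx(2)[OF j]]
    by (rule member_le_sum[of \<beta> "Bs j" "\<lambda>\<beta>. (norm (cip (\<Sigma> j) (snd w j) \<beta>))\<^sup>2"]) (use \<beta> Bs_fin[OF j] in auto)
  have 2: "Re (to_complex (cip (\<Sigma> j) (snd w j) (snd w j))) \<le> (\<Sum>j\<le>n. Re (to_complex (cip (\<Sigma> j) (snd w j) (snd w j))))"
    by (rule member_le_sum[of j "{..n}" "\<lambda>j. Re (to_complex (cip (\<Sigma> j) (snd w j) (snd w j)))", OF jn nn]) simp_all
  have 3: "(\<Sum>j\<le>n. Re (to_complex (cip (\<Sigma> j) (snd w j) (snd w j)))) \<le> s\<^sup>2"
    using sq[unfolded Re_ip] X_ip_nonneg[OF wx(1)] by linarith
  have "(norm (cip (\<Sigma> j) (snd w j) \<beta>))\<^sup>2 \<le> s\<^sup>2"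
    using 1 2 3 by linarith
  then have "norm (cip (\<Sigma> j) (snd w j) \<beta>) \<le> s"
    using s(1) by (rule power2_le_imp_le[OF _ less_imp_le])
  moreover have "0 \<le> (1 / m0 + len b) * s" using m0 len_pos s by simp
  ultimately show "norm (cip (\<Sigma> j) (snd w j) \<beta>) \<le> (1 + 1 / m0 + len b) * s" by (simp add: algebra_simps)
qed

text \<open>The operator \<open>\<theta> - A\<close> on pairs, one component at a time.\<close>

definition L :: "(bool \<Rightarrow> bool \<Rightarrow> 'k) \<Rightarrow> (bool \<Rightarrow> ('k, 'c) state) \<Rightarrow> bool \<Rightarrow> ('k, 'c) state" where
  "L \<theta> u p = cl_scale \<Sigma> (\<theta> p True) (u True) + cl_scale \<Sigma> (\<theta> p False) (u False) - Op (u p)"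

lemma L_V: "(\<And>p. u p \<in> Dom) \<Longrightarrow> L \<theta> u p \<in> V"
  unfolding L_def by (intro V_closed Dom_V Op_V)

lemma ip_L:
  assumes "\<And>p. u p \<in> Dom" "w \<in> V"
  shows "ip (L \<theta> u p) w = to_complex (\<theta> p True) * ip (u True) w + to_complex (\<theta> p False) * ip (u False) w - ip (Op (u p)) w"
  unfolding L_def using assms Dom_V Op_V V_closed by (simp add: ip_lin)

lemma ip_L_diff:
  assumes "\<And>p. u p \<in> Dom" "\<And>p. v p \<in> Dom" "w \<in> V"
  shows "ip (L \<theta> (\<lambda>p. u p - v p) p) w = ip (L \<theta> u p) w - ip (L \<theta> v p) w"
  using assms Dom_closed(2) Dom_V by (simp add: ip_L ip_lin ip_Op_lin algebra_simps)

text \<open>Translates the resolvent equation from the seminorm, in which spectra are defined, to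
  the almost everywhere and componentwise form in which it is solved.\<close>

lemma L_null_iff:
  assumes u: "\<And>p. u p \<in> Dom" and U: "U p \<in> V"
  shows "N (L \<theta> u p - U p) = 0 \<longleftrightarrow>
    (AE \<zeta> in ioo 0 (len b). (\<Sum>p'\<in>UNIV. \<theta> p p' *s fst (u p') \<zeta>) - op_max b (fst (u p)) \<zeta> = fst (U p) \<zeta>) \<and>
    (\<forall>j\<le>n. cres \<theta> (\<lambda>p. fst (u p), \<lambda>p. snd (u p)) p j = snd (U p) j)"
proof -
  have 1: "fst (L \<theta> u p - U p) \<zeta> = 0 \<longleftrightarrow> (\<Sum>p'\<in>UNIV. \<theta> p p' *s fst (u p') \<zeta>) - op_max b (fst (u p)) \<zeta> = fst (U p) \<zeta>" for \<zeta>
    by (simp add: L_def cl_scale_def split_beta fst_Op UNIV_bool add.commute)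
  have 2: "snd (L \<theta> u p - U p) j = 0 \<longleftrightarrow> cres \<theta> (\<lambda>p. fst (u p), \<lambda>p. snd (u p)) p j = snd (U p) j" for j
    by (simp add: L_def cl_scale_def split_beta snd_Op cres_def)
  show ?thesis unfolding N_0_iff[OF V_closed(2)[OF L_V[OF u] U]] 1 2 ..
qed

lemma in_dom_iff_Dom: "in_dom u \<longleftrightarrow> (\<forall>p. (fst u p, snd u p) \<in> Dom)"
  by (auto simp: in_dom_def Dom_iff)

definition injective_at :: "(bool \<Rightarrow> bool \<Rightarrow> 'k) \<Rightarrow> bool" where
  "injective_at \<theta> \<longleftrightarrow> (\<forall>u. (\<forall>p. u p \<in> Dom) \<longrightarrow> (\<forall>p. N (L \<theta> u p) = 0) \<longrightarrow> (\<forall>p. N (u p) = 0))"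

text \<open>The solution comes with bounds on its continuous representatives. This is stronger than
  a norm bound and is the source of compactness.\<close>

lemma resolvent_ex:
  assumes inj: "injective_at \<theta>"
  shows "\<exists>K\<ge>0. \<forall>U. (\<forall>p. U p \<in> V) \<longrightarrow> (\<exists>u. (\<forall>p. u p \<in> Dom) \<and> (\<forall>p. N (L \<theta> u p - U p) = 0) \<and>
    (\<forall>s>0. (\<forall>p. N (U p) \<le> s) \<longrightarrow> (\<forall>p. bounded_rep (fst (u p)) (K * s) \<and>
       (\<forall>j\<le>n. \<forall>\<beta>\<in>Bs j. norm (cip (\<Sigma> j) (snd (u p) j) \<beta>) \<le> K * s))))"
proof -
  have "\<forall>p. (AE \<zeta> in ioo 0 (len b). fst u p \<zeta> = 0) \<and> (\<forall>j\<le>n. snd u p j = 0)"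
    if d: "in_dom u" and e: "eqn \<theta> (fst u) (\<lambda>_. 0)" and c: "\<And>p j. j \<le> n \<Longrightarrow> cres \<theta> u p j = 0" for u
  proof -
    define v where "v p = (fst u p, snd u p)" for p
    have v: "v p \<in> Dom" for p using d by (simp add: in_dom_iff_Dom v_def)
    have "N (L \<theta> v p - (\<lambda>_. 0) p) = 0" for p
    proof (subst L_null_iff[where u = v and U = "\<lambda>_. 0", OF v Dom_V[OF Dom_zero]], intro conjI allI impI)
      show "AE \<zeta> in ioo 0 (len b). (\<Sum>p'\<in>UNIV. \<theta> p p' *s fst (v p') \<zeta>) - op_max b (fst (v p)) \<zeta> = fst 0 \<zeta>"
        using e by (simp add: eqn_def v_def)
      show "cres \<theta> (\<lambda>p. fst (v p), \<lambda>p. snd (v p)) p j = snd 0 j" if "j \<le> n" for j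
        using c[OF that] by (simp add: v_def)
    qed
    then have "N (v p) = 0" for p using inj v unfolding injective_at_def by simp
    then show ?thesis using N_0_iff[OF Dom_V[OF v]] by (simp add: v_def)
  qed
  then obtain K where K: "0 \<le> K" and sol: "\<And>w wc. (\<forall>p. w p \<in> X_space b) \<Longrightarrow> (\<forall>p. \<forall>j\<le>n. wc p j \<in> cs j) \<Longrightarrow>
    (\<exists>u. in_dom u \<and> eqn \<theta> (fst u) w \<and> (\<forall>p. \<forall>j\<le>n. cres \<theta> u p j = wc p j) \<and>
      (\<forall>Q. (\<forall>p i. (LINT \<zeta>|ioo 0 (len b). norm (w p \<zeta> $ i)) \<le> Q) \<longrightarrow> (\<forall>p. \<forall>j\<le>n. \<forall>\<beta>\<in>Bs j. norm (cip (\<Sigma> j) (wc p j) \<beta>) \<le> Q) \<longrightarrow>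
        (\<forall>p. bounded_rep (fst u p) (K * Q)) \<and> (\<forall>p. \<forall>j\<le>n. \<forall>\<beta>\<in>Bs j. norm (cip (\<Sigma> j) (snd u p j) \<beta>) \<le> K * Q)))"
    using solvable[of \<theta>] by blast
  define C where "C = 1 + 1 / m0 + len b"
  have C: "0 \<le> C" using m0 len_pos by (simp add: C_def)
  show ?thesis
  proof (intro exI[of _ "K * C"] conjI allI impI)
    show "0 \<le> K * C" using K C by simp
    fix U :: "bool \<Rightarrow> ('k, 'c) state" assume U: "\<forall>p. U p \<in> V"
    obtain u where u: "in_dom u" "eqn \<theta> (fst u) (\<lambda>p. fst (U p))" "\<And>p j. j \<le> n \<Longrightarrow> cres \<theta> u p j = snd (U p) j"
      and bd: "\<And>Q. (\<forall>p i. (LINT \<zeta>|ioo 0 (len b). norm (fst (U p) \<zeta> $ i)) \<le> Q) \<Longrightarrow> (\<forall>p. \<forall>j\<le>n. \<forall>\<beta>\<in>Bs j. norm (cip (\<Sigma> j) (snd (U p) j) \<beta>) \<le> Q) \<Longrightarrow>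
        (\<forall>p. bounded_rep (fst u p) (K * Q)) \<and> (\<forall>p. \<forall>j\<le>n. \<forall>\<beta>\<in>Bs j. norm (cip (\<Sigma> j) (snd u p j) \<beta>) \<le> K * Q)"
      using sol[of "\<lambda>p. fst (U p)" "\<lambda>p. snd (U p)"] U by (auto simp: V_iff)
    define v where "v p = (fst u p, snd u p)" for p
    have v: "v p \<in> Dom" for p using u(1) by (simp add: in_dom_iff_Dom v_def)
    show "\<exists>u. (\<forall>p. u p \<in> Dom) \<and> (\<forall>p. N (L \<theta> u p - U p) = 0) \<and>
      (\<forall>s>0. (\<forall>p. N (U p) \<le> s) \<longrightarrow> (\<forall>p. bounded_rep (fst (u p)) (K * C * s) \<and>
         (\<forall>j\<le>n. \<forall>\<beta>\<in>Bs j. norm (cip (\<Sigma> j) (snd (u p) j) \<beta>) \<le> K * C * s)))"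
    proof (rule exI[of _ v], intro conjI allI impI ballI)
      fix p show "v p \<in> Dom" by (rule v)
      show "N (L \<theta> v p - U p) = 0"
        unfolding L_null_iff[where u = v and U = U, OF v U[rule_format]] using u(2,3) by (simp add: v_def eqn_def)
    next
      fix s p assume s: "0 < s" "\<forall>p. N (U p) \<le> s"
      have "(\<forall>p. bounded_rep (fst u p) (K * (C * s))) \<and> (\<forall>p. \<forall>j\<le>n. \<forall>\<beta>\<in>Bs j. norm (cip (\<Sigma> j) (snd u p j) \<beta>) \<le> K * (C * s))"
        using norm_bounds_data[OF U[rule_format] s(1) s(2)[rule_format]] unfolding C_def by (intro bd) auto
      then show "bounded_rep (fst (v p)) (K * C * s)"
        "\<And>j \<beta>. j \<le> n \<Longrightarrow> \<beta> \<in> Bs j \<Longrightarrow> norm (cip (\<Sigma> j) (snd (v p) j) \<beta>) \<le> K * C * s"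
        by (auto simp: v_def mult.assoc)
    qed
  qed
qed

text \<open>For arbitrary \<open>u\<close> take the bounded solution \<open>v\<close> with the same
  right side. By injectivity \<open>u - v\<close> is null, so \<open>u\<close> inherits the norm
  bound of \<open>v\<close>.\<close>

lemma resolvent_bound:
  assumes inj: "injective_at \<theta>"
  shows "\<exists>K\<ge>0. \<forall>u. (\<forall>p. u p \<in> Dom) \<longrightarrow> (\<forall>p. N (u p) \<le> K * (N (L \<theta> u True) + N (L \<theta> u False)))"
proof -
  from resolvent_ex[OF inj]
  obtain K where K: "0 \<le> K" and sol: "\<forall>U. (\<forall>p. U p \<in> V) \<longrightarrow> (\<exists>u. (\<forall>p. u p \<in> Dom) \<and> (\<forall>p. N (L \<theta> u p - U p) = 0) \<and>
    (\<forall>s>0. (\<forall>p. N (U p) \<le> s) \<longrightarrow> (\<forall>p. bounded_rep (fst (u p)) (K * s) \<and>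
       (\<forall>j\<le>n. \<forall>\<beta>\<in>Bs j. norm (cip (\<Sigma> j) (snd (u p) j) \<beta>) \<le> K * s))))"
    by (elim exE conjE) (rule that)
  define K' where "K' = Kst * (K / m0 + K)"
  have Kst: "0 \<le> Kst" unfolding Kst_def using m1_pos len_pos by (simp add: sum_nonneg)
  have K': "0 \<le> K'" using K Kst m0 by (simp add: K'_def)
  show ?thesis
  proof (intro exI[of _ K'] conjI allI impI)
    fix u and p :: bool assume u: "\<forall>p :: bool. u p \<in> Dom"
    have LV: "L \<theta> u p \<in> V" for p using u by (intro L_V) auto
    have "\<forall>p. L \<theta> u p \<in> V" using LV by simp
    with sol obtain v where v: "\<forall>p. v p \<in> Dom" "\<forall>p. N (L \<theta> v p - L \<theta> u p) = 0"
      and bd: "\<forall>s>0. (\<forall>p. N (L \<theta> u p) \<le> s) \<longrightarrow> (\<forall>p. bounded_rep (fst (v p)) (K * s) \<and>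
       (\<forall>j\<le>n. \<forall>\<beta>\<in>Bs j. norm (cip (\<Sigma> j) (snd (v p) j) \<beta>) \<le> K * s))"
      by (elim allE[of _ "L \<theta> u"] impE exE conjE) (assumption, rule that)
    have d: "u p - v p \<in> Dom" for p using u v by (intro Dom_closed) auto
    have L0: "N (L \<theta> (\<lambda>p. u p - v p) p) = 0" for p
    proof -
      let ?w = "L \<theta> (\<lambda>p. u p - v p) p"
      have wV: "?w \<in> V" by (rule L_V[OF d])
      have "ip ?w ?w = ip (L \<theta> u p) ?w - ip (L \<theta> v p) ?w"
        using u v(1) wV by (intro ip_L_diff) auto
      moreover have "SI.eqv (L \<theta> v p) (L \<theta> u p)"
        using v(2) LV L_V[of v \<theta>] v(1) by (simp add: SI.eqv_iff q_eq)
      then have "Re (ip (L \<theta> v p) ?w) = Re (ip (L \<theta> u p) ?w)" using wV by (rule SI.eqvD)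
      ultimately show ?thesis by (simp add: cl_norm_def)
    qed
    have "N (u p - v p) = 0"
      using inj[unfolded injective_at_def, THEN spec, of "\<lambda>p. u p - v p"] d L0 by simp
    then have eq: "N (u p) = N (v p)"
      using SI.eqv_iff[of "u p" "v p"] SI.q_cong[of "u p" "v p"] Dom_V[of "u p"] Dom_V[of "v p"] u v(1)
      unfolding q_eq by blast
    show "N (u p) \<le> K' * (N (L \<theta> u True) + N (L \<theta> u False))"
    proof (rule field_le_epsilon)
      fix e :: real assume e: "0 < e"
      \<comment> \<open>The right side may be null, but the data estimate needs a positive bound;
        the excess costs at most \<open>e\<close>.\<close>
      define s where "s = N (L \<theta> u True) + N (L \<theta> u False) + e / (K' + 1)"
      have nn: "0 \<le> N (L \<theta> u p)" for p using SI.q_nonneg[OF LV] by (simp add: q_eq)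
      have e': "0 < e / (K' + 1)" using e K' by simp
      have s: "0 < s" using nn[of True] nn[of False] e' unfolding s_def by linarith
      have s': "N (L \<theta> u p) \<le> s" for p
        using nn[of True] nn[of False] e' unfolding s_def by (cases p) auto
      have b: "bounded_rep (fst (v p)) (K * s)" "\<forall>j\<le>n. \<forall>\<beta>\<in>Bs j. norm (cip (\<Sigma> j) (snd (v p) j) \<beta>) \<le> K * s"
        using bd[rule_format, of s p] s s' by auto
      have le: "K * s / m0 \<le> (K / m0 + K) * s" "K * s \<le> (K / m0 + K) * s"
        using K s m0 by (auto simp: algebra_simps)
      have "bounded_state (v p) ((K / m0 + K) * s)"
        unfolding bounded_state_def using bounded_rep_AE[OF b(1)] b(2) le
        by (auto elim!: eventually_mono intro: order_trans)
      then have "N (v p) \<le> Kst * ((K / m0 + K) * s)" using v(1) Dom_V K s m0 by (intro bounded_state_norm) auto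
      also have "\<dots> = K' * (N (L \<theta> u True) + N (L \<theta> u False)) + K' * (e / (K' + 1))"
        by (simp add: K'_def s_def algebra_simps)
      also have "K' * (e / (K' + 1)) \<le> e" using e K' by (simp add: field_simps)
      finally show "N (u p) \<le> K' * (N (L \<theta> u True) + N (L \<theta> u False)) + e" by (simp add: eq)
    qed
  qed (rule K')
qed

end

section \<open>Injectivity in the closed right half plane\<close>

locale closed_loop = loop_ctx b m0 m1 coef \<Sigma> Bs
  for b :: "'k::real_or_complex beam" and m0 m1 coef and \<Sigma> :: "nat \<Rightarrow> ('k, 'c::ab_group_add) controller" and Bs +
  fixes R :: "(real \<Rightarrow> 'k ^ 2) \<Rightarrow> 'k ^ 4" and \<kappa> :: real
  assumes open_loop_passive: "impedance_passive b"
    and controller_passive: "j \<le> n_seg b \<Longrightarrow> \<exists>\<kappa>\<^sub>j>0. \<forall>xc\<in>cspace (\<Sigma> j). \<forall>uc.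
      Re (to_complex (cip (\<Sigma> j) (cA (\<Sigma> j) xc + cB (\<Sigma> j) uc) xc)) \<le>
      Re (ip_vec (cC (\<Sigma> j) xc + cD (\<Sigma> j) uc) uc) - \<kappa>\<^sub>j * (norm (cD (\<Sigma> j) uc))\<^sup>2"
    and kernels: "j \<le> n_seg b \<Longrightarrow> cD (\<Sigma> j) uc = 0 \<Longrightarrow> cB (\<Sigma> j) uc = 0"
    and controller_stable: "j \<le> n_seg b \<Longrightarrow>
      spectrum (cspace (\<Sigma> j)) (cscale (\<Sigma> j)) (cnorm (\<Sigma> j)) (cspace (\<Sigma> j)) (cA (\<Sigma> j)) \<subseteq> {\<mu>. Re \<mu> < 0}"
    and R_map: "R \<in> R_maps b" and \<kappa>_pos: "0 < \<kappa>"
    and R_dissipative: "u \<in> cl_dom b \<Sigma> \<Longrightarrow> Re (cl_ip b \<Sigma> (cl_op b \<Sigma> u) u) \<le> - \<kappa> * (norm (R (fst u)))\<^sup>2"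
begin

lemma ip_vec_minus: "ip_vec (- v) w = - ip_vec v w"
  by (simp add: ip_vec_def sum_negf)

text \<open>Adding up the passivity inequalities of the open loop and of all controllers leaves only the term
  \<open>\<kappa>\<^sub>j |D\<^sub>c Cx|\<^sup>2\<close>.\<close>

lemma feedthrough_zero:
  assumes u: "u \<in> Dom" and e: "0 \<le> Re (ip (Op u) u)" and j: "j \<le> n"
  shows "cD (\<Sigma> j) (map_C b (fst u) j) = 0"
proof -
  define C where "C j = map_C b (fst u) j" for j
  have d: "fst u \<in> dom_open b" "\<And>j. j \<le> n \<Longrightarrow> snd u j \<in> cs j"
    "\<And>j. j \<le> n \<Longrightarrow> map_B b (fst u) j = - (cC (\<Sigma> j) (snd u j) + cD (\<Sigma> j) (C j))"
    using u unfolding Dom_iff C_def by blast+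
  have "\<exists>k. j \<le> n \<longrightarrow> 0 < k \<and> Re (to_complex (cip (\<Sigma> j) (cA (\<Sigma> j) (snd u j) + cB (\<Sigma> j) (C j)) (snd u j))) \<le>
      Re (ip_vec (cC (\<Sigma> j) (snd u j) + cD (\<Sigma> j) (C j)) (C j)) - k * (norm (cD (\<Sigma> j) (C j)))\<^sup>2" for j
    using controller_passive[of j] d(2)[of j] by blast
  then obtain k where k: "\<And>j. j \<le> n \<Longrightarrow> 0 < k j"
    "\<And>j. j \<le> n \<Longrightarrow> Re (to_complex (cip (\<Sigma> j) (cA (\<Sigma> j) (snd u j) + cB (\<Sigma> j) (C j)) (snd u j))) \<le>
      Re (ip_vec (cC (\<Sigma> j) (snd u j) + cD (\<Sigma> j) (C j)) (C j)) - k j * (norm (cD (\<Sigma> j) (C j)))\<^sup>2"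
    by metis
  have "Re (ip (Op u) u) = Re (X_ip b (op_max b (fst u)) (fst u)) +
      (\<Sum>j\<le>n. Re (to_complex (cip (\<Sigma> j) (cA (\<Sigma> j) (snd u j) + cB (\<Sigma> j) (C j)) (snd u j))))"
    by (simp add: ip_eq fst_Op snd_Op C_def add.commute)
  also have "\<dots> \<le> Re (\<Sum>j\<le>n. ip_vec (map_B b (fst u) j) (C j)) +
      (\<Sum>j\<le>n. Re (ip_vec (cC (\<Sigma> j) (snd u j) + cD (\<Sigma> j) (C j)) (C j)) - k j * (norm (cD (\<Sigma> j) (C j)))\<^sup>2)"
  proof (intro add_mono sum_mono)
    show "Re (X_ip b (op_max b (fst u)) (fst u)) \<le> Re (\<Sum>j\<le>n. ip_vec (map_B b (fst u) j) (C j))"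
      using open_loop_passive d(1) unfolding impedance_passive_def C_def by blast
  qed (use k in simp)
  also have "(\<Sum>j\<le>n. ip_vec (map_B b (fst u) j) (C j)) = - (\<Sum>j\<le>n. ip_vec (cC (\<Sigma> j) (snd u j) + cD (\<Sigma> j) (C j)) (C j))"
    unfolding sum_negf[symmetric] ip_vec_minus[symmetric] using d(3) by (intro sum.cong) simp_all
  finally have "(\<Sum>j\<le>n. k j * (norm (cD (\<Sigma> j) (C j)))\<^sup>2) \<le> 0" using e by (simp add: sum_subtractf)
  moreover have "0 \<le> (\<Sum>j\<le>n. k j * (norm (cD (\<Sigma> j) (C j)))\<^sup>2)"
    using k(1) by (intro sum_nonneg mult_nonneg_nonneg) (auto intro: less_imp_le)
  ultimately have "(\<Sum>j\<le>n. k j * (norm (cD (\<Sigma> j) (C j)))\<^sup>2) = 0" by linarith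
  then have "\<forall>j\<in>{..n}. k j * (norm (cD (\<Sigma> j) (C j)))\<^sup>2 = 0"
    using k(1) by (subst (asm) sum_nonneg_eq_0_iff) (auto intro!: mult_nonneg_nonneg intro: less_imp_le)
  then have "k j * (norm (cD (\<Sigma> j) (C j)))\<^sup>2 = 0" using j by blast
  then show ?thesis using k(1)[OF j] by (simp add: C_def)
qed

section \<open>Controllers have no eigenvalues on the imaginary axis\<close>

lemma cnorm_le_0: assumes "j \<le> n" "z \<in> cs j" "cnorm (\<Sigma> j) z \<le> 0" shows "z = 0"
proof (rule ccontr)
  assume "z \<noteq> 0"
  then show False using cip_pos[OF assms(1,2)] assms(3) by (simp add: cnorm_def)
qed

lemma cnorm_0: "j \<le> n \<Longrightarrow> cnorm (\<Sigma> j) 0 = 0"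
  by (simp add: cnorm_def cip_zero cs_zero)

lemma controller_eigenvector_zero:
  assumes U: "range (to_complex :: 'k \<Rightarrow> complex) = UNIV" and j: "j \<le> n" and z: "z \<in> cs j"
    and e: "cA (\<Sigma> j) z = csc j c z" and c: "Re (to_complex c) = 0"
  shows "z = 0"
proof -
  have "inj (to_complex :: 'k \<Rightarrow> complex)" by (rule injI) simp
  then have i: "inv to_complex (to_complex c) = c" by (rule inv_f_f)
  have "to_complex c \<in> complex_resolvent_set (cs j) (\<lambda>\<mu>. csc j (inv to_complex \<mu>)) (cnorm (\<Sigma> j)) (cs j) (cA (\<Sigma> j))"
    using controller_stable[OF j] c U unfolding spectrum_def by auto
  then have "\<exists>M. \<forall>u\<in>cs j. cnorm (\<Sigma> j) u \<le> M * cnorm (\<Sigma> j) (csc j (inv to_complex (to_complex c)) u - cA (\<Sigma> j) u)"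
    unfolding complex_resolvent_set_def by blast
  then obtain M where "\<And>u. u \<in> cs j \<Longrightarrow> cnorm (\<Sigma> j) u \<le> M * cnorm (\<Sigma> j) (csc j c u - cA (\<Sigma> j) u)"
    unfolding i by blast
  from this[OF z] show ?thesis using e cnorm_0[OF j] by (intro cnorm_le_0[OF j z]) simp
qed

text \<open>The hypotheses say that \<open>x + i y\<close> is an eigenvector for
  \<open>i \<beta>\<close>. Over the reals this is read in the complexification, over the complex
  numbers in the space itself.\<close>

lemma controller_rotation_zero:
  assumes j: "j \<le> n" and x: "x \<in> cs j" and y: "y \<in> cs j"
    and ex: "cA (\<Sigma> j) x = csc j (of_real (- \<beta>)) y" and ey: "cA (\<Sigma> j) y = csc j (of_real \<beta>) x"
  shows "x = 0 \<and> y = 0"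
proof (cases "range (to_complex :: 'k \<Rightarrow> complex) = UNIV")
  case U: True
  interpret vector_space "csc j" by (rule ctrl_vs[OF j])
  obtain \<iota> :: 'k where \<iota>: "to_complex \<iota> = \<i>" using U by (metis UNIV_I imageE)
  have "to_complex (\<iota> * \<iota>) = to_complex (- 1 :: 'k)" by (simp add: to_complex_mult \<iota>)
  then have \<iota>2: "\<iota> * \<iota> = - 1" by (simp only: to_complex_inject)
  \<comment> \<open>Over the complex numbers \<open>x\<close> and \<open>y\<close> are themselves
    complex vectors, so \<open>x + \<iota> y = 0\<close> does not separate them. The second
    eigenvector \<open>x - \<iota> y\<close>, for the conjugate eigenvalue, must vanish too.\<close>
  have z: "csc j s y + x = 0" if s: "s = \<iota> \<or> s = - \<iota>" for s
  proof (rule controller_eigenvector_zero[OF U j])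
    show "csc j s y + x \<in> cs j" by (rule cs_lin[OF j y x])
    have s2: "of_real \<beta> * s * s = (of_real (- \<beta>) :: 'k)" using s \<iota>2 by (auto simp: mult.assoc)
    show "cA (\<Sigma> j) (csc j s y + x) = csc j (of_real \<beta> * s) (csc j s y + x)"
      unfolding ctrl_maps(2)[OF j y x] ex ey scale_right_distrib scale_scale s2 by (simp add: mult.commute)
    show "Re (to_complex (of_real \<beta> * s)) = 0" using s \<iota> by (auto simp: to_complex_mult)
  qed
  have "x + x = (csc j \<iota> y + x) + (csc j (- \<iota>) y + x)" by simp
  also have "\<dots> = 0" using z[of \<iota>] z[of "- \<iota>"] by simp
  finally have "csc j 2 x = 0" using scale_left_distrib[of 1 1 x] by simp
  then have x0: "x = 0" by simp
  moreover have "\<iota> \<noteq> 0" using \<iota> by auto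
  ultimately show ?thesis using z[of \<iota>] by simp
next
  case False
  interpret vector_space "csc j" by (rule ctrl_vs[OF j])
  have "\<i> * of_real \<beta> \<in> complex_resolvent_set (cs j \<times> cs j) (complexified_scale (csc j)) (complexified_norm (cnorm (\<Sigma> j)))
      (cs j \<times> cs j) (map_prod (cA (\<Sigma> j)) (cA (\<Sigma> j)))"
    using controller_stable[OF j] False unfolding spectrum_def by auto
  then obtain M where M: "\<And>u. u \<in> cs j \<times> cs j \<Longrightarrow> complexified_norm (cnorm (\<Sigma> j)) u \<le>
      M * complexified_norm (cnorm (\<Sigma> j)) (complexified_scale (csc j) (\<i> * of_real \<beta>) u - map_prod (cA (\<Sigma> j)) (cA (\<Sigma> j)) u)"
    unfolding complex_resolvent_set_def by blast
  have "complexified_norm (cnorm (\<Sigma> j)) (x, y) \<le> M * complexified_norm (cnorm (\<Sigma> j)) (0, 0)"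
    using M[of "(x, y)"] x y by (simp add: complexified_scale_def ex ey zero_prod_def)
  then have "sqrt ((cnorm (\<Sigma> j) x)\<^sup>2 + (cnorm (\<Sigma> j) y)\<^sup>2) \<le> 0" by (simp add: complexified_norm_def cnorm_0[OF j])
  then have "(cnorm (\<Sigma> j) x)\<^sup>2 + (cnorm (\<Sigma> j) y)\<^sup>2 \<le> 0" by simp
  then have "(cnorm (\<Sigma> j) x)\<^sup>2 = 0 \<and> (cnorm (\<Sigma> j) y)\<^sup>2 = 0"
    using zero_le_power2[of "cnorm (\<Sigma> j) x"] zero_le_power2[of "cnorm (\<Sigma> j) y"] by linarith
  then show ?thesis using cnorm_le_0[OF j x] cnorm_le_0[OF j y] by simp
qed

text \<open>Multiplication by \<open>a + i \<beta>\<close> on pairs of a real part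
  \<open>True\<close> and an imaginary part \<open>False\<close>.\<close>

definition rot :: "real \<Rightarrow> real \<Rightarrow> bool \<Rightarrow> bool \<Rightarrow> 'k" where
  "rot a \<beta> p p' = of_real (if p = p' then a else if p then - \<beta> else \<beta>)"

lemma dissip: "u \<in> Dom \<Longrightarrow> Re (ip (Op u) u) \<le> 0"
  using R_dissipative[of u] \<kappa>_pos mult_nonneg_nonneg[OF less_imp_le[OF \<kappa>_pos] zero_le_power2[of "norm (R (fst u))"]]
  unfolding mult_minus_left by linarith

text \<open>Pairing each component of the equation with the same component of \<open>u\<close>
  produces cross terms with factor \<open>\<beta>\<close> that cancel in the sum. What is left are
  nonnegative terms on one side and nonpositive ones on the other.\<close>

lemma rot_energy:
  assumes a: "0 \<le> a" and u: "\<And>p. u p \<in> Dom" and L0: "\<And>p. N (L (rot a \<beta>) u p) = 0"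
  shows "a * (N (u p))\<^sup>2 = 0" "Re (ip (Op (u p)) (u p)) = 0"
proof -
  have uV: "u p \<in> V" for p using u Dom_V by blast
  have LV: "L (rot a \<beta>) u p \<in> V" for p by (rule L_V[OF u])
  have L: "Re (ip (L (rot a \<beta>) u p) (u p)) = 0" for p
    using SI.Cauchy_Schwarz[OF LV uV, of p p] L0 by (simp add: q_eq)
  have sym: "Re (ip (u False) (u True)) = Re (ip (u True) (u False))"
    by (rule SI.ip_sym[OF uV uV])
  have T: "a * (N (u True))\<^sup>2 - \<beta> * Re (ip (u True) (u False)) = Re (ip (Op (u True)) (u True))"
    using L[of True] ip_L[OF u uV[of True], where \<theta> = "rot a \<beta>" and p = True] by (simp add: rot_def N_sq[OF uV] sym)
  have F: "a * (N (u False))\<^sup>2 + \<beta> * Re (ip (u True) (u False)) = Re (ip (Op (u False)) (u False))"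
    using L[of False] ip_L[OF u uV[of False], where \<theta> = "rot a \<beta>" and p = False] by (simp add: rot_def N_sq[OF uV])
  have nn: "0 \<le> a * (N (u p))\<^sup>2" for p using a by simp
  have "a * (N (u True))\<^sup>2 = 0" "a * (N (u False))\<^sup>2 = 0"
    "Re (ip (Op (u True)) (u True)) = 0" "Re (ip (Op (u False)) (u False)) = 0"
    using T F nn[of True] nn[of False] dissip[OF u, of True] dissip[OF u, of False] by linarith+
  then show "a * (N (u p))\<^sup>2 = 0" "Re (ip (Op (u p)) (u p)) = 0"
    by (cases p; simp only:)+
qed

text \<open>For each of the four junction types the two maps together contain all four
  jumps.\<close>

lemma jumps_zero:
  assumes "junction_B0 b x j = 0" "junction_B b x j = 0" "k = 0 \<or> k = 1"
  shows "val_left b k x j = val_right b k x j"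
proof -
  have z: "vector [s, t] = (0 :: 'k ^ 2) \<longleftrightarrow> s = 0 \<and> t = 0" for s t by (simp add: vec_eq_iff forall_2)
  have "jump b k x j $ i = 0" for i
    using assms exhaust_2[of i] unfolding junction_B0_def junction_B_def
    by (cases "junction b j") (auto simp: z simp del: One_nat_def)
  then show ?thesis by (simp add: jump_def vec_eq_iff)
qed

theorem rotation_injective:
  assumes a: "0 \<le> a" shows "injective_at (rot a \<beta>)"
  unfolding injective_at_def
proof (intro allI impI)
  fix u :: "bool \<Rightarrow> ('k, 'c) state" and p :: bool
  assume u: "\<forall>p. u p \<in> Dom" and L0: "\<forall>p. N (L (rot a \<beta>) u p) = 0"
  have en: "a * (N (u p))\<^sup>2 = 0" "Re (ip (Op (u p)) (u p)) = 0" for p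
    using rot_energy[OF a, of u \<beta> p] u L0 by auto
  show "N (u p) = 0"
  proof (cases "a = 0")
    case False
    then show ?thesis using en(1)[of p] by simp
  next
    case True
    have d: "fst (u p) \<in> dom_open b" "\<And>j. j \<le> n \<Longrightarrow> snd (u p) j \<in> cs j"
      "\<And>j. j \<le> n \<Longrightarrow> map_B b (fst (u p)) j = - (cC (\<Sigma> j) (snd (u p) j) + cD (\<Sigma> j) (map_C b (fst (u p)) j))" for p
      using u unfolding Dom_iff by blast+
    \<comment> \<open>For \<open>a = 0\<close> the energy balance leaves no dissipation at all, the
      hypothesis of \<open>feedthrough_zero\<close>.\<close>
    have D0: "cD (\<Sigma> j) (map_C b (fst (u p)) j) = 0" if "j \<le> n" for j p
      using feedthrough_zero[of "u p" j] u en(2)[of p] that by simp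
    have "N (L (rot 0 \<beta>) u p - (\<lambda>_. 0) p) = 0" for p using L0 True by simp
    then have null: "(AE \<zeta> in ioo 0 (len b). (\<Sum>p'\<in>UNIV. rot 0 \<beta> p p' *s fst (u p') \<zeta>) - op_max b (fst (u p)) \<zeta> = 0)"
      "\<And>j. j \<le> n \<Longrightarrow> cres (rot 0 \<beta>) (\<lambda>p. fst (u p), \<lambda>p. snd (u p)) p j = 0" for p
      using L_null_iff[where u = u and U = "\<lambda>_. 0" and p = p and \<theta> = "rot 0 \<beta>"] u Dom_V[OF Dom_zero] by (auto simp: fst_zero snd_zero)
    \<comment> \<open>With \<open>D C x = 0\<close> also \<open>B C x = 0\<close>, and the
      controller equation becomes the homogeneous rotation system.\<close>
    have xc: "snd (u p) j = 0" if j: "j \<le> n" for p j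
    proof -
      interpret vector_space "csc j" by (rule ctrl_vs[OF j])
      have "cA (\<Sigma> j) (snd (u True) j) = csc j (of_real (- \<beta>)) (snd (u False) j)"
        "cA (\<Sigma> j) (snd (u False) j) = csc j (of_real \<beta>) (snd (u True) j)"
        using null(2)[OF j, of True] null(2)[OF j, of False] kernels[OF j D0[OF j]] by (simp_all add: cres_def rot_def)
      from controller_rotation_zero[OF j d(2)[OF j] d(2)[OF j] this] show ?thesis by (cases p) auto
    qed
    have B0: "map_B b (fst (u p)) j = 0" if j: "j \<le> n" for p j
    proof -
      interpret vector_space "csc j" by (rule ctrl_vs[OF j])
      have "cC (\<Sigma> j) 0 = 0" using ctrl_maps(5)[OF j cs_zero[OF j] cs_zero[OF j], of "- 1"] by simp
      then show ?thesis using d(3)[OF j, of p] xc[OF j, of p] D0[OF j, of p] by simp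
    qed
    have v: "val_left b k (fst (u p)) j = val_right b k (fst (u p)) j" if "j \<in> {1..<n}" "k \<in> {0, 1}" for j k p
      using jumps_zero[of "fst (u p)" j k] d(1)[of p] B0[of j p] that by (auto simp: dom_open_def map_B_def)
    have "undamped \<beta> (fst (u True)) (fst (u False))"
      unfolding undamped_def
    proof (intro conjI ballI)
      show "fst (u True) \<in> dom_max b" "fst (u False) \<in> dom_max b" using d(1) by (auto simp: dom_open_def)
      show "AE \<zeta> in ioo 0 (len b). op_max b (fst (u True)) \<zeta> = - (\<beta> *\<^sub>R fst (u False) \<zeta>)"
        using null(1)[of True] by eventually_elim (simp add: UNIV_bool rot_def vec_eq_iff scaleR_conv_of_real[where 'a = 'k])
      show "AE \<zeta> in ioo 0 (len b). op_max b (fst (u False)) \<zeta> = \<beta> *\<^sub>R fst (u True) \<zeta>"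
        using null(1)[of False] by eventually_elim (simp add: UNIV_bool rot_def vec_eq_iff scaleR_conv_of_real[where 'a = 'k])
    qed (use v in blast)+
    moreover have "R (fst (u p)) = 0" for p
    proof -
      have "\<kappa> * (norm (R (fst (u p))))\<^sup>2 \<le> 0" using R_dissipative[of "u p"] u en(2)[of p] by simp
      then show ?thesis using \<kappa>_pos by (simp add: mult_le_0_iff)
    qed
    ultimately have "AE \<zeta> in ioo 0 (len b). fst (u True) \<zeta> = 0 \<and> fst (u False) \<zeta> = 0"
      by (intro undamped_observed_zero[OF _ R_map])
    then have "AE \<zeta> in ioo 0 (len b). fst (u p) \<zeta> = 0" by (cases p) (auto elim: eventually_mono)
    then show ?thesis using N_0_iff[OF Dom_V, of "u p"] u xc by simp
  qed
qed

end

section \<open>Compactness\<close>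

text \<open>Successive extraction; the second hypothesis on \<open>P\<close> keeps what has already
  been achieved.\<close>

lemma finite_common_subsequence:
  fixes P :: "'j \<Rightarrow> (nat \<Rightarrow> nat) \<Rightarrow> bool"
  assumes "finite J"
    and ex: "\<And>j (r :: nat \<Rightarrow> nat). j \<in> J \<Longrightarrow> strict_mono r \<Longrightarrow> \<exists>r'. strict_mono r' \<and> P j (r \<circ> r')"
    and sub: "\<And>j (r :: nat \<Rightarrow> nat) r'. j \<in> J \<Longrightarrow> P j r \<Longrightarrow> strict_mono r' \<Longrightarrow> P j (r \<circ> r')"
  shows "\<exists>r :: nat \<Rightarrow> nat. strict_mono r \<and> (\<forall>j\<in>J. P j r)"
  using assms
proof (induction J rule: finite_induct)
  case empty
  show ?case by (intro exI[of _ id]) (simp add: strict_mono_def)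
next
  case (insert j J)
  then obtain r where r: "strict_mono r" "\<And>i. i \<in> J \<Longrightarrow> P i r" by auto
  obtain r' where r': "strict_mono r'" "P j (r \<circ> r')" using insert.prems(1)[OF insertI1 r(1)] by blast
  show ?case
  proof (intro exI[of _ "r \<circ> r'"] conjI ballI)
    show "strict_mono (r \<circ> r')" by (rule strict_mono_o[OF r(1) r'(1)])
    fix i assume "i \<in> insert j J"
    then show "P i (r \<circ> r')" using r'(2) insert.prems(2)[OF _ r(2) r'(1)] by blast
  qed
qed

text \<open>The real numbers are closed in the complex plane. Hence compactness is obtained for
  complex values and pulled back to the scalar field.\<close>

lemma to_complex_limit:
  assumes "\<And>n::nat. X n = to_complex (x n :: 'k::real_or_complex)" "X \<longlonglongrightarrow> z"
  shows "z \<in> range (to_complex :: 'k \<Rightarrow> complex)"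
proof -
  have "closed (range (to_complex :: 'k \<Rightarrow> complex))"
    using range_to_complex[where 'a = 'k] closed_complex_Reals by auto
  then show ?thesis by (rule closed_sequentially[OF _ _ assms(2)]) (use assms(1) in auto)
qed

lemma bounded_subsequence_converges:
  fixes x :: "nat \<Rightarrow> 'k::real_or_complex"
  assumes "\<And>n. norm (x n) \<le> Q"
  shows "\<exists>r c. strict_mono r \<and> (\<lambda>n. x (r n)) \<longlonglongrightarrow> c"
proof -
  have "bounded (range (\<lambda>n. to_complex (x n)))"
    using assms by (auto simp: bounded_iff norm_to_complex)
  then obtain z r where r: "strict_mono r" "((\<lambda>n. to_complex (x n)) \<circ> r) \<longlonglongrightarrow> z"
    using bounded_imp_convergent_subsequence by blast
  have z: "(\<lambda>n. to_complex (x (r n))) \<longlonglongrightarrow> z" using r(2) by (simp only: comp_def)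
  from to_complex_limit[OF refl this] obtain c :: 'k where c: "z = to_complex c" by (rule rangeE)
  have "(\<lambda>n. norm (to_complex (x (r n) - c))) \<longlonglongrightarrow> 0"
    using tendsto_norm_zero[OF LIM_zero[OF z]] by (simp only: c to_complex_diff)
  then have "(\<lambda>n. x (r n) - c) \<longlonglongrightarrow> 0"
    unfolding norm_to_complex by (rule tendsto_norm_zero_cancel)
  then have "(\<lambda>n. x (r n)) \<longlonglongrightarrow> c" by (rule LIM_zero_cancel)
  with r(1) show ?thesis by (intro exI conjI)
qed

lemma equilipschitz_subsequence_converges:
  fixes h :: "nat \<Rightarrow> real \<Rightarrow> 'k::real_or_complex"
  assumes bd: "\<And>n t. t \<in> {a..b} \<Longrightarrow> norm (h n t) \<le> Q"
    and lip: "\<And>n s t. s \<in> {a..b} \<Longrightarrow> t \<in> {a..b} \<Longrightarrow> norm (h n s - h n t) \<le> Q * \<bar>s - t\<bar>"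
  shows "\<exists>r g. strict_mono r \<and> continuous_on {a..b} g \<and> (\<forall>e>0. \<forall>\<^sub>F n in sequentially. \<forall>t\<in>{a..b}. norm (h (r n) t - g t) < e)"
proof -
  obtain G r where G: "continuous_on {a..b} G" "strict_mono (r :: nat \<Rightarrow> nat)"
    "\<And>e. 0 < e \<Longrightarrow> \<exists>N. \<forall>n t. n \<ge> N \<and> t \<in> {a..b} \<longrightarrow> norm (to_complex (h (r n) t) - G t) < e"
  proof (rule Arzela_Ascoli[of "{a..b}" "\<lambda>n t. to_complex (h n t)" Q])
    show "norm (to_complex (h n t)) \<le> Q" if "t \<in> {a..b}" for n t
      using bd[OF that] by (simp add: norm_to_complex)
    fix t e :: real assume t: "t \<in> {a..b}" and e: "0 < e"
    show "\<exists>d>0. \<forall>n y. y \<in> {a..b} \<and> norm (t - y) < d \<longrightarrow> norm (to_complex (h n t) - to_complex (h n y)) < e"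
    proof (intro exI[of _ "e / (\<bar>Q\<bar> + 1)"] conjI allI impI)
      fix n y assume y: "y \<in> {a..b} \<and> norm (t - y) < e / (\<bar>Q\<bar> + 1)"
      have "norm (h n t - h n y) \<le> Q * \<bar>t - y\<bar>" using lip t y by blast
      also have "\<dots> \<le> (\<bar>Q\<bar> + 1) * \<bar>t - y\<bar>" by (intro mult_right_mono) auto
      also have "\<dots> < e" using y by (simp add: field_simps)
      finally show "norm (to_complex (h n t) - to_complex (h n y)) < e"
        unfolding to_complex_diff[symmetric] norm_to_complex .
    qed (use e in simp)
  qed (simp, rule that, assumption+)
  define g :: "real \<Rightarrow> 'k" where "g t = inv to_complex (G t)" for t
  have Gg: "G t = to_complex (g t)" if t: "t \<in> {a..b}" for t
  proof -
    have "(\<lambda>n. to_complex (h (r n) t)) \<longlonglongrightarrow> G t"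
      unfolding LIMSEQ_iff using G(3) t by blast
    then have "G t \<in> range (to_complex :: 'k \<Rightarrow> complex)" by (rule to_complex_limit[rotated]) simp
    then show ?thesis by (simp add: g_def f_inv_into_f)
  qed
  have nd: "norm (u - v) = norm (to_complex u - to_complex (v :: 'k))" for u v
    unfolding to_complex_diff[symmetric] norm_to_complex ..
  have "continuous_on {a..b} g"
    using G(1) unfolding continuous_on_iff dist_norm nd using Gg by simp
  moreover have "\<forall>\<^sub>F n in sequentially. \<forall>t\<in>{a..b}. norm (h (r n) t - g t) < e" if e: "0 < e" for e
  proof -
    from G(3)[OF e] obtain N where "\<forall>n t. n \<ge> N \<and> t \<in> {a..b} \<longrightarrow> norm (to_complex (h (r n) t) - G t) < e" by blast
    then show ?thesis unfolding eventually_sequentially by (intro exI[of _ N]) (simp add: nd Gg del: to_complex_diff)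
  qed
  ultimately show ?thesis using G(2) by blast
qed

context beam_ctx
begin

text \<open>\<open>h\<close> is a primitive of \<open>h1\<close>, whose bound \<open>Q\<close> is
  therefore a Lipschitz constant.\<close>

lemma bounded_rep_Lipschitz:
  assumes "bounded_rep x Q" "j < n"
  shows "\<exists>h. (AE \<zeta> in seg j. co_energy b x \<zeta> $ i = h \<zeta>) \<and> (\<forall>t\<in>{nd j..nd (Suc j)}. norm (h t) \<le> Q) \<and>
    (\<forall>s\<in>{nd j..nd (Suc j)}. \<forall>t\<in>{nd j..nd (Suc j)}. norm (h s - h t) \<le> Q * \<bar>s - t\<bar>)"
proof -
  obtain h h1 h2 where h: "seg_rep x j i h h1 h2" and bd: "\<forall>t\<in>{nd j..nd (Suc j)}. norm (h t) \<le> Q \<and> norm (h1 t) \<le> Q"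
    using assms unfolding bounded_rep_def by blast
  have r: "rep2 (nd j) (nd (Suc j)) (\<lambda>\<zeta>. co_energy b x \<zeta> $ i) h h1 h2" using h by (simp add: seg_rep_def)
  have c1: "integrable (seg j) h1" using rep2_continuous(2)[OF r] by (rule integrable_continuous_ioo)
  have p: "prim (nd j) h1 t = h t - h (nd j)" if "t \<in> {nd j..nd (Suc j)}" for t
    using r that unfolding rep2_def by simp
  have le: "norm (h t - h s) \<le> Q * (t - s)" if "s \<in> {nd j..nd (Suc j)}" "t \<in> {nd j..nd (Suc j)}" "s \<le> t" for s t
  proof -
    have "h t - h s = prim s h1 t" using prim_split[OF c1, of s t] p[of s] p[of t] that by simp
    then show ?thesis using norm_prim_le[OF c1, of s t Q] bd that by auto
  qed
  have "norm (h s - h t) \<le> Q * \<bar>s - t\<bar>" if "s \<in> {nd j..nd (Suc j)}" "t \<in> {nd j..nd (Suc j)}" for s t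
  proof (cases "s \<le> t")
    case True
    then show ?thesis using le[of s t] that by (simp add: norm_minus_commute)
  next
    case False
    then show ?thesis using le[of t s] that by simp
  qed
  then show ?thesis using r bd unfolding rep2_def by (intro exI[of _ h]) simp
qed

text \<open>Arzela-Ascoli on each segment and for each component, along a common subsequence. The
  limit of the co-energies is uniform, and division by \<open>coef\<close> costs the factor
  \<open>1 / m0\<close>. The limit is only claimed to lie in \<open>X_space\<close>, which is all
  that compactness demands.\<close>

lemma bounded_rep_subsequence_converges:
  assumes bd: "\<And>k::nat. bounded_rep (x k) Q"
  shows "\<exists>r z. strict_mono r \<and> z \<in> X_space b \<and>
    (\<forall>e>0. \<forall>\<^sub>F k in sequentially. AE \<zeta> in ioo 0 (len b). \<forall>i. norm (x (r k) \<zeta> $ i - z \<zeta> $ i) \<le> e)"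
proof -
  define LP where "LP k j i h \<longleftrightarrow> (AE \<zeta> in seg j. co_energy b (x k) \<zeta> $ i = h \<zeta>) \<and> (\<forall>t\<in>{nd j..nd (Suc j)}. norm (h t) \<le> Q) \<and>
    (\<forall>s\<in>{nd j..nd (Suc j)}. \<forall>t\<in>{nd j..nd (Suc j)}. norm (h s - h t) \<le> Q * \<bar>s - t\<bar>)"
    for k :: nat and j :: nat and i :: 2 and h :: "real \<Rightarrow> 'k"
  \<comment> \<open>Representatives are fixed once and for all, so that passing to subsequences does
    not change them.\<close>
  define h where "h k j i = (SOME h. LP k j i h)" for k j i
  have "LP k j i (h k j i)" if "j < n" for k j i
    unfolding h_def by (rule someI_ex[of "LP k j i"]) (use bounded_rep_Lipschitz[OF bd that] in \<open>simp only: LP_def\<close>)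
  then have h: "\<And>k j i. j < n \<Longrightarrow> AE \<zeta> in seg j. co_energy b (x k) \<zeta> $ i = h k j i \<zeta>"
    "\<And>k j i t. j < n \<Longrightarrow> t \<in> {nd j..nd (Suc j)} \<Longrightarrow> norm (h k j i t) \<le> Q"
    "\<And>k j i s t. j < n \<Longrightarrow> s \<in> {nd j..nd (Suc j)} \<Longrightarrow> t \<in> {nd j..nd (Suc j)} \<Longrightarrow> norm (h k j i s - h k j i t) \<le> Q * \<bar>s - t\<bar>"
    unfolding LP_def by blast+
  define P where "P ji r \<longleftrightarrow> (\<exists>g. continuous_on {nd (fst ji)..nd (Suc (fst ji))} g \<and>
    (\<forall>e>0. \<forall>\<^sub>F k in sequentially. \<forall>t\<in>{nd (fst ji)..nd (Suc (fst ji))}. norm (h (r k) (fst ji) (snd ji) t - g t) < e))"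
    for ji :: "nat \<times> 2" and r :: "nat \<Rightarrow> nat"
  have "\<exists>r. strict_mono r \<and> (\<forall>ji\<in>{..<n} \<times> UNIV. P ji r)"
  proof (rule finite_common_subsequence)
    fix ji :: "nat \<times> 2" and r :: "nat \<Rightarrow> nat" assume ji: "ji \<in> {..<n} \<times> UNIV"
    have j: "fst ji < n" using ji by auto
    show "\<exists>r'. strict_mono r' \<and> P ji (r \<circ> r')"
      using equilipschitz_subsequence_converges[of "nd (fst ji)" "nd (Suc (fst ji))" "\<lambda>k. h (r k) (fst ji) (snd ji)" Q, OF h(2)[OF j] h(3)[OF j]]
      unfolding P_def comp_def by blast
    fix r' :: "nat \<Rightarrow> nat" assume "P ji r" "strict_mono r'"
    then obtain g where g: "continuous_on {nd (fst ji)..nd (Suc (fst ji))} g"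
      "\<And>e. 0 < e \<Longrightarrow> \<forall>\<^sub>F k in sequentially. \<forall>t\<in>{nd (fst ji)..nd (Suc (fst ji))}. norm (h (r k) (fst ji) (snd ji) t - g t) < e"
      unfolding P_def by blast
    show "P ji (r \<circ> r')"
      unfolding P_def comp_def using g(1) eventually_subseq[OF \<open>strict_mono r'\<close> g(2)] by blast
  qed simp
  then obtain r where r: "strict_mono r" "\<And>j i. j < n \<Longrightarrow> P (j, i) r" by auto
  define PG where "PG j i g \<longleftrightarrow> continuous_on {nd j..nd (Suc j)} g \<and>
    (\<forall>e>0. \<forall>\<^sub>F k in sequentially. \<forall>t\<in>{nd j..nd (Suc j)}. norm (h (r k) j i t - g t) < e)"
    for j :: nat and i :: 2 and g :: "real \<Rightarrow> 'k"
  define g where "g j i = (SOME g. PG j i g)" for j i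
  have "PG j i (g j i)" if "j < n" for j i
    unfolding g_def by (rule someI_ex[of "PG j i"]) (use r(2)[OF that, of i] in \<open>simp only: P_def PG_def fst_conv snd_conv\<close>)
  then have g: "\<And>j i. j < n \<Longrightarrow> continuous_on {nd j..nd (Suc j)} (g j i)"
    "\<And>j i e. j < n \<Longrightarrow> 0 < e \<Longrightarrow> \<forall>\<^sub>F k in sequentially. \<forall>t\<in>{nd j..nd (Suc j)}. norm (h (r k) j i t - g j i t) < e"
    unfolding PG_def by blast+
  define z where "z \<zeta> = (\<chi> i. \<Sum>j<n. indicator {nd j<..<nd (Suc j)} \<zeta> *\<^sub>R ((1 / coef i \<zeta>) *\<^sub>R g j i \<zeta>))" for \<zeta>
  have zseg: "z \<zeta> $ i = (1 / coef i \<zeta>) *\<^sub>R g j i \<zeta>" if "j < n" "\<zeta> \<in> {nd j<..<nd (Suc j)}" for j \<zeta> i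
    using seg_sum[OF that, of "\<lambda>j. (1 / coef i \<zeta>) *\<^sub>R g j i \<zeta>"] by (simp only: z_def vec_lambda_beta)
  have zX: "z \<in> X_space b"
    unfolding X_space_coord
  proof (intro allI L2_segs)
    fix i j assume j: "j < n"
    have "L2_on (nd j) (nd (Suc j)) (\<lambda>\<zeta>. (1 / coef i \<zeta>) *\<^sub>R g j i \<zeta>)"
    proof (rule L2_scaleR_bounded[where C = "1 / m0"])
      show "L2_on (nd j) (nd (Suc j)) (g j i)" by (rule L2_continuous[OF g(1)[OF j]])
      show "(\<lambda>\<zeta>. 1 / coef i \<zeta>) \<in> borel_measurable (seg j)" using coef_measurable_seg[OF j, of i] by measurable
      show "\<bar>1 / coef i \<zeta>\<bar> \<le> 1 / m0" if "\<zeta> \<in> {nd j<..<nd (Suc j)}" for \<zeta>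
        using coef_bounds[OF seg_in[OF j that], of i] m0 by (simp add: frac_le)
    qed
    then show "L2_on (nd j) (nd (Suc j)) (\<lambda>\<zeta>. z \<zeta> $ i)"
      by (subst L2_cong[OF zseg[OF j]]) simp_all
  qed
  have "\<forall>\<^sub>F k in sequentially. AE \<zeta> in ioo 0 (len b). \<forall>i. norm (x (r k) \<zeta> $ i - z \<zeta> $ i) \<le> e" if e: "0 < e" for e
  proof -
    have "\<forall>\<^sub>F k in sequentially. \<forall>j\<in>{..<n}. \<forall>i\<in>(UNIV :: 2 set). \<forall>t\<in>{nd j..nd (Suc j)}. norm (h (r k) j i t - g j i t) < m0 * e"
      using m0 e by (intro eventually_ball_finite ballI g(2)) auto
    then show ?thesis
    proof (rule eventually_mono)
      fix k assume k: "\<forall>j\<in>{..<n}. \<forall>i\<in>(UNIV :: 2 set). \<forall>t\<in>{nd j..nd (Suc j)}. norm (h (r k) j i t - g j i t) < m0 * e"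
      have "AE \<zeta> in ioo 0 (len b). norm (x (r k) \<zeta> $ i - z \<zeta> $ i) \<le> e" for i
      proof (rule AE_segs)
        fix j assume j: "j < n"
        show "AE \<zeta> in seg j. norm (x (r k) \<zeta> $ i - z \<zeta> $ i) \<le> e"
          using h(1)[OF j, of "r k" i]
        proof (rule lebesgue_on_mono)
          fix \<zeta> assume c: "co_energy b (x (r k)) \<zeta> $ i = h (r k) j i \<zeta>" and \<zeta>: "\<zeta> \<in> {nd j<..<nd (Suc j)}"
          have cf: "m0 \<le> coef i \<zeta>" "0 < coef i \<zeta>" using coef_bounds[OF seg_in[OF j \<zeta>], of i] m0 by auto
          have "x (r k) \<zeta> $ i = (1 / coef i \<zeta>) *\<^sub>R h (r k) j i \<zeta>"
            using c cf by (simp add: co_energy_coef flip: c)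
          then have "norm (x (r k) \<zeta> $ i - z \<zeta> $ i) = (1 / coef i \<zeta>) * norm (h (r k) j i \<zeta> - g j i \<zeta>)"
            using cf by (simp add: zseg[OF j \<zeta>] flip: scaleR_diff_right)
          also have "\<dots> \<le> (1 / m0) * (m0 * e)"
            using k j \<zeta> cf m0 e by (intro mult_mono) (auto simp: frac_le intro!: less_imp_le)
          finally show "norm (x (r k) \<zeta> $ i - z \<zeta> $ i) \<le> e" using m0 by simp
        qed
      qed
      then show "AE \<zeta> in ioo 0 (len b). \<forall>i. norm (x (r k) \<zeta> $ i - z \<zeta> $ i) \<le> e" by (simp add: forall_2)
    qed
  qed
  then show ?thesis using r(1) zX by blast
qed

end

context loop_ctx
begin

section \<open>Null states and convergent subsequences of states\<close>

lemma null_ip: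
  assumes u: "u \<in> V" and w: "w \<in> V" and N0: "N u = 0"
  shows "ip u w = 0"
proof -
  have z: "AE \<zeta> in ioo 0 (len b). fst u \<zeta> = 0" "\<And>j. j \<le> n \<Longrightarrow> snd u j = 0" using N_0_iff[OF u] N0 by auto
  have "X_ip b (fst u) (fst w) = X_ip b (fst (0 :: ('k, 'c) state)) (fst w)"
    using z u w Dom_V[OF Dom_zero] by (intro X_ip_cong) (auto simp: V_iff)
  moreover have "(\<Sum>j\<le>n. to_complex (cip (\<Sigma> j) (snd u j) (snd w j))) = (\<Sum>j\<le>n. to_complex (cip (\<Sigma> j) (snd (0 :: ('k, 'c) state) j) (snd w j)))"
    using z by (intro sum.cong) auto
  ultimately have "ip u w = ip 0 w" by (simp only: ip_eq)
  then show ?thesis using ip_zero[OF w] by simp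
qed

lemma N_nonneg: "u \<in> V \<Longrightarrow> 0 \<le> N u"
  using SI.q_nonneg[of u] by (simp only: q_eq)

lemma N_eq_0I: "ip u u = 0 \<Longrightarrow> N u = 0"
  by (simp add: cl_norm_def)

lemma weak_eqD: assumes "u \<in> V" "v \<in> V" "N (u - v) = 0" "w \<in> V" shows "Re (ip u w) = Re (ip v w)"
  using SI.eqv_iff[of u v] SI.eqvD[of u v w] assms unfolding q_eq by blast

lemma weak_eqI:
  assumes "u \<in> V" "v \<in> V" "\<And>w. w \<in> V \<Longrightarrow> Re (ip u w) = Re (ip v w)"
  shows "N (u - v) = 0" "N u = N v"
  using SI.eqv_iff[of u v] SI.q_cong[of u v] SI.eqvI[of u v] assms unfolding q_eq by blast+

lemma bounded_states_subsequence_converges: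
  assumes bd: "\<And>k::nat. bounded_rep (fst (X k)) Q" and c: "\<And>k j \<beta>. j \<le> n \<Longrightarrow> \<beta> \<in> Bs j \<Longrightarrow> norm (cip (\<Sigma> j) (snd (X k) j) \<beta>) \<le> Q"
    and X: "\<And>k. X k \<in> V"
  shows "\<exists>z\<in>V. \<exists>r. strict_mono r \<and> (\<lambda>k. N (X (r k) - z)) \<longlonglongrightarrow> 0"
proof -
  obtain r x where r: "strict_mono (r :: nat \<Rightarrow> nat)" "x \<in> X_space b"
    "\<And>e. 0 < e \<Longrightarrow> \<forall>\<^sub>F k in sequentially. AE \<zeta> in ioo 0 (len b). \<forall>i. norm (fst (X (r k)) \<zeta> $ i - x \<zeta> $ i) \<le> e"
    using bounded_rep_subsequence_converges[of "\<lambda>k. fst (X k)" Q] bd by blast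
  define P where "P p s \<longleftrightarrow> (\<exists>c. (\<lambda>k. cip (\<Sigma> (fst p)) (snd (X (r (s k))) (fst p)) (snd p)) \<longlonglongrightarrow> c)" for p :: "nat \<times> 'c" and s :: "nat \<Rightarrow> nat"
  have "\<exists>s. strict_mono s \<and> (\<forall>p\<in>Sigma {..n} Bs. P p s)"
  proof (rule finite_common_subsequence)
    show "finite (Sigma {..n} Bs)" by (intro finite_SigmaI) (auto intro: Bs_fin)
    fix p :: "nat \<times> 'c" and s :: "nat \<Rightarrow> nat" assume p: "p \<in> Sigma {..n} Bs"
    show "\<exists>s'. strict_mono s' \<and> P p (s \<circ> s')"
      using bounded_subsequence_converges[of "\<lambda>k. cip (\<Sigma> (fst p)) (snd (X (r (s k))) (fst p)) (snd p)" Q] c p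
      unfolding P_def comp_def by auto
    fix s' :: "nat \<Rightarrow> nat" assume "P p s" "strict_mono s'"
    then obtain d where "(\<lambda>k. cip (\<Sigma> (fst p)) (snd (X (r (s k))) (fst p)) (snd p)) \<longlonglongrightarrow> d" unfolding P_def by blast
    from LIMSEQ_subseq_LIMSEQ[OF this \<open>strict_mono s'\<close>] show "P p (s \<circ> s')"
      unfolding P_def comp_def by blast
  qed
  then obtain s where s: "strict_mono s" "\<And>p. p \<in> Sigma {..n} Bs \<Longrightarrow> P p s" by blast
  define d where "d j \<beta> = (SOME c. (\<lambda>k. cip (\<Sigma> j) (snd (X (r (s k))) j) \<beta>) \<longlonglongrightarrow> c)" for j \<beta>
  have d: "(\<lambda>k. cip (\<Sigma> j) (snd (X (r (s k))) j) \<beta>) \<longlonglongrightarrow> d j \<beta>" if "j \<le> n" "\<beta> \<in> Bs j" for j \<beta>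
    unfolding d_def by (rule someI_ex) (use s(2)[of "(j, \<beta>)"] that in \<open>simp add: P_def\<close>)
  \<comment> \<open>The limit of the controller states, rebuilt from the limits of their
    coordinates.\<close>
  define y where "y j = (\<Sum>\<beta>\<in>Bs j. csc j (d j \<beta>) \<beta>)" for j
  have y: "y j \<in> cs j" "\<And>\<gamma>. \<gamma> \<in> Bs j \<Longrightarrow> cip (\<Sigma> j) (y j) \<gamma> = d j \<gamma>" if j: "j \<le> n" for j
  proof -
    have "(\<Sum>\<beta>\<in>Bs j. csc j (d j \<beta>) \<beta>) + 0 \<in> cs j"
      using Bs_sub[OF j] cs_lin[OF j] cs_zero[OF j] Bs_fin[OF j] by (intro sum_closed[where P = "\<lambda>x. x \<in> cs j"]) auto
    then show "y j \<in> cs j" by (simp add: y_def)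
    fix \<gamma> assume \<gamma>: "\<gamma> \<in> Bs j"
    have "cip (\<Sigma> j) ((\<Sum>\<beta>\<in>Bs j. csc j (d j \<beta>) \<beta>) + 0) \<gamma> = (\<Sum>\<beta>\<in>Bs j. d j \<beta> * cip (\<Sigma> j) \<beta> \<gamma>) + cip (\<Sigma> j) 0 \<gamma>"
      using Bs_sub[OF j] cs_lin[OF j] cs_zero[OF j] Bs_fin[OF j] cip_lin[OF j _ _ Bs_sub[OF j \<gamma>]]
      by (intro sum_linear[where P = "\<lambda>x. x \<in> cs j" and F = "\<lambda>x. cip (\<Sigma> j) x \<gamma>"]) auto
    also have "\<dots> = (\<Sum>\<beta>\<in>Bs j. if \<beta> = \<gamma> then d j \<gamma> else 0)"
      using Bs_orth[OF j _ \<gamma>] cip_zero[OF j Bs_sub[OF j \<gamma>]] by (auto intro!: sum.cong)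
    also have "\<dots> = d j \<gamma>" using Bs_fin[OF j] \<gamma> by simp
    finally show "cip (\<Sigma> j) (y j) \<gamma> = d j \<gamma>" by (simp add: y_def)
  qed
  define z where "z = (x, y)"
  have z: "z \<in> V" using r(2) y(1) by (simp add: V_iff z_def)
  have Kst: "0 < Kst" unfolding Kst_def using m1_pos len_pos by (intro add_pos_nonneg add_nonneg_nonneg sum_nonneg) auto
  have "(\<lambda>k. N (X (r (s k)) - z)) \<longlonglongrightarrow> 0"
  proof (rule LIMSEQ_I)
    fix e :: real assume e: "0 < e"
    \<comment> \<open>\<open>bounded_state_norm\<close> loses the factor \<open>Kst\<close>, and the
      factor 2 gives strict inequality.\<close>
    define e' where "e' = e / (2 * Kst)"
    have e': "0 < e'" "Kst * e' < e" using e Kst by (auto simp: e'_def)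
    have 1: "\<forall>\<^sub>F k in sequentially. AE \<zeta> in ioo 0 (len b). \<forall>i. norm (fst (X (r (s k))) \<zeta> $ i - x \<zeta> $ i) \<le> e'"
      by (rule eventually_subseq[OF s(1) r(3)[OF e'(1)]])
    have 2: "\<forall>\<^sub>F k in sequentially. \<forall>p\<in>Sigma {..n} Bs. norm (cip (\<Sigma> (fst p)) (snd (X (r (s k))) (fst p)) (snd p) - d (fst p) (snd p)) < e'"
    proof (intro eventually_ball_finite ballI)
      show "finite (Sigma {..n} Bs)" by (intro finite_SigmaI) (auto intro: Bs_fin)
      fix p assume "p \<in> Sigma {..n} Bs"
      then have "(\<lambda>k. cip (\<Sigma> (fst p)) (snd (X (r (s k))) (fst p)) (snd p)) \<longlonglongrightarrow> d (fst p) (snd p)" by (intro d) auto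
      then show "\<forall>\<^sub>F k in sequentially. norm (cip (\<Sigma> (fst p)) (snd (X (r (s k))) (fst p)) (snd p) - d (fst p) (snd p)) < e'"
        unfolding tendsto_iff dist_norm using e'(1) by blast
    qed
    from 1 2 have "\<forall>\<^sub>F k in sequentially. N (X (r (s k)) - z) \<le> Kst * e'"
    proof eventually_elim
      case (elim k)
      have "bounded_state (X (r (s k)) - z) e'"
        unfolding bounded_state_def
      proof (intro conjI allI ballI impI)
        show "AE \<zeta> in ioo 0 (len b). \<forall>i. norm (fst (X (r (s k)) - z) \<zeta> $ i) \<le> e'"
          using elim(1) by (simp add: z_def)
        fix j \<beta> assume j: "j \<le> n" and \<beta>: "\<beta> \<in> Bs j"
        interpret vector_space "csc j" by (rule ctrl_vs[OF j])
        have xj: "snd (X (r (s k))) j \<in> cs j" using X j by (simp add: V_iff)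
        have "csc j (- 1) (y j) + snd (X (r (s k))) j = snd (X (r (s k)) - z) j" by (simp add: z_def)
        then have "cip (\<Sigma> j) (snd (X (r (s k)) - z) j) \<beta> = cip (\<Sigma> j) (snd (X (r (s k))) j) \<beta> - d j \<beta>"
          using cip_lin[OF j y(1)[OF j] xj Bs_sub[OF j \<beta>], of "- 1"] y(2)[OF j \<beta>] by simp
        then show "norm (cip (\<Sigma> j) (snd (X (r (s k)) - z) j) \<beta>) \<le> e'"
          using elim(2)[rule_format, of "(j, \<beta>)"] j \<beta> by simp
      qed
      then show "N (X (r (s k)) - z) \<le> Kst * e'" using X z e'(1) by (intro bounded_state_norm V_closed) auto
    qed
    then obtain k0 where k0: "\<And>k. k0 \<le> k \<Longrightarrow> N (X (r (s k)) - z) \<le> Kst * e'" unfolding eventually_sequentially by blast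
    show "\<exists>no. \<forall>k\<ge>no. norm (N (X (r (s k)) - z) - 0) < e"
    proof (intro exI[of _ k0] allI impI)
      fix k assume "k0 \<le> k"
      then have "N (X (r (s k)) - z) < e" using k0 e'(2) by fastforce
      moreover have "0 \<le> N (X (r (s k)) - z)" using X z by (intro N_nonneg V_closed) auto
      ultimately show "norm (N (X (r (s k)) - z) - 0) < e" by simp
    qed
  qed
  then show ?thesis using z strict_mono_o[OF r(1) s(1)] by (intro bexI[of _ z] exI[of _ "r \<circ> s"]) (simp_all only: comp_def)
qed

end

section \<open>Asymptotic stability\<close>

context closed_loop
begin

lemma L_rot_0: "(\<And>p. u p \<in> Dom) \<Longrightarrow> w \<in> V \<Longrightarrow> ip (L (rot 0 0) u p) w = - ip (Op (u p)) w"
  by (simp add: ip_L rot_def)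

text \<open>At the point 0 the pair system consists of two uncoupled copies of \<open>- Op\<close>.
  Invertibility of \<open>Op\<close> is thus the case \<open>rot 0 0\<close> of the resolvent
  results.\<close>

lemma N_L_rot_0: assumes "\<And>p. u p \<in> Dom" shows "N (L (rot 0 0) u p) = N (Op (u p))"
proof -
  have "N (L (rot 0 0) u p) = N (cl_scale \<Sigma> (- 1) (Op (u p)))"
    using assms L_V[of u] Op_V V_closed by (intro weak_eqI(2)) (simp_all add: L_rot_0 ip_lin)
  also have "\<dots> = N (Op (u p))"
    using SI.q_sc[OF Op_V[OF assms], of "- 1" p] by (simp add: q_eq)
  finally show ?thesis .
qed

lemma Op_onto: assumes w: "w \<in> V" shows "\<exists>u\<in>Dom. N (Op u - w) = 0"
proof -
  have wV: "cl_scale \<Sigma> (- 1) w \<in> V" using w by (rule V_closed)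
  from resolvent_ex[OF rotation_injective[OF order_refl], of 0]
  obtain K where K: "\<forall>U. (\<forall>p. U p \<in> V) \<longrightarrow> (\<exists>u. (\<forall>p. u p \<in> Dom) \<and> (\<forall>p. N (L (rot 0 0) u p - U p) = 0) \<and>
    (\<forall>s>0. (\<forall>p. N (U p) \<le> s) \<longrightarrow> (\<forall>p. bounded_rep (fst (u p)) (K * s) \<and>
       (\<forall>j\<le>n. \<forall>\<beta>\<in>Bs j. norm (cip (\<Sigma> j) (snd (u p) j) \<beta>) \<le> K * s))))"
    by (elim exE conjE) (rule that)
  from K[rule_format, of "\<lambda>_. cl_scale \<Sigma> (- 1) w", OF wV]
  obtain u where u: "\<forall>p. u p \<in> Dom" "\<forall>p. N (L (rot 0 0) u p - cl_scale \<Sigma> (- 1) w) = 0"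
    by (elim exE conjE) (rule that)
  have uD: "\<And>p. u p \<in> Dom" using u(1) by blast
  have "N (Op (u True) - w) = 0"
  proof (rule weak_eqI(1))
    fix v assume v: "v \<in> V"
    have "Re (ip (L (rot 0 0) u True) v) = Re (ip (cl_scale \<Sigma> (- 1) w) v)"
      using u(2) by (intro weak_eqD L_V uD wV v) blast
    then show "Re (ip (Op (u True)) v) = Re (ip w v)" by (simp add: L_rot_0[OF uD v] ip_lin(3)[OF w v])
  qed (use uD Op_V w in auto)
  then show ?thesis using uD by blast
qed

lemma Op_below: "\<exists>M\<ge>0. \<forall>u\<in>Dom. N u \<le> M * N (Op u)"
proof -
  from resolvent_bound[OF rotation_injective[OF order_refl], of 0]
  obtain K where K: "0 \<le> K" "\<forall>u. (\<forall>p. u p \<in> Dom) \<longrightarrow> (\<forall>p. N (u p) \<le> K * (N (L (rot 0 0) u True) + N (L (rot 0 0) u False)))"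
    by (elim exE conjE) (rule that)
  show ?thesis
  proof (intro exI[of _ "2 * K"] conjI ballI)
    fix u assume u: "u \<in> Dom"
    show "N u \<le> 2 * K * N (Op u)"
      using K(2)[rule_format, of "\<lambda>_. u"] N_L_rot_0[of "\<lambda>_. u"] u by simp
  qed (use K in simp)
qed

text \<open>The given \<open>X k\<close> need not come with bounded representatives. It is replaced
  by the solution \<open>Y k\<close> of the same equation, which does and which differs from
  \<open>X k\<close> by a null vector.\<close>

lemma Op_compact:
  assumes X: "\<And>k::nat. X k \<in> Dom" and C: "\<And>k. N (Op (X k)) \<le> C"
  shows "\<exists>z\<in>V. \<exists>r. strict_mono r \<and> (\<lambda>k. N (X (r k) - z)) \<longlonglongrightarrow> 0"
proof -
  obtain M where M: "0 \<le> M" "\<And>u. u \<in> Dom \<Longrightarrow> N u \<le> M * N (Op u)" using Op_below by blast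
  from resolvent_ex[OF rotation_injective[OF order_refl], of 0]
  obtain K where K: "0 \<le> K" "\<forall>U. (\<forall>p. U p \<in> V) \<longrightarrow> (\<exists>u. (\<forall>p. u p \<in> Dom) \<and> (\<forall>p. N (L (rot 0 0) u p - U p) = 0) \<and>
    (\<forall>s>0. (\<forall>p. N (U p) \<le> s) \<longrightarrow> (\<forall>p. bounded_rep (fst (u p)) (K * s) \<and>
       (\<forall>j\<le>n. \<forall>\<beta>\<in>Bs j. norm (cip (\<Sigma> j) (snd (u p) j) \<beta>) \<le> K * s))))"
    by (elim exE conjE) (rule that)
  \<comment> \<open>The estimate for solutions requires a positive bound of the data.\<close>
  define s where "s = max C 1"
  have s: "0 < s" by (simp add: s_def)
  have ex: "\<exists>y. y \<in> Dom \<and> N (X k - y) = 0 \<and> bounded_rep (fst y) (K * s) \<and>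
      (\<forall>j\<le>n. \<forall>\<beta>\<in>Bs j. norm (cip (\<Sigma> j) (snd y j) \<beta>) \<le> K * s)" for k
  proof -
    have XD: "\<And>p :: bool. (\<lambda>_. X k) p \<in> Dom" using X by simp
    have UV: "L (rot 0 0) (\<lambda>_. X k) p \<in> V" for p by (rule L_V[OF XD])
    from K(2)[rule_format, of "L (rot 0 0) (\<lambda>_. X k)", OF UV]
    obtain u where u: "\<forall>p. u p \<in> Dom" "\<forall>p. N (L (rot 0 0) u p - L (rot 0 0) (\<lambda>_. X k) p) = 0"
      and bd: "\<forall>s>0. (\<forall>p. N (L (rot 0 0) (\<lambda>_. X k) p) \<le> s) \<longrightarrow> (\<forall>p. bounded_rep (fst (u p)) (K * s) \<and>
       (\<forall>j\<le>n. \<forall>\<beta>\<in>Bs j. norm (cip (\<Sigma> j) (snd (u p) j) \<beta>) \<le> K * s))"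
      by (elim exE conjE) (rule that)
    have uD: "\<And>p. u p \<in> Dom" using u(1) by blast
    have NU: "\<forall>p. N (L (rot 0 0) (\<lambda>_. X k) p) \<le> s"
      using N_L_rot_0[OF XD] C[of k] by (simp add: s_def)
    have XuD: "X k - u True \<in> Dom" by (rule Dom_closed(2)[OF X uD])
    have "N (Op (X k - u True) - 0) = 0"
    proof (rule weak_eqI(1))
      fix v assume v: "v \<in> V"
      have "Re (ip (L (rot 0 0) u True) v) = Re (ip (L (rot 0 0) (\<lambda>_. X k) True) v)"
        using u(2) by (intro weak_eqD L_V uD UV v) blast
      then show "Re (ip (Op (X k - u True)) v) = Re (ip 0 v)"
        by (simp add: L_rot_0[OF uD v] L_rot_0[OF XD v] ip_Op_lin(2)[OF X uD v] ip_zero[OF v])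
    qed (use XuD Op_V Dom_V[OF Dom_zero] in auto)
    then have "N (X k - u True) \<le> 0" using M(2)[OF XuD] by simp
    then have "N (X k - u True) = 0" using N_nonneg[OF Dom_V[OF XuD]] by simp
    then show ?thesis using uD bd[rule_format, OF s NU[rule_format], of True] by (intro exI[of _ "u True"]) simp
  qed
  define Y where "Y k = (SOME y. y \<in> Dom \<and> N (X k - y) = 0 \<and> bounded_rep (fst y) (K * s) \<and>
      (\<forall>j\<le>n. \<forall>\<beta>\<in>Bs j. norm (cip (\<Sigma> j) (snd y j) \<beta>) \<le> K * s))" for k
  have Y: "Y k \<in> Dom \<and> N (X k - Y k) = 0 \<and> bounded_rep (fst (Y k)) (K * s) \<and>
      (\<forall>j\<le>n. \<forall>\<beta>\<in>Bs j. norm (cip (\<Sigma> j) (snd (Y k) j) \<beta>) \<le> K * s)" for k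
    unfolding Y_def by (rule someI_ex[OF ex])
  then obtain z r where z: "z \<in> V" "strict_mono r" "(\<lambda>k. N (Y (r k) - z)) \<longlonglongrightarrow> 0"
    using bounded_states_subsequence_converges[of Y "K * s"] Dom_V by blast
  have eq: "N (X k - z) = N (Y k - z)" for k
  proof (rule weak_eqI(2))
    have d: "X k \<in> V" "Y k \<in> V" using X Y Dom_V by auto
    show "X k - z \<in> V" "Y k - z \<in> V" using d z by (auto intro: V_closed)
    fix w assume w: "w \<in> V"
    have "Re (ip (X k) w) = Re (ip (Y k) w)" using Y[of k] d w by (intro weak_eqD) auto
    then show "Re (ip (X k - z) w) = Re (ip (Y k - z) w)"
      by (simp add: ip_lin(2)[OF d(1) z(1) w] ip_lin(2)[OF d(2) z(1) w])
  qed
  show ?thesis using z(2,3) by (intro bexI[OF _ z(1)] exI[of _ r]) (simp add: eq)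
qed

lemma cl_stable_op:
  "\<exists>M. stable_op V (\<lambda>r. cl_scale \<Sigma> (of_real r)) (\<lambda>u v. Re (ip u v)) Dom Op M"
proof -
  obtain M where M: "0 \<le> M" "\<And>u. u \<in> Dom \<Longrightarrow> N u \<le> M * N (Op u)" using Op_below by blast
  have "stable_op V (\<lambda>r. cl_scale \<Sigma> (of_real r)) (\<lambda>u v. Re (ip u v)) Dom Op M"
  proof (intro stable_op.intro stable_op_axioms.intro SI.semi_inner_axioms, unfold q_eq)
    fix u v w :: "('k, 'c) state" and a :: real
    show "u \<in> Dom \<Longrightarrow> u \<in> V" "u \<in> Dom \<Longrightarrow> Op u \<in> V" by (rule Dom_V Op_V; assumption)+
    show "u \<in> Dom \<Longrightarrow> v \<in> Dom \<Longrightarrow> u - v \<in> Dom" "u \<in> Dom \<Longrightarrow> cl_scale \<Sigma> (of_real a) u \<in> Dom"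
      by (rule Dom_closed; assumption)+
    show "u \<in> Dom \<Longrightarrow> v \<in> Dom \<Longrightarrow> w \<in> V \<Longrightarrow> Re (ip (Op (u - v)) w) = Re (ip (Op u) w) - Re (ip (Op v) w)"
      by (subst ip_Op_lin(2)) auto
    show "u \<in> Dom \<Longrightarrow> w \<in> V \<Longrightarrow> Re (ip (Op (cl_scale \<Sigma> (of_real a) u)) w) = a * Re (ip (Op u) w)"
      by (subst ip_Op_lin(3)) auto
    show "u \<in> Dom \<Longrightarrow> Re (ip (Op u) u) \<le> 0" by (rule dissip)
    show "\<exists>u\<in>Dom. SI.eqv (Op u) w" if w: "w \<in> V"
    proof -
      obtain u where u: "u \<in> Dom" "N (Op u - w) = 0" using Op_onto[OF w] by blast
      then show ?thesis using SI.eqv_iff[OF Op_V[OF u(1)] w] unfolding q_eq by blast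
    qed
    show "u \<in> Dom \<Longrightarrow> N u \<le> M * N (Op u)" by (rule M)
    show "N u = 0" if u: "u \<in> Dom" and v: "v \<in> Dom" and uv: "SI.eqv (Op u) (cl_scale \<Sigma> (of_real (- a)) v)"
      "SI.eqv (Op v) (cl_scale \<Sigma> (of_real a) u)"
    proof -
      \<comment> \<open>The imaginary eigenvalue equations for \<open>u\<close> and \<open>v\<close>
        are the kernel equations of the rotation by \<open>a\<close> for this pair.\<close>
      define x where "x p = (if p then u else v)" for p
      have x: "\<And>p. x p \<in> Dom" using u v by (simp add: x_def)
      have "N (L (rot 0 a) x p) = 0" for p
      proof -
        have LV: "L (rot 0 a) x p \<in> V" by (rule L_V[OF x])
        have "Re (ip (L (rot 0 a) x p) (L (rot 0 a) x p)) = 0"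
          using ip_L[where u = x and \<theta> = "rot 0 a" and p = p, OF x LV] SI.eqvD[OF uv(1) LV] SI.eqvD[OF uv(2) LV] u v LV Dom_V
          by (cases p) (simp_all add: rot_def x_def ip_lin)
        then show ?thesis by (simp add: cl_norm_def)
      qed
      then have "N (x True) = 0"
        using rotation_injective[OF order_refl, of a] x unfolding injective_at_def by blast
      then show ?thesis by (simp add: x_def)
    qed
  next
    show "\<exists>z\<in>V. \<exists>r. strict_mono r \<and> (\<lambda>k. N (X (r k) - z)) \<longlonglongrightarrow> 0"
      if "\<And>k. X k \<in> Dom" "\<And>k. N (Op (X k)) \<le> C" for X :: "nat \<Rightarrow> ('k, 'c) state" and C
      by (rule Op_compact[OF that])
  qed
  then show ?thesis by blast
qed

text \<open>\<open>C0_semigroup_on\<close> and \<open>has_generator_on\<close> compare vectors in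
  the seminorm; \<open>weak_eqD\<close> turns this into the pairings that the abstract locale
  uses.\<close>

theorem stable:
  assumes C0: "C0_semigroup_on V (cl_scale \<Sigma>) N T" and gen: "has_generator_on V (cl_scale \<Sigma>) N T Dom Op"
  shows "asymptotically_stable_on V N T"
proof -
  obtain M where "stable_op V (\<lambda>r. cl_scale \<Sigma> (of_real r)) (\<lambda>u v. Re (ip u v)) Dom Op M" using cl_stable_op by blast
  then interpret S: stable_op V "\<lambda>r. cl_scale \<Sigma> (of_real r)" "\<lambda>u v. Re (ip u v)" Dom Op M .
  have TV: "T t u \<in> V" if "0 \<le> t" "u \<in> V" for t u using C0 that unfolding C0_semigroup_on_def by blast
  interpret T: stable_semigroup V "\<lambda>r. cl_scale \<Sigma> (of_real r)" "\<lambda>u v. Re (ip u v)" Dom Op M T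
  proof (intro stable_semigroup.intro stable_semigroup_axioms.intro S.stable_op_axioms, unfold q_eq)
    fix t s :: real and u v w :: "('k, 'c) state" and a :: real
    show "0 \<le> t \<Longrightarrow> u \<in> V \<Longrightarrow> T t u \<in> V" by (rule TV)
    show "Re (ip (T t (u + v)) w) = Re (ip (T t u) w) + Re (ip (T t v) w)" if t: "0 \<le> t" and u: "u \<in> V" and v: "v \<in> V" and w: "w \<in> V"
    proof -
      have "Re (ip (T t (u + v)) w) = Re (ip (T t u + T t v) w)"
        using C0 t u v by (intro weak_eqD TV V_closed w) (auto simp: C0_semigroup_on_def)
      then show ?thesis using ip_lin(1)[OF TV[OF t u] TV[OF t v] w] by simp
    qed
    show "Re (ip (T t (cl_scale \<Sigma> (of_real a) u)) w) = a * Re (ip (T t u) w)" if t: "0 \<le> t" and u: "u \<in> V" and w: "w \<in> V"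
    proof -
      have "Re (ip (T t (cl_scale \<Sigma> (of_real a) u)) w) = Re (ip (cl_scale \<Sigma> (of_real a) (T t u)) w)"
        using C0 t u by (intro weak_eqD TV V_closed w) (auto simp: C0_semigroup_on_def)
      then show ?thesis using ip_lin(3)[OF TV[OF t u] w] by simp
    qed
    show "0 \<le> t \<Longrightarrow> \<exists>K. \<forall>u\<in>V. N (T t u) \<le> K * N u" using C0 unfolding C0_semigroup_on_def by blast
    show "u \<in> V \<Longrightarrow> w \<in> V \<Longrightarrow> Re (ip (T 0 u) w) = Re (ip u w)"
      using C0 by (intro weak_eqD TV) (auto simp: C0_semigroup_on_def)
    show "0 \<le> s \<Longrightarrow> 0 \<le> t \<Longrightarrow> u \<in> V \<Longrightarrow> w \<in> V \<Longrightarrow> Re (ip (T (s + t) u) w) = Re (ip (T s (T t u)) w)"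
      using C0 by (intro weak_eqD TV) (auto simp: C0_semigroup_on_def)
    show "u \<in> V \<Longrightarrow> ((\<lambda>t. N (T t u - u)) \<longlongrightarrow> 0) (at_right 0)" using C0 unfolding C0_semigroup_on_def by blast
    show "((\<lambda>h. N (cl_scale \<Sigma> (of_real (1 / h)) (T h u - u) - w)) \<longlongrightarrow> 0) (at_right 0) \<longleftrightarrow> u \<in> Dom \<and> SI.eqv (Op u) w"
      if u: "u \<in> V" and w: "w \<in> V"
    proof -
      have "(u \<in> Dom \<and> SI.eqv (Op u) w) \<longleftrightarrow> (u \<in> Dom \<and> N (Op u - w) = 0)"
        using SI.eqv_iff[OF Op_V w] unfolding q_eq by blast
      then show ?thesis using gen u w unfolding has_generator_on_def by blast
    qed
  qed
  show ?thesis
    unfolding asymptotically_stable_on_def using T.asymptotically_stable unfolding q_eq by blast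
qed

end

section \<open>Spectrum\<close>

context closed_loop
begin

text \<open>Two uncoupled copies of the same resolvent problem. In this way the theorem on pairs
  also covers a single complex state.\<close>

definition scalar :: "'k \<Rightarrow> bool \<Rightarrow> bool \<Rightarrow> 'k" where
  "scalar c p p' = (if p = p' then c else 0)"

lemma L_scalar:
  assumes u: "\<And>p. u p \<in> Dom"
  shows "N (L (scalar c) u p - (cl_scale \<Sigma> c (u p) - Op (u p))) = 0" "N (L (scalar c) u p) = N (cl_scale \<Sigma> c (u p) - Op (u p))"
proof -
  have v: "cl_scale \<Sigma> c (u p) - Op (u p) \<in> V" using u by (intro V_closed Dom_V Op_V)
  have "ip (L (scalar c) u p) w = ip (cl_scale \<Sigma> c (u p) - Op (u p)) w" if w: "w \<in> V" for w
  proof -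
    have uV: "u p \<in> V" "Op (u p) \<in> V" using u by (auto intro: Dom_V Op_V)
    have 1: "ip (L (scalar c) u p) w = to_complex (scalar c p True) * ip (u True) w + to_complex (scalar c p False) * ip (u False) w - ip (Op (u p)) w"
      by (rule ip_L) (rule u, rule w)
    have 2: "ip (cl_scale \<Sigma> c (u p) - Op (u p)) w = to_complex c * ip (u p) w - ip (Op (u p)) w"
      using ip_lin(2)[OF V_closed(3)[OF uV(1)] uV(2) w, of c] ip_lin(3)[OF uV(1) w, of c] by (simp only:)
    show ?thesis unfolding 1 2 by (cases p) (simp_all add: scalar_def)
  qed
  note e = this
  have l: "L (scalar c) u p \<in> V" by (rule L_V) (rule u)
  show "N (L (scalar c) u p - (cl_scale \<Sigma> c (u p) - Op (u p))) = 0" "N (L (scalar c) u p) = N (cl_scale \<Sigma> c (u p) - Op (u p))"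
    by (rule weak_eqI[OF l v], simp only: e)+
qed

text \<open>The literal shape that complexification produces. It agrees with
  \<open>L (rot a \<beta>)\<close> only up to null vectors, since subtracting a multiple equals
  scaling by the negative only in components where \<open>csc j\<close> is a vector space
  scaling.\<close>

definition rotated :: "real \<Rightarrow> real \<Rightarrow> (bool \<Rightarrow> ('k, 'c) state) \<Rightarrow> bool \<Rightarrow> ('k, 'c) state" where
  "rotated a \<beta> u p = (if p then cl_scale \<Sigma> (of_real a) (u True) - cl_scale \<Sigma> (of_real \<beta>) (u False)
     else cl_scale \<Sigma> (of_real a) (u False) + cl_scale \<Sigma> (of_real \<beta>) (u True)) - Op (u p)"

lemma rotated_V: assumes u: "\<And>p. u p \<in> Dom" shows "rotated a \<beta> u p \<in> V"
  unfolding rotated_def using Dom_V[OF u] Op_V[OF u] by (simp add: V_closed)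

lemma ip_rotated:
  assumes u: "\<And>p. u p \<in> Dom" and w: "w \<in> V"
  shows "ip (rotated a \<beta> u p) w = ip (L (rot a \<beta>) u p) w"
proof -
  have uV: "u p \<in> V" "Op (u p) \<in> V" for p using u by (auto intro: Dom_V Op_V)
  have 1: "ip (L (rot a \<beta>) u p) w = to_complex (rot a \<beta> p True :: 'k) * ip (u True) w + to_complex (rot a \<beta> p False :: 'k) * ip (u False) w - ip (Op (u p)) w"
    by (rule ip_L) (rule u, rule w)
  show ?thesis
    unfolding rotated_def 1 using w by (cases p) (simp_all add: ip_lin uV V_closed rot_def)
qed

lemma L_rot:
  assumes u: "\<And>p. u p \<in> Dom"
  shows "N (L (rot a \<beta>) u p - rotated a \<beta> u p) = 0" "N (L (rot a \<beta>) u p) = N (rotated a \<beta> u p)"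
proof -
  have v: "L (rot a \<beta>) u p \<in> V" "rotated a \<beta> u p \<in> V" by (rule L_V rotated_V, rule u)+
  have e: "ip (rotated a \<beta> u p) w = ip (L (rot a \<beta>) u p) w" if "w \<in> V" for w
    by (rule ip_rotated) (rule u, rule that)
  show "N (L (rot a \<beta>) u p - rotated a \<beta> u p) = 0" "N (L (rot a \<beta>) u p) = N (rotated a \<beta> u p)"
    by (rule weak_eqI[OF v], simp only: e)+
qed

lemma complexified_rotated:
  "complexified_scale (cl_scale \<Sigma>) \<mu> (u True, u False) - map_prod Op Op (u True, u False) =
   (rotated (Re \<mu>) (Im \<mu>) u True, rotated (Re \<mu>) (Im \<mu>) u False)"
  by (simp add: complexified_scale_def rotated_def)

lemma complexified_norm_0_iff: "complexified_norm N (x, y) = 0 \<longleftrightarrow> N x = 0 \<and> N y = 0"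
  by (simp add: complexified_norm_def sum_power2_eq_zero_iff)

text \<open>Outside the point spectrum the scalar pair problem is injective, hence boundedly
  solvable, so the spectrum consists of eigenvalues. Those with nonnegative real part are excluded
  by passing to a rotation.\<close>

lemma complex_spectrum:
  assumes U: "range (to_complex :: 'k \<Rightarrow> complex) = UNIV"
  defines "sc \<equiv> \<lambda>\<mu>. cl_scale \<Sigma> (inv to_complex \<mu> :: 'k)"
  shows "- complex_resolvent_set V sc N Dom Op = complex_point_spectrum sc N Dom Op"
    and "complex_point_spectrum sc N Dom Op \<subseteq> {\<mu>. Re \<mu> < 0}"
proof -
  have point: "\<mu> \<notin> complex_resolvent_set V sc N Dom Op" if pt: "\<mu> \<in> complex_point_spectrum sc N Dom Op" for \<mu>
  proof
    assume "\<mu> \<in> complex_resolvent_set V sc N Dom Op"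
    then obtain M where M: "\<forall>u\<in>Dom. N u \<le> M * N (sc \<mu> u - Op u)" unfolding complex_resolvent_set_def by blast
    obtain u where u: "u \<in> Dom" "N u \<noteq> 0" "N (sc \<mu> u - Op u) = 0" using pt unfolding complex_point_spectrum_def by blast
    have "N u \<le> 0" using M[rule_format, OF u(1)] u(3) by simp
    then show False using u(2) N_nonneg[OF Dom_V[OF u(1)]] by simp
  qed
  have res: "\<mu> \<in> complex_resolvent_set V sc N Dom Op" if \<mu>: "\<mu> \<notin> complex_point_spectrum sc N Dom Op" for \<mu>
  proof -
    define c :: 'k where "c = inv to_complex \<mu>"
    have inj: "injective_at (scalar c)"
      unfolding injective_at_def
    proof (intro allI impI)
      fix u :: "bool \<Rightarrow> ('k, 'c) state" and p :: bool assume u: "\<forall>p. u p \<in> Dom" and L0: "\<forall>p. N (L (scalar c) u p) = 0"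
      have "N (cl_scale \<Sigma> c (u p) - Op (u p)) = 0" using L_scalar(2)[of u c p] u L0 by simp
      then show "N (u p) = 0" using \<mu> u unfolding complex_point_spectrum_def sc_def c_def by blast
    qed
    from resolvent_bound[OF inj]
    obtain K where K: "\<forall>u. (\<forall>p. u p \<in> Dom) \<longrightarrow> (\<forall>p. N (u p) \<le> K * (N (L (scalar c) u True) + N (L (scalar c) u False)))"
      by (elim exE conjE) (rule that)
    have bound: "N u \<le> (2 * K) * N (sc \<mu> u - Op u)" if u: "u \<in> Dom" for u
      using K[rule_format, of "\<lambda>_. u"] L_scalar(2)[of "\<lambda>_. u" c] u by (simp add: sc_def c_def)
    from resolvent_ex[OF inj]
    obtain K' where K': "\<forall>U. (\<forall>p. U p \<in> V) \<longrightarrow> (\<exists>u. (\<forall>p. u p \<in> Dom) \<and> (\<forall>p. N (L (scalar c) u p - U p) = 0) \<and>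
      (\<forall>s>0. (\<forall>p. N (U p) \<le> s) \<longrightarrow> (\<forall>p. bounded_rep (fst (u p)) (K' * s) \<and>
         (\<forall>j\<le>n. \<forall>\<beta>\<in>Bs j. norm (cip (\<Sigma> j) (snd (u p) j) \<beta>) \<le> K' * s))))"
      by (elim exE conjE) (rule that)
    have onto: "\<exists>u\<in>Dom. N (sc \<mu> u - Op u - w) = 0" if w: "w \<in> V" for w
    proof -
      from K'[rule_format, of "\<lambda>_. w", OF w]
      obtain u where u: "\<forall>p. u p \<in> Dom" "\<forall>p. N (L (scalar c) u p - w) = 0"
        by (elim exE conjE) (rule that)
      have uD: "\<And>p. u p \<in> Dom" using u(1) by blast
      let ?x = "cl_scale \<Sigma> c (u True) - Op (u True)"
      have xV: "?x \<in> V" using uD by (intro V_closed Dom_V Op_V)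
      have "N (?x - w) = 0"
      proof (rule weak_eqI(1)[OF xV w])
        fix v assume v: "v \<in> V"
        have "Re (ip (L (scalar c) u True) v) = Re (ip ?x v)" by (intro weak_eqD L_V L_scalar(1) uD xV v)
        moreover have "Re (ip (L (scalar c) u True) v) = Re (ip w v)"
          by (rule weak_eqD[OF _ w u(2)[rule_format] v]) (intro L_V uD)
        ultimately show "Re (ip ?x v) = Re (ip w v)" by simp
      qed
      then show ?thesis using uD[of True] unfolding sc_def c_def by blast
    qed
    show ?thesis unfolding complex_resolvent_set_def using onto bound by blast
  qed
  show "- complex_resolvent_set V sc N Dom Op = complex_point_spectrum sc N Dom Op"
    using point res by blast
  show "complex_point_spectrum sc N Dom Op \<subseteq> {\<mu>. Re \<mu> < 0}"
  proof (rule subsetI, rule ccontr)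
    fix \<mu> assume \<mu>: "\<mu> \<in> complex_point_spectrum sc N Dom Op" and "\<mu> \<notin> {\<mu>. Re \<mu> < 0}"
    then have re: "0 \<le> Re \<mu>" by simp
    obtain u where u: "u \<in> Dom" "N u \<noteq> 0" "N (sc \<mu> u - Op u) = 0" using \<mu> unfolding complex_point_spectrum_def by blast
    obtain \<iota> :: 'k where \<iota>: "to_complex \<iota> = \<i>" using U by (metis UNIV_I imageE)
    have c: "to_complex (inv to_complex \<mu> :: 'k) = \<mu>" using U by (intro f_inv_into_f) simp
    \<comment> \<open>The pair \<open>(u, - i u)\<close> turns multiplication by
      \<open>\<mu>\<close> into the rotation matrix of \<open>\<mu>\<close>.\<close>
    define x where "x p = (if p then u else cl_scale \<Sigma> (- \<iota>) u)" for p
    have x: "\<And>p. x p \<in> Dom" using u(1) Dom_closed(3) by (simp add: x_def)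
    have opw: "ip (Op u) w = \<mu> * ip u w" if w: "w \<in> V" for w
    proof -
      have "ip (sc \<mu> u - Op u) w = 0"
        using u Dom_V Op_V V_closed w by (intro null_ip) (auto simp: sc_def)
      then show ?thesis
        using ip_lin(2)[OF V_closed(3)[OF Dom_V[OF u(1)]] Op_V[OF u(1)] w] ip_lin(3)[OF Dom_V[OF u(1)] w] by (simp add: sc_def c)
    qed
    have "N (L (rot (Re \<mu>) (Im \<mu>)) x p) = 0" for p
    proof (rule N_eq_0I)
      let ?w = "L (rot (Re \<mu>) (Im \<mu>)) x p"
      have LV: "?w \<in> V" by (rule L_V[OF x])
      have t: "ip (x True) ?w = ip u ?w" "ip (x False) ?w = - \<i> * ip u ?w"
        using ip_lin(3)[OF Dom_V[OF u(1)] LV, of "- \<iota>"] by (simp_all add: x_def \<iota>)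
      have o: "ip (Op (x True)) ?w = \<mu> * ip u ?w" "ip (Op (x False)) ?w = - \<i> * \<mu> * ip u ?w"
        using ip_Op_lin(3)[OF u(1) LV, of "- \<iota>"] opw[OF LV] by (simp_all add: x_def \<iota>)
      have m: "\<mu> = of_real (Re \<mu>) + \<i> * of_real (Im \<mu>)" by (rule complex_eq)
      define z where "z = ip u ?w"
      have "ip ?w ?w = to_complex (rot (Re \<mu>) (Im \<mu>) p True :: 'k) * z + to_complex (rot (Re \<mu>) (Im \<mu>) p False :: 'k) * (- \<i> * z) - ip (Op (x p)) ?w"
        using ip_L[where u = x and w = ?w and \<theta> = "rot (Re \<mu>) (Im \<mu>)" and p = p, OF x LV] unfolding t z_def .
      also have "ip (Op (x p)) ?w = (if p then \<mu> * z else - \<i> * \<mu> * z)" using o by (cases p) (simp_all only: z_def if_True if_False)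
      also have "to_complex (rot (Re \<mu>) (Im \<mu>) p True :: 'k) * z + to_complex (rot (Re \<mu>) (Im \<mu>) p False :: 'k) * (- \<i> * z) - (if p then \<mu> * z else - \<i> * \<mu> * z) = 0"
        by (cases p; subst (4) m) (simp_all add: rot_def algebra_simps)
      finally show "ip ?w ?w = 0" .
    qed
    then have "N (x True) = 0" using rotation_injective[OF re, of "Im \<mu>"] x unfolding injective_at_def by blast
    then show False using u(2) by (simp add: x_def)
  qed
qed

text \<open>The complexified resolvent equation is a single instance of the pair problem, with the
  rotation matrix of \<open>\<mu>\<close>; so all parts follow from the same results.\<close>

lemma complexified_spectrum:
  defines "sc \<equiv> complexified_scale (cl_scale \<Sigma>)" and "cn \<equiv> complexified_norm N" and "cOp \<equiv> map_prod Op Op"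
  shows "- complex_resolvent_set (V \<times> V) sc cn (Dom \<times> Dom) cOp = complex_point_spectrum sc cn (Dom \<times> Dom) cOp"
    and "complex_point_spectrum sc cn (Dom \<times> Dom) cOp \<subseteq> {\<mu>. Re \<mu> < 0}"
proof -
  define pr where "pr z p = (if p then fst z else snd z)" for z :: "('k, 'c) state \<times> ('k, 'c) state" and p
  have pr: "z \<in> Dom \<times> Dom \<Longrightarrow> pr z p \<in> Dom" "(pr z True, pr z False) = z" for z p by (auto simp: pr_def)
  have rt: "sc \<mu> (u True, u False) - cOp (u True, u False) = (rotated (Re \<mu>) (Im \<mu>) u True, rotated (Re \<mu>) (Im \<mu>) u False)" for \<mu> u
    unfolding sc_def cOp_def by (rule complexified_rotated)
  have cn0: "cn (x, y) = 0 \<longleftrightarrow> N x = 0 \<and> N y = 0" for x y unfolding cn_def by (rule complexified_norm_0_iff)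
  have point: "\<exists>u. (\<forall>p. u p \<in> Dom) \<and> (N (u True) \<noteq> 0 \<or> N (u False) \<noteq> 0) \<and> (\<forall>p. N (rotated (Re \<mu>) (Im \<mu>) u p) = 0)"
    if pt: "\<mu> \<in> complex_point_spectrum sc cn (Dom \<times> Dom) cOp" for \<mu>
  proof -
    obtain z where z: "z \<in> Dom \<times> Dom" "cn z \<noteq> 0" "cn (sc \<mu> z - cOp z) = 0" using pt unfolding complex_point_spectrum_def by blast
    have "N (rotated (Re \<mu>) (Im \<mu>) (pr z) p) = 0" for p
      using z(3) rt[of \<mu> "pr z"] unfolding pr(2) by (cases p) (simp_all add: cn0)
    moreover have "N (pr z True) \<noteq> 0 \<or> N (pr z False) \<noteq> 0" using z(2) cn0[of "pr z True" "pr z False"] unfolding pr(2) by blast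
    ultimately show ?thesis using pr(1)[OF z(1)] by blast
  qed
  have no: "\<mu> \<notin> complex_resolvent_set (V \<times> V) sc cn (Dom \<times> Dom) cOp" if pt: "\<mu> \<in> complex_point_spectrum sc cn (Dom \<times> Dom) cOp" for \<mu>
  proof
    assume "\<mu> \<in> complex_resolvent_set (V \<times> V) sc cn (Dom \<times> Dom) cOp"
    then obtain M where M: "\<forall>z\<in>Dom \<times> Dom. cn z \<le> M * cn (sc \<mu> z - cOp z)" unfolding complex_resolvent_set_def by blast
    obtain z where z: "z \<in> Dom \<times> Dom" "cn z \<noteq> 0" "cn (sc \<mu> z - cOp z) = 0" using pt unfolding complex_point_spectrum_def by blast
    have "cn z \<le> 0" using M[rule_format, OF z(1)] z(3) by simp
    moreover have "0 \<le> cn z" unfolding cn_def complexified_norm_def by (simp add: split_beta)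
    ultimately show False using z(2) by simp
  qed
  have res: "\<mu> \<in> complex_resolvent_set (V \<times> V) sc cn (Dom \<times> Dom) cOp" if \<mu>: "\<mu> \<notin> complex_point_spectrum sc cn (Dom \<times> Dom) cOp" for \<mu>
  proof -
    let ?\<theta> = "rot (Re \<mu>) (Im \<mu>)"
    have inj: "injective_at ?\<theta>"
      unfolding injective_at_def
    proof (intro allI impI)
      fix u :: "bool \<Rightarrow> ('k, 'c) state" and p :: bool assume u: "\<forall>p. u p \<in> Dom" and L0: "\<forall>p. N (L ?\<theta> u p) = 0"
      have "N (rotated (Re \<mu>) (Im \<mu>) u p) = 0" for p using L_rot(2)[of u "Re \<mu>" "Im \<mu>" p] u L0 by simp
      then have "cn (sc \<mu> (u True, u False) - cOp (u True, u False)) = 0" unfolding rt by (simp add: cn0)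
      then have "cn (u True, u False) = 0" using \<mu> u unfolding complex_point_spectrum_def by blast
      then show "N (u p) = 0" by (cases p) (simp_all add: cn0)
    qed
    from resolvent_bound[OF inj]
    obtain K where K0: "0 \<le> K" and K: "\<forall>u. (\<forall>p. u p \<in> Dom) \<longrightarrow> (\<forall>p. N (u p) \<le> K * (N (L ?\<theta> u True) + N (L ?\<theta> u False)))"
      by (elim exE conjE) (rule that)
    \<comment> \<open>Both components are bounded by \<open>K (r True + r False)\<close>, which
      gives \<open>2 K\<close>; each \<open>r\<close> is at most the norm of the pair, which gives
      another 2.\<close>
    have bound: "cn z \<le> (4 * K) * cn (sc \<mu> z - cOp z)" if z: "z \<in> Dom \<times> Dom" for z
    proof -
      have pD: "\<And>p. pr z p \<in> Dom" by (rule pr(1)[OF z])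
      define r where "r p = N (rotated (Re \<mu>) (Im \<mu>) (pr z) p)" for p
      have rn: "0 \<le> r p" for p unfolding r_def by (rule N_nonneg[OF rotated_V[OF pD]])
      have b: "N (pr z p) \<le> K * (r True + r False)" for p
        using K[rule_format, of "pr z" p, OF pD] L_rot(2)[OF pD] by (simp add: r_def)
      have e: "cn (sc \<mu> z - cOp z) = sqrt ((r True)\<^sup>2 + (r False)\<^sup>2)"
        using rt[of \<mu> "pr z"] unfolding pr(2) by (simp add: cn_def complexified_norm_def r_def)
      have le: "r p \<le> cn (sc \<mu> z - cOp z)" for p
        unfolding e by (cases p) (auto intro: real_le_rsqrt)
      have "cn z = sqrt ((N (pr z True))\<^sup>2 + (N (pr z False))\<^sup>2)"
        by (simp add: cn_def complexified_norm_def pr_def split_beta)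
      also have "\<dots> \<le> N (pr z True) + N (pr z False)"
        using N_nonneg[OF Dom_V[OF pD]] by (intro sqrt_sum_squares_le_sum) auto
      also have "\<dots> \<le> 2 * K * (r True + r False)" using b[of True] b[of False] by simp
      also have "\<dots> \<le> 2 * K * (2 * cn (sc \<mu> z - cOp z))" using le[of True] le[of False] K0 by (intro mult_left_mono) auto
      finally show ?thesis by simp
    qed
    from resolvent_ex[OF inj]
    obtain K' where K': "\<forall>U. (\<forall>p. U p \<in> V) \<longrightarrow> (\<exists>u. (\<forall>p. u p \<in> Dom) \<and> (\<forall>p. N (L ?\<theta> u p - U p) = 0) \<and>
      (\<forall>s>0. (\<forall>p. N (U p) \<le> s) \<longrightarrow> (\<forall>p. bounded_rep (fst (u p)) (K' * s) \<and>
         (\<forall>j\<le>n. \<forall>\<beta>\<in>Bs j. norm (cip (\<Sigma> j) (snd (u p) j) \<beta>) \<le> K' * s))))"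
      by (elim exE conjE) (rule that)
    have onto: "\<exists>z\<in>Dom \<times> Dom. cn (sc \<mu> z - cOp z - w) = 0" if w: "w \<in> V \<times> V" for w
    proof -
      have wV: "\<And>p. pr w p \<in> V" using w by (auto simp: pr_def)
      from K'[rule_format, of "pr w", OF wV]
      obtain u where u: "\<forall>p. u p \<in> Dom" "\<forall>p. N (L ?\<theta> u p - pr w p) = 0"
        by (elim exE conjE) (rule that)
      have uD: "\<And>p. u p \<in> Dom" using u(1) by blast
      have nz: "N (rotated (Re \<mu>) (Im \<mu>) u p - pr w p) = 0" for p
      proof (rule weak_eqI(1)[OF rotated_V[OF uD] wV])
        fix v assume v: "v \<in> V"
        have "Re (ip (L ?\<theta> u p) v) = Re (ip (pr w p) v)"
          by (rule weak_eqD[OF _ wV u(2)[rule_format] v]) (intro L_V uD)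
        then show "Re (ip (rotated (Re \<mu>) (Im \<mu>) u p) v) = Re (ip (pr w p) v)"
          by (subst ip_rotated[OF _ v]) (use uD in auto)
      qed
      have "cn ((sc \<mu> (u True, u False) - cOp (u True, u False)) - (pr w True, pr w False)) = 0"
        unfolding rt using nz by (simp add: cn0)
      then show ?thesis unfolding pr(2) using uD by blast
    qed
    show ?thesis unfolding complex_resolvent_set_def using onto bound by blast
  qed
  show "- complex_resolvent_set (V \<times> V) sc cn (Dom \<times> Dom) cOp = complex_point_spectrum sc cn (Dom \<times> Dom) cOp"
    using no res by blast
  show "complex_point_spectrum sc cn (Dom \<times> Dom) cOp \<subseteq> {\<mu>. Re \<mu> < 0}"
  proof (rule subsetI, rule ccontr)
    fix \<mu> assume \<mu>: "\<mu> \<in> complex_point_spectrum sc cn (Dom \<times> Dom) cOp" and "\<mu> \<notin> {\<mu>. Re \<mu> < 0}"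
    then have re: "0 \<le> Re \<mu>" by simp
    obtain u where u: "\<forall>p. u p \<in> Dom" "N (u True) \<noteq> 0 \<or> N (u False) \<noteq> 0" "\<forall>p. N (rotated (Re \<mu>) (Im \<mu>) u p) = 0"
      using point[OF \<mu>] by blast
    have "\<forall>p. N (L (rot (Re \<mu>) (Im \<mu>)) u p) = 0" using L_rot(2)[of u "Re \<mu>" "Im \<mu>"] u by simp
    then have "\<forall>p. N (u p) = 0" using rotation_injective[OF re, of "Im \<mu>"] u(1) unfolding injective_at_def by blast
    then show False using u(2) by blast
  qed
qed

theorem spectrum_eq_point_spectrum:
  "spectrum V (cl_scale \<Sigma>) N Dom Op = point_spectrum (cl_scale \<Sigma>) N Dom Op"
  "point_spectrum (cl_scale \<Sigma>) N Dom Op \<subseteq> {\<mu>. Re \<mu> < 0}"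
  using complex_spectrum complexified_spectrum unfolding spectrum_def point_spectrum_def by auto

end

section \<open>The theorem\<close>

theorem theorem3p4:
  fixes b :: "'k::real_or_complex beam"
    and \<Sigma> :: "nat \<Rightarrow> ('k, 'c::ab_group_add) controller"
    and R :: "(real \<Rightarrow> 'k ^ 2) \<Rightarrow> 'k ^ 4"
    and \<kappa> :: real
  assumes setting: "beam_setting b"
    and controllers: "\<forall>j\<le>n_seg b. is_controller (\<Sigma> j)"
    and lipschitz: "\<forall>j\<in>{1..n_seg b}. \<forall>g\<in>{rho b, EI b}.
      (\<exists>K. K-lipschitz_on {node b (j - 1)<..<node b j} g) \<and>
      (\<exists>\<epsilon>>0. \<forall>\<zeta>\<in>{node b (j - 1)<..<node b j}. \<epsilon> \<le> g \<zeta>)"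
    and open_loop_passive: "impedance_passive b"
    and controller_passive: "\<forall>j\<le>n_seg b. \<exists>\<kappa>\<^sub>j>0. \<forall>xc\<in>cspace (\<Sigma> j). \<forall>uc.
      Re (to_complex (cip (\<Sigma> j) (cA (\<Sigma> j) xc + cB (\<Sigma> j) uc) xc)) \<le>
      Re (ip_vec (cC (\<Sigma> j) xc + cD (\<Sigma> j) uc) uc) - \<kappa>\<^sub>j * (norm (cD (\<Sigma> j) uc))\<^sup>2"
    and kernels: "\<forall>j\<le>n_seg b. {uc. cD (\<Sigma> j) uc = 0} \<subseteq> {uc. cB (\<Sigma> j) uc = 0}"
    and controller_stable: "\<forall>j\<le>n_seg b.
      spectrum (cspace (\<Sigma> j)) (cscale (\<Sigma> j)) (cnorm (\<Sigma> j)) (cspace (\<Sigma> j)) (cA (\<Sigma> j))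
        \<subseteq> {\<mu>. Re \<mu> < 0}"
    and R_map: "R \<in> R_maps b"
    and "\<kappa> > 0"
    and dissipative: "\<forall>(x, xc)\<in>cl_dom b \<Sigma>.
      Re (cl_ip b \<Sigma> (cl_op b \<Sigma> (x, xc)) (x, xc)) \<le> - \<kappa> * (norm (R x))\<^sup>2"
  shows "(\<forall>T. C0_semigroup_on (cl_space b \<Sigma>) (cl_scale \<Sigma>) (cl_norm b \<Sigma>) T \<and>
              has_generator_on (cl_space b \<Sigma>) (cl_scale \<Sigma>) (cl_norm b \<Sigma>) T
                (cl_dom b \<Sigma>) (cl_op b \<Sigma>) \<longrightarrow>
              asymptotically_stable_on (cl_space b \<Sigma>) (cl_norm b \<Sigma>) T) \<and>
    spectrum (cl_space b \<Sigma>) (cl_scale \<Sigma>) (cl_norm b \<Sigma>) (cl_dom b \<Sigma>) (cl_op b \<Sigma>) =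
      point_spectrum (cl_scale \<Sigma>) (cl_norm b \<Sigma>) (cl_dom b \<Sigma>) (cl_op b \<Sigma>) \<and>
    point_spectrum (cl_scale \<Sigma>) (cl_norm b \<Sigma>) (cl_dom b \<Sigma>) (cl_op b \<Sigma>) \<subseteq> {\<mu>. Re \<mu> < 0}"
proof -
  obtain r0 r1 where r: "0 < r0" "\<And>\<zeta>. \<zeta> \<in> {0<..<len b} \<Longrightarrow> r0 \<le> rho b \<zeta> \<and> rho b \<zeta> \<le> r1"
    using setting unfolding beam_setting_def by (metis insertI1)
  obtain e0 e1 where e: "0 < e0" "\<And>\<zeta>. \<zeta> \<in> {0<..<len b} \<Longrightarrow> e0 \<le> EI b \<zeta> \<and> EI b \<zeta> \<le> e1"
    using setting unfolding beam_setting_def by (metis insertI1 insertI2)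
  define coef where "coef = (\<lambda>(i::2) \<zeta>. if i = 1 then inverse (rho b \<zeta>) else EI b \<zeta>)"
  \<comment> \<open>The first entry of \<open>coef\<close> is the inverse of \<open>rho\<close>, so
    its lower bound comes from the upper bound \<open>r1\<close>; the maximum with 1 makes it
    visibly positive.\<close>
  define m0 where "m0 = min (inverse (max r1 1)) e0"
  define m1 where "m1 = max (inverse r0) e1"
  have coef_bounds: "m0 \<le> coef i \<zeta> \<and> coef i \<zeta> \<le> m1" if \<zeta>: "\<zeta> \<in> {0<..<len b}" for i \<zeta>
  proof -
    have "inverse (max r1 1) \<le> inverse (rho b \<zeta>)" "inverse (rho b \<zeta>) \<le> inverse r0"
      using r(1) r(2)[OF \<zeta>] by (auto intro!: le_imp_inverse_le)
    then show ?thesis using e(2)[OF \<zeta>] unfolding coef_def m0_def m1_def by auto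
  qed
  \<comment> \<open>Orthonormal bases exist for the controllers \<open>j \<le> n\<close> only, so
    they are selected by choice from this predicate.\<close>
  define OB where "OB j B \<longleftrightarrow> finite B \<and> B \<subseteq> cspace (\<Sigma> j) \<and>
      (\<forall>\<beta>\<in>B. \<forall>\<gamma>\<in>B. cip (\<Sigma> j) \<beta> \<gamma> = (if \<beta> = \<gamma> then 1 else 0)) \<and>
      (\<forall>v\<in>cspace (\<Sigma> j). v = (\<Sum>\<beta>\<in>B. cscale (\<Sigma> j) (cip (\<Sigma> j) v \<beta>) \<beta>))" for j B
  have ex: "\<exists>B. OB j B" if j: "j \<le> n_seg b" for j
  proof -
    have c: "vector_space (cscale (\<Sigma> j))" "inner_product_on (cspace (\<Sigma> j)) (cscale (\<Sigma> j)) (cip (\<Sigma> j))"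
      using controllers j by (auto simp: is_controller_def)
    interpret vector_space "cscale (\<Sigma> j)" by (rule c(1))
    obtain S where S: "finite S" "span S = cspace (\<Sigma> j)" using controllers j by (auto simp: is_controller_def)
    have "subspace (cspace (\<Sigma> j))" "S \<subseteq> cspace (\<Sigma> j)" using subspace_span[of S] span_superset[of S] S(2) by auto
    from orthonormal_basis_span[OF c this(1) S(1) this(2)] show ?thesis unfolding OB_def S(2) .
  qed
  define Bs where "Bs j = (SOME B. OB j B)" for j
  have OB: "OB j (Bs j)" if "j \<le> n_seg b" for j
    unfolding Bs_def by (rule someI_ex[OF ex[OF that]])
  interpret closed_loop b m0 m1 coef \<Sigma> Bs R \<kappa>
  proof
    show "beam_setting b" by (rule setting)
    show "coef = (\<lambda>i \<zeta>. if i = 1 then inverse (rho b \<zeta>) else EI b \<zeta>)" by (rule coef_def)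
    show "0 < m0" using e(1) by (simp add: m0_def)
    show "m0 \<le> coef i \<zeta> \<and> coef i \<zeta> \<le> m1" if "\<zeta> \<in> {0<..<len b}" for i \<zeta> by (rule coef_bounds[OF that])
    show "impedance_passive b" by (rule open_loop_passive)
    show "R \<in> R_maps b" "0 < \<kappa>" by fact+
    show "Re (cl_ip b \<Sigma> (cl_op b \<Sigma> u) u) \<le> - \<kappa> * (norm (R (fst u)))\<^sup>2" if "u \<in> cl_dom b \<Sigma>" for u
      using dissipative that by (cases u) auto
    fix j assume j: "j \<le> n_seg b"
    show "is_controller (\<Sigma> j)" using controllers j by blast
    show "finite (Bs j)" "\<And>\<beta>. \<beta> \<in> Bs j \<Longrightarrow> \<beta> \<in> cspace (\<Sigma> j)"
      "\<And>\<beta> \<gamma>. \<beta> \<in> Bs j \<Longrightarrow> \<gamma> \<in> Bs j \<Longrightarrow> cip (\<Sigma> j) \<beta> \<gamma> = (if \<beta> = \<gamma> then 1 else 0)"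
      using OB[OF j] unfolding OB_def by blast+
    show "(\<Sum>\<beta>\<in>Bs j. cscale (\<Sigma> j) (cip (\<Sigma> j) v \<beta>) \<beta>) = v" if "v \<in> cspace (\<Sigma> j)" for v
      using OB[OF j] that unfolding OB_def by (metis (no_types))
    show "\<exists>\<kappa>\<^sub>j>0. \<forall>xc\<in>cspace (\<Sigma> j). \<forall>uc.
      Re (to_complex (cip (\<Sigma> j) (cA (\<Sigma> j) xc + cB (\<Sigma> j) uc) xc)) \<le>
      Re (ip_vec (cC (\<Sigma> j) xc + cD (\<Sigma> j) uc) uc) - \<kappa>\<^sub>j * (norm (cD (\<Sigma> j) uc))\<^sup>2"
      using controller_passive j by blast
    show "cB (\<Sigma> j) uc = 0" if "cD (\<Sigma> j) uc = 0" for uc using kernels j that by blast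
    show "spectrum (cspace (\<Sigma> j)) (cscale (\<Sigma> j)) (cnorm (\<Sigma> j)) (cspace (\<Sigma> j)) (cA (\<Sigma> j)) \<subseteq> {\<mu>. Re \<mu> < 0}"
      using controller_stable j by blast
  qed
  show ?thesis
    using stable spectrum_eq_point_spectrum by blast
qed

end
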